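(* Let $T\in\mathcal T$. For all $\underline v:=(\boldsymbol\sigma,v)\in(\boldsymbol H^{\nu_\sigma}(T)\cap\boldsymbol H(\nabla\cdot;T))\times H^1(T)$ with $\nu_\sigma>\frac12$, the following estimates hold: \begin{align*} \|\Pi^v_T(\underline v)-\Pi^{k'}_T(v)\|_T&\lesssim \ell_\Omega^{-1}h_T^2\|\nabla\cdot\boldsymbol\sigma-\Pi^{k-1}_T(\nabla\cdot\boldsymbol\sigma)\|_T+h_T\|\nabla(v-\mathcal E^{k+1}_T(v))\|_T,\\ \|\boldsymbol\Pi^{\boldsymbol\sigma}_T(\underline v)-\boldsymbol\Pi^k_T(\boldsymbol\sigma)\|_T&\lesssim h_T^{1/2}\|(\boldsymbol\Pi^k_T(\boldsymbol\sigma)-\boldsymbol\sigma)\cdot\boldsymbol n_T\|_{\partial T}+h_T\|\nabla\cdot\boldsymbol\sigma-\Pi^{k-1}_T(\nabla\cdot\boldsymbol\sigma)\|_T+\ell_\Omega\|\nabla(v-\mathcal E^{k+1}_T(v))\|_T, \end{align*} with the convention $\Pi^{k-1}_T(\nabla\cdot\boldsymbol\sigma):=0$ for $k=0$.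
   Context: $\Omega\subset\mathbb R^d$, $d\in\{2,3\}$, polyhedral Lipschitz domain, $\ell_\Omega:=\mathrm{diam}(\Omega)$. $\mathcal T$ is a simplicial mesh of $\Omega$ (member of a shape-regular family); for $T\in\mathcal T$: $h_T$ diameter, $\boldsymbol n_T$ unit outward normal, $\mathcal F_{\partial T}$ its faces. Fix integers $k\ge0$ and $k'\in\{k,k+1\}$. $\mathbb P^m(T;\mathbb R)$, $\mathbb P^m(T;\mathbb R^d)$: scalar/vector polynomials of degree $\le m$ on $T$, with $\mathbb P^{-1}:=\{0\}$; $\mathbb P^k(\mathcal F_{\partial T};\mathbb R):=\times_{F\in\mathcal F_{\partial T}}\mathbb P^k(F;\mathbb R)$. $\Pi^m_T,\boldsymbol\Pi^m_T$: $L^2(T)$-orthogonal projections onto $\mathbb P^m(T;\mathbb R)$, $\mathbb P^m(T;\mathbb R^d)$; $\Pi^k_{\partial T}$ (componentwise $\boldsymbol\Pi^k_{\partial T}$): $L^2(\partial T)$-orthogonal projection onto $\mathbb P^k(\mathcal F_{\partial T};\mathbb R)$. Elliptic projection $\mathcal E^{k+1}_T:H^1(T)\to\mathbb P^{k+1}(T;\mathbb R)$: $(\nabla\mathcal E^{k+1}_T(v),\nabla q)_T=(\nabla v,\nabla q)_T$ for all $q\in\mathbb P^{k+1}(T;\mathbb R)$, $(\mathcal E^{k+1}_T(v),1)_T=(v,1)_T$. $\hat V^k_T:=\mathbb P^{k'}(T;\mathbb R)\times\mathbb P^k(\mathcal F_{\partial T};\mathbb R)$, $\hat v_T=(v_T,v_{\partial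 T})$, $\delta_{\partial T}(\hat v_T):=v_T|_{\partial T}-v_{\partial T}$. $R_T:\hat V^k_T\to\mathbb P^{k+1}(T;\mathbb R)$: $(\nabla R_T(\hat v_T),\nabla w)_T=(\nabla v_T,\nabla w)_T-(v_T-v_{\partial T},\nabla w\cdot\boldsymbol n_T)_{\partial T}$ for all $w\in\mathbb P^{k+1}(T;\mathbb R)$ and $(R_T(\hat v_T)-v_T,1)_T=0$. Stabilization $S_{\partial T}:\hat V^k_T\to\mathbb P^k(\mathcal F_{\partial T};\mathbb R)$: if $k'=k$, $S_{\partial T}(\hat v_T):=\Pi^k_{\partial T}\{\delta_{\partial T}(\hat v_T)+((R_T(\hat v_T)-\Pi^k_TR_T(\hat v_T))|_{\partial T}\}$; if $k'=k+1$, $S_{\partial T}(\hat v_T):=\Pi^k_{\partial T}(\delta_{\partial T}(\hat v_T))$. $\tau_T:=\ell_\Omega h_T^{-1}$. H-interpolation operator: for $\underline v=(\boldsymbol\sigma,v)\in\boldsymbol H^{\nu_\sigma}(T)\times H^{\nu_v}(T)$, $\nu_\sigma,\nu_v>\frac12$, $(\boldsymbol\Pi^{\boldsymbol\sigma}_T(\underline v),\Pi^v_T(\underline v))\in\mathbb P^k(T;\mathbb R^d)\times\mathbb P^{k'}(T;\mathbb R)$ is the (unique) solution of: $(\Pi^v_T(\underline v)-v,w)_T=0$ for all $w\in\mathbb P^{k-1}(T;\mathbb R)$; $(\boldsymbol\Pi^{\boldsymbol\sigma}_T(\underline v)-\boldsymbol\sigma,\boldsymbol\xi)_T=0$ for all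 $\boldsymbol\xi\in\mathbb P^{k-1}(T;\mathbb R^d)$; $((\boldsymbol\sigma-\boldsymbol\Pi^{\boldsymbol\sigma}_T(\underline v))\cdot\boldsymbol n_T,\mu)_{\partial T}=\tau_T(S_{\partial T}(\Pi^v_T(\underline v),\Pi^k_{\partial T}(v|_{\partial T})),S_{\partial T}(0,\mu))_{\partial T}$ for all $\mu\in\mathbb P^k(\mathcal F_{\partial T};\mathbb R)$; $(\boldsymbol\Pi^{\boldsymbol\sigma}_T(\underline v)-\boldsymbol\sigma,\nabla q)_T=((\boldsymbol\Pi^k_{\partial T}(\boldsymbol\sigma|_{\partial T})-\boldsymbol\sigma)\cdot\boldsymbol n_T,q)_{\partial T}$ for all $q\in\mathbb P^{k'}(T;\mathbb R)$. $a\lesssim b$ means $a\le Cb$ with $C$ depending only on mesh shape-regularity, $k$, $d$ (independent of $h_T$ and $\ell_\Omega$). *)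

theory Defs
  imports "HOL-Analysis.Analysis"
begin

definition pdiff :: "'n::finite \<Rightarrow> (real^'n \<Rightarrow> real) \<Rightarrow> real^'n \<Rightarrow> real" where
  "pdiff i f x = frechet_derivative f (at x) (axis i 1)"

definition cgrad :: "(real^'n::finite \<Rightarrow> real) \<Rightarrow> real^'n \<Rightarrow> real^'n" where
  "cgrad f x = (\<chi> i. pdiff i f x)"

definition Cinf :: "(real^'n::finite \<Rightarrow> real) \<Rightarrow> bool" where
  "Cinf f \<longleftrightarrow> (\<forall>js::'n list. \<forall>x. (foldr pdiff js f) differentiable (at x))"

definition test_fun :: "(real^'n::finite) set \<Rightarrow> (real^'n \<Rightarrow> real) \<Rightarrow> bool" where
  "test_fun U \<phi> \<longleftrightarrow> Cinf \<phi> \<and> compact (closure {x. \<phi> x \<noteq> 0}) \<and> closure {x. \<phi> x \<noteq> 0} \<subseteq> U"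

definition sqnn :: "(real^'n::finite) set \<Rightarrow> (real^'n \<Rightarrow> real) \<Rightarrow> ennreal" where
  "sqnn U u = (\<integral>\<^sup>+ x. ennreal ((u x)\<^sup>2) \<partial>lebesgue_on U)"

definition L2 :: "(real^'n::finite) set \<Rightarrow> (real^'n \<Rightarrow> real) \<Rightarrow> bool" where
  "L2 U u \<longleftrightarrow> u \<in> borel_measurable (lebesgue_on U) \<and> sqnn U u < \<infinity>"

definition ipT :: "(real^'n::finite) set \<Rightarrow> (real^'n \<Rightarrow> real) \<Rightarrow> (real^'n \<Rightarrow> real) \<Rightarrow> real" where
  "ipT U f g = (\<integral>x. f x * g x \<partial>lebesgue_on U)"

definition ipTv :: "(real^'n::finite) set \<Rightarrow> (real^'n \<Rightarrow> real^'n) \<Rightarrow> (real^'n \<Rightarrow> real^'n) \<Rightarrow> real" where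
  "ipTv U f g = (\<integral>x. f x \<bullet> g x \<partial>lebesgue_on U)"

definition normT :: "(real^'n::finite) set \<Rightarrow> (real^'n \<Rightarrow> real) \<Rightarrow> real" where
  "normT U f = sqrt (ipT U f f)"

definition normTv :: "(real^'n::finite) set \<Rightarrow> (real^'n \<Rightarrow> real^'n) \<Rightarrow> real" where
  "normTv U f = sqrt (ipTv U f f)"

definition weak_grad :: "(real^'n::finite) set \<Rightarrow> (real^'n \<Rightarrow> real) \<Rightarrow> (real^'n \<Rightarrow> real^'n) \<Rightarrow> bool" where
  "weak_grad U u G \<longleftrightarrow> (\<forall>\<phi> i. test_fun (interior U) \<phi> \<longrightarrow>
     (\<integral>x. u x * pdiff i \<phi> x \<partial>lebesgue_on U) = - (\<integral>x. G x $ i * \<phi> x \<partial>lebesgue_on U))"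

definition weak_div :: "(real^'n::finite) set \<Rightarrow> (real^'n \<Rightarrow> real^'n) \<Rightarrow> (real^'n \<Rightarrow> real) \<Rightarrow> bool" where
  "weak_div U \<sigma> D \<longleftrightarrow> (\<forall>\<phi>. test_fun (interior U) \<phi> \<longrightarrow>
     (\<integral>x. \<sigma> x \<bullet> cgrad \<phi> x \<partial>lebesgue_on U) = - (\<integral>x. D x * \<phi> x \<partial>lebesgue_on U))"

definition H1_grad :: "(real^'n::finite) set \<Rightarrow> (real^'n \<Rightarrow> real) \<Rightarrow> (real^'n \<Rightarrow> real^'n) \<Rightarrow> bool" where
  "H1_grad U u G \<longleftrightarrow> L2 U u \<and> (\<forall>i. L2 U (\<lambda>x. G x $ i)) \<and> weak_grad U u G"

definition Hdiv_div :: "(real^'n::finite) set \<Rightarrow> (real^'n \<Rightarrow> real^'n) \<Rightarrow> (real^'n \<Rightarrow> real) \<Rightarrow> bool" where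
  "Hdiv_div U \<sigma> D \<longleftrightarrow> (\<forall>i. L2 U (\<lambda>x. \<sigma> x $ i)) \<and> L2 U D \<and> weak_div U \<sigma> D"

definition slob :: "real \<Rightarrow> (real^'n::finite) set \<Rightarrow> (real^'n \<Rightarrow> real) \<Rightarrow> ennreal" where
  "slob s U u = (\<integral>\<^sup>+ x. \<integral>\<^sup>+ y. ennreal ((u x - u y)\<^sup>2 / norm (x - y) powr (real CARD('n) + 2 * s))
                    \<partial>lebesgue_on U \<partial>lebesgue_on U)"

definition Hs :: "real \<Rightarrow> (real^'n::finite) set \<Rightarrow> (real^'n \<Rightarrow> real) \<Rightarrow> bool" where
  "Hs s U u \<longleftrightarrow> L2 U u \<and> slob s U u < \<infinity>"

definition face :: "(real^'n::finite) set \<Rightarrow> real^'n \<Rightarrow> (real^'n) set" where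
  "face V z = convex hull (V - {z})"

definition onormal :: "(real^'n::finite) set \<Rightarrow> real^'n \<Rightarrow> real^'n" where
  "onormal V z = (THE n. norm n = 1 \<and> (\<forall>w\<in>V-{z}. \<forall>w'\<in>V-{z}. n \<bullet> (w - w') = 0)
                        \<and> (\<forall>w\<in>V-{z}. n \<bullet> (w - z) > 0))"

definition height :: "(real^'n::finite) set \<Rightarrow> real^'n \<Rightarrow> real" where
  "height V z = infdist z (affine hull (V - {z}))"

definition rproj :: "(real^'n::finite) set \<Rightarrow> real^'n \<Rightarrow> real^'n \<Rightarrow> real^'n" where
  "rproj V z x = z + (height V z / (onormal V z \<bullet> (x - z))) *\<^sub>R (x - z)"

text \<open>Surface ((d-1)-dimensional) integral over the face F opposite to z, expressed by the exact
  cone formula  int_T g(rproj x) dx = (h_z / d) int_F g dS.\<close>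
definition fint :: "(real^'n::finite) set \<Rightarrow> real^'n \<Rightarrow> (real^'n \<Rightarrow> real) \<Rightarrow> real" where
  "fint V z g = (real CARD('n) / height V z) * (\<integral>x. g (rproj V z x) \<partial>lebesgue_on (convex hull V))"

definition fintnn :: "(real^'n::finite) set \<Rightarrow> real^'n \<Rightarrow> (real^'n \<Rightarrow> real) \<Rightarrow> ennreal" where
  "fintnn V z g = ennreal (real CARD('n) / height V z) *
       (\<integral>\<^sup>+ x. ennreal (g (rproj V z x)) \<partial>lebesgue_on (convex hull V))"

text \<open>Functions on the boundary are families indexed by the faces (by the opposite vertex).\<close>
type_synonym 'n bfun = "real^'n \<Rightarrow> real^'n \<Rightarrow> real"

definition bip :: "(real^'n::finite) set \<Rightarrow> 'n bfun \<Rightarrow> 'n bfun \<Rightarrow> real" where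
  "bip V f g = (\<Sum>z\<in>V. fint V z (\<lambda>y. f z y * g z y))"

definition bnorm :: "(real^'n::finite) set \<Rightarrow> 'n bfun \<Rightarrow> real" where
  "bnorm V f = sqrt (bip V f f)"

definition canon :: "(real^'n::finite) set \<Rightarrow> 'n bfun \<Rightarrow> 'n bfun" where
  "canon V f = (\<lambda>z y. if z \<in> V \<and> y \<in> face V z then f z y else 0)"

definition btr :: "(real^'n::finite) set \<Rightarrow> (real^'n \<Rightarrow> real) \<Rightarrow> 'n bfun" where
  "btr V u = canon V (\<lambda>z y. u y)"

definition is_trace :: "(real^'n::finite) set \<Rightarrow> (real^'n \<Rightarrow> real) \<Rightarrow> 'n bfun \<Rightarrow> bool" where
  "is_trace V u g \<longleftrightarrow> (\<exists>s. 1/2 < s \<and> s < 1 \<and> Hs s (convex hull V) u \<and>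
     (\<forall>z\<in>V. (\<lambda>x. g z (rproj V z x)) \<in> borel_measurable (lebesgue_on (convex hull V))) \<and>
     (\<exists>un. (\<forall>n. Cinf (un n)) \<and>
        ((\<lambda>n. sqnn (convex hull V) (\<lambda>x. un n x - u x) + slob s (convex hull V) (\<lambda>x. un n x - u x))
            \<longlonglongrightarrow> 0) \<and>
        (\<forall>z\<in>V. (\<lambda>n. fintnn V z (\<lambda>y. (un n y - g z y)\<^sup>2)) \<longlonglongrightarrow> 0)))"

definition is_vtrace :: "(real^'n::finite) set \<Rightarrow> (real^'n \<Rightarrow> real^'n) \<Rightarrow> (real^'n \<Rightarrow> real^'n \<Rightarrow> real^'n) \<Rightarrow> bool" where
  "is_vtrace V \<sigma> g \<longleftrightarrow> (\<forall>i. is_trace V (\<lambda>x. \<sigma> x $ i) (\<lambda>z y. g z y $ i))"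

definition mis :: "nat \<Rightarrow> ('n::finite \<Rightarrow> nat) set" where
  "mis m = {\<alpha>. sum \<alpha> UNIV \<le> m}"

definition Pm :: "int \<Rightarrow> (real^'n::finite \<Rightarrow> real) set" where
  "Pm m = (if m < 0 then {\<lambda>x. 0} else
     {p. \<exists>c. p = (\<lambda>x. \<Sum>\<alpha>\<in>mis (nat m). c \<alpha> * (\<Prod>i\<in>UNIV. (x $ i) ^ \<alpha> i))})"

definition Pmv :: "int \<Rightarrow> (real^'n::finite \<Rightarrow> real^'n) set" where
  "Pmv m = {p. \<forall>i. (\<lambda>x. p x $ i) \<in> Pm m}"

definition Pface :: "(real^'n::finite) set \<Rightarrow> int \<Rightarrow> 'n bfun set" where
  "Pface V m = {\<mu>. canon V \<mu> = \<mu> \<and> (\<forall>z\<in>V. \<exists>p\<in>Pm m. \<forall>y\<in>face V z. \<mu> z y = p y)}"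

definition orth_proj :: "('a \<Rightarrow> 'a \<Rightarrow> real) \<Rightarrow> 'a set \<Rightarrow> 'a \<Rightarrow> 'a" where
  "orth_proj ip P u = (THE p. p \<in> P \<and> (\<forall>q\<in>P. ip u q = ip p q))"

definition PiT :: "(real^'n::finite) set \<Rightarrow> int \<Rightarrow> (real^'n \<Rightarrow> real) \<Rightarrow> (real^'n \<Rightarrow> real)" where
  "PiT V m = orth_proj (ipT (convex hull V)) (Pm m)"

definition PiTv :: "(real^'n::finite) set \<Rightarrow> int \<Rightarrow> (real^'n \<Rightarrow> real^'n) \<Rightarrow> (real^'n \<Rightarrow> real^'n)" where
  "PiTv V m = orth_proj (ipTv (convex hull V)) (Pmv m)"

definition PidT :: "(real^'n::finite) set \<Rightarrow> int \<Rightarrow> 'n bfun \<Rightarrow> 'n bfun" where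
  "PidT V m = orth_proj (bip V) (Pface V m)"

definition PidTv :: "(real^'n::finite) set \<Rightarrow> int \<Rightarrow> (real^'n \<Rightarrow> real^'n \<Rightarrow> real^'n)
                     \<Rightarrow> (real^'n \<Rightarrow> real^'n \<Rightarrow> real^'n)" where
  "PidTv V m g = (\<lambda>z y. \<chi> i. PidT V m (\<lambda>z' y'. g z' y' $ i) z y)"

definition ellproj :: "(real^'n::finite) set \<Rightarrow> nat \<Rightarrow> (real^'n \<Rightarrow> real) \<Rightarrow> (real^'n \<Rightarrow> real^'n)
                       \<Rightarrow> (real^'n \<Rightarrow> real)" where
  "ellproj V k v G = (THE p. p \<in> Pm (int k + 1) \<and>
      (\<forall>q\<in>Pm (int k + 1). ipTv (convex hull V) (cgrad p) (cgrad q) = ipTv (convex hull V) G (cgrad q)) \<and>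
      ipT (convex hull V) p (\<lambda>x. 1) = ipT (convex hull V) v (\<lambda>x. 1))"

definition deltaT :: "(real^'n::finite) set \<Rightarrow> (real^'n \<Rightarrow> real) \<Rightarrow> 'n bfun \<Rightarrow> 'n bfun" where
  "deltaT V vT vdT = (\<lambda>z y. btr V vT z y - vdT z y)"

definition RT :: "(real^'n::finite) set \<Rightarrow> nat \<Rightarrow> (real^'n \<Rightarrow> real) \<Rightarrow> 'n bfun \<Rightarrow> (real^'n \<Rightarrow> real)" where
  "RT V k vT vdT = (THE r. r \<in> Pm (int k + 1) \<and>
      (\<forall>w\<in>Pm (int k + 1). ipTv (convex hull V) (cgrad r) (cgrad w) =
          ipTv (convex hull V) (cgrad vT) (cgrad w)
          - bip V (deltaT V vT vdT) (\<lambda>z y. cgrad w y \<bullet> onormal V z)) \<and>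
      ipT (convex hull V) (\<lambda>x. r x - vT x) (\<lambda>x. 1) = 0)"

definition SdT :: "(real^'n::finite) set \<Rightarrow> nat \<Rightarrow> nat \<Rightarrow> (real^'n \<Rightarrow> real) \<Rightarrow> 'n bfun \<Rightarrow> 'n bfun" where
  "SdT V k k' vT vdT = (if k' = k
     then PidT V (int k) (\<lambda>z y. deltaT V vT vdT z y +
            btr V (\<lambda>x. RT V k vT vdT x - PiT V (int k) (RT V k vT vdT) x) z y)
     else PidT V (int k) (deltaT V vT vdT))"

text \<open>(ps, pv) is the H-interpolate of (sigma, v); gs, gv are the traces of sigma, v;
  ell is the diameter of Omega.\<close>
definition Hinterp :: "real \<Rightarrow> (real^'n::finite) set \<Rightarrow> nat \<Rightarrow> nat \<Rightarrow>
     (real^'n \<Rightarrow> real^'n) \<Rightarrow> (real^'n \<Rightarrow> real^'n \<Rightarrow> real^'n) \<Rightarrow> (real^'n \<Rightarrow> real) \<Rightarrow> 'n bfun \<Rightarrow>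
     (real^'n \<Rightarrow> real^'n) \<Rightarrow> (real^'n \<Rightarrow> real) \<Rightarrow> bool" where
  "Hinterp ell V k k' \<sigma> gs v gv ps pv \<longleftrightarrow>
     (let T = convex hull V; \<tau> = ell / diameter T in
      ps \<in> Pmv (int k) \<and> pv \<in> Pm (int k') \<and>
      (\<forall>w\<in>Pm (int k - 1). ipT T (\<lambda>x. pv x - v x) w = 0) \<and>
      (\<forall>\<xi>\<in>Pmv (int k - 1). ipTv T (\<lambda>x. ps x - \<sigma> x) \<xi> = 0) \<and>
      (\<forall>\<mu>\<in>Pface V (int k).
          bip V (\<lambda>z y. (gs z y - ps y) \<bullet> onormal V z) \<mu> =
          \<tau> * bip V (SdT V k k' pv (PidT V (int k) gv)) (SdT V k k' (\<lambda>x. 0) \<mu>)) \<and>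
      (\<forall>q\<in>Pm (int k'). ipTv T (\<lambda>x. ps x - \<sigma> x) (cgrad q) =
          bip V (\<lambda>z y. (PidTv V (int k) gs z y - gs z y) \<bullet> onormal V z) (btr V q)))"

definition inradius :: "(real^'n::finite) set \<Rightarrow> real" where
  "inradius T = Sup {r. \<exists>c. cball c r \<subseteq> T}"

end

theory Submission
  imports Defs "HOL-Library.Function_Algebras"
begin

text \<open>
  The projection error \<open>e = pv - Pi v\<close> is orthogonal to polynomials of degree \<open>k - 1\<close>, hence it is
  controlled by the face projection \<open>a\<close> of its trace. The stabilization of the interpolate splits
  as \<open>a + b\<close>, where \<open>b\<close> collects interpolation errors of \<open>v - E v\<close> and is bounded by its gradient.
  Testing the flux equation with \<open>a\<close>, whose reconstruction is \<open>e\<close> up to a constant, and integrating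
  by parts turns the flux side into \<open>(div \<sigma> - Pi div \<sigma>, e)\<close>; this bounds \<open>a\<close>. Testing with the
  normal trace of \<open>ps - Pi \<sigma>\<close>, which is orthogonal to lower degree and therefore controlled by that
  trace, bounds the flux error.

  Uniform constants come from finite-dimensional linear algebra on the reference simplex for
  inequalities that are invariant under affine maps; regularity enters only through the quotients
  of the diameter and the heights. Traces in \<open>H\<^sup>s\<close> with \<open>s > 1/2\<close> and the weak derivative are linked
  by integrating over thin strips along the boundary.
\<close>

text \<open>The error \<open>v - E v\<close> is no polynomial, so finite-dimensional linear algebra
  cannot bound it. It enters, however, only through moments against polynomials on the cell and on
  the faces. Each moment is rewritten by integration by parts against a polynomial field of
  controlled norm: a bubble field for the cell, a radial field \<open>p (x - z)\<close> for a face.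
  This takes the place of Poincare and trace inequalities for Sobolev functions. The test function
  \<open>a\<close> is decisive because the stabilization of \<open>(0, a)\<close> is exactly
  \<open>- a\<close>. The flux equation becomes
  \<open>\<tau> (a + b, a) = - (div \<sigma>, e)\<close>, coercive in \<open>a\<close> for both
  choices of \<open>k'\<close>, and the orthogonality of \<open>e\<close> removes the projected part
  of \<open>div \<sigma>\<close>. Weak derivatives are tested only with functions supported inside
  the simplex, while traces are limits in a norm that does not control gradients. The cut-offs
  joining the two have gradients as large as the inverse width of a boundary strip; hence the
  crucial bound says that the mean of a function over a thin strip stays controlled by its
  \<open>H\<^sup>s\<close> norm.\<close>

section \<open>Pointwise vector space structure, so that spaces of functions and fields can be
  linear subspaces\<close>

instantiation "fun" :: (type, real_vector) real_vector
begin

definition "scaleR_fun r f = (\<lambda>x. r *\<^sub>R f x)"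

instance
  by standard (auto simp: scaleR_fun_def plus_fun_def algebra_simps)

end

lemma scaleR_fun_apply [simp]: "(r *\<^sub>R f) x = r *\<^sub>R f x"
  by (simp add: scaleR_fun_def)

lemma sum_fun_apply: "(\<Sum>i\<in>I. f i) x = (\<Sum>i\<in>I. f i x)" for f :: "'i \<Rightarrow> 'a \<Rightarrow> 'b::real_vector"
  by (induction I rule: infinite_finite_induct) auto

section \<open>Positive semidefinite forms\<close>

text \<open>Semidefinite rather than definite, because functions are not identified when equal
  almost everywhere and face forms do not see interior values. Linearity is confined to
  \<open>W\<close>, since integrals are additive only on integrable functions.\<close>

locale psd_form =
  fixes B :: "'v::real_vector \<Rightarrow> 'v \<Rightarrow> real" and W :: "'v set"
  assumes subspace_W: "subspace W"
    and B_add: "\<And>u v w. u \<in> W \<Longrightarrow> v \<in> W \<Longrightarrow> w \<in> W \<Longrightarrow> B (u + v) w = B u w + B v w"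
    and B_scale: "\<And>c u w. u \<in> W \<Longrightarrow> w \<in> W \<Longrightarrow> B (c *\<^sub>R u) w = c * B u w"
    and B_sym: "\<And>u w. B u w = B w u"
    and B_nonneg: "\<And>u. u \<in> W \<Longrightarrow> 0 \<le> B u u"
begin

lemma W_add: "u \<in> W \<Longrightarrow> v \<in> W \<Longrightarrow> u + v \<in> W"
  and W_scale: "u \<in> W \<Longrightarrow> c *\<^sub>R u \<in> W"
  and W_diff: "u \<in> W \<Longrightarrow> v \<in> W \<Longrightarrow> u - v \<in> W"
  and W_zero: "0 \<in> W"
  using subspace_W by (auto simp: subspace_def intro: subspace_diff[OF subspace_W])

lemma B_add_right: "u \<in> W \<Longrightarrow> v \<in> W \<Longrightarrow> w \<in> W \<Longrightarrow> B w (u + v) = B w u + B w v"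
  using B_add[of u v w] by (simp add: B_sym)

lemma B_scale_right: "u \<in> W \<Longrightarrow> w \<in> W \<Longrightarrow> B w (c *\<^sub>R u) = c * B w u"
  using B_scale[of u w c] by (simp add: B_sym)

lemma B_diff: "u \<in> W \<Longrightarrow> v \<in> W \<Longrightarrow> w \<in> W \<Longrightarrow> B (u - v) w = B u w - B v w"
  using B_add[of "u - v" v w] W_diff by simp

lemma B_diff_right: "u \<in> W \<Longrightarrow> v \<in> W \<Longrightarrow> w \<in> W \<Longrightarrow> B w (u - v) = B w u - B w v"
  using B_diff[of u v w] by (simp add: B_sym)

lemma B_zero: "w \<in> W \<Longrightarrow> B 0 w = 0" "w \<in> W \<Longrightarrow> B w 0 = 0"
  using B_scale[of w w 0] B_scale_right[of w w 0] by auto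

lemmas B_simps = B_add B_add_right B_diff B_diff_right B_scale B_scale_right
  W_add W_diff W_scale

lemma Cauchy_Schwarz_sq:
  assumes "u \<in> W" "v \<in> W"
  shows "(B u v)\<^sup>2 \<le> B u u * B v v"
proof -
  have expand: "0 \<le> B u u - 2 * t * B u v + t\<^sup>2 * B v v" for t
  proof -
    have "0 \<le> B (u - t *\<^sub>R v) (u - t *\<^sub>R v)"
      using assms by (intro B_nonneg W_diff W_scale)
    also have "\<dots> = B u u - 2 * t * B u v + t\<^sup>2 * B v v"
      using assms by (simp add: B_simps B_sym[of v u] power2_eq_square algebra_simps)
    finally show ?thesis .
  qed
  show ?thesis
  proof (cases "B v v = 0")
    case True
    have "B u v = 0"
    proof (rule ccontr)
      assume "B u v \<noteq> 0"
      then show False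
        \<comment> \<open>The quadratic in \<open>t\<close> degenerates to an affine function, and
          this \<open>t\<close> gives it the value -1.\<close>
        using expand[of "(B u u + 1) / (2 * B u v)"] True by simp
    qed
    then show ?thesis using True by simp
  next
    case False
    then have pos: "B v v > 0" using B_nonneg[OF assms(2)] by simp
    have "0 \<le> B u u - (B u v)\<^sup>2 / B v v"
      using expand[of "B u v / B v v"] False by (simp add: power2_eq_square)
    then show ?thesis using pos by (simp add: field_simps)
  qed
qed

lemma Cauchy_Schwarz:
  assumes "u \<in> W" "v \<in> W"
  shows "\<bar>B u v\<bar> \<le> sqrt (B u u) * sqrt (B v v)"
  using real_sqrt_le_mono[OF Cauchy_Schwarz_sq[OF assms]] by (simp add: real_sqrt_mult)

lemma null_orthogonal:
  assumes "u \<in> W" "v \<in> W" "B u u = 0"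
  shows "B u v = 0"
  using Cauchy_Schwarz_sq[OF assms(1,2)] assms(3) by simp

lemma sum_sq_le:
  assumes "u \<in> W" "v \<in> W"
  shows "B (u + v) (u + v) \<le> 2 * B u u + 2 * B v v"
proof -
  have "0 \<le> B (u - v) (u - v)" using assms by (intro B_nonneg W_diff)
  then show ?thesis using assms by (simp add: B_simps B_sym[of v u])
qed

lemma norm_triangle:
  assumes "u \<in> W" "v \<in> W"
  shows "sqrt (B (u + v) (u + v)) \<le> sqrt (B u u) + sqrt (B v v)"
proof (rule real_le_lsqrt)
  have "B (u + v) (u + v) = B u u + 2 * B u v + B v v"
    using assms by (simp add: B_simps B_sym[of v u])
  also have "\<dots> \<le> B u u + 2 * (sqrt (B u u) * sqrt (B v v)) + B v v"
    using Cauchy_Schwarz[OF assms] by linarith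
  also have "\<dots> = (sqrt (B u u) + sqrt (B v v))\<^sup>2"
    using assms B_nonneg by (simp add: power2_sum)
  finally show "B (u + v) (u + v) \<le> (sqrt (B u u) + sqrt (B v v))\<^sup>2" .
qed (use assms B_nonneg in auto)

lemma psd_form_subspace: "subspace W' \<Longrightarrow> W' \<subseteq> W \<Longrightarrow> psd_form B W'"
  by unfold_locales (auto simp: B_add B_scale B_nonneg subset_iff intro: B_sym)

text \<open>Gram-Schmidt, one generator at a time. As \<open>B\<close> may be degenerate, a solution
  can exist only if \<open>l\<close> vanishes on null vectors; that hypothesis passes to the smaller
  span, so the induction needs no basis.\<close>

lemma riesz_span:
  assumes "finite S" "span S \<subseteq> W"
    and add: "\<And>u v. u \<in> span S \<Longrightarrow> v \<in> span S \<Longrightarrow> l (u + v) = l u + l v"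
    and scale: "\<And>c u. u \<in> span S \<Longrightarrow> l (c *\<^sub>R u) = c * l u"
    and null: "\<And>u. u \<in> span S \<Longrightarrow> B u u = 0 \<Longrightarrow> l u = 0"
  shows "\<exists>p\<in>span S. \<forall>q\<in>span S. B p q = l q"
  using assms
proof (induction S arbitrary: l rule: finite_induct)
  case empty
  then show ?case by (auto simp: B_zero W_zero)
next
  case (insert b S)
  have sub: "span S \<subseteq> span (insert b S)" by (rule span_mono) auto
  have SW: "span S \<subseteq> W" using insert.prems(1) sub by blast
  have bW: "b \<in> W" using insert.prems(1) by (meson in_mono insertI1 span_base)
  have nullb: "B b u = 0" if "u \<in> span S" "B u u = 0" for u
    using null_orthogonal[of u b] that SW bW B_sym[of b u] by auto
  have "\<exists>p\<in>span S. \<forall>q\<in>span S. B p q = B b q"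
    by (rule insert.IH) (use SW bW nullb in \<open>simp_all add: B_add_right B_scale_right subset_iff\<close>)
  then obtain pb where pb: "pb \<in> span S" "\<And>q. q \<in> span S \<Longrightarrow> B pb q = B b q" by auto
  define b' where "b' = b - pb"
  have b'W: "b' \<in> W" unfolding b'_def using bW pb SW by (intro W_diff) auto
  have b'S: "b' \<in> span (insert b S)"
    unfolding b'_def by (rule span_diff) (use pb(1) sub in \<open>auto intro: span_base\<close>)
  have orth: "B b' q = 0" if "q \<in> span S" for q
    unfolding b'_def using that pb bW SW by (subst B_diff) auto
  have "\<exists>p\<in>span S. \<forall>q\<in>span S. B p q = l q"
    by (rule insert.IH) (use SW insert.prems sub in \<open>auto simp: subset_iff\<close>)
  then obtain p where p: "p \<in> span S" "\<And>q. q \<in> span S \<Longrightarrow> B p q = l q" by auto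
  \<comment> \<open>For a null vector \<open>b'\<close> also \<open>l b' = 0\<close>, and the value
    0 of the division serves as coefficient.\<close>
  define t where "t = l b' / B b' b'"
  have tB: "t * B b' b' = l b'"
    using insert.prems(4)[OF b'S] by (cases "B b' b' = 0") (auto simp: t_def)
  have "B (p + t *\<^sub>R b') q = l q" if q: "q \<in> span (insert b S)" for q
  proof -
    obtain c where c: "q - c *\<^sub>R b \<in> span S"
      using q by (auto simp: span_insert)
    define s where "s = q - c *\<^sub>R b'"
    have s: "s \<in> span S"
    proof -
      have "s = (q - c *\<^sub>R b) + c *\<^sub>R pb" by (simp add: s_def b'_def algebra_simps)
      then show ?thesis using c pb by (metis span_add span_scale)
    qed
    have qeq: "q = s + c *\<^sub>R b'" by (simp add: s_def)
    have W: "s \<in> W" "p \<in> W" using s p SW by auto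
    have bb: "B p b' = 0" "B b' s = 0" using orth[OF p(1)] orth[OF s] by (auto simp: B_sym)
    have "B (p + t *\<^sub>R b') q = B p s + c * (t * B b' b')"
      unfolding qeq using W b'W by (simp add: B_simps bb algebra_simps)
    also have "\<dots> = l s + c * l b'" using p s tB by simp
    also have "\<dots> = l q"
      unfolding qeq using insert.prems(2)[of s "c *\<^sub>R b'"] insert.prems(3)[of b' c] s b'S sub
      by (simp add: span_scale subset_iff)
    finally show ?thesis .
  qed
  moreover have "p + t *\<^sub>R b' \<in> span (insert b S)"
    using p sub b'S by (intro span_add span_scale) auto
  ultimately show ?case by blast
qed

end

text \<open>The controlled form is evaluated at a partner \<open>\<xi>\<close> of \<open>p\<close> in a linear relation,
  so that the lemma also yields bounded right inverses of linear maps.\<close>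
lemma finite_dim_bound:
  assumes B: "psd_form B W" and N: "psd_form N X"
    and fin: "finite S" and SW: "span S \<subseteq> W"
    and K: "subspace K" "snd ` K \<subseteq> X"
    and ex: "\<And>p. p \<in> span S \<Longrightarrow> \<exists>\<xi>. (p, \<xi>) \<in> K \<and> (B p p = 0 \<longrightarrow> N \<xi> \<xi> = 0)"
  shows "\<exists>C\<ge>0. \<forall>p\<in>span S. \<exists>\<xi>. (p, \<xi>) \<in> K \<and> N \<xi> \<xi> \<le> C * B p p"
  using fin SW ex
proof (induction S rule: finite_induct)
  case empty
  interpret B: psd_form B W by fact
  show ?case
    using empty(2)[of 0] B.B_zero[OF B.W_zero] by (intro exI[of _ 0]) auto
next
  case (insert b S)
  interpret B: psd_form B W by fact
  interpret N: psd_form N X by fact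
  have sub: "span S \<subseteq> span (insert b S)" by (rule span_mono) auto
  have SW: "span S \<subseteq> W" using insert.prems(1) sub by blast
  have bW: "b \<in> W" using insert.prems(1) by (meson in_mono insertI1 span_base)
  have "\<exists>C\<ge>0. \<forall>p\<in>span S. \<exists>\<xi>. (p, \<xi>) \<in> K \<and> N \<xi> \<xi> \<le> C * B p p"
    by (rule insert.IH) (use SW insert.prems sub in auto)
  then obtain C where C: "C \<ge> 0" "\<And>p. p \<in> span S \<Longrightarrow> \<exists>\<xi>. (p, \<xi>) \<in> K \<and> N \<xi> \<xi> \<le> C * B p p"
    by blast
  have nullb: "B b u = 0" if "u \<in> span S" "B u u = 0" for u
    using B.null_orthogonal[of u b] that SW bW B.B_sym[of b u] by auto
  have "\<exists>p\<in>span S. \<forall>q\<in>span S. B p q = B b q"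
    by (rule B.riesz_span) (use SW bW insert.hyps nullb in \<open>simp_all add: B.B_add_right B.B_scale_right subset_iff\<close>)
  then obtain pb where pb: "pb \<in> span S" "\<And>q. q \<in> span S \<Longrightarrow> B pb q = B b q" by auto
  define b' where "b' = b - pb"
  have b'W: "b' \<in> W" unfolding b'_def using bW pb SW by (intro B.W_diff) auto
  have b'S: "b' \<in> span (insert b S)"
    unfolding b'_def by (rule span_diff) (use pb(1) sub in \<open>auto intro: span_base\<close>)
  have orth: "B b' q = 0" if "q \<in> span S" for q
    unfolding b'_def using that pb bW SW by (subst B.B_diff) auto
  obtain \<eta> where \<eta>: "(b', \<eta>) \<in> K" "B b' b' = 0 \<Longrightarrow> N \<eta> \<eta> = 0"
    using insert.prems(2)[OF b'S] by blast
  have \<eta>X: "\<eta> \<in> X" using \<eta>(1) K(2) by force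
  \<comment> \<open>If \<open>b'\<close> is a null vector, the quotient is 0 and the partner
    \<open>\<eta>\<close> was chosen with \<open>N \<eta> \<eta> = 0\<close>.\<close>
  define c' where "c' = N \<eta> \<eta> / B b' b'"
  have c': "c' \<ge> 0" unfolding c'_def using N.B_nonneg[OF \<eta>X] B.B_nonneg[OF b'W] by simp
  have c'B: "N \<eta> \<eta> = c' * B b' b'" using \<eta>(2) by (auto simp: c'_def)
  \<comment> \<open>The factors 2 come from \<open>sum_sq_le\<close>. No cross term arises in
    \<open>B q q\<close>, because \<open>b'\<close> is orthogonal to \<open>span S\<close>.\<close>
  define C' where "C' = 2 * C + 2 * c'"
  have "\<exists>\<xi>. (q, \<xi>) \<in> K \<and> N \<xi> \<xi> \<le> C' * B q q" if q: "q \<in> span (insert b S)" for q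
  proof -
    obtain c where c: "q - c *\<^sub>R b \<in> span S"
      using q by (auto simp: span_insert)
    define s where "s = q - c *\<^sub>R b'"
    have s: "s \<in> span S"
    proof -
      have "s = (q - c *\<^sub>R b) + c *\<^sub>R pb" by (simp add: s_def b'_def algebra_simps)
      then show ?thesis using c pb by (metis span_add span_scale)
    qed
    have qeq: "q = s + c *\<^sub>R b'" by (simp add: s_def)
    have sW: "s \<in> W" using s SW by auto
    obtain \<xi> where \<xi>: "(s, \<xi>) \<in> K" "N \<xi> \<xi> \<le> C * B s s" using C(2)[OF s] by blast
    have \<xi>X: "\<xi> \<in> X" using \<xi>(1) K(2) by force
    have inK: "(q, \<xi> + c *\<^sub>R \<eta>) \<in> K"
      using subspace_add[OF K(1) \<xi>(1) subspace_scale[OF K(1) \<eta>(1), of c]] by (simp add: qeq)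
    have Bq: "B q q = B s s + c\<^sup>2 * B b' b'"
      unfolding qeq using sW b'W orth[OF s] B.B_sym[of s b']
      by (simp add: B.B_simps power2_eq_square)
    have "N (\<xi> + c *\<^sub>R \<eta>) (\<xi> + c *\<^sub>R \<eta>) \<le> 2 * N \<xi> \<xi> + 2 * N (c *\<^sub>R \<eta>) (c *\<^sub>R \<eta>)"
      using \<xi>X \<eta>X by (intro N.sum_sq_le N.W_scale)
    also have "N (c *\<^sub>R \<eta>) (c *\<^sub>R \<eta>) = c\<^sup>2 * (c' * B b' b')"
      using \<eta>X c'B by (simp add: N.B_simps power2_eq_square)
    also have "2 * N \<xi> \<xi> + 2 * (c\<^sup>2 * (c' * B b' b')) \<le> 2 * C * B s s + 2 * c' * (c\<^sup>2 * B b' b')"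
      using \<xi>(2) by simp
    also have "\<dots> \<le> C' * B s s + C' * (c\<^sup>2 * B b' b')"
      using C(1) c' B.B_nonneg[OF sW] B.B_nonneg[OF b'W]
      by (intro add_mono mult_right_mono) (auto simp: C'_def)
    finally show ?thesis using inK by (auto simp: Bq algebra_simps)
  qed
  moreover have "C' \<ge> 0" using C c' by (simp add: C'_def)
  ultimately show ?case by blast
qed

lemma subspace_finite_spanning:
  fixes W :: "'v::real_vector set"
  assumes "subspace W" "W \<subseteq> span M" "finite M"
  shows "\<exists>S. finite S \<and> span S = W"
proof -
  obtain S where S: "S \<subseteq> W" "independent S" "W \<subseteq> span S"
    using maximal_independent_subset[of W] by blast
  have "finite S" using independent_span_bound[OF assms(3) S(2)] S(1) assms(2) by auto
  moreover have "span S = W" using S assms(1) by (metis span_minimal subset_antisym)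
  ultimately show ?thesis by blast
qed

text \<open>The diagonal relation turns \<open>finite_dim_bound\<close> into a comparison of two
  forms on one space.\<close>

lemma finite_dim_bound_id:
  assumes "psd_form B W" "psd_form N W" "finite S" "span S \<subseteq> W"
    and "\<And>p. p \<in> span S \<Longrightarrow> B p p = 0 \<Longrightarrow> N p p = 0"
  shows "\<exists>C\<ge>0. \<forall>p\<in>span S. N p p \<le> C * B p p"
proof -
  have "subspace W" using assms(1) by (rule psd_form.subspace_W)
  then have "subspace {(p, \<xi>). p = \<xi> \<and> p \<in> W}"
    by (auto simp: subspace_def zero_prod_def)
  from finite_dim_bound[OF assms(1,2,3,4) this] show ?thesis
    using assms(4,5) by (fastforce simp: subset_iff)
qed

section \<open>Finite-dimensional subspaces and orthogonal projections onto them\<close>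

definition fin_dim :: "'v::real_vector set \<Rightarrow> bool" where
  "fin_dim P \<longleftrightarrow> (\<exists>S. finite S \<and> span S = P)"

lemma fin_dim_subspace: "fin_dim P \<Longrightarrow> subspace P"
  unfolding fin_dim_def using subspace_span by blast

lemma fin_dim_subset: "fin_dim P \<Longrightarrow> subspace Q \<Longrightarrow> Q \<subseteq> P \<Longrightarrow> fin_dim Q"
  unfolding fin_dim_def using subspace_finite_spanning by metis

text \<open>Gives meaning to the definite description in \<open>orth_proj\<close>: existence is
  \<open>riesz_span\<close>, and uniqueness uses definiteness on \<open>P\<close> only, while
  \<open>u\<close> ranges over the larger space \<open>W\<close>.\<close>

lemma (in psd_form) orth_proj:
  assumes P: "fin_dim P" "P \<subseteq> W" and u: "u \<in> W"
    and definite: "\<And>p. p \<in> P \<Longrightarrow> B p p = 0 \<Longrightarrow> p = 0"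
  shows orth_proj_in: "orth_proj B P u \<in> P"
    and orth_proj_eq: "\<And>q. q \<in> P \<Longrightarrow> B (orth_proj B P u) q = B u q"
    and orth_proj_unique: "\<And>p. p \<in> P \<Longrightarrow> (\<And>q. q \<in> P \<Longrightarrow> B p q = B u q) \<Longrightarrow> orth_proj B P u = p"
proof -
  obtain S where S: "finite S" "span S = P" using P(1) by (auto simp: fin_dim_def)
  have "\<exists>p\<in>span S. \<forall>q\<in>span S. B p q = B u q"
    by (rule riesz_span)
      (use S P u definite in \<open>auto simp: B_add_right B_scale_right subset_iff dest: B_zero(2)\<close>)
  then obtain p where p: "p \<in> P" "\<And>q. q \<in> P \<Longrightarrow> B p q = B u q" using S by auto
  have uniq: "p' = p''" if "p' \<in> P" "p'' \<in> P" "\<And>q. q \<in> P \<Longrightarrow> B p' q = B u q"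
    "\<And>q. q \<in> P \<Longrightarrow> B p'' q = B u q" for p' p''
  proof -
    have d: "p' - p'' \<in> P" using that fin_dim_subspace[OF P(1)] by (simp add: subspace_diff)
    then have "B (p' - p'') (p' - p'') = 0"
      using that(3,4)[OF d] that(1,2) P(2) by (subst B_diff) auto
    then show ?thesis using definite[OF d] by simp
  qed
  have ex1: "\<exists>!p. p \<in> P \<and> (\<forall>q\<in>P. B u q = B p q)"
    using p by (intro ex1I[of _ p]) (auto intro!: uniq)
  show "orth_proj B P u \<in> P" "\<And>q. q \<in> P \<Longrightarrow> B (orth_proj B P u) q = B u q"
    using theI'[OF ex1] by (auto simp: orth_proj_def)
  then show "\<And>p. p \<in> P \<Longrightarrow> (\<And>q. q \<in> P \<Longrightarrow> B p q = B u q) \<Longrightarrow> orth_proj B P u = p"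
    by (auto intro!: uniq)
qed

section \<open>Polynomials\<close>

abbreviation monomial :: "('n::finite \<Rightarrow> nat) \<Rightarrow> real^'n \<Rightarrow> real" where
  "monomial \<alpha> \<equiv> (\<lambda>x. \<Prod>i\<in>UNIV. x $ i ^ \<alpha> i)"

lemma finite_mis: "finite (mis m :: ('n::finite \<Rightarrow> nat) set)"
proof (rule finite_subset)
  show "mis m \<subseteq> (PiE UNIV (\<lambda>_. {..m}) :: ('n \<Rightarrow> nat) set)"
  proof
    fix \<alpha> :: "'n \<Rightarrow> nat" assume "\<alpha> \<in> mis m"
    then have "sum \<alpha> UNIV \<le> m" by (simp add: mis_def)
    then have "\<alpha> i \<le> m" for i using member_le_sum[of i UNIV \<alpha>] by (auto intro: order_trans)
    then show "\<alpha> \<in> PiE UNIV (\<lambda>_. {..m})" by (auto simp: PiE_def)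
  qed
qed (auto intro: finite_PiE)

text \<open>Replaces the coefficient sums of the definition by a span, which provides span induction
  and finite dimension.\<close>

lemma Pm_eq_span:
  assumes "m \<ge> 0"
  shows "(Pm m :: (real^'n::finite \<Rightarrow> real) set) = span (monomial ` mis (nat m))"
proof
  show "(Pm m :: (real^'n \<Rightarrow> real) set) \<subseteq> span (monomial ` mis (nat m))"
  proof
    fix p :: "real^'n \<Rightarrow> real" assume "p \<in> Pm m"
    then obtain c where "p = (\<lambda>x. \<Sum>\<alpha>\<in>mis (nat m). c \<alpha> * monomial \<alpha> x)"
      using assms by (auto simp: Pm_def)
    then have "p = (\<Sum>\<alpha>\<in>mis (nat m). c \<alpha> *\<^sub>R monomial \<alpha>)"
      by (simp add: fun_eq_iff sum_fun_apply)
    then show "p \<in> span (monomial ` mis (nat m))"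
      by (auto intro: span_sum span_scale span_base)
  qed
  have sub: "subspace (Pm m :: (real^'n \<Rightarrow> real) set)"
    unfolding subspace_def
  proof (intro conjI ballI allI)
    show "0 \<in> (Pm m :: (real^'n \<Rightarrow> real) set)"
      using assms by (auto simp: Pm_def fun_eq_iff intro!: exI[of _ "\<lambda>_. 0"])
    fix p q :: "real^'n \<Rightarrow> real" assume "p \<in> Pm m" "q \<in> Pm m"
    then obtain c d where "p = (\<lambda>x. \<Sum>\<alpha>\<in>mis (nat m). c \<alpha> * monomial \<alpha> x)"
      "q = (\<lambda>x. \<Sum>\<alpha>\<in>mis (nat m). d \<alpha> * monomial \<alpha> x)"
      using assms by (auto simp: Pm_def)
    then have "p + q = (\<lambda>x. \<Sum>\<alpha>\<in>mis (nat m). (c \<alpha> + d \<alpha>) * monomial \<alpha> x)"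
      by (simp add: fun_eq_iff sum.distrib algebra_simps)
    then show "p + q \<in> Pm m" using assms by (auto simp: Pm_def)
  next
    fix a and p :: "real^'n \<Rightarrow> real" assume "p \<in> Pm m"
    then obtain c where "p = (\<lambda>x. \<Sum>\<alpha>\<in>mis (nat m). c \<alpha> * monomial \<alpha> x)"
      using assms by (auto simp: Pm_def)
    then have "a *\<^sub>R p = (\<lambda>x. \<Sum>\<alpha>\<in>mis (nat m). (a * c \<alpha>) * monomial \<alpha> x)"
      by (simp add: fun_eq_iff sum_distrib_left algebra_simps)
    then show "a *\<^sub>R p \<in> Pm m" using assms by (auto simp: Pm_def)
  qed
  show "span (monomial ` mis (nat m)) \<subseteq> (Pm m :: (real^'n \<Rightarrow> real) set)"
  proof (rule span_minimal[OF _ sub], clarify)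
    fix \<alpha> :: "'n \<Rightarrow> nat" assume \<alpha>: "\<alpha> \<in> mis (nat m)"
    have "monomial \<alpha> = (\<lambda>x. \<Sum>\<beta>\<in>mis (nat m). (if \<beta> = \<alpha> then 1 else 0) * monomial \<beta> x)"
    proof
      fix x :: "real^'n"
      have "(\<Sum>\<beta>\<in>mis (nat m). (if \<beta> = \<alpha> then 1 else 0) * monomial \<beta> x)
        = (\<Sum>\<beta>\<in>mis (nat m). if \<beta> = \<alpha> then monomial \<alpha> x else 0)"
        by (rule sum.cong) auto
      also have "\<dots> = monomial \<alpha> x"
        using \<alpha> by (simp add: sum.delta finite_mis)
      finally show "monomial \<alpha> x = (\<Sum>\<beta>\<in>mis (nat m). (if \<beta> = \<alpha> then 1 else 0) * monomial \<beta> x)" ..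
    qed
    then show "monomial \<alpha> \<in> Pm m" using assms by (auto simp: Pm_def intro!: exI[of _ "\<lambda>\<beta>. if \<beta> = \<alpha> then 1 else 0"])
  qed
qed

lemma Pm_neg: "m < 0 \<Longrightarrow> Pm m = {0}"
  by (simp add: Pm_def zero_fun_def)

lemma fin_dim_Pm: "fin_dim (Pm m :: (real^'n::finite \<Rightarrow> real) set)"
proof (cases "m < 0")
  case True
  then show ?thesis unfolding fin_dim_def by (intro exI[of _ "{}"]) (simp add: Pm_neg)
next
  case False
  then show ?thesis
    unfolding fin_dim_def using finite_mis[of "nat m"]
    by (intro exI[of _ "monomial ` mis (nat m)"] conjI finite_imageI Pm_eq_span[symmetric]) auto
qed

lemma subspace_Pm: "subspace (Pm m :: (real^'n::finite \<Rightarrow> real) set)"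
  by (rule fin_dim_subspace[OF fin_dim_Pm])

lemma Pm_add: "p \<in> Pm m \<Longrightarrow> q \<in> Pm m \<Longrightarrow> (\<lambda>x. p x + q x) \<in> Pm m"
  using subspace_add[OF subspace_Pm, of p m q] by (simp add: plus_fun_def)

lemma Pm_diff: "p \<in> Pm m \<Longrightarrow> q \<in> Pm m \<Longrightarrow> (\<lambda>x. p x - q x) \<in> Pm m"
  using subspace_diff[OF subspace_Pm, of p m q] by (simp add: fun_diff_def)

lemma Pm_scale: "p \<in> Pm m \<Longrightarrow> (\<lambda>x. c * p x) \<in> Pm m"
  using subspace_scale[OF subspace_Pm, of p m c] by (simp add: scaleR_fun_def)

lemma Pm_zero: "(\<lambda>x. 0) \<in> Pm m"
  using subspace_0[OF subspace_Pm, of m] by (simp add: zero_fun_def)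

lemma Pm_sum: "(\<And>i. i \<in> I \<Longrightarrow> p i \<in> Pm m) \<Longrightarrow> (\<lambda>x. \<Sum>i\<in>I. p i x) \<in> Pm m"
  by (induction I rule: infinite_finite_induct) (auto intro: Pm_zero Pm_add)

lemma monomial_in_Pm: "\<alpha> \<in> mis m \<Longrightarrow> monomial \<alpha> \<in> Pm (int m)"
  by (subst Pm_eq_span) (auto intro: span_base)

lemma mis_mono: "m \<le> m' \<Longrightarrow> mis m \<subseteq> mis m'"
  by (auto simp: mis_def)

lemma Pm_mono:
  assumes "m \<le> m'" "p \<in> Pm m"
  shows "p \<in> Pm m'"
proof (cases "m < 0")
  case True
  then show ?thesis using assms Pm_zero[of m'] by (simp add: Pm_neg zero_fun_def)
next
  case False
  then have "0 \<le> m" "0 \<le> m'" using assms(1) by auto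
  have "span (monomial ` mis (nat m)) \<subseteq> span (monomial ` mis (nat m'))"
    using assms(1) by (intro span_mono image_mono mis_mono) auto
  then show ?thesis
    using assms(2) unfolding Pm_eq_span[OF \<open>0 \<le> m\<close>] Pm_eq_span[OF \<open>0 \<le> m'\<close>] by blast
qed

lemma Pm_const: "0 \<le> m \<Longrightarrow> (\<lambda>x. c) \<in> Pm m"
proof -
  assume "0 \<le> m"
  have "monomial (\<lambda>_. 0) \<in> Pm (int 0)" by (rule monomial_in_Pm) (simp add: mis_def)
  then have "(\<lambda>x. 1) \<in> Pm 0" by simp
  from Pm_mono[OF \<open>0 \<le> m\<close> Pm_scale[OF this, of c]] show ?thesis by simp
qed

lemma monomial_Suc:
  "x $ i * monomial \<alpha> x = monomial (\<alpha>(i := Suc (\<alpha> i))) x"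
proof -
  have "monomial (\<alpha>(i := Suc (\<alpha> i))) x = (\<Prod>j\<in>UNIV. (if j = i then x $ j else 1) * x $ j ^ \<alpha> j)"
    by (rule prod.cong) auto
  also have "\<dots> = x $ i * monomial \<alpha> x"
    by (simp add: prod.distrib)
  finally show ?thesis by simp
qed

lemma sum_fun_upd_Suc: "sum (\<alpha>(i := Suc (\<alpha> i))) (UNIV :: 'n::finite set) = Suc (sum \<alpha> UNIV)"
proof -
  have "sum (\<alpha>(i := Suc (\<alpha> i))) UNIV = (\<Sum>j\<in>UNIV. (if j = i then 1 else 0) + \<alpha> j)"
    by (rule sum.cong) auto
  also have "\<dots> = Suc (sum \<alpha> UNIV)"
    by (simp add: sum.distrib)
  finally show ?thesis .
qed

lemma Pm_mult_nth:
  assumes "p \<in> Pm m"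
  shows "(\<lambda>x. x $ i * p x) \<in> Pm (m + 1)"
proof (cases "m < 0")
  case True
  then show ?thesis using assms Pm_zero by (simp add: Pm_neg)
next
  case False
  then have "p \<in> span (monomial ` mis (nat m))" using assms by (simp add: Pm_eq_span)
  then show ?thesis
  proof (induction rule: span_induct_alt)
    case base
    then show ?case by (simp add: Pm_zero)
  next
    case (step c q p)
    then obtain \<alpha> where \<alpha>: "\<alpha> \<in> mis (nat m)" "q = monomial \<alpha>" by auto
    have "\<alpha>(i := Suc (\<alpha> i)) \<in> mis (nat (m + 1))"
      using \<alpha>(1) False unfolding mis_def mem_Collect_eq sum_fun_upd_Suc by simp
    from monomial_in_Pm[OF this] have "monomial (\<alpha>(i := Suc (\<alpha> i))) \<in> Pm (m + 1)"
      using False by (simp only: int_nat_eq) simp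
    then have "(\<lambda>x. x $ i * q x) \<in> Pm (m + 1)" by (simp only: \<alpha>(2) monomial_Suc)
    from Pm_add[OF Pm_scale[OF this, of c] step(2)] show ?case
      by (simp add: algebra_simps)
  qed
qed

lemma Pm_nth: "1 \<le> m \<Longrightarrow> (\<lambda>x. x $ i) \<in> Pm m"
  using Pm_mono[OF _ Pm_mult_nth[OF Pm_const[of 0 1], of i]] by simp

text \<open>Structural induction with the degree bound as an index that only multiplication by a
  coordinate raises. The case \<open>mult\<close> keeps the monomial explicit because
  \<open>ref_divergence_decomposition\<close> depends on its exponents.\<close>

lemma Pm_induct_monomial [consumes 1, case_names one mult add]:
  fixes p :: "real^'n::finite \<Rightarrow> real" and m :: nat
  assumes "p \<in> Pm (int m)"
    and one: "\<And>m. P m (\<lambda>x. 1)"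
    and mult: "\<And>m i \<alpha>. \<alpha> \<in> mis m \<Longrightarrow> P m (monomial \<alpha>) \<Longrightarrow> P (Suc m) (\<lambda>x. x $ i * monomial \<alpha> x)"
    and add: "\<And>m c p q. p \<in> Pm (int m) \<Longrightarrow> q \<in> Pm (int m) \<Longrightarrow> P m p \<Longrightarrow> P m q \<Longrightarrow> P m (\<lambda>x. c * p x + q x)"
  shows "P m p"
proof -
  have mon: "P m (monomial \<alpha>)" if "\<alpha> \<in> mis m" for \<alpha> :: "'n \<Rightarrow> nat" and m
    using that
  proof (induction m arbitrary: \<alpha>)
    case 0
    then have "\<alpha> = (\<lambda>_. 0)" by (auto simp: mis_def)
    then show ?case using one by simp
  next
    case (Suc m)
    show ?case
    proof (cases "\<exists>i. \<alpha> i > 0")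
      case False
      then have "\<alpha> = (\<lambda>_. 0)" by auto
      then show ?thesis using one by simp
    next
      case True
      then obtain i where i: "\<alpha> i > 0" by auto
      define \<beta> where "\<beta> = \<alpha>(i := \<alpha> i - 1)"
      have \<alpha>\<beta>: "\<alpha> = \<beta>(i := Suc (\<beta> i))" using i by (auto simp: \<beta>_def)
      have \<beta>: "\<beta> \<in> mis m"
        using Suc.prems sum_fun_upd_Suc[of \<beta> i] \<alpha>\<beta> by (simp add: mis_def)
      from mult[OF \<beta> Suc.IH[OF \<beta>], of i] show ?thesis
        unfolding monomial_Suc \<alpha>\<beta>[symmetric] .
    qed
  qed
  have "p \<in> span (monomial ` mis m)" using assms(1) by (simp add: Pm_eq_span)
  then have "P m p \<and> p \<in> Pm (int m)"
  proof (induction rule: span_induct_alt)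
    case base
    \<comment> \<open>The zero polynomial has to be produced from the rules \<open>one\<close> and
      \<open>add\<close>.\<close>
    have "P m (\<lambda>x. (-1) * 1 + 1)" by (intro add one Pm_const) auto
    then show ?case by (simp add: zero_fun_def Pm_zero)
  next
    case (step c q p)
    then obtain \<alpha> where \<alpha>: "\<alpha> \<in> mis m" "q = monomial \<alpha>" by auto
    have q: "P m q" "q \<in> Pm (int m)" using mon[OF \<alpha>(1)] monomial_in_Pm[OF \<alpha>(1)] \<alpha>(2) by auto
    have eq: "c *\<^sub>R q + p = (\<lambda>x. c * q x + p x)" by (simp add: fun_eq_iff)
    show ?case unfolding eq using q step(2) by (auto intro!: add Pm_add Pm_scale)
  qed
  then show ?thesis ..
qed

lemma Pm_induct [consumes 1, case_names one mult add]:
  fixes p :: "real^'n::finite \<Rightarrow> real" and m :: nat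
  assumes "p \<in> Pm (int m)"
    and one: "\<And>m. P m (\<lambda>x. 1)"
    and mult: "\<And>m i p. p \<in> Pm (int m) \<Longrightarrow> P m p \<Longrightarrow> P (Suc m) (\<lambda>x. x $ i * p x)"
    and add: "\<And>m c p q. p \<in> Pm (int m) \<Longrightarrow> q \<in> Pm (int m) \<Longrightarrow> P m p \<Longrightarrow> P m q \<Longrightarrow> P m (\<lambda>x. c * p x + q x)"
  shows "P m p"
  using assms(1)
proof (induction rule: Pm_induct_monomial)
  case (mult m i \<alpha>)
  then show ?case using assms(3) monomial_in_Pm by blast
qed (use one add in auto)

lemma Pm_mult:
  assumes p: "p \<in> Pm a" and q: "q \<in> Pm b"
  shows "(\<lambda>x. p x * q x) \<in> Pm (a + b)"
proof (cases "a < 0 \<or> b < 0")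
  case True
  then show ?thesis using assms Pm_zero[of "a + b"] by (auto simp: Pm_neg)
next
  case False
  then have "p \<in> Pm (int (nat a))" using p by simp
  then have "(\<lambda>x. p x * q x) \<in> Pm (int (nat a) + b)"
  proof (induction rule: Pm_induct)
    case (one m)
    then show ?case using Pm_mono[OF _ q] by simp
  next
    case (mult m i p)
    from Pm_mult_nth[OF mult(2), of i] show ?case by (simp add: algebra_simps)
  next
    case (add m c p r)
    from Pm_add[OF Pm_scale[OF add(3), of c] add(4)] show ?case by (simp add: algebra_simps)
  qed
  then show ?thesis using False by simp
qed

lemma Pm_compose:
  fixes f :: "real^'m::finite \<Rightarrow> real^'n::finite"
  assumes f: "\<And>i. (\<lambda>x. f x $ i) \<in> Pm 1" and p: "p \<in> Pm m"
  shows "(\<lambda>x. p (f x)) \<in> Pm m"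
proof (cases "m < 0")
  case True
  then show ?thesis using p Pm_zero[of m] by (simp add: Pm_neg zero_fun_def)
next
  case False
  then have "p \<in> Pm (int (nat m))" using p by simp
  then have "(\<lambda>x. p (f x)) \<in> Pm (int (nat m))"
  proof (induction rule: Pm_induct)
    case (mult m i p)
    from Pm_mult[OF f[of i] mult(2)] show ?case by (simp add: algebra_simps)
  qed (auto intro: Pm_add Pm_scale Pm_const)
  then show ?thesis using False by simp
qed

lemma vec_basis_sum: "(\<Sum>i\<in>UNIV. x $ i *\<^sub>R axis i 1) = (x :: real^'n::finite)"
  using basis_expansion[of x] by (simp add: scalar_mult_eq_scaleR)

lemma Pm_affine:
  fixes f :: "real^'m::finite \<Rightarrow> real"
  assumes "linear f"
  shows "(\<lambda>x. c + f x) \<in> Pm 1"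
proof -
  have "f = (\<lambda>x. \<Sum>i\<in>UNIV. f (axis i 1) * x $ i)"
  proof
    fix x
    have "f x = f (\<Sum>i\<in>UNIV. x $ i *\<^sub>R axis i 1)" by (simp add: vec_basis_sum)
    then show "f x = (\<Sum>i\<in>UNIV. f (axis i 1) * x $ i)"
      by (simp only: linear_sum[OF assms] linear_scale[OF assms] real_scaleR_def mult.commute)
  qed
  then have "(\<lambda>x. c + f x) = (\<lambda>x. c + (\<Sum>i\<in>UNIV. f (axis i 1) * x $ i))" by metis
  also have "\<dots> \<in> Pm 1" by (intro Pm_add Pm_const Pm_sum Pm_scale Pm_nth) auto
  finally show ?thesis .
qed

lemma Pm_polynomial_function: "p \<in> Pm m \<Longrightarrow> real_polynomial_function p"
proof -
  assume p: "p \<in> Pm m"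
  then have "p \<in> Pm (int (nat m))" by (rule Pm_mono[rotated]) simp
  then show ?thesis
  proof (induction rule: Pm_induct)
    case (mult m i p)
    have "real_polynomial_function (\<lambda>x::real^'a. x $ i)"
      by (intro real_polynomial_function.intros(1) bounded_linear_vec_nth)
    then show ?case using mult by (auto intro: real_polynomial_function.intros(4))
  qed (auto intro!: real_polynomial_function.intros(2,3,4))
qed

lemma Pm_continuous_on: "p \<in> Pm m \<Longrightarrow> continuous_on S p"
  using Pm_polynomial_function real_polynomial_function_eq continuous_on_polymonial_function by blast

lemma Pm_differentiable: "p \<in> Pm m \<Longrightarrow> p differentiable (at x)"
  using Pm_polynomial_function differentiable_at_real_polynomial_function by blast

text \<open>On the line from a point of \<open>S\<close> to \<open>x\<close> the polynomial is
  univariate and has infinitely many roots, as the line meets \<open>S\<close> in a nonempty open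
  set of parameters.\<close>

lemma Pm_identity:
  assumes p: "p \<in> Pm m" and S: "open S" "S \<noteq> {}" and zero: "\<And>x. x \<in> S \<Longrightarrow> p x = 0"
  shows "p = 0"
proof
  fix x
  obtain a where a: "a \<in> S" using S by auto
  define g where "g t = p (a + t *\<^sub>R (x - a))" for t :: real
  have "polynomial_function (\<lambda>t::real. a + t *\<^sub>R (x - a))"
    by (intro polynomial_function_add polynomial_function_const polynomial_function_mult
        polynomial_function_id)
  then have "real_polynomial_function g"
    using real_polynomial_function_compose[OF _ Pm_polynomial_function[OF p]]
    unfolding g_def by (auto simp: o_def)
  then obtain c n where g: "g = (\<lambda>t. \<Sum>i\<le>n. c i * t ^ i)"
    using real_polynomial_function_imp_sum by metis
  have "continuous_on UNIV (\<lambda>t::real. a + t *\<^sub>R (x - a))" by (intro continuous_intros)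
  then have op: "open ((\<lambda>t::real. a + t *\<^sub>R (x - a)) -` S)"
    using S(1) by (rule open_vimage[rotated])
  have "0 \<in> (\<lambda>t::real. a + t *\<^sub>R (x - a)) -` S" using a by simp
  with op have "infinite ((\<lambda>t::real. a + t *\<^sub>R (x - a)) -` S)"
    by (metis empty_iff finite_imp_not_open)
  moreover have "(\<lambda>t::real. a + t *\<^sub>R (x - a)) -` S \<subseteq> {t. (\<Sum>i\<le>n. c i * t ^ i) = 0}"
  proof
    fix t assume "t \<in> (\<lambda>t::real. a + t *\<^sub>R (x - a)) -` S"
    then have "g t = 0" using zero by (simp add: g_def)
    then show "t \<in> {t. (\<Sum>i\<le>n. c i * t ^ i) = 0}" using g by simp
  qed
  ultimately have "infinite {t. (\<Sum>i\<le>n. c i * t ^ i) = 0}" using finite_subset by blast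
  then have "\<forall>i\<le>n. c i = 0" using polyfun_rootbound_finite by (metis polyfun_finite_roots)
  then have "g 1 = 0" by (simp add: g)
  then show "p x = 0 x" by (simp add: g_def)
qed

section \<open>Partial derivatives\<close>

lemma pdiff_eq: "(f has_derivative f') (at x) \<Longrightarrow> pdiff i f x = f' (axis i 1)"
  unfolding pdiff_def using frechet_derivative_at by metis

lemma has_derivative_cgrad:
  assumes "f differentiable (at x)"
  shows "(f has_derivative (\<lambda>h. cgrad f x \<bullet> h)) (at x)"
proof -
  have fd: "(f has_derivative frechet_derivative f (at x)) (at x)"
    using assms frechet_derivative_works by blast
  then have lin: "linear (frechet_derivative f (at x))" by (rule has_derivative_linear)
  have "frechet_derivative f (at x) h = cgrad f x \<bullet> h" for h
  proof -
    have "frechet_derivative f (at x) h = frechet_derivative f (at x) (\<Sum>i\<in>UNIV. h $ i *\<^sub>R axis i 1)"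
      by (simp add: vec_basis_sum)
    also have "\<dots> = (\<Sum>i\<in>UNIV. h $ i * frechet_derivative f (at x) (axis i 1))"
      by (simp add: linear_sum[OF lin] linear_scale[OF lin])
    finally show ?thesis by (simp add: cgrad_def pdiff_def inner_vec_def mult.commute)
  qed
  then have "frechet_derivative f (at x) = (\<lambda>h. cgrad f x \<bullet> h)" by (rule ext)
  then show ?thesis using fd by simp
qed

lemma cgrad_inner_eq: "(f has_derivative f') (at x) \<Longrightarrow> cgrad f x \<bullet> h = f' h"
  using has_derivative_unique[OF has_derivative_cgrad[OF differentiableI]] by metis

lemma pdiff_const [simp]: "pdiff i (\<lambda>x. c) = (\<lambda>x. 0)"
  by (rule ext) (simp add: pdiff_eq[OF has_derivative_const])

lemma pdiff_nth [simp]: "pdiff i (\<lambda>x. x $ j) = (\<lambda>x. if i = j then 1 else 0)"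
  by (rule ext) (simp add: pdiff_eq[OF bounded_linear_imp_has_derivative[OF bounded_linear_vec_nth]] axis_def)

lemma pdiff_add:
  "f differentiable (at x) \<Longrightarrow> g differentiable (at x) \<Longrightarrow>
    pdiff i (\<lambda>x. f x + g x) x = pdiff i f x + pdiff i g x"
  using pdiff_eq[OF has_derivative_add[OF has_derivative_cgrad has_derivative_cgrad], of f x g i]
  by (simp add: cgrad_def inner_axis)

lemma pdiff_diff:
  "f differentiable (at x) \<Longrightarrow> g differentiable (at x) \<Longrightarrow>
    pdiff i (\<lambda>x. f x - g x) x = pdiff i f x - pdiff i g x"
  using pdiff_eq[OF has_derivative_diff[OF has_derivative_cgrad has_derivative_cgrad], of f x g i]
  by (simp add: cgrad_def inner_axis)

lemma pdiff_mult:
  "f differentiable (at x) \<Longrightarrow> g differentiable (at x) \<Longrightarrow>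
    pdiff i (\<lambda>x. f x * g x) x = f x * pdiff i g x + pdiff i f x * g x"
  using pdiff_eq[OF has_derivative_mult[OF has_derivative_cgrad has_derivative_cgrad], of f x g i]
  by (simp add: cgrad_def inner_axis)

lemma pdiff_cmult:
  "f differentiable (at x) \<Longrightarrow> pdiff i (\<lambda>x. c * f x) x = c * pdiff i f x"
  using pdiff_mult[of "\<lambda>x. c" x f i] by simp

lemma pdiff_sum:
  "(\<And>j. j \<in> J \<Longrightarrow> f j differentiable (at x)) \<Longrightarrow>
    pdiff i (\<lambda>x. \<Sum>j\<in>J. f j x) x = (\<Sum>j\<in>J. pdiff i (f j) x)"
proof (induction J rule: infinite_finite_induct)
  case (insert j J)
  then show ?case by (simp add: pdiff_add differentiable_sum)
qed auto

lemma pdiff_compose: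
  assumes "(F has_real_derivative D) (at (f x))" "f differentiable (at x)"
  shows "pdiff i (\<lambda>x. F (f x)) x = D * pdiff i f x"
  using pdiff_eq[OF has_derivative_compose[OF has_derivative_cgrad[OF assms(2)]
     assms(1)[unfolded has_field_derivative_def]]]
  by (simp add: cgrad_def inner_axis)

lemma Pm_pdiff:
  assumes "p \<in> Pm m"
  shows "pdiff i p \<in> Pm (m - 1)"
proof (cases "m < 0")
  case True
  then show ?thesis using assms Pm_zero[of "m - 1"] by (simp add: Pm_neg zero_fun_def)
next
  case False
  then have "p \<in> Pm (int (nat m))" using assms by simp
  then have "pdiff i p \<in> Pm (int (nat m) - 1)"
  proof (induction rule: Pm_induct)
    case (one m)
    then show ?case by (simp add: Pm_zero)
  next
    case (mult m j p)
    have d: "(\<lambda>x::real^'a. x $ j) differentiable (at x)" for x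
      using Pm_differentiable[OF Pm_nth[of 1 j]] by simp
    have "pdiff i (\<lambda>x. x $ j * p x) = (\<lambda>x. x $ j * pdiff i p x + (if i = j then 1 else 0) * p x)"
      using d Pm_differentiable[OF mult(1)] by (auto simp: pdiff_mult fun_eq_iff)
    then show ?case
      using Pm_add[OF _ Pm_scale[OF mult(1)]] Pm_mult_nth[OF mult(2), of j] by simp
  next
    case (add m c p q)
    have "pdiff i (\<lambda>x. c * p x + q x) = (\<lambda>x. c * pdiff i p x + pdiff i q x)"
      using Pm_differentiable[OF add(1)] Pm_differentiable[OF add(2)]
      by (auto simp: pdiff_add pdiff_cmult fun_eq_iff)
    then show ?case using Pm_add[OF Pm_scale[OF add(3)] add(4)] by simp
  qed
  then show ?thesis using False by simp
qed

lemma Pm_Cinf: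
  assumes "p \<in> Pm m"
  shows "Cinf p"
proof -
  have "\<exists>m. foldr pdiff js p \<in> Pm m" for js
    using assms by (induction js) (auto intro: Pm_pdiff)
  then show ?thesis unfolding Cinf_def using Pm_differentiable by blast
qed

lemma Pm_frechet:
  assumes "p \<in> Pm m"
  shows "cgrad p \<in> Pmv (m - 1)"
  using Pm_pdiff[OF assms] by (simp add: Pmv_def cgrad_def)

definition pdiv :: "(real^'n::finite \<Rightarrow> real^'n) \<Rightarrow> real^'n \<Rightarrow> real" where
  "pdiv \<xi> x = (\<Sum>i\<in>UNIV. pdiff i (\<lambda>x. \<xi> x $ i) x)"

lemma pdiv_Pm: "\<xi> \<in> Pmv m \<Longrightarrow> pdiv \<xi> \<in> Pm (m - 1)"
  unfolding pdiv_def Pmv_def by (intro Pm_sum Pm_pdiff) auto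

text \<open>Division by the linear factor \<open>1 - s\<close>: the map \<open>L x = x + (1 - s x) e\<^sub>j\<close> projects
  onto the hyperplane \<open>s = 1\<close>.\<close>
lemma Pm_hyperplane_division:
  fixes s :: "real^'n::finite \<Rightarrow> real" and e :: "real^'n"
  assumes "p \<in> Pm m" and s: "s \<in> Pm 1"
  shows "\<exists>q\<in>Pm (m - 1). \<forall>x. p x = p (x + (1 - s x) *\<^sub>R e) + (1 - s x) * q x"
proof (cases "m < 0")
  case True
  then show ?thesis using assms Pm_zero[of "m - 1"] by (intro bexI[of _ 0]) (auto simp: Pm_neg zero_fun_def)
next
  case False
  then have "p \<in> Pm (int (nat m))" using assms by simp
  then have "\<exists>q\<in>Pm (int (nat m) - 1). \<forall>x. p x = p (x + (1 - s x) *\<^sub>R e) + (1 - s x) * q x"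
  proof (induction rule: Pm_induct)
    case (one m)
    then show ?case by (intro bexI[of _ "\<lambda>x. 0"]) (auto simp: Pm_zero)
  next
    case (mult m i p)
    then obtain q where q: "q \<in> Pm (int m - 1)"
      "\<And>x. p x = p (x + (1 - s x) *\<^sub>R e) + (1 - s x) * q x" by blast
    define L where "L x = x + (1 - s x) *\<^sub>R e" for x
    have L: "L x $ i = x $ i + e $ i - e $ i * s x" for x by (simp add: L_def algebra_simps)
    \<comment> \<open>The new quotient results from
      \<open>x $ i = L x $ i - (1 - s x) * e $ i\<close> applied to the factor in front of
      \<open>p x\<close>.\<close>
    have "(\<lambda>x. L x $ i * q x - e $ i * p x) \<in> Pm (int m)"
    proof (rule Pm_diff)
      have "(\<lambda>x. L x $ i) \<in> Pm 1"
        unfolding L by (intro Pm_diff Pm_add Pm_scale s Pm_nth Pm_const) auto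
      from Pm_mult[OF this q(1)] show "(\<lambda>x. L x $ i * q x) \<in> Pm (int m)" by simp
    qed (intro Pm_scale mult)
    moreover have "x $ i * p x = L x $ i * p (L x) + (1 - s x) * (L x $ i * q x - e $ i * p x)" for x
    proof -
      have "x $ i * p x = L x $ i * p x - (1 - s x) * e $ i * p x"
        by (simp add: L algebra_simps)
      also have "L x $ i * p x = L x $ i * (p (L x) + (1 - s x) * q x)"
        using q(2)[of x] by (simp only: L_def)
      finally show ?thesis by (simp add: algebra_simps)
    qed
    ultimately show ?case by (auto simp: L_def)
  next
    case (add m c p r)
    then obtain q q' where q: "q \<in> Pm (int m - 1)" "q' \<in> Pm (int m - 1)"
      "\<And>x. p x = p (x + (1 - s x) *\<^sub>R e) + (1 - s x) * q x"
      "\<And>x. r x = r (x + (1 - s x) *\<^sub>R e) + (1 - s x) * q' x" by blast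
    have eq: "c * p x + r x = c * p (x + (1 - s x) *\<^sub>R e) + r (x + (1 - s x) *\<^sub>R e)
       + (1 - s x) * (c * q x + q' x)" for x
    proof -
      have "c * p x = c * p (x + (1 - s x) *\<^sub>R e) + c * ((1 - s x) * q x)"
        by (metis distrib_left q(3))
      then show ?thesis using q(4)[of x] by (simp only:) (simp add: algebra_simps)
    qed
    show ?case by (rule bexI[OF _ Pm_add[OF Pm_scale[OF q(1), of c] q(2)]]) (use eq in blast)
  qed
  then show ?thesis using False by simp
qed

section \<open>Affine changes of variables\<close>

lemma prod_Basis_vec: "(\<Prod>b\<in>(Basis :: (real^'n::finite) set). f b) = (\<Prod>i\<in>UNIV. f (axis i 1))"
proof -
  have eq: "(Basis :: (real^'n) set) = range (\<lambda>i. axis i 1)" by (auto simp: Basis_vec_def)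
  have inj: "inj (\<lambda>i. axis i 1 :: real^'n)" by (rule injI) (simp add: axis_eq_axis)
  show ?thesis unfolding eq by (subst prod.reindex[OF inj]) simp
qed

lemma linear_borel_measurable:
  fixes L :: "'a::euclidean_space \<Rightarrow> 'b::euclidean_space"
  shows "linear L \<Longrightarrow> L \<in> borel_measurable borel"
  by (simp add: borel_measurable_continuous_onI linear_continuous_on linear_conv_bounded_linear)

text \<open>Lebesgue measure is determined by its values on boxes, so it suffices to compare the
  rescaled image measure there. The factor is the determinant of the inverse \<open>A\<close>,
  because preimages under \<open>B\<close> are images under \<open>A\<close>.\<close>

lemma emeasure_linear_vimage_wellorder:
  fixes B :: "real^'m::{finite,wellorder} \<Rightarrow> real^'m::_"
  assumes B: "linear B" "bij B"
  shows "\<exists>c>0. \<forall>S\<in>sets borel. emeasure lborel (B -` S) = ennreal c * emeasure lborel S"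
proof -
  define A where "A = inv B"
  have A: "linear A" "inj A"
    unfolding A_def using B by (auto intro: inj_linear_imp_inv_linear bij_is_inj bij_imp_bij_inv)
  define c where "c = \<bar>det (matrix A)\<bar>"
  have c: "c > 0" unfolding c_def using det_nz_iff_inj[OF A(1)] A(2) by simp
  have Bm: "B \<in> borel_measurable borel"
    using B(1) by (rule linear_borel_measurable)
  have vim: "B -` S = A ` S" for S
    unfolding A_def using B(2) by (simp add: bij_vimage_eq_inv_image)
  have "lborel = density (distr lborel borel B) (\<lambda>_. ennreal (1 / c))"
  proof (rule lborel_eqI)
    fix l u :: "real^'m::_" assume lu: "\<And>b. b \<in> Basis \<Longrightarrow> l \<bullet> b \<le> u \<bullet> b"
    have "emeasure (density (distr lborel borel B) (\<lambda>_. ennreal (1 / c))) (box l u)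
      = ennreal (1 / c) * emeasure lborel (A ` box l u)"
      using Bm by (subst emeasure_density_const) (simp_all add: emeasure_distr vim[symmetric])
    also have "emeasure lborel (A ` box l u) = emeasure lebesgue (A ` box l u)"
      using measurable_sets[OF Bm, of "box l u"] by (simp add: vim emeasure_completion)
    also have "\<dots> = ennreal (measure lebesgue (A ` box l u))"
      using measurable_linear_image[OF A(1), of "box l u"]
      by (intro emeasure_eq_measure2) (auto simp: fmeasurableD2)
    also have "measure lebesgue (A ` box l u) = c * (\<Prod>b\<in>Basis. (u - l) \<bullet> b)"
      using measure_linear_image[OF A(1), of "box l u"] lu by (simp add: c_def measure_lborel_box)
    also have "ennreal (1 / c) * ennreal (c * (\<Prod>b\<in>Basis. (u - l) \<bullet> b)) = ennreal (\<Prod>b\<in>Basis. (u - l) \<bullet> b)"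
      using c by (subst ennreal_mult'[symmetric]) auto
    finally show "emeasure (density (distr lborel borel B) (\<lambda>_. ennreal (1 / c))) (box l u)
      = ennreal (\<Prod>b\<in>Basis. (u - l) \<bullet> b)" by simp
  qed simp
  note eq = this
  have "emeasure lborel S = ennreal (1 / c) * emeasure lborel (B -` S)" if S: "S \<in> sets borel" for S
  proof -
    have "emeasure lborel S = emeasure (density (distr lborel borel B) (\<lambda>_. ennreal (1 / c))) S"
      by (rule arg_cong[OF eq, of "\<lambda>M. emeasure M S"])
    also have "\<dots> = ennreal (1 / c) * emeasure lborel (B -` S)"
      using S Bm by (subst emeasure_density_const) (simp_all add: emeasure_distr)
    finally show ?thesis .
  qed
  then have "ennreal c * emeasure lborel S = ennreal (c * (1 / c)) * emeasure lborel (B -` S)"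
    if "S \<in> sets borel" for S
    using that c by (simp add: ennreal_mult' mult.assoc del: times_divide_eq_right)
  then show ?thesis using c by (intro exI[of _ c]) simp
qed

lemma emeasure_reindex_vimage:
  fixes \<pi> :: "'m::finite \<Rightarrow> 'n::finite"
  assumes \<pi>: "bij \<pi>" and S: "S \<in> sets borel"
  shows "emeasure lborel ((\<lambda>x::real^'n. \<chi> j. x $ \<pi> j) -` S) = emeasure lborel S"
proof -
  define P where "P x = (\<chi> j. x $ \<pi> j)" for x :: "real^'n"
  have lin: "linear P" by (rule linearI) (auto simp: P_def vec_eq_iff)
  have Pm: "P \<in> borel_measurable borel"
    using lin by (rule linear_borel_measurable)
  have "lborel = distr lborel borel P"
  proof (rule lborel_eqI)
    fix l u :: "real^'m" assume lu: "\<And>b. b \<in> Basis \<Longrightarrow> l \<bullet> b \<le> u \<bullet> b"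
    define Q where "Q y = (\<chi> i. y $ inv \<pi> i)" for y :: "real^'m"
    have inv: "inv \<pi> (\<pi> j) = j" "\<pi> (inv \<pi> i) = i" for i j
      using \<pi> by (simp_all add: bij_is_inj bij_is_surj surj_f_inv_f)
    have vim: "P -` box l u = box (Q l) (Q u)"
      by (auto simp: P_def Q_def mem_box_cart) (metis inv)+
    have lu': "l $ i \<le> u $ i" for i
      using lu[of "axis i 1"] by (auto simp: inner_axis Basis_vec_def)
    have "emeasure (distr lborel borel P) (box l u) = emeasure lborel (box (Q l) (Q u))"
      using Pm by (simp add: emeasure_distr vim)
    also have "\<dots> = ennreal (\<Prod>b\<in>Basis. (Q u - Q l) \<bullet> b)"
      by (intro emeasure_lborel_box) (use lu' in \<open>auto simp: Basis_vec_def inner_axis Q_def\<close>)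
    also have "(\<Prod>b\<in>Basis. (Q u - Q l) \<bullet> b) = (\<Prod>i\<in>UNIV. u $ inv \<pi> i - l $ inv \<pi> i)"
      by (simp add: prod_Basis_vec inner_axis Q_def)
    also have "\<dots> = (\<Prod>j\<in>UNIV. u $ j - l $ j)"
      using \<pi> by (intro prod.reindex_bij_betw bij_imp_bij_inv)
    also have "\<dots> = (\<Prod>b\<in>Basis. (u - l) \<bullet> b)"
      by (simp add: prod_Basis_vec inner_axis)
    finally show "emeasure (distr lborel borel P) (box l u) = ennreal (\<Prod>b\<in>Basis. (u - l) \<bullet> b)" .
  qed simp
  then have "emeasure lborel S = emeasure (distr lborel borel P) S" by simp
  then show ?thesis using S Pm by (simp add: emeasure_distr P_def[abs_def])
qed

text \<open>The determinant formula of the library needs a well-ordered index type; only the existence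
  of a scaling factor is needed here, so a reindexing suffices.\<close>
lemma emeasure_linear_vimage:
  fixes B :: "real^'n::finite \<Rightarrow> real^'n" and m :: "'m::{finite,wellorder} itself"
  assumes card: "card (UNIV :: 'm::_ set) = CARD('n)" and B: "linear B" "bij B"
  shows "\<exists>c>0. \<forall>S\<in>sets borel. emeasure lborel (B -` S) = ennreal c * emeasure lborel S"
proof -
  obtain \<pi> :: "'m \<Rightarrow> 'n" where \<pi>: "bij \<pi>"
    using finite_same_card_bij[of "UNIV :: 'm set" "UNIV :: 'n set"] card by auto
  have inv: "inv \<pi> (\<pi> j) = j" "\<pi> (inv \<pi> i) = i" for i j
    using \<pi> by (simp_all add: bij_is_inj bij_is_surj surj_f_inv_f)
  define P where "P = (\<lambda>x::real^'n. \<chi> j. x $ \<pi> j)"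
  define Q where "Q = (\<lambda>y::real^'m::_. \<chi> i. y $ inv \<pi> i)"
  have PQ: "P (Q y) = y" "Q (P x) = x" for x y by (simp_all add: P_def Q_def vec_eq_iff inv)
  have lin: "linear P" "linear Q"
    by (auto intro!: linearI simp: P_def Q_def vec_eq_iff)
  define B' where "B' = P \<circ> B \<circ> Q"
  have linB: "linear B'" unfolding B'_def using lin B by (intro linear_compose)
  have "bij P" by (rule o_bij[of Q]) (auto simp: fun_eq_iff PQ)
  moreover have "bij Q" by (rule o_bij[of P]) (auto simp: fun_eq_iff PQ)
  ultimately have "bij B'"
    unfolding B'_def using B(2) by (intro bij_comp)
  from emeasure_linear_vimage_wellorder[OF linB this]
  obtain c where c: "c > 0" "\<And>S. S \<in> sets borel \<Longrightarrow> emeasure lborel (B' -` S) = ennreal c * emeasure lborel S"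
    by blast
  note meas = linear_borel_measurable
  have "emeasure lborel (B -` S) = ennreal c * emeasure lborel S" if S: "S \<in> sets borel" for S
  proof -
    have "B -` S = P -` (B' -` (Q -` S))" by (auto simp: B'_def PQ)
    also have "emeasure lborel \<dots> = emeasure lborel (B' -` (Q -` S))"
      unfolding P_def
      using measurable_sets[OF meas[OF linB] measurable_sets[OF meas[OF lin(2)] S, simplified]]
      by (intro emeasure_reindex_vimage \<pi>) (simp add: space_borel)
    also have "\<dots> = ennreal c * emeasure lborel (Q -` S)"
      using measurable_sets[OF meas[OF lin(2)] S] by (intro c(2)) (simp add: space_borel)
    also have "emeasure lborel (Q -` S) = emeasure lborel S"
      unfolding Q_def using \<pi> S by (intro emeasure_reindex_vimage bij_imp_bij_inv)
    finally show ?thesis .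
  qed
  then show ?thesis using c(1) by blast
qed

lemma integral_affine_change:
  fixes B :: "real^'n::finite \<Rightarrow> real^'n"
  assumes dim: "CARD('n) = 2 \<or> CARD('n) = 3" and B: "linear B" "bij B"
  shows "\<exists>c>0. \<forall>g::real^'n \<Rightarrow> real. g \<in> borel_measurable borel \<longrightarrow>
    (\<integral>x. g (a + B x) \<partial>lborel) = c * (\<integral>x. g x \<partial>lborel)"
proof -
  have "\<exists>c>0. \<forall>S\<in>sets borel. emeasure lborel (B -` S) = ennreal c * emeasure lborel S"
    \<comment> \<open>The numeral types \<open>2\<close> and \<open>3\<close> are well-ordered index
      types of the two admissible cardinalities.\<close>
    using dim emeasure_linear_vimage[where 'm=2, OF _ B] emeasure_linear_vimage[where 'm=3, OF _ B] by auto
  then obtain c where c: "c > 0"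
    "\<And>S. S \<in> sets borel \<Longrightarrow> emeasure lborel (B -` S) = ennreal c * emeasure lborel S" by blast
  have Bm: "B \<in> borel_measurable borel"
    using B(1) by (rule linear_borel_measurable)
  have distr_B: "distr lborel borel B = density lborel (\<lambda>_. ennreal c)"
    by (rule measure_eqI) (use Bm c in \<open>auto simp: emeasure_distr emeasure_density_const\<close>)
  have "(\<integral>x. g (a + B x) \<partial>lborel) = c * (\<integral>x. g x \<partial>lborel)"
    if g: "g \<in> borel_measurable borel" for g :: "real^'n \<Rightarrow> real"
  proof -
    have "(\<integral>x. g (a + B x) \<partial>lborel) = (\<integral>y. g (a + y) \<partial>distr lborel borel B)"
      using Bm g by (subst integral_distr) auto
    also have "\<dots> = c * (\<integral>y. g (a + y) \<partial>lborel)"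
      using c g by (simp add: distr_B integral_density)
    also have "(\<integral>y. g (a + y) \<partial>lborel) = (\<integral>y. g y \<partial>distr lborel borel ((+) a))"
      using g by (subst integral_distr) auto
    finally show ?thesis by (simp add: lborel_distr_plus)
  qed
  then show ?thesis using c by blast
qed

lemma integral_lebesgue_on_borel:
  fixes g :: "'a::euclidean_space \<Rightarrow> real"
  assumes "S \<in> sets borel" "g \<in> borel_measurable borel"
  shows "(\<integral>x. g x \<partial>lebesgue_on S) = (\<integral>x. indicator S x * g x \<partial>lborel)"
  using assms by (simp add: integral_restrict_space integral_completion)

section \<open>Simplices and barycentric coordinates\<close>

text \<open>The barycentric coordinate of the vertex \<open>z\<close>, written with normal and
  height because \<open>rproj\<close> and the face integrals are built from these.\<close>

definition lam :: "(real^'n::finite) set \<Rightarrow> real^'n \<Rightarrow> real^'n \<Rightarrow> real" where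
  "lam V z x = 1 - onormal V z \<bullet> (x - z) / height V z"

locale nsimplex =
  fixes V :: "(real^'n::finite) set"
  assumes indep: "\<not> affine_dependent V" and cardV: "card V = CARD('n) + 1"
begin

abbreviation T where "T \<equiv> convex hull V"

lemma finite_V [simp]: "finite V"
  using cardV card.infinite by fastforce

lemma affine_hull_V: "affine hull V = UNIV"
  using aff_dim_affine_independent[OF indep] cardV by (simp add: aff_dim_eq_full[symmetric])

lemma V_nontrivial: "\<exists>w\<in>V. w \<noteq> z"
proof (rule ccontr)
  assume "\<not> ?thesis"
  then have "V \<subseteq> {z}" by auto
  then have "card V \<le> 1" using card_mono[of "{z}" V] by simp
  then show False using cardV by simp
qed

lemma affine_vanish:
  fixes b :: "real^'n"
  assumes "\<And>w. w \<in> V \<Longrightarrow> b \<bullet> w = c"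
  shows "b = 0"
proof -
  have "affine hull V \<subseteq> {x. b \<bullet> x = c}"
    by (rule hull_minimal) (use assms in \<open>auto simp: affine_hyperplane\<close>)
  then have "b \<bullet> x = c" for x using affine_hull_V by auto
  from this[of 0] this[of b] show ?thesis by simp
qed

text \<open>The vector is the gradient of the barycentric coordinate of \<open>z\<close>. The edges
  at another vertex \<open>w0\<close> are independent, so a linear functional may be prescribed on
  them.\<close>

lemma dual_vector:
  assumes "z \<in> V"
  shows "\<exists>a. \<forall>w\<in>V - {z}. a \<bullet> (z - w) = 1"
proof -
  obtain w0 where w0: "w0 \<in> V" "w0 \<noteq> z" using V_nontrivial by blast
  let ?S = "(\<lambda>x. - w0 + x) ` (V - {w0})"
  have ind: "independent ?S"
    using affine_dependent_iff_dependent2[OF w0(1)] indep by simp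
  obtain g where g: "linear g" "\<And>x. x \<in> ?S \<Longrightarrow> g x = (if x = - w0 + z then 1 else 0 :: real)"
    using linear_independent_extend[OF ind, of "\<lambda>x. if x = - w0 + z then 1 else 0"] by blast
  define a where "a = adjoint g 1"
  have a: "a \<bullet> x = g x" for x
    using adjoint_works[OF g(1), of x 1] by (simp add: a_def inner_commute)
  have az: "a \<bullet> (z - w0) = 1"
    using g(2)[of "- w0 + z"] assms w0 by (simp add: a)
  have "a \<bullet> (z - w) = 1" if w: "w \<in> V - {z}" for w
  proof (cases "w = w0")
    case False
    have "a \<bullet> (- w0 + w) = 0" using g(2)[of "- w0 + w"] w False by (auto simp: a)
    then show ?thesis using az by (simp add: inner_diff_right inner_add_right)
  qed (use az in simp)
  then show ?thesis by blast
qed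

text \<open>Ties two implicit notions together: \<open>onormal\<close> is a definite description and
  \<open>height\<close> a distance. Both are read off the dual vector \<open>a\<close>, the normal
  being \<open>- a / norm a\<close> and the height \<open>1 / norm a\<close>.\<close>

lemma normal_height:
  assumes z: "z \<in> V"
  shows norm_onormal: "norm (onormal V z) = 1"
    and height_pos: "height V z > 0"
    and onormal_height: "\<And>w. w \<in> V - {z} \<Longrightarrow> onormal V z \<bullet> (w - z) = height V z"
proof -
  obtain a where a: "\<And>w. w \<in> V - {z} \<Longrightarrow> a \<bullet> (z - w) = 1" using dual_vector[OF z] by blast
  obtain w0 where w0: "w0 \<in> V - {z}" using V_nontrivial by blast
  have a0: "a \<noteq> 0" using a[OF w0] by auto
  then have na: "norm a > 0" by simp
  define n where "n = - (1 / norm a) *\<^sub>R a"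
  have n1: "norm n = 1" using a0 by (simp add: n_def)
  have nw: "n \<bullet> (w - z) = 1 / norm a" if "w \<in> V - {z}" for w
  proof -
    have "n \<bullet> (w - z) = (a \<bullet> (z - w)) / norm a" by (simp add: n_def inner_diff_right diff_divide_distrib)
    then show ?thesis using a[OF that] by simp
  qed
  have on: "onormal V z = n"
    unfolding onormal_def
  proof (rule the_equality, intro conjI ballI)
    show "norm n = 1" by (rule n1)
    fix w w' assume w: "w \<in> V - {z}"
    show "n \<bullet> (w - z) > 0" using nw[OF w] na by simp
    assume w': "w' \<in> V - {z}"
    show "n \<bullet> (w - w') = 0" using nw[OF w] nw[OF w'] by (simp add: inner_diff_right)
  next
    fix m assume m: "norm m = 1 \<and> (\<forall>w\<in>V - {z}. \<forall>w'\<in>V - {z}. m \<bullet> (w - w') = 0) \<and> (\<forall>w\<in>V - {z}. 0 < m \<bullet> (w - z))"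
    define c where "c = m \<bullet> (w0 - z)"
    have c: "c > 0" using m w0 by (auto simp: c_def)
    have mw: "m \<bullet> w = m \<bullet> w0" if "w \<in> V - {z}" for w
    proof -
      have "m \<bullet> (w - w0) = 0" using m that w0 by blast
      then show ?thesis by (simp add: inner_diff_right)
    qed
    have nw': "n \<bullet> w = 1 / norm a + n \<bullet> z" if "w \<in> V - {z}" for w
      using nw[OF that] by (simp add: inner_diff_right)
    \<comment> \<open>The difference has the same inner product with every vertex, \<open>z\<close>
      included, so \<open>affine_vanish\<close> makes it zero; comparing norms then gives uniqueness
      of the normal.\<close>
    have "(m - (c * norm a) *\<^sub>R n) \<bullet> w = m \<bullet> z - (c * norm a) * (n \<bullet> z)" if "w \<in> V" for w
    proof (cases "w = z")
      case False
      then have w: "w \<in> V - {z}" using that by simp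
      have "m \<bullet> w = c + m \<bullet> z" using mw[OF w] by (simp add: c_def inner_diff_right)
      then show ?thesis using nw'[OF w] na by (simp add: inner_diff_left algebra_simps add_divide_distrib)
    qed (simp add: inner_diff_left)
    then have "m = (c * norm a) *\<^sub>R n" using affine_vanish[of "m - (c * norm a) *\<^sub>R n"] by simp
    moreover have "c * norm a = 1"
      using m n1 calculation c na by (metis abs_of_pos mult.right_neutral mult_pos_pos norm_scaleR)
    ultimately show "m = n" by simp
  qed
  have hull_val: "a \<bullet> (z - y) = 1" if "y \<in> affine hull (V - {z})" for y
  proof -
    have "affine hull (V - {z}) \<subseteq> {y. a \<bullet> y = a \<bullet> z - 1}"
    proof (rule hull_minimal)
      show "V - {z} \<subseteq> {y. a \<bullet> y = a \<bullet> z - 1}"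
      proof
        fix x assume "x \<in> V - {z}"
        from a[OF this] show "x \<in> {y. a \<bullet> y = a \<bullet> z - 1}" by (simp add: inner_diff_right)
      qed
    qed (rule affine_hyperplane)
    then show ?thesis using that by (auto simp: inner_diff_right)
  qed
  \<comment> \<open>The foot of the perpendicular from \<open>z\<close>. Once it is known to lie in
    the affine hull, it attains the distance.\<close>
  define y where "y = z - (1 / (norm a)\<^sup>2) *\<^sub>R a"
  have y: "y \<in> affine hull (V - {z})"
  proof -
    have "y \<in> affine hull V" using affine_hull_V by simp
    then obtain u where u: "sum u V = 1" "(\<Sum>v\<in>V. u v *\<^sub>R v) = y"
      by (auto simp: affine_hull_finite)
    have "a \<bullet> (z - y) = 1"
      using a0 by (simp add: y_def power2_norm_eq_inner)
    moreover have "z - y = (\<Sum>v\<in>V. u v *\<^sub>R (z - v))"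
      using u by (simp add: scaleR_diff_right sum_subtractf scaleR_left.sum[symmetric])
    moreover have "a \<bullet> (\<Sum>v\<in>V. u v *\<^sub>R (z - v)) = (\<Sum>v\<in>V - {z}. u v)"
    proof -
      have "a \<bullet> (\<Sum>v\<in>V. u v *\<^sub>R (z - v)) = (\<Sum>v\<in>V. u v * (a \<bullet> (z - v)))"
        by (simp add: inner_sum_right)
      also have "\<dots> = (\<Sum>v\<in>V - {z}. u v * (a \<bullet> (z - v)))"
        using z by (subst sum.remove[of V z]) auto
      also have "\<dots> = (\<Sum>v\<in>V - {z}. u v)" by (rule sum.cong) (use a in auto)
      finally show ?thesis .
    qed
    ultimately have s1: "(\<Sum>v\<in>V - {z}. u v) = 1" by simp
    then have "u z = 0" using u(1) sum.remove[OF finite_V z, of u] by simp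
    then have "(\<Sum>v\<in>V - {z}. u v *\<^sub>R v) = y" using u(2) sum.remove[OF finite_V z, of "\<lambda>v. u v *\<^sub>R v"] by simp
    then show ?thesis using s1 by (auto simp: affine_hull_finite)
  qed
  have "height V z = 1 / norm a"
    unfolding height_def
  proof (rule antisym)
    have "infdist z (affine hull (V - {z})) \<le> dist z y" by (rule infdist_le[OF y])
    also have "\<dots> = 1 / norm a" using na by (simp add: y_def dist_norm power2_eq_square)
    finally show "infdist z (affine hull (V - {z})) \<le> 1 / norm a" .
    have "1 / norm a \<le> dist z x" if "x \<in> affine hull (V - {z})" for x
    proof -
      have "1 \<le> norm a * norm (z - x)"
        using hull_val[OF that] norm_cauchy_schwarz[of a "z - x"] by simp
      then show ?thesis using na by (simp add: dist_norm field_simps)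
    qed
    moreover have ne: "affine hull (V - {z}) \<noteq> {}" using y by blast
    ultimately show "1 / norm a \<le> infdist z (affine hull (V - {z}))"
      unfolding infdist_notempty[OF ne] by (intro cINF_greatest[OF ne])
  qed
  then show "norm (onormal V z) = 1" "height V z > 0"
    "\<And>w. w \<in> V - {z} \<Longrightarrow> onormal V z \<bullet> (w - z) = height V z"
    using n1 nw na by (auto simp: on)
qed

lemma lam_vertex: "z \<in> V \<Longrightarrow> w \<in> V \<Longrightarrow> lam V z w = (if w = z then 1 else 0)"
  using height_pos[of z] onormal_height[of z w] by (auto simp: lam_def)

lemma lam_affine_sum:
  assumes "finite I" "sum u I = 1"
  shows "lam V z (\<Sum>i\<in>I. u i *\<^sub>R f i) = (\<Sum>i\<in>I. u i * lam V z (f i))"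
proof -
  have "(\<Sum>i\<in>I. u i *\<^sub>R f i) - z = (\<Sum>i\<in>I. u i *\<^sub>R (f i - z))"
    using assms by (simp add: scaleR_diff_right sum_subtractf scaleR_left.sum[symmetric])
  then have "lam V z (\<Sum>i\<in>I. u i *\<^sub>R f i) = sum u I - (\<Sum>i\<in>I. u i * (onormal V z \<bullet> (f i - z) / height V z))"
    using assms by (simp add: lam_def inner_sum_right sum_divide_distrib)
  also have "\<dots> = (\<Sum>i\<in>I. u i * lam V z (f i))"
    by (simp add: lam_def algebra_simps sum_subtractf)
  finally show ?thesis .
qed

lemma lam_bary:
  assumes "sum u V = 1" "z \<in> V"
  shows "lam V z (\<Sum>w\<in>V. u w *\<^sub>R w) = u z"
proof -
  have "lam V z (\<Sum>w\<in>V. u w *\<^sub>R w) = (\<Sum>w\<in>V. u w * lam V z w)"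
    using assms by (intro lam_affine_sum) auto
  also have "\<dots> = (\<Sum>w\<in>V. if w = z then u z else 0)"
    by (rule sum.cong) (use assms lam_vertex in auto)
  finally show ?thesis using assms by simp
qed

lemma sum_lam: "(\<Sum>z\<in>V. lam V z x) = 1"
  and sum_lam_vertex: "(\<Sum>z\<in>V. lam V z x *\<^sub>R z) = x"
proof -
  have "x \<in> affine hull V" using affine_hull_V by simp
  then obtain u where u: "sum u V = 1" "(\<Sum>v\<in>V. u v *\<^sub>R v) = x"
    by (auto simp: affine_hull_finite)
  have "lam V z x = u z" if "z \<in> V" for z using lam_bary[OF u(1) that] u(2) by simp
  then show "(\<Sum>z\<in>V. lam V z x) = 1" "(\<Sum>z\<in>V. lam V z x *\<^sub>R z) = x"
    using u by (simp_all cong: sum.cong)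
qed

lemma affine_eq_bary:
  assumes "linear f"
  shows "c + f x = (\<Sum>w\<in>V. lam V w x * (c + f w))"
proof -
  have "(\<Sum>w\<in>V. lam V w x * (c + f w)) = c * (\<Sum>w\<in>V. lam V w x) + f (\<Sum>w\<in>V. lam V w x *\<^sub>R w)"
    by (simp add: linear_sum[OF assms] linear_scale[OF assms] algebra_simps sum.distrib sum_distrib_left)
  then show ?thesis by (simp add: sum_lam sum_lam_vertex)
qed

lemma lam_unique:
  assumes "linear f" "z \<in> V" "c + f z = 1" "\<And>w. w \<in> V \<Longrightarrow> w \<noteq> z \<Longrightarrow> c + f w = 0"
  shows "lam V z x = c + f x"
proof -
  have "c + f x = (\<Sum>w\<in>V. lam V w x * (c + f w))" by (rule affine_eq_bary[OF assms(1)])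
  also have "\<dots> = (\<Sum>w\<in>V. if w = z then lam V z x else 0)"
    by (rule sum.cong) (use assms in auto)
  finally show ?thesis using assms(2) by simp
qed

lemma T_eq: "T = {x. \<forall>z\<in>V. 0 \<le> lam V z x}"
proof (intro set_eqI iffI)
  fix x assume "x \<in> T"
  then obtain u where u: "\<forall>w\<in>V. 0 \<le> u w" "sum u V = 1" "(\<Sum>v\<in>V. u v *\<^sub>R v) = x"
    by (auto simp: convex_hull_finite)
  then show "x \<in> {x. \<forall>z\<in>V. 0 \<le> lam V z x}" using lam_bary[OF u(2)] by auto
next
  fix x assume "x \<in> {x. \<forall>z\<in>V. 0 \<le> lam V z x}"
  then show "x \<in> T"
    using sum_lam[of x] sum_lam_vertex[of x] by (auto simp: convex_hull_finite intro!: exI[of _ "\<lambda>z. lam V z x"])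
qed

lemma lam_nonneg: "x \<in> T \<Longrightarrow> z \<in> V \<Longrightarrow> 0 \<le> lam V z x"
  using T_eq by blast

lemma lam_le_1: "x \<in> T \<Longrightarrow> z \<in> V \<Longrightarrow> lam V z x \<le> 1"
  using sum_lam[of x] member_le_sum[of z V "\<lambda>w. lam V w x"] lam_nonneg by simp

lemma V_subset_T: "V \<subseteq> T"
  by (rule hull_subset)

lemma continuous_lam [continuous_intros]: "continuous_on S (lam V z)"
  unfolding lam_def divide_inverse by (intro continuous_intros)

lemma lam_neq_1: "x \<in> T \<Longrightarrow> z \<in> V \<Longrightarrow> x \<noteq> z \<Longrightarrow> lam V z x < 1"
proof (rule ccontr)
  assume *: "x \<in> T" "z \<in> V" "x \<noteq> z" "\<not> lam V z x < 1"
  then have z1: "lam V z x = 1" using lam_le_1 by (simp add: antisym)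
  then have "(\<Sum>w\<in>V - {z}. lam V w x) = 0"
    using sum_lam[of x] sum.remove[OF finite_V *(2), of "\<lambda>w. lam V w x"] by simp
  then have "\<forall>w\<in>V - {z}. lam V w x = 0"
    using lam_nonneg[OF *(1)] by (subst sum_nonneg_eq_0_iff[symmetric]) auto
  then have "(\<Sum>w\<in>V. lam V w x *\<^sub>R w) = z"
    using *(2) z1 by (subst sum.remove[of V z]) auto
  then show False using *(3) sum_lam_vertex by simp
qed

lemma interior_T: "interior T = {x. \<forall>z\<in>V. 0 < lam V z x}"
proof
  have "open (\<Inter>z\<in>V. {x. 0 < lam V z x})"
    by (intro open_INT ballI finite_V open_Collect_less continuous_on_const continuous_lam)
  moreover have "(\<Inter>z\<in>V. {x. 0 < lam V z x}) = {x. \<forall>z\<in>V. 0 < lam V z x}" by auto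
  ultimately have "open {x. \<forall>z\<in>V. 0 < lam V z x}" by simp
  then show "{x. \<forall>z\<in>V. 0 < lam V z x} \<subseteq> interior T"
    by (rule interior_maximal[rotated]) (use T_eq in \<open>auto intro: less_imp_le\<close>)
  show "interior T \<subseteq> {x. \<forall>z\<in>V. 0 < lam V z x}"
  proof clarify
    fix x z assume x: "x \<in> interior T" and z: "z \<in> V"
    obtain e where e: "e > 0" "cball x e \<subseteq> T" using x mem_interior_cball by blast
    have "x + e *\<^sub>R onormal V z \<in> cball x e" using norm_onormal[OF z] e by (simp add: dist_norm)
    then have "0 \<le> lam V z (x + e *\<^sub>R onormal V z)" using e z lam_nonneg by blast
    also have "lam V z (x + e *\<^sub>R onormal V z) = lam V z x - e / height V z"
      using norm_onormal[OF z] by (simp add: lam_def inner_diff_right inner_add_right dot_square_norm diff_divide_distrib add_divide_distrib)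
    finally show "0 < lam V z x" using e height_pos[OF z] by (smt (verit) divide_pos_pos)
  qed
qed

lemma interior_nonempty: "interior T \<noteq> {}"
proof -
  define u where "u = (\<lambda>w::real^'n. 1 / real (card V))"
  have "sum u V = 1" using cardV by (simp add: u_def)
  then have "(\<Sum>w\<in>V. u w *\<^sub>R w) \<in> interior T"
    using lam_bary[of u] cardV by (auto simp: interior_T u_def)
  then show ?thesis by auto
qed

lemma compact_T: "compact T"
  by (simp add: compact_convex_hull finite_imp_compact)

lemma T_borel [measurable, simp]: "T \<in> sets borel"
  using compact_T by (simp add: borel_compact)

lemma T_lmeasurable [simp]: "T \<in> lmeasurable"
  using compact_T by (simp add: lmeasurable_compact)

lemma T_sets_lebesgue [simp]: "T \<in> sets lebesgue"
  using T_lmeasurable by blast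

lemma closure_interior_T: "closure (interior T) = T"
  using convex_closure_interior[OF convex_convex_hull interior_nonempty] compact_T
  by (simp add: compact_imp_closed)

lemma measure_T_pos: "0 < measure lebesgue T"
proof -
  have "\<not> negligible T"
    using interior_nonempty negligible_subset[OF _ interior_subset[of T]] open_not_negligible[of "interior T"] by auto
  then show ?thesis
    using negligible_iff_measure0[of T] measure_nonneg[of lebesgue T] by (metis T_lmeasurable less_eq_real_def)
qed

lemma diameter_pos: "0 < diameter T"
  and height_le_diameter: "z \<in> V \<Longrightarrow> height V z \<le> diameter T"
proof -
  have *: "height V z \<le> diameter T" if z: "z \<in> V" for z
  proof -
    obtain w where w: "w \<in> V - {z}" using V_nontrivial by blast
    have "height V z = onormal V z \<bullet> (w - z)" using onormal_height[OF z w] by simp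
    also have "\<dots> \<le> norm (w - z)"
      using norm_cauchy_schwarz[of "onormal V z" "w - z"] norm_onormal[OF z] by simp
    also have "\<dots> \<le> diameter T"
      using diameter_bounded_bound[OF compact_imp_bounded[OF compact_T], of w z] V_subset_T w z
      by (auto simp: dist_norm)
    finally show ?thesis .
  qed
  then show "z \<in> V \<Longrightarrow> height V z \<le> diameter T" .
  obtain z where "z \<in> V" using V_nontrivial by blast
  then show "0 < diameter T" using * height_pos by fastforce
qed

lemma norm_diff_le_diameter: "x \<in> T \<Longrightarrow> y \<in> T \<Longrightarrow> norm (x - y) \<le> diameter T"
  using diameter_bounded_bound[OF compact_imp_bounded[OF compact_T], of x y] by (simp add: dist_norm)

text \<open>Moving the centre by \<open>r\<close> against the outward normal raises the barycentric
  coordinate by \<open>r / height V z\<close>, while the coordinate cannot exceed 1 on the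
  simplex.\<close>

lemma radius_le_height:
  assumes z: "z \<in> V" and c: "cball c r \<subseteq> T"
  shows "r \<le> height V z"
proof (cases "r \<ge> 0")
  case True
  have n: "norm (onormal V z) = 1" by (rule norm_onormal[OF z])
  have "c \<in> T" "c - r *\<^sub>R onormal V z \<in> T" using c True n by (auto simp: dist_norm subset_iff)
  then have "lam V z (c - r *\<^sub>R onormal V z) \<le> 1" "0 \<le> lam V z c" using z lam_le_1 lam_nonneg by auto
  moreover have "lam V z (c - r *\<^sub>R onormal V z) = lam V z c + r / height V z"
    using n by (simp add: lam_def inner_diff_right dot_square_norm diff_divide_distrib)
  ultimately have "r / height V z \<le> 1" by simp
  then show ?thesis using height_pos[OF z] by (simp add: field_simps)
qed (use height_pos[OF z] in simp)

text \<open>The radius -1, whose ball is empty, witnesses that the supremum is taken over a nonempty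
  set.\<close>

lemma inradius_le_height: "z \<in> V \<Longrightarrow> inradius T \<le> height V z"
  unfolding inradius_def by (rule cSup_least) (auto intro!: exI[of _ "-1"] radius_le_height)

lemma inradius_nonneg: "0 \<le> inradius T"
proof -
  obtain z where z: "z \<in> V" using V_nontrivial by blast
  have "bdd_above {r. \<exists>c. cball c r \<subseteq> T}" by (rule bdd_aboveI[of _ "height V z"]) (auto intro: radius_le_height[OF z])
  moreover have "cball z 0 \<subseteq> T" using z V_subset_T by auto
  ultimately show ?thesis unfolding inradius_def by (intro cSup_upper) blast+
qed

lemma rproj_eq: "rproj V z x = z + (1 / (1 - lam V z x)) *\<^sub>R (x - z)"
  by (simp add: rproj_def lam_def)

lemma lam_seg: "lam V z (y + t *\<^sub>R (x - y)) = (1 - t) * lam V z y + t * lam V z x"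
  by (simp add: lam_def inner_diff_right inner_add_right algebra_simps diff_divide_distrib add_divide_distrib)

lemma face_eq:
  assumes z: "z \<in> V"
  shows "face V z = {x \<in> T. lam V z x = 0}"
proof (intro set_eqI iffI)
  fix x assume "x \<in> face V z"
  then obtain u where u: "\<forall>w\<in>V - {z}. 0 \<le> u w" "sum u (V - {z}) = 1" "(\<Sum>w\<in>V - {z}. u w *\<^sub>R w) = x"
    by (auto simp: face_def convex_hull_finite)
  have "x \<in> T" using \<open>x \<in> face V z\<close> hull_mono[of "V - {z}" V convex] by (auto simp: face_def)
  moreover have "lam V z x = (\<Sum>w\<in>V - {z}. u w * lam V z w)"
    using lam_affine_sum[OF _ u(2), of z "\<lambda>w. w"] u(3) by simp
  then have "lam V z x = 0" using z by (simp add: lam_vertex)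
  ultimately show "x \<in> {x \<in> T. lam V z x = 0}" by simp
next
  fix x assume x: "x \<in> {x \<in> T. lam V z x = 0}"
  have "(\<Sum>w\<in>V - {z}. lam V w x) = 1"
    using sum_lam[of x] x sum.remove[OF finite_V z, of "\<lambda>w. lam V w x"] by simp
  moreover have "(\<Sum>w\<in>V - {z}. lam V w x *\<^sub>R w) = x"
    using sum_lam_vertex[of x] x sum.remove[OF finite_V z, of "\<lambda>w. lam V w x *\<^sub>R w"] by simp
  moreover have "\<forall>w\<in>V - {z}. 0 \<le> lam V w x" using x lam_nonneg by simp
  ultimately show "x \<in> face V z"
    unfolding face_def convex_hull_finite[OF finite_Diff[OF finite_V]]
    by (intro CollectI exI[of _ "\<lambda>w. lam V w x"]) simp
qed

lemma lam_rproj: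
  assumes "lam V z x \<noteq> 1" "z \<in> V" "w \<in> V"
  shows "lam V w (rproj V z x) = (if w = z then 0 else lam V w x / (1 - lam V z x))"
  using assms unfolding rproj_eq lam_seg by (auto simp: lam_vertex divide_simps)

lemma rproj_face:
  assumes "x \<in> T" "x \<noteq> z" "z \<in> V"
  shows "rproj V z x \<in> face V z"
proof -
  have lt: "lam V z x < 1" by (rule lam_neq_1[OF assms(1,3,2)])
  have "rproj V z x \<in> T"
    using lt lam_nonneg[OF assms(1)] lam_rproj[of z x] assms(3) by (auto simp: T_eq)
  then show ?thesis using lt lam_rproj[of z x z] assms(3) by (simp add: face_eq)
qed

lemma rproj_of_face: "lam V z x = 0 \<Longrightarrow> rproj V z x = x"
  by (simp add: rproj_eq)

text \<open>Constancy along rays from \<open>z\<close> is what makes strip integrals of projected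
  functions exact in \<open>integral_radial_divergence\<close>.\<close>

lemma rproj_dilate:
  assumes "z \<in> V" "t \<noteq> 0"
  shows "rproj V z (z + t *\<^sub>R (x - z)) = rproj V z x"
proof -
  have "1 - lam V z (z + t *\<^sub>R (x - z)) = t * (1 - lam V z x)"
    using assms(1) unfolding lam_seg by (simp add: lam_vertex algebra_simps)
  then show ?thesis using assms(2) by (simp add: rproj_eq)
qed

lemma rproj_continuous: "z \<in> V \<Longrightarrow> continuous_on {x. lam V z x \<noteq> 1} (rproj V z)"
  unfolding rproj_eq[abs_def] by (intro continuous_intros) auto

lemma rproj_measurable [measurable]: "rproj V z \<in> borel_measurable borel"
  unfolding rproj_eq[abs_def] lam_def by measurable

text \<open>\<open>grad (lam V z) = - onormal V z / height V z\<close>; these are the derivatives of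
  \<open>sum_lam\<close> and \<open>sum_lam_vertex\<close>.\<close>
lemma sum_normals: "(\<Sum>z\<in>V. (e \<bullet> onormal V z) / height V z) = 0"
  and sum_normals_vertex: "(\<Sum>z\<in>V. ((e \<bullet> onormal V z) / height V z) *\<^sub>R (x - z)) = e"
proof -
  have d: "lam V z 0 - lam V z e = (e \<bullet> onormal V z) / height V z" for z
    by (simp add: lam_def inner_diff_right diff_divide_distrib inner_commute)
  show 1: "(\<Sum>z\<in>V. (e \<bullet> onormal V z) / height V z) = 0"
    unfolding d[symmetric] by (simp add: sum_subtractf sum_lam)
  have 2: "(\<Sum>z\<in>V. ((e \<bullet> onormal V z) / height V z) *\<^sub>R z) = - e"
    unfolding d[symmetric] by (simp add: scaleR_diff_left sum_subtractf sum_lam_vertex)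
  have "(\<Sum>z\<in>V. ((e \<bullet> onormal V z) / height V z) *\<^sub>R (x - z))
    = (\<Sum>z\<in>V. (e \<bullet> onormal V z) / height V z) *\<^sub>R x - (\<Sum>z\<in>V. ((e \<bullet> onormal V z) / height V z) *\<^sub>R z)"
    by (simp add: scaleR_diff_right sum_subtractf scaleR_left.sum)
  then show "(\<Sum>z\<in>V. ((e \<bullet> onormal V z) / height V z) *\<^sub>R (x - z)) = e"
    by (simp only: 1 2) simp
qed

lemma lam_Pm: "lam V z \<in> Pm 1"
proof -
  have "linear (\<lambda>x. - (onormal V z \<bullet> x / height V z))"
    by (rule linearI) (auto simp: inner_add_right add_divide_distrib)
  from Pm_affine[OF this, of "1 + onormal V z \<bullet> z / height V z"]
  show ?thesis by (rule back_subst[of "\<lambda>p. p \<in> Pm 1"])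
     (auto simp: lam_def fun_eq_iff inner_diff_right diff_divide_distrib)
qed

end

section \<open>Boundary strips\<close>

lemma nn_integral_dilate:
  fixes g :: "'a::euclidean_space \<Rightarrow> ennreal"
  assumes c: "c > 0" and g: "g \<in> borel_measurable borel"
  shows "(\<integral>\<^sup>+x. g (a + c *\<^sub>R x) \<partial>lborel) = ennreal (1 / c ^ DIM('a)) * (\<integral>\<^sup>+x. g x \<partial>lborel)"
proof -
  have "(\<integral>\<^sup>+x. g x \<partial>lborel)
    = (\<integral>\<^sup>+x. g x \<partial>density (distr lborel borel (\<lambda>x. a + c *\<^sub>R x)) (\<lambda>_. \<bar>c\<bar> ^ DIM('a)))"
    using lborel_affine[of c a] c by (metis less_irrefl)
  also have "\<dots> = ennreal (c ^ DIM('a)) * (\<integral>\<^sup>+x. g (a + c *\<^sub>R x) \<partial>lborel)"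
    using g c by (simp add: nn_integral_density nn_integral_distr nn_integral_cmult)
  finally have "ennreal (1 / c ^ DIM('a)) * (\<integral>\<^sup>+x. g x \<partial>lborel)
    = ennreal (1 / c ^ DIM('a) * c ^ DIM('a)) * (\<integral>\<^sup>+x. g (a + c *\<^sub>R x) \<partial>lborel)"
    using c by (simp add: ennreal_mult' mult.assoc del: times_divide_eq_left)
  then show ?thesis using c by simp
qed

lemma integral_dilate:
  fixes g :: "'a::euclidean_space \<Rightarrow> real"
  assumes c: "c > 0" and g: "g \<in> borel_measurable borel"
  shows "(\<integral>x. g (a + c *\<^sub>R x) \<partial>lborel) = 1 / c ^ DIM('a) * (\<integral>x. g x \<partial>lborel)"
proof -
  have "(\<integral>x. g x \<partial>lborel)
    = (\<integral>x. g x \<partial>density (distr lborel borel (\<lambda>x. a + c *\<^sub>R x)) (\<lambda>_. \<bar>c\<bar> ^ DIM('a)))"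
    using lborel_affine[of c a] c by (metis less_irrefl)
  also have "\<dots> = c ^ DIM('a) * (\<integral>x. g (a + c *\<^sub>R x) \<partial>lborel)"
    using g c by (simp add: integral_density integral_distr)
  finally show ?thesis using c by simp
qed

text \<open>A discrete Gronwall inequality: bounded sums of \<open>q\<close> and \<open>e\<close>
  keep \<open>P\<close> bounded. The condition \<open>q j \<le> 1/2\<close> allows division by
  \<open>1 - q j\<close> to be replaced by the factor \<open>exp (2 * q j)\<close>.\<close>

lemma recursive_bound:
  fixes P q e :: "nat \<Rightarrow> real"
  assumes step: "\<And>j. P (Suc j) * (1 - q j) \<le> P j + e j"
    and q: "\<And>j. 0 \<le> q j" "\<And>j. q j \<le> 1/2" and e: "\<And>j. 0 \<le> e j" and P: "\<And>j. 0 \<le> P j"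
    and Q: "\<And>n. (\<Sum>j<n. q j) \<le> Q" and E: "\<And>n. (\<Sum>j<n. e j) \<le> E"
  shows "P n \<le> exp (2 * Q) * (P 0 + E)"
proof -
  have "P n \<le> exp (2 * (\<Sum>j<n. q j)) * (P 0 + (\<Sum>j<n. e j))"
  proof (induction n)
    case (Suc n)
    have "1 \<le> (1 - q n) * (1 + 2 * q n)"
      using mult_nonneg_nonneg[OF q(1)[of n], of "1 - 2 * q n"] q(2)[of n] by (simp add: algebra_simps)
    also have "\<dots> \<le> (1 - q n) * exp (2 * q n)"
      using q(2)[of n] by (intro mult_left_mono exp_ge_add_one_self) auto
    finally have "P (Suc n) * 1 \<le> P (Suc n) * ((1 - q n) * exp (2 * q n))"
      by (intro mult_left_mono P)
    also have "\<dots> = (P (Suc n) * (1 - q n)) * exp (2 * q n)" by simp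
    also have "\<dots> \<le> (P n + e n) * exp (2 * q n)"
      by (intro mult_right_mono step) simp
    also have "P n + e n \<le> exp (2 * (\<Sum>j<n. q j)) * (P 0 + (\<Sum>j<n. e j)) + exp (2 * (\<Sum>j<n. q j)) * e n"
    proof (intro add_mono Suc.IH)
      have "1 \<le> exp (2 * (\<Sum>j<n. q j))" using q by (simp add: sum_nonneg)
      then show "e n \<le> exp (2 * (\<Sum>j<n. q j)) * e n" using e[of n] by (simp add: mult_le_cancel_right1)
    qed
    then have "(P n + e n) * exp (2 * q n) \<le> (exp (2 * (\<Sum>j<n. q j)) * (P 0 + (\<Sum>j<Suc n. e j))) * exp (2 * q n)"
      by (intro mult_right_mono) (auto simp: algebra_simps)
    finally show ?case by (simp add: exp_add algebra_simps)
  qed simp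
  also have "\<dots> \<le> exp (2 * Q) * (P 0 + E)"
    using Q E P e by (intro mult_mono) (auto intro!: add_nonneg_nonneg sum_nonneg)
  finally show ?thesis .
qed

text \<open>Contraction towards \<open>z\<close> with ratio \<open>1 - t\<close>. It pushes points
  near the face opposite to \<open>z\<close> into the interior and turns boundary strips into
  parallel layers.\<close>

abbreviation dil :: "'a::real_vector \<Rightarrow> real \<Rightarrow> 'a \<Rightarrow> 'a" where
  "dil z t x \<equiv> z + (1 - t) *\<^sub>R (x - z)"

lemma dil_eq: "dil z t x = t *\<^sub>R z + (1 - t) *\<^sub>R x"
  by (simp add: algebra_simps)

text \<open>The inner integral of the Slobodeckij seminorm, taken over \<open>lborel\<close> so that
  it depends Borel measurably on the outer point.\<close>

definition Psi :: "real \<Rightarrow> (real^'n::finite) set \<Rightarrow> (real^'n \<Rightarrow> real) \<Rightarrow> real^'n \<Rightarrow> ennreal" where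
  "Psi s S w x = (\<integral>\<^sup>+p. indicator S p * ennreal ((w x - w p)\<^sup>2 / norm (x - p) powr (real CARD('n) + 2 * s)) \<partial>lborel)"

lemma Psi_measurable [measurable]:
  assumes [measurable]: "w \<in> borel_measurable borel" "S \<in> sets borel"
  shows "Psi s S w \<in> borel_measurable borel"
  unfolding Psi_def by measurable

lemma sq_le_Psi_integrand:
  fixes q p :: "real^'n::finite"
  assumes "norm (q - p) \<le> r" "0 \<le> \<alpha>"
  shows "(w q - w p)\<^sup>2 \<le> r powr \<alpha> * ((w q - w p)\<^sup>2 / norm (q - p) powr \<alpha>)"
proof (cases "q = p")
  case False
  then have "0 < norm (q - p) powr \<alpha>" by simp
  moreover have "norm (q - p) powr \<alpha> \<le> r powr \<alpha>" using assms by (intro powr_mono2) auto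
  ultimately have "1 \<le> r powr \<alpha> / norm (q - p) powr \<alpha>" by simp
  from mult_right_mono[OF this, of "(w q - w p)\<^sup>2"] show ?thesis by simp
qed simp

context nsimplex
begin

lemma dil_in_T:
  assumes "z \<in> T" "x \<in> T" "0 \<le> t" "t \<le> 1"
  shows "dil z t x \<in> T"
  using convexD[OF convex_convex_hull assms(1,2), of t "1 - t"] assms by (simp add: dil_eq)

lemma lam_dil: "z \<in> V \<Longrightarrow> lam V z (dil z t x) = t + (1 - t) * lam V z x"
  unfolding lam_seg by (simp add: lam_vertex)

abbreviation strip where "strip z t \<equiv> {x \<in> T. lam V z x < t}"

lemma lam_measurable [measurable]: "lam V z \<in> borel_measurable borel"
  by (intro borel_measurable_continuous_onI continuous_lam)

lemma strip_borel [measurable]: "strip z t \<in> sets borel"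
  by measurable

lemma emeasure_T: "emeasure lborel T = ennreal (measure lebesgue T)"
  using emeasure_eq_measure2[OF T_lmeasurable] by (simp add: emeasure_completion)

text \<open>Contraction towards \<open>z\<close> maps the simplex into the complement of the strip,
  which therefore keeps at least the fraction \<open>(1 - t) ^ CARD('n)\<close> of the volume.
  Bernoulli's inequality makes the bound linear in \<open>t\<close>.\<close>

lemma measure_strip:
  assumes z: "z \<in> V" and t: "0 \<le> t" "t < 1"
  shows "emeasure lborel (strip z t) \<le> ennreal (real CARD('n) * t * measure lebesgue T)"
proof -
  define R where "R = {x \<in> T. t \<le> lam V z x}"
  have R [measurable]: "R \<in> sets borel" unfolding R_def by measurable
  have zT: "z \<in> T" using z V_subset_T by blast
  have "emeasure lborel T = (\<integral>\<^sup>+x. indicator T x \<partial>lborel)" by simp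
  also have "\<dots> \<le> (\<integral>\<^sup>+x. indicator R (t *\<^sub>R z + (1 - t) *\<^sub>R x) \<partial>lborel)"
  proof (intro nn_integral_mono)
    fix x
    show "(indicator T x :: ennreal) \<le> indicator R (t *\<^sub>R z + (1 - t) *\<^sub>R x)"
    proof (cases "x \<in> T")
      case True
      then have "dil z t x \<in> R"
        using dil_in_T[OF zT True] t lam_dil[OF z, of t x] lam_nonneg[OF True z] by (simp add: R_def)
      then show ?thesis using True by (simp add: dil_eq)
    qed simp
  qed
  also have "\<dots> = ennreal (1 / (1 - t) ^ CARD('n)) * emeasure lborel R"
    using t nn_integral_dilate[of "1 - t" "indicator R" "t *\<^sub>R z"] by simp
  finally have 1: "emeasure lborel T \<le> ennreal (1 / (1 - t) ^ CARD('n)) * emeasure lborel R" .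
  have RT: "R \<subseteq> T" "strip z t = T - R" by (auto simp: R_def)
  have Rfin: "emeasure lborel R = ennreal (measure lborel R)"
    using emeasure_mono[OF RT(1), of lborel] emeasure_T
    by (intro emeasure_eq_ennreal_measure) (auto simp: top_unique)
  have mT: "measure lborel T = measure lebesgue T" by simp
  have "measure lebesgue T \<le> 1 / (1 - t) ^ CARD('n) * measure lborel R"
    using 1 t unfolding emeasure_T Rfin by (subst (asm) ennreal_mult'[symmetric]) (auto simp: ennreal_le_iff)
  then have 2: "(1 - t) ^ CARD('n) * measure lebesgue T \<le> measure lborel R"
    using t by (simp add: field_simps)
  have "emeasure lborel (strip z t) = emeasure lborel T - emeasure lborel R"
    unfolding RT(2) using Rfin by (intro emeasure_Diff RT(1)) auto
  also have "\<dots> = ennreal (measure lebesgue T - measure lborel R)"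
    unfolding emeasure_T Rfin by (simp add: ennreal_minus)
  also have "\<dots> \<le> ennreal (real CARD('n) * t * measure lebesgue T)"
  proof (rule ennreal_leI)
    have "1 + real CARD('n) * (- t) \<le> (1 + (- t)) ^ CARD('n)"
      using t by (intro Bernoulli_inequality) simp
    from mult_right_mono[OF this, of "measure lebesgue T"] 2
    show "measure lebesgue T - measure lborel R \<le> real CARD('n) * t * measure lebesgue T"
      by (simp add: algebra_simps)
  qed
  finally show ?thesis .
qed

text \<open>The points \<open>p = (1 - t) x + t y\<close> with \<open>y\<close> in the simplex form
  a copy of size \<open>t\<close>, and all of them lie within \<open>t * diameter T\<close> of both
  \<open>x\<close> and its contraction. The difference is split at \<open>p\<close> and averaged
  over the copy. The kernel gains \<open>t\<close> to the power \<open>d + 2 s\<close>, the volume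
  of the copy costs \<open>t\<close> to the power \<open>d\<close>, and
  \<open>t powr (2 * s)\<close> remains.\<close>

lemma dil_difference_pointwise:
  fixes w :: "real^'n \<Rightarrow> real"
  assumes z: "z \<in> V" and x: "x \<in> T" and t: "0 < t" "t \<le> 1" and s: "0 \<le> s"
    and w [measurable]: "w \<in> borel_measurable borel"
  shows "ennreal ((w x - w (dil z t x))\<^sup>2) * emeasure lborel T
    \<le> ennreal (2 * diameter T powr (real CARD('n) + 2 * s) * t powr (2 * s)) * (Psi s T w x + Psi s T w (dil z t x))"
proof -
  define \<alpha> where "\<alpha> = real CARD('n) + 2 * s"
  define X where "X = dil z t x"
  define h where "h = diameter T"
  have h: "h > 0" using diameter_pos by (simp add: h_def)
  have zT: "z \<in> T" using z V_subset_T by blast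
  define F where "F q p = ennreal ((w q - w p)\<^sup>2 / norm (q - p) powr \<alpha>)" for q p
  define c where "c = 2 * (t * h) powr \<alpha>"
  have c: "c \<ge> 0" by (simp add: c_def)
  have main: "indicator T y * ennreal ((w x - w X)\<^sup>2)
    \<le> ennreal c * (indicator T ((1 - t) *\<^sub>R x + t *\<^sub>R y) * F x ((1 - t) *\<^sub>R x + t *\<^sub>R y))
    + ennreal c * (indicator T ((1 - t) *\<^sub>R x + t *\<^sub>R y) * F X ((1 - t) *\<^sub>R x + t *\<^sub>R y))" for y
  proof (cases "y \<in> T")
    case True
    define p where "p = (1 - t) *\<^sub>R x + t *\<^sub>R y"
    have pT: "p \<in> T" using convexD[OF convex_convex_hull x True, of "1 - t" t] t by (simp add: p_def)
    have "x - p = t *\<^sub>R (x - y)" by (simp add: p_def algebra_simps)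
    then have n1: "norm (x - p) \<le> t * h"
      using norm_diff_le_diameter[OF x True] t by (simp add: h_def)
    have "X - p = t *\<^sub>R (z - y)" by (simp add: p_def X_def algebra_simps)
    then have n2: "norm (X - p) \<le> t * h"
      using norm_diff_le_diameter[OF zT True] t by (simp add: h_def)
    have \<alpha>0: "\<alpha> \<ge> 0" using s by (simp add: \<alpha>_def)
    have "0 \<le> ((w x - w p) + (w X - w p))\<^sup>2" by simp
    then have "(w x - w X)\<^sup>2 \<le> 2 * (w x - w p)\<^sup>2 + 2 * (w X - w p)\<^sup>2"
      by (simp add: power2_eq_square algebra_simps)
    also have "\<dots> \<le> c * ((w x - w p)\<^sup>2 / norm (x - p) powr \<alpha>) + c * ((w X - w p)\<^sup>2 / norm (X - p) powr \<alpha>)"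
      using sq_le_Psi_integrand[OF n1 \<alpha>0, of w] sq_le_Psi_integrand[OF n2 \<alpha>0, of w] by (simp add: c_def)
    finally show ?thesis
      using True pT c unfolding p_def[symmetric] F_def
      by (simp add: ennreal_mult'[symmetric] ennreal_plus[symmetric] ennreal_leI del: ennreal_plus)
  qed simp
  have int: "(\<integral>\<^sup>+y. indicator T ((1 - t) *\<^sub>R x + t *\<^sub>R y) * F q ((1 - t) *\<^sub>R x + t *\<^sub>R y) \<partial>lborel)
    = ennreal (1 / t ^ CARD('n)) * Psi s T w q" for q
    using t nn_integral_dilate[of t "\<lambda>p. indicator T p * F q p" "(1 - t) *\<^sub>R x"]
    by (simp add: Psi_def F_def \<alpha>_def)
  have "ennreal ((w x - w X)\<^sup>2) * emeasure lborel T = (\<integral>\<^sup>+y. indicator T y * ennreal ((w x - w X)\<^sup>2) \<partial>lborel)"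
    by (simp add: nn_integral_multc mult.commute)
  also have "\<dots> \<le> (\<integral>\<^sup>+y. ennreal c * (indicator T ((1 - t) *\<^sub>R x + t *\<^sub>R y) * F x ((1 - t) *\<^sub>R x + t *\<^sub>R y))
    + ennreal c * (indicator T ((1 - t) *\<^sub>R x + t *\<^sub>R y) * F X ((1 - t) *\<^sub>R x + t *\<^sub>R y)) \<partial>lborel)"
    by (intro nn_integral_mono main)
  also have "\<dots> = ennreal c * (ennreal (1 / t ^ CARD('n)) * Psi s T w x)
     + ennreal c * (ennreal (1 / t ^ CARD('n)) * Psi s T w X)"
    unfolding int[symmetric] F_def by (subst nn_integral_add) (auto simp: nn_integral_cmult)
  also have "\<dots> = ennreal (c * (1 / t ^ CARD('n))) * (Psi s T w x + Psi s T w X)"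
    using c by (simp add: ennreal_mult' distrib_left mult.assoc del: times_divide_eq_right)
  also have "c * (1 / t ^ CARD('n)) = 2 * h powr \<alpha> * t powr (2 * s)"
  proof -
    have "(t * h) powr \<alpha> = t powr real CARD('n) * t powr (2 * s) * h powr \<alpha>"
      using t h by (simp add: powr_mult \<alpha>_def powr_add)
    then show ?thesis using t by (simp add: c_def powr_realpow)
  qed
  finally show ?thesis by (simp add: X_def h_def \<alpha>_def)
qed

lemma dil_difference_L2:
  fixes w :: "real^'n \<Rightarrow> real"
  assumes z: "z \<in> V" and t: "0 < t" "t \<le> 1/2" and s: "0 \<le> s"
    and w [measurable]: "w \<in> borel_measurable borel"
  shows "(\<integral>\<^sup>+x. indicator T x * ennreal ((w x - w (dil z t x))\<^sup>2) \<partial>lborel) * emeasure lborel T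
    \<le> ennreal (2 * diameter T powr (real CARD('n) + 2 * s) * (1 + 2 ^ CARD('n)) * t powr (2 * s))
      * (\<integral>\<^sup>+x. indicator T x * Psi s T w x \<partial>lborel)"
proof -
  define k where "k = 2 * diameter T powr (real CARD('n) + 2 * s) * t powr (2 * s)"
  define Sl where "Sl = (\<integral>\<^sup>+x. indicator T x * Psi s T w x \<partial>lborel)"
  have k: "k \<ge> 0" by (simp add: k_def)
  have zT: "z \<in> T" using z V_subset_T by blast
  have "(\<integral>\<^sup>+x. indicator T x * ennreal ((w x - w (dil z t x))\<^sup>2) \<partial>lborel) * emeasure lborel T
    = (\<integral>\<^sup>+x. indicator T x * (ennreal ((w x - w (dil z t x))\<^sup>2) * emeasure lborel T) \<partial>lborel)"
    by (subst nn_integral_multc[symmetric]) (auto simp: mult.assoc)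
  also have "\<dots> \<le> (\<integral>\<^sup>+x. ennreal k * (indicator T x * Psi s T w x)
     + ennreal k * (indicator T (t *\<^sub>R z + (1 - t) *\<^sub>R x) * Psi s T w (t *\<^sub>R z + (1 - t) *\<^sub>R x)) \<partial>lborel)"
  proof (intro nn_integral_mono)
    fix x
    show "indicator T x * (ennreal ((w x - w (dil z t x))\<^sup>2) * emeasure lborel T)
      \<le> ennreal k * (indicator T x * Psi s T w x)
     + ennreal k * (indicator T (t *\<^sub>R z + (1 - t) *\<^sub>R x) * Psi s T w (t *\<^sub>R z + (1 - t) *\<^sub>R x))"
    proof (cases "x \<in> T")
      case True
      then have "dil z t x \<in> T" using dil_in_T[OF zT True] t by simp
      then show ?thesis
        using dil_difference_pointwise[OF z True t(1) _ s w] t True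
        by (simp add: dil_eq k_def distrib_left)
    qed simp
  qed
  also have "\<dots> = ennreal k * Sl + ennreal k * (ennreal (1 / (1 - t) ^ CARD('n)) * Sl)"
    using t nn_integral_dilate[of "1 - t" "\<lambda>x. indicator T x * Psi s T w x" "t *\<^sub>R z"]
    by (subst nn_integral_add) (auto simp: nn_integral_cmult Sl_def)
  \<comment> \<open>For \<open>t \<le> 1/2\<close> the Jacobian of the inverse contraction is at
    most \<open>2 ^ CARD('n)\<close>.\<close>
  also have "\<dots> \<le> ennreal k * Sl + ennreal k * (ennreal (2 ^ CARD('n)) * Sl)"
  proof -
    have "(1/2) ^ CARD('n) \<le> (1 - t) ^ CARD('n)" using t by (intro power_mono) auto
    then have "1 / (1 - t) ^ CARD('n) \<le> 2 ^ CARD('n)"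
      using t by (simp add: divide_simps power_one_over mult.commute)
    then show ?thesis by (intro add_left_mono mult_left_mono mult_right_mono ennreal_leI) auto
  qed
  also have "\<dots> = ennreal (k * (1 + 2 ^ CARD('n))) * Sl"
    using k by (simp add: ennreal_mult' ennreal_plus distrib_left distrib_right mult.assoc)
  finally show ?thesis by (simp add: k_def Sl_def mult_ac)
qed

text \<open>A trace inequality in disguise: as \<open>s > 1/2\<close>, the dilation differences are summable over
  dyadic scales.\<close>
lemma strip_bound:
  assumes z: "z \<in> V" and s: "1/2 < s"
  shows "\<exists>C\<ge>0. \<exists>J. \<forall>(w::real^'n \<Rightarrow> real) a j. w \<in> borel_measurable borel \<longrightarrow> 0 < a \<longrightarrow> J \<le> j \<longrightarrow>
    (\<integral>\<^sup>+x. indicator T x * ennreal ((w x)\<^sup>2) \<partial>lborel) \<le> ennreal (a\<^sup>2) \<longrightarrow>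
    (\<integral>\<^sup>+x. indicator T x * Psi s T w x \<partial>lborel) \<le> ennreal (a\<^sup>2) \<longrightarrow>
    (\<integral>\<^sup>+x. indicator (strip z ((1/2) ^ j)) x * ennreal \<bar>w x\<bar> \<partial>lborel) \<le> ennreal (C * a * (1/2) ^ j)"
proof -
  define d where "d = real CARD('n)"
  define m where "m = measure lebesgue T"
  have m: "m > 0" using measure_T_pos by (simp add: m_def)
  have d: "d \<ge> 0" by (simp add: d_def)
  define K1 where "K1 = 2 * diameter T powr (d + 2 * s) * (1 + 2 ^ CARD('n)) / m"
  have K1: "K1 \<ge> 0" using m by (simp add: K1_def)
  define K where "K = (d * m + K1) / 2"
  have K: "K \<ge> 0" using K1 d m by (simp add: K_def)
  \<comment> \<open>From this scale on, the relative loss per halving is small enough for the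
    hypothesis \<open>q j \<le> 1/2\<close> of \<open>recursive_bound\<close>.\<close>
  obtain J where J: "d * (1/2) ^ J \<le> 1"
  proof -
    have "(\<lambda>j. d * (1/2) ^ j) \<longlonglongrightarrow> d * 0"
      by (intro tendsto_mult tendsto_const LIMSEQ_realpow_zero) auto
    then have "eventually (\<lambda>j. d * (1/2) ^ j < 1) sequentially" by (rule order_tendstoD) simp
    then show ?thesis using that by (auto simp: eventually_sequentially intro: less_imp_le)
  qed
  \<comment> \<open>The ratio of errors at successive dyadic scales; it is below 1 precisely because
    \<open>s > 1/2\<close>.\<close>
  define r where "r = (1/2::real) powr (s - 1/2)"
  have r: "0 < r" "r < 1" using s powr_less_mono'[of "1/2::real" 0 "s - 1/2"] by (auto simp: r_def)
  define Q where "Q = d * (1/2) ^ J"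
  define E where "E = K * r ^ (Suc J) / (1 - r)"
  \<comment> \<open>\<open>Q\<close> and \<open>E\<close> bound the geometric sums of the relative
    and the absolute errors; the remaining term bounds the strip mean at the starting scale
    \<open>J\<close>.\<close>
  define C where "C = exp (2 * Q) * (2 ^ J * ((m + 1) / 2) + E)"
  have C: "C \<ge> 0" using m K r by (auto simp: C_def E_def intro!: mult_nonneg_nonneg add_nonneg_nonneg)
  have "(\<integral>\<^sup>+x. indicator (strip z ((1/2) ^ j)) x * ennreal \<bar>w x\<bar> \<partial>lborel) \<le> ennreal (C * a * (1/2) ^ j)"
    if [measurable]: "w \<in> borel_measurable borel" and a: "0 < a" and jJ: "J \<le> j"
    and L2: "(\<integral>\<^sup>+x. indicator T x * ennreal ((w x)\<^sup>2) \<partial>lborel) \<le> ennreal (a\<^sup>2)"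
    and Sl: "(\<integral>\<^sup>+x. indicator T x * Psi s T w x \<partial>lborel) \<le> ennreal (a\<^sup>2)"
    for w :: "real^'n \<Rightarrow> real" and a j
  proof -
    define N where "N t = (\<integral>\<^sup>+x. indicator (strip z t) x * ennreal \<bar>w x\<bar> \<partial>lborel)" for t
    have young: "\<bar>x\<bar> \<le> \<theta> / 2 + x\<^sup>2 / (2 * \<theta>)" if "\<theta> > 0" for x \<theta> :: real
    proof -
      have "0 \<le> (\<bar>x\<bar> - \<theta>)\<^sup>2" by simp
      then have "2 * \<theta> * \<bar>x\<bar> \<le> \<theta>\<^sup>2 + x\<^sup>2" by (simp add: power2_diff mult_ac)
      then show ?thesis using that by (simp add: field_simps power2_eq_square)
    qed
    have young_int: "(\<integral>\<^sup>+x. indicator S x * ennreal \<bar>f x\<bar> \<partial>lborel)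
      \<le> ennreal (\<theta> / 2) * emeasure lborel S + ennreal (1 / (2 * \<theta>)) * (\<integral>\<^sup>+x. indicator T x * ennreal ((f x)\<^sup>2) \<partial>lborel)"
      if \<theta>: "\<theta> > 0" and [measurable]: "f \<in> borel_measurable borel" "S \<in> sets borel" and ST: "S \<subseteq> T"
      for S and f :: "real^'n \<Rightarrow> real" and \<theta>
    proof -
      have "(\<integral>\<^sup>+x. indicator S x * ennreal \<bar>f x\<bar> \<partial>lborel)
        \<le> (\<integral>\<^sup>+x. ennreal (\<theta> / 2) * indicator S x + ennreal (1 / (2 * \<theta>)) * (indicator T x * ennreal ((f x)\<^sup>2)) \<partial>lborel)"
      proof (intro nn_integral_mono)
        fix x
        show "indicator S x * ennreal \<bar>f x\<bar> \<le> ennreal (\<theta> / 2) * indicator S x + ennreal (1 / (2 * \<theta>)) * (indicator T x * ennreal ((f x)\<^sup>2))"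
        proof (cases "x \<in> S")
          case True
          then have "x \<in> T" using ST by blast
          then show ?thesis
            using young[OF \<theta>, of "f x"] \<theta> True
            by (simp add: ennreal_mult'[symmetric] ennreal_plus[symmetric] ennreal_leI del: ennreal_plus)
        qed simp
      qed
      also have "\<dots> = ennreal (\<theta> / 2) * emeasure lborel S + ennreal (1 / (2 * \<theta>)) * (\<integral>\<^sup>+x. indicator T x * ennreal ((f x)\<^sup>2) \<partial>lborel)"
        by (subst nn_integral_add) (auto simp: nn_integral_cmult)
      finally show ?thesis .
    qed
    have eT: "emeasure lborel T = ennreal m" by (simp add: emeasure_T m_def)
    have N_le: "N t \<le> ennreal (a * ((m + 1) / 2))" for t
    proof -
      have "N t \<le> (\<integral>\<^sup>+x. indicator T x * ennreal \<bar>w x\<bar> \<partial>lborel)"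
        unfolding N_def by (intro nn_integral_mono) (auto simp: indicator_def)
      also have "\<dots> \<le> ennreal (a / 2) * ennreal m + ennreal (1 / (2 * a)) * ennreal (a\<^sup>2)"
        using young_int[OF a, of w T] L2 unfolding eT
        by (intro order_trans[OF young_int[OF a, of w T, unfolded eT]] add_left_mono mult_left_mono) auto
      also have "\<dots> = ennreal (a * ((m + 1) / 2))"
        using a m by (simp add: ennreal_mult'[symmetric] ennreal_plus[symmetric] field_simps power2_eq_square del: ennreal_plus)
      finally show ?thesis .
    qed
    define n where "n t = enn2real (N t)" for t
    have Nn: "N t = ennreal (n t)" for t
      unfolding n_def using le_less_trans[OF N_le[of t] ennreal_less_top] by (simp add: ennreal_enn2real)
    have n0: "n t \<ge> 0" for t by (simp add: n_def)
    have n_le: "n t \<le> a * ((m + 1) / 2)" for t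
      using N_le[of t] a m by (simp add: Nn ennreal_le_iff)
    \<comment> \<open>The contraction sends the strip of width \<open>t\<close> into the layer
      between \<open>t\<close> and \<open>2 * t\<close>. So \<open>n t\<close> is at most the mass
      of the layer, up to the contraction error and a Jacobian loss \<open>d * t\<close>. Adding the
      strip itself completes the strip of width \<open>2 * t\<close> and produces the factor
      2.\<close>
    have step: "n t * (2 - d * t) \<le> K * a * t powr (s + 1/2) + n (2 * t)" if t: "0 < t" "t \<le> 1/2" for t
    proof -
      define f where "f x = w x - w (dil z t x)" for x
      have [measurable]: "f \<in> borel_measurable borel" unfolding f_def by measurable
      \<comment> \<open>This weight balances Young's inequality: the strip has volume of order
        \<open>t\<close>, the squared difference has order \<open>t powr (2 * s)\<close>, and both
        terms become multiples of \<open>t powr (s + 1/2)\<close>.\<close>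
      define \<theta> where "\<theta> = a * t powr (s - 1/2)"
      have \<theta>: "\<theta> > 0" using a t by (simp add: \<theta>_def)
      have f2: "(\<integral>\<^sup>+x. indicator T x * ennreal ((f x)\<^sup>2) \<partial>lborel) \<le> ennreal (K1 * t powr (2 * s) * a\<^sup>2)"
      proof -
        have "(\<integral>\<^sup>+x. indicator T x * ennreal ((f x)\<^sup>2) \<partial>lborel) * ennreal m
          \<le> ennreal (2 * diameter T powr (d + 2 * s) * (1 + 2 ^ CARD('n)) * t powr (2 * s)) * ennreal (a\<^sup>2)"
          using dil_difference_L2[OF z t, of s w] s Sl unfolding eT f_def d_def
          by (meson mult_left_mono order_trans zero_le \<open>w \<in> borel_measurable borel\<close> less_eq_real_def less_trans half_gt_zero zero_less_one)
        then have "(\<integral>\<^sup>+x. indicator T x * ennreal ((f x)\<^sup>2) \<partial>lborel) * ennreal m * ennreal (1 / m)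
          \<le> ennreal (2 * diameter T powr (d + 2 * s) * (1 + 2 ^ CARD('n)) * t powr (2 * s)) * ennreal (a\<^sup>2) * ennreal (1 / m)"
          by (rule mult_right_mono) simp
        moreover have "ennreal m * ennreal (1 / m) = 1" using m by (simp add: ennreal_mult'[symmetric])
        moreover have "ennreal A * ennreal B * ennreal (1 / m) = ennreal (A * B * (1 / m))"
          if "0 \<le> A" "0 \<le> B" for A B
          using that m by (simp add: ennreal_mult' del: times_divide_eq_right)
        moreover have "2 * diameter T powr (d + 2 * s) * (1 + 2 ^ CARD('n)) * t powr (2 * s) * a\<^sup>2 * (1 / m)
          = K1 * t powr (2 * s) * a\<^sup>2" by (simp add: K1_def)
        ultimately show ?thesis by (simp add: mult.assoc)
      qed
      have "(\<integral>\<^sup>+x. indicator (strip z t) x * ennreal \<bar>f x\<bar> \<partial>lborel)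
        \<le> ennreal (\<theta> / 2) * emeasure lborel (strip z t) + ennreal (1 / (2 * \<theta>)) * (\<integral>\<^sup>+x. indicator T x * ennreal ((f x)\<^sup>2) \<partial>lborel)"
        by (rule young_int[OF \<theta>]) auto
      also have "\<dots> \<le> ennreal (\<theta> / 2) * ennreal (d * t * m) + ennreal (1 / (2 * \<theta>)) * ennreal (K1 * t powr (2 * s) * a\<^sup>2)"
        using measure_strip[OF z, of t] t f2 by (intro add_mono mult_left_mono) (auto simp: d_def m_def)
      also have "\<dots> = ennreal (\<theta> / 2 * (d * t * m) + 1 / (2 * \<theta>) * (K1 * t powr (2 * s) * a\<^sup>2))"
        using \<theta> d m t K1 by (simp add: ennreal_mult'[symmetric] ennreal_plus[symmetric] del: ennreal_plus)
      also have "\<theta> / 2 * (d * t * m) + 1 / (2 * \<theta>) * (K1 * t powr (2 * s) * a\<^sup>2) = K * a * t powr (s + 1/2)"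
      proof -
        have p1: "t powr (s - 1/2) * t = t powr (s + 1/2)"
          using t powr_add[of t "s - 1/2" 1] by (simp add: add.commute)
        have p2: "t powr (2 * s) = t powr (s + 1/2) * t powr (s - 1/2)"
          by (simp add: powr_add[symmetric])
        show ?thesis
          using a t unfolding \<theta>_def K_def p2 p1[symmetric] by (simp add: field_simps power2_eq_square)
      qed
      finally have err: "(\<integral>\<^sup>+x. indicator (strip z t) x * ennreal \<bar>f x\<bar> \<partial>lborel) \<le> ennreal (K * a * t powr (s + 1/2))" .
      define M where "M = (\<integral>\<^sup>+x. indicator {x \<in> T. t \<le> lam V z x \<and> lam V z x < 2 * t} x * ennreal \<bar>w x\<bar> \<partial>lborel)"
      have zT: "z \<in> T" using z V_subset_T by blast
      have "N t \<le> (\<integral>\<^sup>+x. indicator (strip z t) x * ennreal \<bar>f x\<bar> + indicator (strip z t) x * ennreal \<bar>w (dil z t x)\<bar> \<partial>lborel)"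
        unfolding N_def
        by (intro nn_integral_mono) (auto simp: indicator_def f_def ennreal_plus[symmetric] intro!: ennreal_leI simp del: ennreal_plus)
      also have "\<dots> = (\<integral>\<^sup>+x. indicator (strip z t) x * ennreal \<bar>f x\<bar> \<partial>lborel)
         + (\<integral>\<^sup>+x. indicator (strip z t) x * ennreal \<bar>w (dil z t x)\<bar> \<partial>lborel)"
        by (subst nn_integral_add) auto
      also have "\<dots> \<le> ennreal (K * a * t powr (s + 1/2)) + ennreal (1 / (1 - t) ^ CARD('n)) * M"
      proof (rule add_mono[OF err])
        have "(\<integral>\<^sup>+x. indicator (strip z t) x * ennreal \<bar>w (dil z t x)\<bar> \<partial>lborel)
          \<le> (\<integral>\<^sup>+x. indicator {x \<in> T. t \<le> lam V z x \<and> lam V z x < 2 * t} (t *\<^sub>R z + (1 - t) *\<^sub>R x) * ennreal \<bar>w (t *\<^sub>R z + (1 - t) *\<^sub>R x)\<bar> \<partial>lborel)"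
        proof (intro nn_integral_mono)
          fix x
          show "indicator (strip z t) x * ennreal \<bar>w (dil z t x)\<bar>
            \<le> indicator {x \<in> T. t \<le> lam V z x \<and> lam V z x < 2 * t} (t *\<^sub>R z + (1 - t) *\<^sub>R x) * ennreal \<bar>w (t *\<^sub>R z + (1 - t) *\<^sub>R x)\<bar>"
          proof (cases "x \<in> strip z t")
            case True
            then have l: "0 \<le> lam V z x" "lam V z x < t" "x \<in> T" using lam_nonneg z by auto
            have "(1 - t) * lam V z x \<le> 1 * lam V z x" using l t by (intro mult_right_mono) auto
            then have "dil z t x \<in> {x \<in> T. t \<le> lam V z x \<and> lam V z x < 2 * t}"
              using dil_in_T[OF zT l(3)] t l lam_dil[OF z, of t x] by simp
            then show ?thesis using True by (simp add: dil_eq)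
          qed simp
        qed
        also have "\<dots> = ennreal (1 / (1 - t) ^ CARD('n)) * M"
          using t nn_integral_dilate[of "1 - t" "\<lambda>x. indicator {x \<in> T. t \<le> lam V z x \<and> lam V z x < 2 * t} x * ennreal \<bar>w x\<bar>" "t *\<^sub>R z"]
          by (simp add: M_def)
        finally show "(\<integral>\<^sup>+x. indicator (strip z t) x * ennreal \<bar>w (dil z t x)\<bar> \<partial>lborel) \<le> ennreal (1 / (1 - t) ^ CARD('n)) * M" .
      qed
      finally have 1: "N t \<le> ennreal (K * a * t powr (s + 1/2)) + ennreal (1 / (1 - t) ^ CARD('n)) * M" .
      have 2: "N t + M \<le> N (2 * t)"
      proof -
        have "N t + M = (\<integral>\<^sup>+x. indicator (strip z t) x * ennreal \<bar>w x\<bar>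
           + indicator {x \<in> T. t \<le> lam V z x \<and> lam V z x < 2 * t} x * ennreal \<bar>w x\<bar> \<partial>lborel)"
          unfolding N_def M_def by (subst nn_integral_add) auto
        also have "\<dots> \<le> N (2 * t)"
          unfolding N_def using t by (intro nn_integral_mono) (auto simp: indicator_def)
        finally show ?thesis .
      qed
      obtain \<mu> where \<mu>: "M = ennreal \<mu>" "\<mu> \<ge> 0"
        using 2 unfolding Nn by (cases M) (auto simp: top_unique)
      have 3: "n t + \<mu> \<le> n (2 * t)"
        using 2 \<mu> n0 unfolding Nn by (simp add: ennreal_plus[symmetric] ennreal_le_iff del: ennreal_plus)
      define b where "b = (1 - t) ^ CARD('n)"
      have b: "0 < b" "b \<le> 1" using t by (auto simp: b_def intro: power_le_one)
      have KK: "0 \<le> K * a * t powr (s + 1/2)" using K a by simp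
      have "n t \<le> K * a * t powr (s + 1/2) + 1 / b * \<mu>"
        using 1 \<mu> n0 b KK unfolding Nn b_def[symmetric]
        by (simp add: ennreal_mult'[symmetric] ennreal_plus[symmetric] ennreal_le_iff del: ennreal_plus)
      then have "b * n t \<le> b * (K * a * t powr (s + 1/2) + 1 / b * \<mu>)"
        using b by (intro mult_left_mono) auto
      also have "\<dots> = b * (K * a * t powr (s + 1/2)) + \<mu>" using b by (simp add: distrib_left)
      also have "\<dots> \<le> 1 * (K * a * t powr (s + 1/2)) + \<mu>"
        using b KK by (intro add_right_mono mult_right_mono) auto
      finally have 4: "b * n t \<le> K * a * t powr (s + 1/2) + \<mu>" by simp
      have "1 + real CARD('n) * (- t) \<le> (1 + (- t)) ^ CARD('n)"
        using t by (intro Bernoulli_inequality) simp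
      then have "1 - d * t \<le> b" by (simp add: b_def d_def)
      then have "n t * (1 - d * t) \<le> n t * b" using n0 by (intro mult_left_mono) auto
      then show ?thesis using 3 4 by (simp add: algebra_simps)
    qed
    \<comment> \<open>The strip integral divided by the strip width, at dyadic widths; a uniform
      bound for it is the claim.\<close>
    define P where "P i = 2 ^ (J + i) * n ((1/2) ^ (J + i))" for i
    define q where "q i = d * (1/2) ^ J * (1/2) ^ Suc (Suc i)" for i :: nat
    define e where "e i = K * a * r ^ Suc (J + i)" for i
    have stepP: "P (Suc i) * (1 - q i) \<le> P i + e i" for i
    proof -
      define t where "t = (1/2::real) ^ Suc (J + i)"
      have t: "0 < t" "t \<le> 1/2" by (auto simp: t_def power_le_one)
      have tinv: "2 ^ Suc (J + i) * t = 1" by (simp add: t_def power_one_over)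
      have tt: "(1/2) ^ (J + i) = 2 * t" by (simp add: t_def)
      have qt: "q i = d * t / 2" by (simp add: q_def t_def power_add mult_ac)
      have "t powr (s + 1/2) = t * t powr (s - 1/2)"
        using t powr_add[of t "s - 1/2" 1] by (simp add: mult.commute add.commute)
      also have "t powr (s - 1/2) = r ^ Suc (J + i)"
        by (simp add: t_def r_def powr_power powr_realpow[symmetric] powr_powr mult.commute del: power_Suc)
      finally have pw: "t powr (s + 1/2) = t * r ^ Suc (J + i)" .
      have "P (Suc i) * (1 - q i) = 2 ^ Suc (J + i) / 2 * (n t * (2 - d * t))"
        by (simp add: P_def qt t_def[symmetric] field_simps del: power_Suc) (simp add: t_def field_simps)
      also have "\<dots> \<le> 2 ^ Suc (J + i) / 2 * (K * a * t powr (s + 1/2) + n (2 * t))"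
        by (intro mult_left_mono step t) auto
      also have "\<dots> = (2 ^ Suc (J + i) * t) * (K * a * r ^ Suc (J + i)) / 2 + P i"
      proof -
        have "P i = 2 ^ (J + i) * n (2 * t)" by (simp only: P_def tt)
        then show ?thesis unfolding pw by (simp add: algebra_simps)
      qed
      also have "\<dots> \<le> P i + e i"
        unfolding tinv e_def using K a r by simp
      finally show ?thesis .
    qed
    have Ple: "P (j - J) \<le> exp (2 * Q) * (P 0 + a * E)"
    proof (rule recursive_bound[where q = q and e = e])
      show "P (Suc i) * (1 - q i) \<le> P i + e i" for i by (rule stepP)
      show "0 \<le> q i" for i using d by (simp add: q_def)
      show "q i \<le> 1/2" for i
      proof -
        have half: "(1/2::real) ^ Suc (Suc i) \<le> 1/2" using power_le_one[of "1/2::real" "Suc i"] by simp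
        have "d * (1/2) ^ J * (1/2) ^ Suc (Suc i) \<le> 1 * (1/2)"
          by (rule mult_mono[OF J half]) auto
        then show ?thesis by (simp add: q_def)
      qed
      show "0 \<le> e i" for i using K a r by (simp add: e_def)
      show "0 \<le> P i" for i using n0 by (simp add: P_def)
      show "(\<Sum>i<k. q i) \<le> Q" for k
      proof -
        have "(\<Sum>i<k. (1/2::real) ^ i) \<le> (\<Sum>i. (1/2) ^ i)"
          by (rule sum_le_suminf) (auto intro: summable_geometric)
        also have "\<dots> = 2" by (simp add: suminf_geometric)
        finally have "Q / 4 * (\<Sum>i<k. (1/2::real) ^ i) \<le> Q / 4 * 2"
          using d by (intro mult_left_mono) (auto simp: Q_def)
        moreover have "(\<Sum>i<k. q i) = Q / 4 * (\<Sum>i<k. (1/2::real) ^ i)"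
          by (simp add: q_def Q_def sum_distrib_left)
        moreover have "0 \<le> Q" using d by (simp add: Q_def)
        ultimately show ?thesis by linarith
      qed
      show "(\<Sum>i<k. e i) \<le> a * E" for k
      proof -
        have "(\<Sum>i<k. r ^ i) \<le> (\<Sum>i. r ^ i)"
          using r by (intro sum_le_suminf) (auto intro: summable_geometric)
        also have "\<dots> = 1 / (1 - r)" using r by (simp add: suminf_geometric)
        finally have "K * a * r ^ Suc J * (\<Sum>i<k. r ^ i) \<le> K * a * r ^ Suc J * (1 / (1 - r))"
          using K a r by (intro mult_left_mono) auto
        moreover have "(\<Sum>i<k. e i) = K * a * r ^ Suc J * (\<Sum>i<k. r ^ i)"
          by (simp add: e_def sum_distrib_left power_add mult_ac)
        ultimately show ?thesis by (simp add: E_def mult_ac)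
      qed
    qed
    also have "\<dots> \<le> exp (2 * Q) * (2 ^ J * (a * ((m + 1) / 2)) + a * E)"
      using n_le[of "(1/2) ^ J"] by (intro mult_left_mono add_right_mono) (auto simp: P_def)
    also have "\<dots> = C * a" by (simp add: C_def algebra_simps)
    finally have "2 ^ j * n ((1/2) ^ j) \<le> C * a" using jJ by (simp add: P_def)
    then have "n ((1/2) ^ j) \<le> C * a * (1/2) ^ j" by (simp add: field_simps power_one_over)
    then show ?thesis using Nn[of "(1/2) ^ j"] unfolding N_def by (simp add: ennreal_leI)
  qed
  then show ?thesis using C by blast
qed

end

section \<open>Smooth functions and cut-offs\<close>

lemma Cinf_coinduct:
  assumes "X f" "\<And>f x. X f \<Longrightarrow> f differentiable (at x)" "\<And>f i. X f \<Longrightarrow> X (pdiff i f)"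
  shows "Cinf f"
proof -
  have "X (foldr pdiff js f)" for js by (induction js) (auto intro: assms)
  then show ?thesis unfolding Cinf_def using assms(2) by blast
qed

lemma Cinf_differentiable: "Cinf f \<Longrightarrow> f differentiable (at x)"
  unfolding Cinf_def by (metis foldr.simps(1) id_apply)

lemma Cinf_pdiff: "Cinf f \<Longrightarrow> Cinf (pdiff i f)"
  unfolding Cinf_def
proof (intro allI)
  fix js x assume "\<forall>js x. foldr pdiff js f differentiable at x"
  from this[rule_format, of "js @ [i]" x] show "foldr pdiff js (pdiff i f) differentiable at x" by simp
qed

lemma Cinf_continuous_on: "Cinf f \<Longrightarrow> continuous_on S f"
  by (meson Cinf_differentiable continuous_at_imp_continuous_on differentiable_imp_continuous_within)

lemma Cinf_measurable: "Cinf f \<Longrightarrow> f \<in> borel_measurable borel"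
  by (intro borel_measurable_continuous_onI Cinf_continuous_on)

lemma power_le_fact_exp: "0 \<le> y \<Longrightarrow> y ^ k \<le> fact k * exp (y::real)"
proof -
  assume y: "0 \<le> y"
  have "(\<Sum>n\<in>{k}. y ^ n /\<^sub>R fact n) \<le> (\<Sum>n. y ^ n /\<^sub>R fact n)"
    using y by (intro sum_le_suminf summable_exp_generic) auto
  moreover have "(\<Sum>n. y ^ n /\<^sub>R fact n) = exp y" using exp_converges[of y] by (simp add: sums_iff)
  ultimately show ?thesis by (simp add: field_simps)
qed

text \<open>The functions \<open>s \<mapsto> P (1/s) exp (-1/s)\<close>, extended by \<open>0\<close>, are closed under differentiation.\<close>
definition flat_fun :: "real poly \<Rightarrow> real \<Rightarrow> real" where
  "flat_fun P s = (if s > 0 then poly P (1 / s) * exp (- 1 / s) else 0)"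

text \<open>With \<open>y = 1 / s\<close>, the derivative of \<open>P(y) exp (- y)\<close> with
  respect to \<open>s\<close> is \<open>y\<^sup>2 (P - P')(y) exp (- y)\<close>.\<close>

definition flat_deriv :: "real poly \<Rightarrow> real poly" where
  "flat_deriv P = [:0, 0, 1:] * (P - pderiv P)"

text \<open>Each power of \<open>1 / s\<close> is dominated by a factorial times
  \<open>exp (1 / s)\<close>, which the exponential factor cancels.\<close>

lemma flat_fun_bounded: "\<exists>C. \<forall>s. \<bar>flat_fun P s\<bar> \<le> C"
proof -
  define C where "C = (\<Sum>i\<le>degree P. \<bar>coeff P i\<bar> * fact i)"
  have "\<bar>flat_fun P s\<bar> \<le> C" for s
  proof (cases "s > 0")
    case True
    then have y: "0 \<le> 1 / s" by simp
    have "\<bar>poly P (1 / s)\<bar> \<le> (\<Sum>i\<le>degree P. \<bar>coeff P i * (1 / s) ^ i\<bar>)"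
      unfolding poly_altdef by (rule sum_abs)
    also have "\<dots> \<le> (\<Sum>i\<le>degree P. \<bar>coeff P i\<bar> * (fact i * exp (1 / s)))"
      using power_le_fact_exp[OF y] True by (intro sum_mono) (auto simp: abs_mult intro!: mult_left_mono)
    also have "\<dots> = C * exp (1 / s)" by (simp add: C_def sum_distrib_right mult.assoc)
    finally have "\<bar>poly P (1 / s)\<bar> * exp (- 1 / s) \<le> C * exp (1 / s) * exp (- 1 / s)"
      by (intro mult_right_mono) auto
    also have "\<dots> = C" by (simp add: exp_add[symmetric] mult.assoc)
    finally show ?thesis using True by (simp add: flat_fun_def abs_mult)
  qed (auto simp: flat_fun_def C_def intro!: sum_nonneg)
  then show ?thesis by blast
qed

lemma flat_fun_deriv: "(flat_fun P has_real_derivative flat_fun (flat_deriv P) s) (at s)"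
proof -
  consider "s > 0" | "s < 0" | "s = 0" by linarith
  then show ?thesis
  proof cases
    case 1
    have "((\<lambda>s. poly P (1 / s) * exp (- 1 / s)) has_real_derivative flat_fun (flat_deriv P) s) (at s)"
      using 1 by (auto intro!: derivative_eq_intros DERIV_chain2[OF poly_DERIV]
         simp: flat_fun_def flat_deriv_def field_simps power2_eq_square)
    then show ?thesis
      by (rule has_field_derivative_transform_within_open[of _ _ _ "{0<..}"]) (use 1 in \<open>auto simp: flat_fun_def\<close>)
  next
    case 2
    have "((\<lambda>s. 0) has_real_derivative flat_fun (flat_deriv P) s) (at s)"
      using 2 by (auto simp: flat_fun_def)
    then show ?thesis
      by (rule has_field_derivative_transform_within_open[of _ _ _ "{..<0}"]) (use 2 in \<open>auto simp: flat_fun_def\<close>)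
  next
    case 3
    \<comment> \<open>Boundedness with two extra powers of \<open>1 / s\<close> means quadratic
      decay at 0, which gives the derivative 0 there.\<close>
    obtain C where C: "\<And>s. \<bar>flat_fun ([:0, 0, 1:] * P) s\<bar> \<le> C" using flat_fun_bounded by blast
    have bound: "\<bar>flat_fun P h\<bar> \<le> C * h\<^sup>2" for h
    proof (cases "h > 0")
      case True
      then have "flat_fun P h = flat_fun ([:0, 0, 1:] * P) h * h\<^sup>2"
        by (simp add: flat_fun_def power2_eq_square)
      then show ?thesis using C[of h] by (simp add: abs_mult mult_right_mono)
    next
      case False
      have "0 \<le> C" using C[of 0] by linarith
      then show ?thesis using False by (simp add: flat_fun_def)
    qed
    have "((\<lambda>h. flat_fun P h / h) \<longlongrightarrow> 0) (at 0)"
    proof (rule Lim_null_comparison)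
      show "eventually (\<lambda>h. norm (flat_fun P h / h) \<le> C * \<bar>h\<bar>) (at 0)"
        unfolding eventually_at_filter
      proof (intro always_eventually allI impI)
        fix h :: real assume "h \<noteq> 0"
        then show "norm (flat_fun P h / h) \<le> C * \<bar>h\<bar>"
          using bound[of h] by (simp add: abs_divide field_simps power2_eq_square abs_mult_self_eq)
      qed
      show "((\<lambda>h. C * \<bar>h\<bar>) \<longlongrightarrow> 0) (at (0::real))" by (auto intro!: tendsto_eq_intros)
    qed
    moreover have "flat_fun P 0 = 0" by (simp add: flat_fun_def)
    ultimately have "(flat_fun P has_real_derivative 0) (at 0)"
      by (simp add: has_field_derivative_iff)
    then show ?thesis using 3 by (simp add: flat_fun_def)
  qed
qed

text \<open>A class of expressions that contains the cut-offs and is stable under partial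
  derivatives, so it can serve as the invariant in \<open>Cinf_coinduct\<close>; no formula for
  higher derivatives is required.\<close>

inductive smooth_term :: "(real^'n::finite \<Rightarrow> real) \<Rightarrow> bool" where
  base: "Cinf f \<Longrightarrow> smooth_term f"
| add: "smooth_term f \<Longrightarrow> smooth_term g \<Longrightarrow> smooth_term (\<lambda>x. f x + g x)"
| mult: "smooth_term f \<Longrightarrow> smooth_term g \<Longrightarrow> smooth_term (\<lambda>x. f x * g x)"
| flat: "smooth_term f \<Longrightarrow> smooth_term (\<lambda>x. flat_fun P (f x))"

lemma smooth_term_props:
  "smooth_term f \<Longrightarrow> (\<forall>x. f differentiable (at x)) \<and> (\<forall>i. smooth_term (pdiff i f))"
proof (induction rule: smooth_term.induct)
  case (base f)
  then show ?case using Cinf_differentiable Cinf_pdiff smooth_term.base by blast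
next
  case (add f g)
  then have "pdiff i (\<lambda>x. f x + g x) = (\<lambda>x. pdiff i f x + pdiff i g x)" for i
    by (simp add: pdiff_add fun_eq_iff)
  then show ?case using add by (auto intro: smooth_term.intros)
next
  case (mult f g)
  then have "pdiff i (\<lambda>x. f x * g x) = (\<lambda>x. f x * pdiff i g x + pdiff i f x * g x)" for i
    by (simp add: pdiff_mult fun_eq_iff)
  moreover have "(\<lambda>x. f x * g x) differentiable (at x)" for x using mult by (intro differentiable_mult) auto
  ultimately show ?case using mult by (simp, intro allI smooth_term.add smooth_term.mult; simp)
next
  case (flat f P)
  then have "pdiff i (\<lambda>x. flat_fun P (f x)) = (\<lambda>x. flat_fun (flat_deriv P) (f x) * pdiff i f x)" for i
    by (intro ext pdiff_compose[OF flat_fun_deriv]) simp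
  moreover have "(\<lambda>x. flat_fun P (f x)) differentiable (at x)" for x
    using has_derivative_compose[OF has_derivative_cgrad[of f x] flat_fun_deriv[unfolded has_field_derivative_def]]
      flat by (auto simp: differentiable_def)
  ultimately show ?case using flat by (auto intro: smooth_term.intros)
qed

lemma smooth_term_Cinf: "smooth_term f \<Longrightarrow> Cinf f"
proof (erule Cinf_coinduct)
  fix f :: "real^'a \<Rightarrow> real" and x i assume "smooth_term f"
  from smooth_term_props[OF this] show "f differentiable (at x)" "smooth_term (pdiff i f)" by blast+
qed

lemma Cinf_mult: "Cinf f \<Longrightarrow> Cinf g \<Longrightarrow> Cinf (\<lambda>x. f x * g x)"
  by (rule smooth_term_Cinf, rule smooth_term.mult; rule smooth_term.base)

text \<open>A smooth step, 0 for \<open>s \<le> 1\<close> and 1 for \<open>2 \<le> s\<close>. For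
  \<open>s \<le> 1\<close> the inner flat function is at least \<open>exp (- 1)\<close>, its value
  at 1, so the outer one receives a nonpositive argument; for \<open>2 \<le> s\<close> the inner one
  vanishes and the normalisation gives 1.\<close>

definition cutoff :: "real \<Rightarrow> real" where
  "cutoff s = flat_fun 1 (exp (- 1) - flat_fun 1 (2 - s)) / flat_fun 1 (exp (- 1))"

lemma flat_fun_1_mono: "s \<le> t \<Longrightarrow> flat_fun 1 s \<le> flat_fun 1 t"
  by (auto simp: flat_fun_def field_simps)

lemma flat_fun_1_nonneg: "0 \<le> flat_fun 1 s"
  by (auto simp: flat_fun_def)

lemma flat_fun_1_pos: "0 < flat_fun 1 (exp (- 1))"
  by (auto simp: flat_fun_def)

lemma flat_fun_nonpos: "s \<le> 0 \<Longrightarrow> flat_fun P s = 0"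
  by (auto simp: flat_fun_def)

lemma cutoff_nonneg: "0 \<le> cutoff s"
  using flat_fun_1_nonneg flat_fun_1_pos by (simp add: cutoff_def less_imp_le)

lemma cutoff_le_1: "cutoff s \<le> 1"
  using flat_fun_1_mono[of "exp (- 1) - flat_fun 1 (2 - s)" "exp (- 1)"] flat_fun_1_nonneg[of "2 - s"] flat_fun_1_pos
  by (simp add: cutoff_def)

lemma cutoff_eq_0: "s \<le> 1 \<Longrightarrow> cutoff s = 0"
proof -
  assume "s \<le> 1"
  then have "flat_fun 1 1 \<le> flat_fun 1 (2 - s)" by (intro flat_fun_1_mono) simp
  then show ?thesis by (simp add: cutoff_def flat_fun_def[of _ 1] flat_fun_nonpos)
qed

lemma cutoff_eq_1: "2 \<le> s \<Longrightarrow> cutoff s = 1"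
  using flat_fun_1_pos by (simp add: cutoff_def flat_fun_nonpos[of "2 - s"])

lemma cutoff_deriv:
  "\<exists>C\<ge>0. \<exists>D. \<forall>s. (cutoff has_real_derivative D s) (at s) \<and> \<bar>D s\<bar> \<le> C \<and> (2 \<le> s \<longrightarrow> D s = 0)"
proof -
  define Q where "Q = flat_deriv 1"
  obtain C where C: "\<And>s. \<bar>flat_fun Q s\<bar> \<le> C" using flat_fun_bounded by blast
  define D where "D s = flat_fun Q (exp (- 1) - flat_fun 1 (2 - s)) * flat_fun Q (2 - s) / flat_fun 1 (exp (- 1))" for s
  have C0: "0 \<le> C" using C[of 0] by linarith
  have 1: "(cutoff has_real_derivative D s) (at s)" for s
    unfolding cutoff_def[abs_def] D_def Q_def
    using flat_fun_1_pos by (auto intro!: derivative_eq_intros DERIV_chain2[OF flat_fun_deriv])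
  have "\<bar>D s\<bar> \<le> C * C / flat_fun 1 (exp (- 1))" for s
    unfolding D_def abs_divide abs_mult using flat_fun_1_pos C C0
    by (intro divide_mono mult_mono) auto
  moreover have "D s = 0" if "2 \<le> s" for s using that by (simp add: D_def flat_fun_nonpos[of "2 - s"])
  moreover have "0 \<le> C * C / flat_fun 1 (exp (- 1))" using flat_fun_1_pos C0 by simp
  ultimately show ?thesis using 1 by blast
qed

lemma smooth_term_const: "smooth_term (\<lambda>x. c)"
  by (rule smooth_term.base[OF Pm_Cinf[OF Pm_const[of 0]]]) simp

lemma smooth_term_cutoff: "smooth_term f \<Longrightarrow> smooth_term (\<lambda>x. cutoff (f x))"
proof -
  assume f: "smooth_term f"
  have "smooth_term (\<lambda>x. (1 / flat_fun 1 (exp (- 1))) *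
     flat_fun 1 (exp (- 1) + (- 1) * flat_fun 1 (2 + (- 1) * f x)))"
    by (intro smooth_term.intros(2,3,4) smooth_term_const f)
  then show ?thesis by (simp add: cutoff_def)
qed

lemma smooth_term_prod: "(\<And>i. i \<in> I \<Longrightarrow> smooth_term (f i)) \<Longrightarrow> smooth_term (\<lambda>x. \<Prod>i\<in>I. f i x)"
proof (induction I rule: infinite_finite_induct)
  case (insert i I)
  have "smooth_term (\<lambda>x. f i x * (\<Prod>i\<in>I. f i x))"
    by (rule smooth_term.mult) (use insert in auto)
  then show ?case using insert.hyps by simp
qed (simp_all add: smooth_term_const)

lemma pdiff_prod:
  assumes "finite I" "\<And>i. i \<in> I \<Longrightarrow> f i differentiable (at x)"
  shows "pdiff k (\<lambda>x. \<Prod>i\<in>I. f i x) x = (\<Sum>i\<in>I. pdiff k (f i) x * (\<Prod>j\<in>I - {i}. f j x))"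
proof -
  have "((\<lambda>x. \<Prod>i\<in>I. f i x) has_derivative (\<lambda>h. \<Sum>i\<in>I. cgrad (f i) x \<bullet> h * (\<Prod>j\<in>I - {i}. f j x))) (at x)"
    by (intro has_derivative_prod has_derivative_cgrad assms)
  then show ?thesis by (simp add: pdiff_eq cgrad_def inner_axis)
qed

section \<open>Square integrable functions\<close>

lemma L2_iff: "L2 U f \<longleftrightarrow> f \<in> borel_measurable (lebesgue_on U) \<and> integrable (lebesgue_on U) (\<lambda>x. (f x)\<^sup>2)"
  unfolding L2_def sqnn_def by (auto simp: integrable_iff_bounded)

lemma L2_measurable: "L2 U f \<Longrightarrow> f \<in> borel_measurable (lebesgue_on U)"
  by (simp add: L2_def)

lemma L2_mult_integrable:
  assumes "L2 U f" "L2 U g"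
  shows "integrable (lebesgue_on U) (\<lambda>x. f x * g x)"
proof (rule Bochner_Integration.integrable_bound)
  show "integrable (lebesgue_on U) (\<lambda>x. (f x)\<^sup>2 + (g x)\<^sup>2)"
    using assms by (auto simp: L2_iff)
  show "(\<lambda>x. f x * g x) \<in> borel_measurable (lebesgue_on U)" using assms by (auto simp: L2_iff)
  have "\<bar>a * b\<bar> \<le> a\<^sup>2 + b\<^sup>2" for a b :: real
  proof -
    have "2 * (\<bar>a\<bar> * \<bar>b\<bar>) \<le> a\<^sup>2 + b\<^sup>2" using sum_squares_bound[of "\<bar>a\<bar>" "\<bar>b\<bar>"] by simp
    moreover have "0 \<le> \<bar>a\<bar> * \<bar>b\<bar>" by simp
    ultimately show ?thesis unfolding abs_mult by linarith
  qed
  then show "AE x in lebesgue_on U. norm (f x * g x) \<le> norm ((f x)\<^sup>2 + (g x)\<^sup>2)" by simp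
qed

lemma L2_add: "L2 U f \<Longrightarrow> L2 U g \<Longrightarrow> L2 U (\<lambda>x. f x + g x)"
  using L2_mult_integrable[of U f g] unfolding L2_iff by (auto simp: power2_sum mult.assoc)

lemma L2_scale: "L2 U f \<Longrightarrow> L2 U (\<lambda>x. c * f x)"
  unfolding L2_iff by (auto simp: power_mult_distrib)

lemma L2_diff: "L2 U f \<Longrightarrow> L2 U g \<Longrightarrow> L2 U (\<lambda>x. f x - g x)"
  using L2_add[of U f "\<lambda>x. (-1) * g x"] L2_scale[of U g "-1"] by simp

lemma L2_zero: "L2 U (\<lambda>x. 0)"
  by (simp add: L2_iff)

lemma L2_sum: "(\<And>i. i \<in> I \<Longrightarrow> L2 U (f i)) \<Longrightarrow> L2 U (\<lambda>x. \<Sum>i\<in>I. f i x)"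
  by (induction I rule: infinite_finite_induct) (auto intro: L2_zero L2_add)

lemma L2_mult_bounded:
  assumes f: "L2 U f" and b: "b \<in> borel_measurable (lebesgue_on U)"
    and B: "\<And>x. x \<in> U \<Longrightarrow> \<bar>b x\<bar> \<le> B"
  shows "L2 U (\<lambda>x. b x * f x)"
  unfolding L2_iff
proof
  show "(\<lambda>x. b x * f x) \<in> borel_measurable (lebesgue_on U)" using f b by (auto simp: L2_iff)
  show "integrable (lebesgue_on U) (\<lambda>x. (b x * f x)\<^sup>2)"
  proof (rule Bochner_Integration.integrable_bound)
    show "integrable (lebesgue_on U) (\<lambda>x. B\<^sup>2 * (f x)\<^sup>2)" using f by (auto simp: L2_iff)
    show "(\<lambda>x. (b x * f x)\<^sup>2) \<in> borel_measurable (lebesgue_on U)" using f b by (auto simp: L2_iff)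
    show "AE x in lebesgue_on U. norm ((b x * f x)\<^sup>2) \<le> norm (B\<^sup>2 * (f x)\<^sup>2)"
    proof (rule AE_I2)
      fix x assume "x \<in> space (lebesgue_on U)"
      then have "x \<in> U" by (simp add: space_restrict_space)
      then have "(b x)\<^sup>2 \<le> B\<^sup>2" using B by (metis abs_le_square_iff abs_of_nonneg abs_ge_zero order_trans abs_abs)
      then show "norm ((b x * f x)\<^sup>2) \<le> norm (B\<^sup>2 * (f x)\<^sup>2)"
        by (simp add: power_mult_distrib mult_right_mono)
    qed
  qed
qed

lemma psd_form_ipT: "psd_form (ipT U) {f. L2 U f}"
proof
  show "subspace {f. L2 U f}"
    using L2_scale by (auto simp: subspace_def plus_fun_def zero_fun_def scaleR_fun_def L2_add L2_zero)
  fix u v w :: "real^'a \<Rightarrow> real" and c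
  show "ipT U (u + v) w = ipT U u w + ipT U v w"
    if "u \<in> {f. L2 U f}" "v \<in> {f. L2 U f}" "w \<in> {f. L2 U f}"
    using that L2_mult_integrable[of U _ w] by (simp add: ipT_def distrib_right)
  show "ipT U (c *\<^sub>R u) w = c * ipT U u w" by (simp add: ipT_def mult.assoc)
  show "ipT U u w = ipT U w u" by (simp add: ipT_def mult.commute)
  show "0 \<le> ipT U u u" by (simp add: ipT_def)
qed

definition L2v :: "(real^'n::finite) set \<Rightarrow> (real^'n \<Rightarrow> real^'n) \<Rightarrow> bool" where
  "L2v U f \<longleftrightarrow> (\<forall>i. L2 U (\<lambda>x. f x $ i))"

lemma L2v_inner_integrable:
  assumes "L2v U f" "L2v U g"
  shows "integrable (lebesgue_on U) (\<lambda>x. f x \<bullet> g x)"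
  using assms by (simp add: inner_vec_def L2v_def L2_mult_integrable)

lemma ipTv_sum:
  assumes "L2v U f" "L2v U g"
  shows "ipTv U f g = (\<Sum>i\<in>UNIV. ipT U (\<lambda>x. f x $ i) (\<lambda>x. g x $ i))"
  using assms by (simp add: ipTv_def ipT_def inner_vec_def L2v_def L2_mult_integrable Bochner_Integration.integral_sum)

lemma L2v_add: "L2v U f \<Longrightarrow> L2v U g \<Longrightarrow> L2v U (\<lambda>x. f x + g x)"
  and L2v_diff: "L2v U f \<Longrightarrow> L2v U g \<Longrightarrow> L2v U (\<lambda>x. f x - g x)"
  and L2v_scale: "L2v U f \<Longrightarrow> L2v U (\<lambda>x. c *\<^sub>R f x)"
  and L2v_zero: "L2v U (\<lambda>x. 0)"
  by (simp_all add: L2v_def L2_add L2_diff L2_scale L2_zero)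

lemma psd_form_ipTv: "psd_form (ipTv U) {f. L2v U f}"
proof
  show "subspace {f. L2v U f}"
    by (auto simp: subspace_def plus_fun_def zero_fun_def scaleR_fun_def L2v_add L2v_zero L2v_scale)
  fix u v w :: "real^'a \<Rightarrow> real^'a" and c
  show "ipTv U (u + v) w = ipTv U u w + ipTv U v w"
    if "u \<in> {f. L2v U f}" "v \<in> {f. L2v U f}" "w \<in> {f. L2v U f}"
    using that L2v_inner_integrable[of U _ w] by (simp add: ipTv_def inner_add_left)
  show "ipTv U (c *\<^sub>R u) w = c * ipTv U u w" by (simp add: ipTv_def)
  show "ipTv U u w = ipTv U w u" by (simp add: ipTv_def inner_commute)
  show "0 \<le> ipTv U u u" by (simp add: ipTv_def)
qed

context nsimplex
begin

lemma finite_measure_T: "finite_measure (lebesgue_on T)"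
  by (rule finite_measure_lebesgue_on) simp

lemma bounded_measurable_L2:
  assumes "f \<in> borel_measurable (lebesgue_on T)" "\<And>x. x \<in> T \<Longrightarrow> \<bar>f x\<bar> \<le> B"
  shows "L2 T f"
proof -
  have "L2 T (\<lambda>x. 1)" using finite_measure.integrable_const[OF finite_measure_T, of "1::real"] by (simp add: L2_iff)
  from L2_mult_bounded[OF this assms] show ?thesis by simp
qed

lemma continuous_bounded_T:
  fixes f :: "real^'n \<Rightarrow> real"
  assumes "continuous_on T f"
  shows "\<exists>B\<ge>0. \<forall>x\<in>T. \<bar>f x\<bar> \<le> B"
proof -
  have "bounded (f ` T)" using assms compact_T by (simp add: compact_continuous_image compact_imp_bounded)
  then obtain B where "\<And>x. x \<in> T \<Longrightarrow> \<bar>f x\<bar> \<le> B" by (auto simp: bounded_iff)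
  then show ?thesis by (intro exI[of _ "max B 0"]) fastforce
qed

lemma continuous_L2:
  assumes "continuous_on T f"
  shows "L2 T f"
proof -
  obtain B where B: "\<And>x. x \<in> T \<Longrightarrow> \<bar>f x\<bar> \<le> B" using continuous_bounded_T[OF assms] by blast
  show ?thesis
    by (rule bounded_measurable_L2[OF continuous_imp_measurable_on_sets_lebesgue[OF assms T_sets_lebesgue] B])
qed

lemma L2_integrable: "L2 T f \<Longrightarrow> integrable (lebesgue_on T) f"
  using L2_mult_integrable[of T f "\<lambda>x. 1"] continuous_L2[of "\<lambda>x. 1"] by simp

lemma Pm_L2: "p \<in> Pm m \<Longrightarrow> L2 T p"
  by (intro continuous_L2 Pm_continuous_on)

section \<open>The divergence theorem for smooth functions\<close>

lemma Cinf_Lipschitz: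
  assumes u: "Cinf u"
  shows "\<exists>L\<ge>0. \<forall>x\<in>T. \<forall>y\<in>T. \<bar>u x - u y\<bar> \<le> L * norm (x - y)"
proof -
  have "continuous_on T (\<lambda>x. norm (cgrad u x))"
    unfolding cgrad_def
    by (intro continuous_on_norm continuous_on_vec_lambda Cinf_continuous_on Cinf_pdiff u)
  from continuous_bounded_T[OF this]
  obtain L where L: "0 \<le> L" "\<And>x. x \<in> T \<Longrightarrow> \<bar>norm (cgrad u x)\<bar> \<le> L" by blast
  have "\<bar>u x - u y\<bar> \<le> L * norm (x - y)" if "x \<in> T" "y \<in> T" for x y
  proof -
    have "norm (u x - u y) \<le> L * norm (x - y)"
    proof (rule differentiable_bound[OF convex_convex_hull _ _ that])
      show "(u has_derivative (\<lambda>h. cgrad u x \<bullet> h)) (at x within T)" if "x \<in> T" for x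
        by (rule has_derivative_at_withinI[OF has_derivative_cgrad[OF Cinf_differentiable[OF u]]])
      show "onorm (\<lambda>h. cgrad u x \<bullet> h) \<le> L" if "x \<in> T" for x
      proof (rule onorm_le)
        fix h show "norm (cgrad u x \<bullet> h) \<le> L * norm h"
          using Cauchy_Schwarz_ineq2[of "cgrad u x" h] L(2)[OF that] mult_right_mono[of "norm (cgrad u x)" L "norm h"]
          by simp
      qed
    qed
    then show ?thesis by simp
  qed
  then show ?thesis using L(1) by blast
qed

lemma dil_mem_iff:
  assumes z: "z \<in> V" and t: "0 \<le> t" "t < 1"
  shows "dil z t x \<in> T \<and> t \<le> lam V z (dil z t x) \<longleftrightarrow> x \<in> T"
proof -
  have w: "lam V w (dil z t x) = (1 - t) * lam V w x" if "w \<in> V" "w \<noteq> z" for w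
    unfolding lam_seg using that z by (simp add: lam_vertex)
  have zT: "z \<in> T" using z V_subset_T by blast
  show ?thesis
  proof
    assume *: "dil z t x \<in> T \<and> t \<le> lam V z (dil z t x)"
    show "x \<in> T"
      unfolding T_eq
    proof (clarify)
      fix v assume v: "v \<in> V"
      show "0 \<le> lam V v x"
      proof (cases "v = z")
        case True
        then show ?thesis using * t lam_dil[OF z, of t x] by (simp add: zero_le_mult_iff)
      next
        case False
        have "0 \<le> lam V v (dil z t x)" using * v lam_nonneg by blast
        then show ?thesis using w[OF v False] t by (simp add: zero_le_mult_iff)
      qed
    qed
  next
    assume "x \<in> T"
    then show "dil z t x \<in> T \<and> t \<le> lam V z (dil z t x)"
      using dil_in_T[OF zT, of x t] t lam_dil[OF z, of t x] lam_nonneg[of x z] z by simp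
  qed
qed

text \<open>The complement of the strip is a contracted copy of the simplex, so a strip integral
  becomes a difference of two integrals over one fixed domain.\<close>

lemma integral_strip:
  assumes z: "z \<in> V" and t: "0 \<le> t" "t < 1"
    and v: "v \<in> borel_measurable borel" and B: "\<And>x. x \<in> T \<Longrightarrow> \<bar>v x\<bar> \<le> B"
  shows "(\<integral>x. indicator (strip z t) x * v x \<partial>lborel)
     = (\<integral>x. v x \<partial>lebesgue_on T) - (1 - t) ^ CARD('n) * (\<integral>x. v (dil z t x) \<partial>lebesgue_on T)"
proof -
  define R where "R = {x \<in> T. t \<le> lam V z x}"
  have Rm [measurable]: "R \<in> sets borel" unfolding R_def by measurable
  note [measurable] = v
  have "integrable (lebesgue_on T) v"
    by (rule L2_integrable[OF bounded_measurable_L2[OF _ B]]) (use v in \<open>auto simp: measurable_completion measurable_restrict_space1\<close>)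
  then have int: "integrable lborel (\<lambda>x. indicator T x * v x)"
    using v by (simp add: integrable_restrict_space integrable_completion)
  have intS: "integrable lborel (\<lambda>x. indicator S x * v x)" if "S \<in> sets borel" "S \<subseteq> T" for S
    by (rule Bochner_Integration.integrable_bound[OF int]) (use that in \<open>auto simp: indicator_def\<close>)
  have "(\<integral>x. v (dil z t x) \<partial>lebesgue_on T) = (\<integral>x. indicator T x * v (dil z t x) \<partial>lborel)"
    by (intro integral_lebesgue_on_borel) auto
  also have "\<dots> = (\<integral>x. indicator R (t *\<^sub>R z + (1 - t) *\<^sub>R x) * v (t *\<^sub>R z + (1 - t) *\<^sub>R x) \<partial>lborel)"
  proof (rule Bochner_Integration.integral_cong[OF refl])
    fix x
    have "dil z t x \<in> R \<longleftrightarrow> x \<in> T" using dil_mem_iff[OF z t] by (simp add: R_def)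
    then show "indicator T x * v (dil z t x) = indicator R (t *\<^sub>R z + (1 - t) *\<^sub>R x) * v (t *\<^sub>R z + (1 - t) *\<^sub>R x)"
      by (simp add: dil_eq indicator_def)
  qed
  also have "\<dots> = 1 / (1 - t) ^ CARD('n) * (\<integral>x. indicator R x * v x \<partial>lborel)"
    using t integral_dilate[of "1 - t" "\<lambda>x. indicator R x * v x" "t *\<^sub>R z"] by simp
  finally have 1: "(1 - t) ^ CARD('n) * (\<integral>x. v (dil z t x) \<partial>lebesgue_on T) = (\<integral>x. indicator R x * v x \<partial>lborel)"
    using t by simp
  have "(\<integral>x. v x \<partial>lebesgue_on T) = (\<integral>x. indicator T x * v x \<partial>lborel)"
    by (intro integral_lebesgue_on_borel) auto
  also have "\<dots> = (\<integral>x. indicator (strip z t) x * v x + indicator R x * v x \<partial>lborel)"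
    by (rule Bochner_Integration.integral_cong) (auto simp: R_def indicator_def)
  also have "\<dots> = (\<integral>x. indicator (strip z t) x * v x \<partial>lborel) + (\<integral>x. indicator R x * v x \<partial>lborel)"
    by (intro Bochner_Integration.integral_add intS) (auto simp: R_def)
  finally show ?thesis using 1 by simp
qed

text \<open>The divergence theorem for the field \<open>u (x - z)\<close>, whose flux passes only
  through the face opposite to \<open>z\<close>. Both sides are limits of strip integrals of
  \<open>u\<close> divided by the width. By \<open>integral_strip\<close> these are integrals of
  difference quotients at \<open>r = 1\<close> of \<open>r ^ d * u (z + r (x - z))\<close>, which
  tend to the left integrand. On a thin strip \<open>u\<close> is also close to its value at the
  projected point, which yields the right side.\<close>

lemma integral_radial_divergence:
  assumes z: "z \<in> V" and u: "Cinf u"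
  shows "(\<integral>x. real CARD('n) * u x + cgrad u x \<bullet> (x - z) \<partial>lebesgue_on T)
    = real CARD('n) * (\<integral>x. u (rproj V z x) \<partial>lebesgue_on T)"
proof -
  define d where "d = CARD('n)"
  define h where "h = diameter T"
  define m where "m = measure lebesgue T"
  define t where "t n = 1 / (real n + 2)" for n :: nat
  have t: "0 < t n" "t n \<le> 1/2" for n by (auto simp: t_def field_simps)
  have t0: "t \<longlonglongrightarrow> 0" unfolding t_def by real_asymp
  have zT: "z \<in> T" using z V_subset_T by blast
  have h: "h > 0" using diameter_pos by (simp add: h_def)
  obtain L where L: "L \<ge> 0" "\<And>x y. x \<in> T \<Longrightarrow> y \<in> T \<Longrightarrow> \<bar>u x - u y\<bar> \<le> L * norm (x - y)"
    using Cinf_Lipschitz[OF u] by blast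
  obtain M where M: "0 \<le> M" "\<And>x. x \<in> T \<Longrightarrow> \<bar>u x\<bar> \<le> M"
    using continuous_bounded_T[OF Cinf_continuous_on[OF u]] by blast
  have um [measurable]: "u \<in> borel_measurable borel" by (rule Cinf_measurable[OF u])
  have Bern: "(1 - (1 - t n) ^ d) / t n \<le> d" "0 \<le> (1 - (1 - t n) ^ d) / t n" for n
  proof -
    have "1 + real d * (- t n) \<le> (1 + (- t n)) ^ d"
      using t[of n] by (intro Bernoulli_inequality) simp
    then show "(1 - (1 - t n) ^ d) / t n \<le> d" using t[of n] by (simp add: field_simps)
    have "(1 - t n) ^ d \<le> 1" using t[of n] by (intro power_le_one) auto
    then show "0 \<le> (1 - (1 - t n) ^ d) / t n" using t[of n] by simp
  qed
  have Bern_lim: "(\<lambda>n. (1 - (1 - t n) ^ d) / t n) \<longlonglongrightarrow> d"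
  proof -
    have "((\<lambda>r::real. r ^ d) has_real_derivative real d) (at 1)"
      by (auto intro!: derivative_eq_intros)
    then have "((\<lambda>r. (r ^ d - 1 ^ d) / (r - 1)) \<longlongrightarrow> d) (at 1)"
      by (simp add: has_field_derivative_iff)
    moreover have "filterlim (\<lambda>n. 1 - t n) (at 1) sequentially"
      unfolding filterlim_at using t by (auto intro!: tendsto_eq_intros t0 simp: less_imp_neq eventually_sequentially)
    ultimately have "(\<lambda>n. ((1 - t n) ^ d - 1 ^ d) / ((1 - t n) - 1)) \<longlonglongrightarrow> d"
      by (rule filterlim_compose)
    moreover have "((1 - t n) ^ d - 1 ^ d) / ((1 - t n) - 1) = (1 - (1 - t n) ^ d) / t n" for n
      using t[of n] by (simp add: field_simps)
    ultimately show ?thesis by simp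
  qed
  define I where "I n = (\<integral>x. indicator (strip z (t n)) x * u x \<partial>lborel) / t n" for n
  have "I \<longlonglongrightarrow> (\<integral>x. real d * u x + cgrad u x \<bullet> (x - z) \<partial>lebesgue_on T)"
  proof -
    define F where "F n x = (u x - (1 - t n) ^ d * u (dil z (t n) x)) / t n" for n x
    have Ieq: "I n = (\<integral>x. F n x \<partial>lebesgue_on T)" for n
    proof -
      have c1: "integrable (lebesgue_on T) u"
        by (intro L2_integrable continuous_L2 Cinf_continuous_on u)
      have c2: "integrable (lebesgue_on T) (\<lambda>x. u (dil z (t n) x))"
        by (intro L2_integrable continuous_L2 continuous_on_compose2[OF Cinf_continuous_on[OF u, of UNIV]] continuous_intros) auto
      have "(\<integral>x. F n x \<partial>lebesgue_on T) = ((\<integral>x. u x \<partial>lebesgue_on T) - (1 - t n) ^ d * (\<integral>x. u (dil z (t n) x) \<partial>lebesgue_on T)) / t n"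
        unfolding F_def using c1 c2 by simp
      then show ?thesis
        using integral_strip[OF z _ _ um M(2), of "t n"] t[of n] by (simp add: I_def d_def)
    qed
    have "(\<lambda>n. \<integral>x. F n x \<partial>lebesgue_on T) \<longlonglongrightarrow> (\<integral>x. real d * u x + cgrad u x \<bullet> (x - z) \<partial>lebesgue_on T)"
    proof (rule integral_dominated_convergence[where w = "\<lambda>x. L * h + M * d"])
      show "F n \<in> borel_measurable (lebesgue_on T)" for n
        unfolding F_def by (intro measurable_restrict_space1 measurable_completion) measurable
      have cg: "(\<lambda>x. pdiff i u x) \<in> borel_measurable borel" for i
        by (rule Cinf_measurable[OF Cinf_pdiff[OF u]])
      have "(\<lambda>x. real d * u x + (\<Sum>i\<in>UNIV. pdiff i u x * (x - z) $ i)) \<in> borel_measurable borel"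
        using cg by (intro borel_measurable_add borel_measurable_sum borel_measurable_times) 
          (auto intro!: borel_measurable_continuous_onI continuous_intros)
      then show "(\<lambda>x. real d * u x + cgrad u x \<bullet> (x - z)) \<in> borel_measurable (lebesgue_on T)"
        by (intro measurable_restrict_space1 measurable_completion) (simp add: inner_vec_def cgrad_def)
      show "integrable (lebesgue_on T) (\<lambda>x. L * h + M * d)"
        by (rule finite_measure.integrable_const[OF finite_measure_T])
      show "AE x in lebesgue_on T. (\<lambda>n. F n x) \<longlonglongrightarrow> real d * u x + cgrad u x \<bullet> (x - z)"
      proof (rule AE_I2)
        fix x
        have "((\<lambda>r. u (z + r *\<^sub>R (x - z))) has_derivative (\<lambda>k. cgrad u (z + 1 *\<^sub>R (x - z)) \<bullet> (k *\<^sub>R (x - z)))) (at 1)"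
          by (rule has_derivative_compose[where f = "\<lambda>r. z + r *\<^sub>R (x - z)"])
             (auto intro!: derivative_eq_intros has_derivative_cgrad Cinf_differentiable u)
        then have "((\<lambda>r. u (z + r *\<^sub>R (x - z))) has_real_derivative cgrad u x \<bullet> (x - z)) (at 1)"
          by (simp add: has_field_derivative_def mult_commute_abs)
        then have "((\<lambda>r. r ^ d * u (z + r *\<^sub>R (x - z))) has_real_derivative real d * u x + cgrad u x \<bullet> (x - z)) (at 1)"
          by (auto intro!: derivative_eq_intros)
        then have "((\<lambda>r. (r ^ d * u (z + r *\<^sub>R (x - z)) - u x) / (r - 1)) \<longlongrightarrow> real d * u x + cgrad u x \<bullet> (x - z)) (at 1)"
          by (simp add: has_field_derivative_iff)
        moreover have "filterlim (\<lambda>n. 1 - t n) (at 1) sequentially"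
          unfolding filterlim_at using t by (auto intro!: tendsto_eq_intros t0 simp: less_imp_neq eventually_sequentially)
        ultimately have "(\<lambda>n. ((1 - t n) ^ d * u (dil z (t n) x) - u x) / ((1 - t n) - 1)) \<longlonglongrightarrow> real d * u x + cgrad u x \<bullet> (x - z)"
          by (rule filterlim_compose)
        moreover have "((1 - t n) ^ d * u (dil z (t n) x) - u x) / ((1 - t n) - 1) = F n x" for n
          using t[of n] by (simp add: F_def field_simps)
        ultimately show "(\<lambda>n. F n x) \<longlonglongrightarrow> real d * u x + cgrad u x \<bullet> (x - z)" by simp
      qed
      show "AE x in lebesgue_on T. norm (F n x) \<le> L * h + M * d" for n
      proof (rule AE_I2)
        fix x assume "x \<in> space (lebesgue_on T)"
        then have x: "x \<in> T" by (simp add: space_restrict_space)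
        have D: "dil z (t n) x \<in> T" using dil_in_T[OF zT x] t[of n] by simp
        have "F n x = (u x - u (dil z (t n) x)) / t n + u (dil z (t n) x) * ((1 - (1 - t n) ^ d) / t n)"
          using t[of n] by (simp add: F_def field_simps)
        moreover have "\<bar>(u x - u (dil z (t n) x)) / t n\<bar> \<le> L * h"
        proof -
          have "x - dil z (t n) x = t n *\<^sub>R (x - z)" by (simp add: algebra_simps)
          then have "\<bar>u x - u (dil z (t n) x)\<bar> \<le> L * (t n * norm (x - z))"
            using L(2)[OF x D] t[of n] by simp
          also have "\<dots> \<le> L * (t n * h)"
            using norm_diff_le_diameter[OF x zT] L t[of n] by (intro mult_left_mono) (auto simp: h_def)
          finally show ?thesis using t[of n] by (simp add: abs_divide field_simps)
        qed
        moreover have "\<bar>u (dil z (t n) x) * ((1 - (1 - t n) ^ d) / t n)\<bar> \<le> M * d"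
          unfolding abs_mult using M(2)[OF D] Bern[of n] M(1) by (intro mult_mono) auto
        ultimately show "norm (F n x) \<le> L * h + M * d" unfolding real_norm_def by linarith
      qed
    qed
    moreover have "I = (\<lambda>n. \<integral>x. F n x \<partial>lebesgue_on T)" by (rule ext) (rule Ieq)
    ultimately show ?thesis by (simp only:)
  qed
  moreover have "I \<longlonglongrightarrow> d * (\<integral>x. u (rproj V z x) \<partial>lebesgue_on T)"
  proof -
    define v where "v x = u (if x = z then z else rproj V z x)" for x
    have vz: "v x = u (rproj V z x)" for x by (simp add: v_def rproj_eq)
    have vm [measurable]: "v \<in> borel_measurable borel" unfolding vz[abs_def] by measurable
    have rT: "rproj V z x \<in> T" if "x \<in> T" for x
      using rproj_face[OF that _ z] face_eq[OF z] zT by (cases "x = z") (auto simp: rproj_eq)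
    have vB: "\<bar>v x\<bar> \<le> M" if "x \<in> T" for x using M(2)[OF rT[OF that]] by (simp add: vz)
    define A where "A = (\<integral>x. v x \<partial>lebesgue_on T)"
    \<comment> \<open>A function constant along rays is unchanged by the contraction, so its strip
      integral is an exact multiple of \<open>A\<close>.\<close>
    have strip_v: "(\<integral>x. indicator (strip z (t n)) x * v x \<partial>lborel) = (1 - (1 - t n) ^ d) * A" for n
    proof -
      have "v (dil z (t n) x) = v x" for x using rproj_dilate[OF z, of "1 - t n" x] t[of n] by (simp add: vz)
      then show ?thesis using integral_strip[OF z _ _ vm vB, of "t n"] t[of n] by (simp add: A_def d_def algebra_simps)
    qed
    have "(\<lambda>n. I n - (1 - (1 - t n) ^ d) / t n * A) \<longlonglongrightarrow> 0"
    proof (rule Lim_null_comparison[OF always_eventually])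
      \<comment> \<open>Lipschitz constant \<open>L\<close>, times the displacement
        \<open>2 * t n * h\<close> to the face, times the strip volume \<open>d * t n * m\<close>,
        divided by \<open>t n\<close>.\<close>
      show "\<forall>n. norm (I n - (1 - (1 - t n) ^ d) / t n * A) \<le> 2 * L * h * d * m * t n"
      proof
        fix n
        define S where "S = strip z (t n)"
        have Sm [measurable]: "S \<in> sets borel" by (simp add: S_def)
        have Sem: "emeasure lborel S \<le> ennreal (d * t n * m)"
          using measure_strip[OF z, of "t n"] t[of n] by (simp add: S_def d_def m_def)
        then have Sfin: "emeasure lborel S < \<infinity>" using le_less_trans by fastforce
        then have indS: "integrable lborel (indicator S :: _ \<Rightarrow> real)" by simp
        have Sb: "integrable lborel (\<lambda>x. indicator S x * f x)"
          if "f \<in> borel_measurable borel" "\<And>x. x \<in> T \<Longrightarrow> \<bar>f x\<bar> \<le> M" for f :: "real^'n \<Rightarrow> real"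
        proof (rule Bochner_Integration.integrable_bound)
          show "integrable lborel (\<lambda>x. M * indicator S x)" using indS by simp
          show "AE x in lborel. norm (indicator S x * f x) \<le> norm (M * indicator S x)"
            using that(2) M(1) by (auto simp: indicator_def S_def)
        qed (use that(1) in auto)
        have "I n - (1 - (1 - t n) ^ d) / t n * A
          = ((\<integral>x. indicator S x * u x \<partial>lborel) - (\<integral>x. indicator S x * v x \<partial>lborel)) / t n"
          unfolding I_def S_def strip_v using t[of n] by (simp add: field_simps)
        also have "\<dots> = (\<integral>x. indicator S x * (u x - v x) \<partial>lborel) / t n"
          using Sb[OF um M(2)] Sb[OF vm vB] by (simp add: right_diff_distrib)
        finally have eq: "I n - (1 - (1 - t n) ^ d) / t n * A = (\<integral>x. indicator S x * (u x - v x) \<partial>lborel) / t n" .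
        have "norm (\<integral>x. indicator S x * (u x - v x) \<partial>lborel) \<le> (\<integral>x. (2 * L * h * t n) * indicator S x \<partial>lborel)"
        proof (rule order_trans[OF integral_norm_bound integral_mono])
          show "integrable lborel (\<lambda>x. norm (indicator S x * (u x - v x)))"
            using Bochner_Integration.integrable_diff[OF Sb[OF um M(2)] Sb[OF vm vB]]
            by (intro integrable_norm) (simp add: right_diff_distrib)
          show "integrable lborel (\<lambda>x. (2 * L * h * t n) * indicator S x)" using indS by simp
          fix x
          show "norm (indicator S x * (u x - v x)) \<le> (2 * L * h * t n) * indicator S x"
          proof (cases "x \<in> S")
            case True
            then have x: "x \<in> T" "lam V z x < t n" by (auto simp: S_def)
            define l where "l = lam V z x"
            have l: "0 \<le> l" "l < t n" "l \<le> 1/2" using x lam_nonneg[OF x(1) z] t[of n] by (auto simp: l_def)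
            have "x - rproj V z x = (1 - 1 / (1 - l)) *\<^sub>R (x - z)"
              by (simp add: rproj_eq l_def algebra_simps)
            also have "1 - 1 / (1 - l) = - (l / (1 - l))" using l by (simp add: field_simps)
            finally have "norm (x - rproj V z x) = l / (1 - l) * norm (x - z)" using l by simp
            also have "\<dots> \<le> 2 * t n * h"
            proof (intro mult_mono)
              have "l / (1 - l) \<le> l / (1/2)" using l by (intro divide_left_mono) auto
              then show "l / (1 - l) \<le> 2 * t n" using l by simp
            qed (use norm_diff_le_diameter[OF x(1) zT] t[of n] in \<open>auto simp: h_def\<close>)
            finally have "\<bar>u x - v x\<bar> \<le> L * (2 * t n * h)"
              using L(2)[OF x(1) rT[OF x(1)]] L(1) unfolding vz by (meson mult_left_mono order_trans)
            then show ?thesis using True by (simp add: mult_ac)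
          qed simp
        qed
        also have "\<dots> = 2 * L * h * t n * measure lborel S" using Sfin by simp
        also have "\<dots> \<le> 2 * L * h * t n * (d * t n * m)"
        proof (intro mult_left_mono)
          show "measure lborel S \<le> d * t n * m"
            using Sem t[of n] measure_T_pos unfolding measure_def m_def
            by (intro enn2real_leI) auto
        qed (use L h t[of n] in auto)
        finally show "norm (I n - (1 - (1 - t n) ^ d) / t n * A) \<le> 2 * L * h * d * m * t n"
          unfolding eq using t[of n] by (simp add: abs_divide field_simps)
      qed
      show "(\<lambda>n. 2 * L * h * d * m * t n) \<longlonglongrightarrow> 0" by (auto intro!: tendsto_eq_intros t0)
    qed
    then have "(\<lambda>n. (I n - (1 - (1 - t n) ^ d) / t n * A) + (1 - (1 - t n) ^ d) / t n * A) \<longlonglongrightarrow> 0 + d * A"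
      by (intro tendsto_add tendsto_mult Bern_lim tendsto_const)
    then show ?thesis by (simp add: A_def vz)
  qed
  ultimately show ?thesis unfolding d_def by (rule LIMSEQ_unique)
qed

text \<open>The radial identities of all vertices are added with the weights \<open>c z\<close>. By
  \<open>sum_normals\<close> the terms in \<open>u\<close> cancel, and by
  \<open>sum_normals_vertex\<close> the vectors \<open>x - z\<close> recombine to the i-th unit
  vector.\<close>

lemma divergence_theorem:
  assumes u: "Cinf u"
  shows "(\<integral>x. pdiff i u x \<partial>lebesgue_on T) = (\<Sum>z\<in>V. onormal V z $ i * fint V z u)"
proof -
  define c where "c z = (axis i 1 \<bullet> onormal V z) / height V z" for z
  define d where "d = real CARD('n)"
  have int1: "integrable (lebesgue_on T) u" "integrable (lebesgue_on T) (\<lambda>x. cgrad u x \<bullet> (x - z))" for z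
  proof -
    show "integrable (lebesgue_on T) u" by (intro L2_integrable continuous_L2 Cinf_continuous_on u)
    have "continuous_on T (\<lambda>x. \<Sum>i\<in>UNIV. pdiff i u x * (x - z) $ i)"
      by (intro continuous_intros Cinf_continuous_on Cinf_pdiff u)
    then show "integrable (lebesgue_on T) (\<lambda>x. cgrad u x \<bullet> (x - z))"
      by (intro L2_integrable continuous_L2) (simp add: inner_vec_def cgrad_def)
  qed
  have "(\<Sum>z\<in>V. onormal V z $ i * fint V z u) = (\<Sum>z\<in>V. c z * (d * (\<integral>x. u (rproj V z x) \<partial>lebesgue_on T)))"
    by (simp add: fint_def c_def d_def inner_axis' )
  also have "\<dots> = (\<Sum>z\<in>V. c z * (\<integral>x. d * u x + cgrad u x \<bullet> (x - z) \<partial>lebesgue_on T))"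
    by (intro sum.cong refl) (simp add: integral_radial_divergence[OF _ u] d_def)
  also have "\<dots> = (\<integral>x. (\<Sum>z\<in>V. c z * (d * u x + cgrad u x \<bullet> (x - z))) \<partial>lebesgue_on T)"
    using int1 by (subst Bochner_Integration.integral_sum) auto
  also have "\<dots> = (\<integral>x. pdiff i u x \<partial>lebesgue_on T)"
  proof (rule Bochner_Integration.integral_cong[OF refl])
    fix x
    have "(\<Sum>z\<in>V. c z * (d * u x + cgrad u x \<bullet> (x - z)))
      = (\<Sum>z\<in>V. c z) * (d * u x) + cgrad u x \<bullet> (\<Sum>z\<in>V. c z *\<^sub>R (x - z))"
      by (simp add: distrib_left sum.distrib sum_distrib_right inner_sum_right)
    also have "\<dots> = cgrad u x \<bullet> axis i 1"
      using sum_normals[of "axis i 1"] sum_normals_vertex[of "axis i 1" x] by (simp add: c_def)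
    finally show "(\<Sum>z\<in>V. c z * (d * u x + cgrad u x \<bullet> (x - z))) = pdiff i u x"
      by (simp add: inner_axis cgrad_def)
  qed
  finally show ?thesis ..
qed

end

section \<open>Integration by parts for traces\<close>

context nsimplex
begin

text \<open>Vanishes wherever some barycentric coordinate is at most \<open>(1/2) ^ j\<close> and
  equals 1 where all are at least twice that. Multiplication by it turns any smooth function into a
  test function.\<close>

definition vcut :: "nat \<Rightarrow> real^'n \<Rightarrow> real" where
  "vcut j x = (\<Prod>z\<in>V. cutoff (2 ^ j * lam V z x))"

lemma smooth_term_vcut: "smooth_term (vcut j)"
  unfolding vcut_def[abs_def]
  by (intro smooth_term_prod smooth_term_cutoff smooth_term.base Pm_Cinf[OF Pm_scale[OF lam_Pm]])

lemma Cinf_vcut: "Cinf (vcut j)"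
  by (rule smooth_term_Cinf[OF smooth_term_vcut])

lemma vcut_nonneg: "0 \<le> vcut j x" and vcut_le_1: "vcut j x \<le> 1"
  unfolding vcut_def by (auto intro!: prod_nonneg prod_le_1 simp: cutoff_nonneg cutoff_le_1)

lemma vcut_support:
  assumes "vcut j x \<noteq> 0" "z \<in> V"
  shows "(1/2) ^ j \<le> lam V z x"
proof (rule ccontr)
  assume "\<not> ?thesis"
  then have "2 ^ j * lam V z x \<le> 2 ^ j * (1/2) ^ j" by (intro mult_left_mono) auto
  then have "cutoff (2 ^ j * lam V z x) = 0" by (intro cutoff_eq_0) (simp add: power_one_over)
  then have "vcut j x = 0" using assms(2) by (auto simp: vcut_def)
  then show False using assms(1) by simp
qed

lemma test_fun_vcut:
  assumes q: "Cinf q"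
  shows "test_fun (interior T) (\<lambda>x. vcut j x * q x)"
proof -
  define R where "R = {x. \<forall>z\<in>V. (1/2) ^ j \<le> lam V z x}"
  have "closed (\<Inter>z\<in>V. {x. (1/2) ^ j \<le> lam V z x})"
    by (intro closed_INT ballI closed_Collect_le continuous_on_const continuous_lam)
  moreover have "(\<Inter>z\<in>V. {x. (1/2) ^ j \<le> lam V z x}) = R" by (auto simp: R_def)
  ultimately have R: "closed R" by simp
  have Ri: "R \<subseteq> interior T"
    unfolding R_def interior_T by (auto intro: less_le_trans[rotated])
  have sub: "closure {x. vcut j x * q x \<noteq> 0} \<subseteq> R"
    by (rule closure_minimal[OF _ R]) (auto simp: R_def vcut_support)
  have "bounded (closure {x. vcut j x * q x \<noteq> 0})"
    using sub Ri interior_subset[of T] compact_imp_bounded[OF compact_T] by (meson bounded_subset subset_trans)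
  then show ?thesis
    unfolding test_fun_def using sub Ri Cinf_mult[OF Cinf_vcut q] by (auto simp: compact_eq_bounded_closed)
qed

lemma vcut_limit:
  assumes x: "x \<in> interior T"
  shows "(\<lambda>j. vcut j x) \<longlonglongrightarrow> 1"
proof -
  have "eventually (\<lambda>j. cutoff (2 ^ j * lam V z x) = 1) sequentially" if z: "z \<in> V" for z
  proof -
    have l: "0 < lam V z x" using x z by (simp add: interior_T)
    have "filterlim (\<lambda>j::nat. (2::real) ^ j) at_top sequentially"
      by real_asymp
    then have "eventually (\<lambda>j::nat. 2 / lam V z x \<le> 2 ^ j) sequentially"
      by (simp add: filterlim_at_top)
    then show ?thesis
      by eventually_elim (use l in \<open>auto intro!: cutoff_eq_1 simp: field_simps\<close>)
  qed
  then have "eventually (\<lambda>j. \<forall>z\<in>V. cutoff (2 ^ j * lam V z x) = 1) sequentially"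
    by (intro eventually_ball_finite) auto
  then have "eventually (\<lambda>j. vcut j x = 1) sequentially"
    by eventually_elim (simp add: vcut_def)
  then show ?thesis by (rule tendsto_eventually)
qed

lemma AE_interior_T: "AE x in lebesgue_on T. x \<in> interior T"
proof -
  have "negligible (frontier T)" by (rule negligible_convex_frontier) simp
  then have "AE x in lebesgue. x \<notin> frontier T"
    by (simp add: negligible_iff_null_sets AE_not_in)
  then have "AE x in lebesgue. x \<in> T \<longrightarrow> x \<in> interior T"
    by eventually_elim (use compact_T in \<open>auto simp: frontier_def closure_closed compact_imp_closed\<close>)
  then show ?thesis by (simp add: AE_restrict_space_iff)
qed

lemma integral_vcut_limit:
  assumes f: "integrable (lebesgue_on T) f"
  shows "(\<lambda>j. \<integral>x. f x * vcut j x \<partial>lebesgue_on T) \<longlonglongrightarrow> (\<integral>x. f x \<partial>lebesgue_on T)"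
proof (rule integral_dominated_convergence[where w = "\<lambda>x. norm (f x)"])
  have cm: "vcut j \<in> borel_measurable (lebesgue_on T)" for j
    by (intro measurable_restrict_space1 measurable_completion) (simp add: Cinf_measurable[OF Cinf_vcut])
  show "(\<lambda>x. f x * vcut j x) \<in> borel_measurable (lebesgue_on T)" for j
    using f cm by (intro borel_measurable_times) auto
  show "AE x in lebesgue_on T. (\<lambda>j. f x * vcut j x) \<longlonglongrightarrow> f x"
    using AE_interior_T
  proof eventually_elim
    case (elim x)
    then show ?case using tendsto_mult[OF tendsto_const[of "f x"] vcut_limit[of x]] by simp
  qed
  show "AE x in lebesgue_on T. norm (f x * vcut j x) \<le> norm (f x)" for j
    using vcut_nonneg vcut_le_1 by (auto simp: abs_mult intro!: mult_left_le)
qed (use f in auto)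

lemma pdiff_lam: "pdiff i (lam V z) x = - (onormal V z $ i) / height V z"
proof -
  have "(lam V z has_derivative (\<lambda>h. 0 - onormal V z \<bullet> h / height V z)) (at x)"
    unfolding lam_def[abs_def] divide_inverse by (auto intro!: derivative_eq_intros)
  then show ?thesis by (simp add: pdiff_eq inner_axis)
qed

text \<open>The growth \<open>2 ^ j\<close> of the gradient is compensated by its localisation in
  strips whose width is of the inverse order.\<close>

lemma pdiff_vcut_bound:
  "\<exists>C\<ge>0. \<forall>j x i. \<bar>pdiff i (vcut j) x\<bar> \<le> (\<Sum>z\<in>V. C * 2 ^ j * (if lam V z x < 2 * (1/2) ^ j then 1 else 0))"
proof -
  obtain C D where C: "C \<ge> 0" and D: "\<And>s. (cutoff has_real_derivative D s) (at s)" "\<And>s. \<bar>D s\<bar> \<le> C"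
    "\<And>s. 2 \<le> s \<Longrightarrow> D s = 0"
    using cutoff_deriv by blast
  define K where "K = Max (insert 0 ((\<lambda>z. 1 / height V z) ` V))"
  have K: "1 / height V z \<le> K" if "z \<in> V" for z unfolding K_def using that by (intro Max_ge) auto
  have K0: "0 \<le> K" unfolding K_def by (intro Max_ge) auto
  have "\<bar>pdiff i (vcut j) x\<bar> \<le> (\<Sum>z\<in>V. (C * K) * 2 ^ j * (if lam V z x < 2 * (1/2) ^ j then 1 else 0))" for i j x
  proof -
    define f where "f z x = cutoff (2 ^ j * lam V z x)" for z x
    have lamd: "(\<lambda>x. 2 ^ j * lam V z x) differentiable (at x)" for z
      by (rule Pm_differentiable[OF Pm_scale[OF lam_Pm]])
    have fd: "f z differentiable (at x)" for z
      unfolding f_def by (rule Cinf_differentiable[OF smooth_term_Cinf])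
        (intro smooth_term_cutoff smooth_term.base Pm_Cinf[OF Pm_scale[OF lam_Pm]])
    have pf: "pdiff i (f z) x = D (2 ^ j * lam V z x) * (2 ^ j * (- (onormal V z $ i) / height V z))" for z
      unfolding f_def
      by (subst pdiff_compose[OF D(1) lamd], subst pdiff_cmult[OF Pm_differentiable[OF lam_Pm]]) (simp add: pdiff_lam)
    have "pdiff i (vcut j) x = (\<Sum>z\<in>V. pdiff i (f z) x * (\<Prod>w\<in>V - {z}. f w x))"
      unfolding vcut_def[abs_def] f_def[symmetric] by (rule pdiff_prod) (auto simp: fd)
    also have "\<bar>\<dots>\<bar> \<le> (\<Sum>z\<in>V. \<bar>pdiff i (f z) x * (\<Prod>w\<in>V - {z}. f w x)\<bar>)" by (rule sum_abs)
    also have "\<dots> \<le> (\<Sum>z\<in>V. (C * K) * 2 ^ j * (if lam V z x < 2 * (1/2) ^ j then 1 else 0))"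
    proof (rule sum_mono)
      fix z assume z: "z \<in> V"
      have pr: "\<bar>\<Prod>w\<in>V - {z}. f w x\<bar> \<le> 1"
        unfolding f_def abs_prod by (rule prod_le_1) (simp add: cutoff_nonneg cutoff_le_1)
      show "\<bar>pdiff i (f z) x * (\<Prod>w\<in>V - {z}. f w x)\<bar> \<le> (C * K) * 2 ^ j * (if lam V z x < 2 * (1/2) ^ j then 1 else 0)"
      proof (cases "lam V z x < 2 * (1/2) ^ j")
        case True
        have "\<bar>onormal V z $ i\<bar> \<le> 1" using component_le_norm_cart[of "onormal V z" i] norm_onormal[OF z] by simp
        then have "\<bar>- (onormal V z $ i) / height V z\<bar> \<le> 1 / height V z"
          using height_pos[OF z] by (simp add: abs_divide divide_right_mono)
        also have "\<dots> \<le> K" by (rule K[OF z])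
        finally have "\<bar>pdiff i (f z) x\<bar> \<le> C * (2 ^ j * K)"
          unfolding pf abs_mult using C D(2) by (intro mult_mono) auto
        then have "\<bar>pdiff i (f z) x\<bar> * \<bar>\<Prod>w\<in>V - {z}. f w x\<bar> \<le> C * (2 ^ j * K) * 1"
          using pr C K0 by (intro mult_mono) auto
        then show ?thesis using True by (simp add: abs_mult mult_ac)
      next
        case False
        then have "2 ^ j * (2 * (1/2) ^ j) \<le> 2 ^ j * lam V z x" by (intro mult_left_mono) auto
        then have "D (2 ^ j * lam V z x) = 0" by (intro D(3)) (simp add: power_one_over)
        then show ?thesis using False by (simp add: pf)
      qed
    qed
    finally show ?thesis .
  qed
  then show ?thesis using C K0 by (intro exI[of _ "C * K"]) auto
qed

text \<open>The strip bounds concern Borel functions on \<open>lborel\<close>, whereas Sobolev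
  functions are only Lebesgue measurable on the simplex.\<close>

lemma borel_representative:
  assumes "w \<in> borel_measurable (lebesgue_on T)"
  shows "\<exists>w'\<in>borel_measurable borel. AE x in lebesgue_on T. w x = (w' x :: real)"
proof -
  have "(\<lambda>x. if x \<in> T then w x else 0) \<in> borel_measurable (completion lborel)"
    using assms by (simp add: borel_measurable_if)
  from completion_ex_borel_measurable_real[OF this] obtain w' where
    w': "w' \<in> borel_measurable lborel" "AE x in lborel. (if x \<in> T then w x else 0) = w' x" by blast
  have "AE x in lebesgue. (if x \<in> T then w x else 0) = w' x" using w'(2) by (rule AE_completion)
  then have "AE x in lebesgue. x \<in> T \<longrightarrow> w x = w' x" by eventually_elim auto
  then show ?thesis using w'(1) by (auto simp: AE_restrict_space_iff)
qed

lemma nn_integral_T: "f \<in> borel_measurable borel \<Longrightarrow> (\<integral>\<^sup>+x. f x \<partial>lebesgue_on T) = (\<integral>\<^sup>+x. indicator T x * f x \<partial>lborel)"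
  by (simp add: nn_integral_restrict_space nn_integral_completion mult.commute)

text \<open>The gradient of order \<open>2 ^ j\<close> meets a strip integral of order
  \<open>(1/2) ^ j\<close>. The resulting bound is uniform in \<open>j\<close> and linear in the
  size \<open>a\<close> of \<open>w\<close>, which later permits the exchange of the limits in the
  cut-off and in the smooth approximation.\<close>

lemma strip_bound_vcut:
  assumes s: "1/2 < s" and \<psi>: "Cinf \<psi>"
  shows "\<exists>K\<ge>0. \<exists>J. \<forall>w a j. w \<in> borel_measurable (lebesgue_on T) \<longrightarrow> 0 < a \<longrightarrow> J \<le> j \<longrightarrow>
    sqnn T w \<le> ennreal (a\<^sup>2) \<longrightarrow> slob s T w \<le> ennreal (a\<^sup>2) \<longrightarrow>
    \<bar>\<integral>x. w x * \<psi> x * pdiff i (vcut j) x \<partial>lebesgue_on T\<bar> \<le> K * a"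
proof -
  obtain C where C: "C \<ge> 0" "\<And>j x. \<bar>pdiff i (vcut j) x\<bar> \<le> (\<Sum>z\<in>V. C * 2 ^ j * (if lam V z x < 2 * (1/2) ^ j then 1 else 0))"
    using pdiff_vcut_bound by blast
  obtain M where M: "0 \<le> M" "\<And>x. x \<in> T \<Longrightarrow> \<bar>\<psi> x\<bar> \<le> M"
    using continuous_bounded_T[OF Cinf_continuous_on[OF \<psi>]] by blast
  define P where "P z B J \<longleftrightarrow> 0 \<le> B \<and> (\<forall>(w::real^'n \<Rightarrow> real) a j. w \<in> borel_measurable borel \<longrightarrow> 0 < a \<longrightarrow> J \<le> j \<longrightarrow>
    (\<integral>\<^sup>+x. indicator T x * ennreal ((w x)\<^sup>2) \<partial>lborel) \<le> ennreal (a\<^sup>2) \<longrightarrow>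
    (\<integral>\<^sup>+x. indicator T x * Psi s T w x \<partial>lborel) \<le> ennreal (a\<^sup>2) \<longrightarrow>
    (\<integral>\<^sup>+x. indicator (strip z ((1/2) ^ j)) x * ennreal \<bar>w x\<bar> \<partial>lborel) \<le> ennreal (B * a * (1/2) ^ j))" for z B J
  have "\<exists>B J. P z B J" if "z \<in> V" for z
    using strip_bound[OF that s] unfolding P_def by blast
  then obtain B J where BJ: "\<And>z. z \<in> V \<Longrightarrow> P z (B z) (J z)" by metis
  have B: "\<And>z. z \<in> V \<Longrightarrow> B z \<ge> 0"
    "\<And>z w a j. z \<in> V \<Longrightarrow> w \<in> borel_measurable borel \<Longrightarrow> 0 < a \<Longrightarrow> J z \<le> j \<Longrightarrow>
    (\<integral>\<^sup>+x. indicator T x * ennreal ((w x)\<^sup>2) \<partial>lborel) \<le> ennreal (a\<^sup>2) \<Longrightarrow>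
    (\<integral>\<^sup>+x. indicator T x * Psi s T w x \<partial>lborel) \<le> ennreal (a\<^sup>2) \<Longrightarrow>
    (\<integral>\<^sup>+x. indicator (strip z ((1/2) ^ j)) x * ennreal \<bar>w x\<bar> \<partial>lborel) \<le> ennreal (B z * a * (1/2) ^ j)"
    using BJ unfolding P_def by blast+
  define J0 where "J0 = Suc (Max (J ` V))"
  have J0: "J z < J0" if "z \<in> V" for z unfolding J0_def using that by (simp add: less_Suc_eq_le)
  define K where "K = (\<Sum>z\<in>V. M * C * 2 * B z)"
  have K: "K \<ge> 0" unfolding K_def using M(1) C(1) B(1) by (intro sum_nonneg) auto
  have "\<bar>\<integral>x. w x * \<psi> x * pdiff i (vcut j) x \<partial>lebesgue_on T\<bar> \<le> K * a"
    if w: "w \<in> borel_measurable (lebesgue_on T)" and a: "0 < a" and j: "J0 \<le> j"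
    and sq: "sqnn T w \<le> ennreal (a\<^sup>2)" and sl: "slob s T w \<le> ennreal (a\<^sup>2)" for w a j
  proof -
    obtain w' where [measurable]: "w' \<in> borel_measurable borel" and ww': "AE x in lebesgue_on T. w x = w' x"
      using borel_representative[OF w] by blast
    have 1: "(\<integral>\<^sup>+x. indicator T x * ennreal ((w' x)\<^sup>2) \<partial>lborel) \<le> ennreal (a\<^sup>2)"
    proof -
      have "(\<integral>\<^sup>+x. indicator T x * ennreal ((w' x)\<^sup>2) \<partial>lborel) = (\<integral>\<^sup>+x. ennreal ((w' x)\<^sup>2) \<partial>lebesgue_on T)"
        by (subst nn_integral_T) auto
      also have "\<dots> = sqnn T w"
        unfolding sqnn_def by (rule nn_integral_cong_AE) (use ww' in eventually_elim, simp)
      finally show ?thesis using sq by simp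
    qed
    have 2: "(\<integral>\<^sup>+x. indicator T x * Psi s T w' x \<partial>lborel) \<le> ennreal (a\<^sup>2)"
    proof -
      have "(\<integral>\<^sup>+x. indicator T x * Psi s T w' x \<partial>lborel) = (\<integral>\<^sup>+x. Psi s T w' x \<partial>lebesgue_on T)"
        by (subst nn_integral_T) auto
      also have "\<dots> = slob s T w"
        unfolding slob_def
      proof (rule nn_integral_cong_AE, use ww' in eventually_elim)
        fix x assume x: "w x = w' x"
        have "Psi s T w' x = (\<integral>\<^sup>+y. ennreal ((w' x - w' y)\<^sup>2 / norm (x - y) powr (real CARD('n) + 2 * s)) \<partial>lebesgue_on T)"
          unfolding Psi_def by (subst nn_integral_T) auto
        also have "\<dots> = (\<integral>\<^sup>+y. ennreal ((w x - w y)\<^sup>2 / norm (x - y) powr (real CARD('n) + 2 * s)) \<partial>lebesgue_on T)"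
          by (rule nn_integral_cong_AE) (use ww' in eventually_elim, simp add: x)
        finally show "Psi s T w' x = (\<integral>\<^sup>+y. ennreal ((w x - w y)\<^sup>2 / norm (x - y) powr (real CARD('n) + 2 * s)) \<partial>lebesgue_on T)" .
      qed
      finally show ?thesis using sl by simp
    qed
    \<comment> \<open>The gradient lives where a coordinate is below \<open>2 * (1/2) ^ j\<close>,
      so the strip bound is applied one scale earlier; the successor in \<open>J0\<close> provides
      for this shift.\<close>
    obtain j' where j': "j = Suc j'" using j by (cases j) (auto simp: J0_def)
    have str: "(\<integral>\<^sup>+x. indicator (strip z ((1/2) ^ j')) x * ennreal \<bar>w' x\<bar> \<partial>lborel) \<le> ennreal (B z * a * (1/2) ^ j')"
      if z: "z \<in> V" for z
      using B(2)[OF z _ a _ 1 2, of j'] J0[OF z] j j' by simp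
    have "ennreal (norm (\<integral>x. w x * \<psi> x * pdiff i (vcut j) x \<partial>lebesgue_on T))
      \<le> (\<integral>\<^sup>+x. ennreal (norm (w x * \<psi> x * pdiff i (vcut j) x)) \<partial>lebesgue_on T)"
    \<comment> \<open>Without integrability the integral has the default value 0 and the bound is
      trivial.\<close>
    proof (cases "integrable (lebesgue_on T) (\<lambda>x. w x * \<psi> x * pdiff i (vcut j) x)")
      case True
      then show ?thesis by (rule integral_norm_bound_ennreal)
    qed (simp add: not_integrable_integral_eq)
    also have "\<dots> \<le> (\<integral>\<^sup>+x. (\<Sum>z\<in>V. ennreal (M * C * 2 ^ j) * (indicator (strip z ((1/2) ^ j')) x * ennreal \<bar>w' x\<bar>)) \<partial>lebesgue_on T)"
    proof (rule nn_integral_mono_AE, use ww' AE_space in eventually_elim)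
      fix x assume x: "w x = w' x" "x \<in> space (lebesgue_on T)"
      then have xT: "x \<in> T" by (simp add: space_restrict_space)
      have half: "2 * (1/2::real) ^ j = (1/2) ^ j'" by (simp add: j')
      have "norm (w x * \<psi> x * pdiff i (vcut j) x) = \<bar>w' x\<bar> * \<bar>\<psi> x\<bar> * \<bar>pdiff i (vcut j) x\<bar>"
        by (simp add: abs_mult x)
      also have "\<dots> \<le> \<bar>w' x\<bar> * M * (\<Sum>z\<in>V. C * 2 ^ j * (if lam V z x < (1/2) ^ j' then 1 else 0))"
        using M(2)[OF xT] C(2)[of j x] M(1) unfolding half by (intro mult_mono) auto
      also have "\<dots> = (\<Sum>z\<in>V. (M * C * 2 ^ j) * (indicator (strip z ((1/2) ^ j')) x * \<bar>w' x\<bar>))"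
        unfolding sum_distrib_left by (rule sum.cong) (auto simp: xT)
      finally have "ennreal (norm (w x * \<psi> x * pdiff i (vcut j) x))
        \<le> ennreal (\<Sum>z\<in>V. (M * C * 2 ^ j) * (indicator (strip z ((1/2) ^ j')) x * \<bar>w' x\<bar>))"
        by (rule ennreal_leI)
      also have "\<dots> = (\<Sum>z\<in>V. ennreal ((M * C * 2 ^ j) * (indicator (strip z ((1/2) ^ j')) x * \<bar>w' x\<bar>)))"
        using M(1) C(1) by (intro sum_ennreal[symmetric]) auto
      also have "\<dots> = (\<Sum>z\<in>V. ennreal (M * C * 2 ^ j) * (indicator (strip z ((1/2) ^ j')) x * ennreal \<bar>w' x\<bar>))"
        using M(1) C(1) by (intro sum.cong refl) (auto simp: ennreal_mult' indicator_def)
      finally show "ennreal (norm (w x * \<psi> x * pdiff i (vcut j) x))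
        \<le> (\<Sum>z\<in>V. ennreal (M * C * 2 ^ j) * (indicator (strip z ((1/2) ^ j')) x * ennreal \<bar>w' x\<bar>))" .
    qed
    also have "\<dots> = (\<Sum>z\<in>V. ennreal (M * C * 2 ^ j) * (\<integral>\<^sup>+x. indicator (strip z ((1/2) ^ j')) x * ennreal \<bar>w' x\<bar> \<partial>lebesgue_on T))"
    proof -
      have [measurable]: "(\<lambda>x. indicator (strip z t) x * ennreal \<bar>w' x\<bar>) \<in> borel_measurable (lebesgue_on T)" for z t
        by (intro measurable_restrict_space1 measurable_completion) measurable
      show ?thesis by (subst nn_integral_sum) (auto simp: nn_integral_cmult)
    qed
    also have "\<dots> \<le> (\<Sum>z\<in>V. ennreal (M * C * 2 ^ j) * ennreal (B z * a * (1/2) ^ j'))"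
    proof (intro sum_mono mult_left_mono)
      fix z assume z: "z \<in> V"
      have "(\<integral>\<^sup>+x. indicator (strip z ((1/2) ^ j')) x * ennreal \<bar>w' x\<bar> \<partial>lebesgue_on T)
        = (\<integral>\<^sup>+x. indicator (strip z ((1/2) ^ j')) x * ennreal \<bar>w' x\<bar> \<partial>lborel)"
        by (subst nn_integral_T) (auto intro!: nn_integral_cong simp: indicator_def)
      also have "\<dots> \<le> ennreal (B z * a * (1/2) ^ j')" by (rule str[OF z])
      finally show "(\<integral>\<^sup>+x. indicator (strip z ((1/2) ^ j')) x * ennreal \<bar>w' x\<bar> \<partial>lebesgue_on T) \<le> ennreal (B z * a * (1/2) ^ j')" .
    qed simp
    also have "\<dots> = (\<Sum>z\<in>V. ennreal (M * C * 2 * B z * a))"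
    proof (rule sum.cong[OF refl])
      fix z assume z: "z \<in> V"
      have "(M * C * 2 ^ j) * (B z * a * (1/2) ^ j') = M * C * 2 * B z * a"
        by (simp add: j' power_one_over)
      then show "ennreal (M * C * 2 ^ j) * ennreal (B z * a * (1/2) ^ j') = ennreal (M * C * 2 * B z * a)"
        using M(1) C(1) by (metis ennreal_mult' mult_nonneg_nonneg zero_le_numeral zero_le_power)
    qed
    also have "\<dots> = ennreal (\<Sum>z\<in>V. M * C * 2 * B z * a)"
      using M(1) C(1) B(1) a by (intro sum_ennreal) auto
    also have "(\<Sum>z\<in>V. M * C * 2 * B z * a) = K * a" by (simp add: K_def sum_distrib_right)
    finally show ?thesis using K a by (simp add: ennreal_le_iff)
  qed
  then show ?thesis using K by blast
qed

lemma integrable_mult_smooth: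
  assumes "L2 T u" "Cinf \<psi>" "Cinf \<phi>"
  shows "integrable (lebesgue_on T) (\<lambda>x. u x * \<psi> x * \<phi> x)"
proof -
  have "L2 T (\<lambda>x. \<psi> x * \<phi> x)" by (intro continuous_L2 Cinf_continuous_on Cinf_mult assms)
  from L2_mult_integrable[OF assms(1) this] show ?thesis by (simp add: mult.assoc)
qed

lemma rproj_in_T: "x \<in> T \<Longrightarrow> z \<in> V \<Longrightarrow> rproj V z x \<in> T"
  using rproj_face[of x z] face_eq[of z] V_subset_T by (cases "x = z") (auto simp: rproj_eq)

lemma vcut_rproj: "x \<in> T \<Longrightarrow> z \<in> V \<Longrightarrow> vcut j (rproj V z x) = 0"
proof -
  assume x: "x \<in> T" and z: "z \<in> V"
  obtain w where w: "w \<in> V" "w \<noteq> z" using V_nontrivial by blast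
  have "\<exists>w\<in>V. lam V w (rproj V z x) = 0"
  proof (cases "x = z")
    case True
    then show ?thesis using w z by (auto simp: rproj_eq lam_vertex intro!: bexI[of _ w])
  next
    case False
    then show ?thesis using rproj_face[OF x False z] face_eq[OF z] z by auto
  qed
  then obtain v where v: "v \<in> V" "lam V v (rproj V z x) = 0" by blast
  show ?thesis
  proof (rule ccontr)
    assume "vcut j (rproj V z x) \<noteq> 0"
    from vcut_support[OF this v(1)] show False using v(2) zero_less_power[of "1/2::real" j] by linarith
  qed
qed

text \<open>The product of \<open>u\<close>, \<open>\<psi>\<close> and the cut-off has no boundary
  contribution in the divergence theorem. The term with the gradient of the cut-off therefore equals
  a volume term, whose limit the divergence theorem, now without cut-off, turns into boundary
  integrals.\<close>

lemma smooth_vcut_limit: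
  assumes u: "Cinf u" and \<psi>: "Cinf \<psi>"
  shows "(\<lambda>j. - (\<integral>x. u x * \<psi> x * pdiff i (vcut j) x \<partial>lebesgue_on T))
    \<longlonglongrightarrow> (\<Sum>z\<in>V. onormal V z $ i * fint V z (\<lambda>y. u y * \<psi> y))"
proof -
  define f where "f x = u x * \<psi> x" for x
  have f: "Cinf f" unfolding f_def[abs_def] by (rule Cinf_mult[OF u \<psi>])
  have I: "integrable (lebesgue_on T) (\<lambda>x. \<psi> x * \<phi> x)" if "Cinf \<psi>" "Cinf \<phi>" for \<psi> \<phi>
    by (intro L2_integrable continuous_L2 Cinf_continuous_on Cinf_mult that)
  have "- (\<integral>x. u x * \<psi> x * pdiff i (vcut j) x \<partial>lebesgue_on T) = (\<integral>x. pdiff i f x * vcut j x \<partial>lebesgue_on T)" for j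
  proof -
    have "(\<integral>x. pdiff i (\<lambda>x. f x * vcut j x) x \<partial>lebesgue_on T) = (\<Sum>z\<in>V. onormal V z $ i * fint V z (\<lambda>x. f x * vcut j x))"
      by (rule divergence_theorem[OF Cinf_mult[OF f Cinf_vcut]])
    also have "\<dots> = 0"
    proof (rule sum.neutral, rule ballI)
      fix z assume z: "z \<in> V"
      have "(\<integral>x. f (rproj V z x) * vcut j (rproj V z x) \<partial>lebesgue_on T) = (\<integral>x. 0 \<partial>lebesgue_on T)"
        by (rule Bochner_Integration.integral_cong) (auto simp: space_restrict_space vcut_rproj z)
      then show "onormal V z $ i * fint V z (\<lambda>x. f x * vcut j x) = 0" by (simp add: fint_def)
    qed
    also have "(\<integral>x. pdiff i (\<lambda>x. f x * vcut j x) x \<partial>lebesgue_on T)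
      = (\<integral>x. f x * pdiff i (vcut j) x + pdiff i f x * vcut j x \<partial>lebesgue_on T)"
      by (simp add: pdiff_mult Cinf_differentiable f Cinf_vcut)
    also have "\<dots> = (\<integral>x. f x * pdiff i (vcut j) x \<partial>lebesgue_on T) + (\<integral>x. pdiff i f x * vcut j x \<partial>lebesgue_on T)"
      by (intro Bochner_Integration.integral_add I f Cinf_pdiff Cinf_vcut)
    finally show ?thesis by (simp add: f_def)
  qed
  moreover have "(\<lambda>j. \<integral>x. pdiff i f x * vcut j x \<partial>lebesgue_on T) \<longlonglongrightarrow> (\<integral>x. pdiff i f x \<partial>lebesgue_on T)"
    by (intro integral_vcut_limit L2_integrable continuous_L2 Cinf_continuous_on Cinf_pdiff f)
  ultimately show ?thesis unfolding divergence_theorem[OF f] by (simp add: f_def[abs_def])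
qed

section \<open>Square integrable face functions, traces and their boundary terms\<close>

text \<open>Square integrability over the faces, expressed through the cone parametrisation on which
  \<open>fint\<close> rests.\<close>

definition L2b :: "(real^'n \<Rightarrow> real^'n \<Rightarrow> real) \<Rightarrow> bool" where
  "L2b f \<longleftrightarrow> (\<forall>z\<in>V. L2 T (\<lambda>x. f z (rproj V z x)))"

lemma continuous_rproj_L2:
  assumes "continuous_on T f" "f \<in> borel_measurable borel" "z \<in> V"
  shows "L2 T (\<lambda>x. f (rproj V z x))"
proof -
  obtain M where M: "\<And>x. x \<in> T \<Longrightarrow> \<bar>f x\<bar> \<le> M"
    using continuous_bounded_T[OF assms(1)] by blast
  show ?thesis
  proof (rule bounded_measurable_L2)
    show "(\<lambda>x. f (rproj V z x)) \<in> borel_measurable (lebesgue_on T)"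
      using measurable_compose[OF rproj_measurable assms(2)]
      by (intro measurable_restrict_space1 measurable_completion) simp
    show "\<bar>f (rproj V z x)\<bar> \<le> M" if "x \<in> T" for x using M rproj_in_T[OF that assms(3)] by blast
  qed
qed

lemma Cinf_rproj_L2: "Cinf f \<Longrightarrow> z \<in> V \<Longrightarrow> L2 T (\<lambda>x. f (rproj V z x))"
  by (intro continuous_rproj_L2 Cinf_continuous_on Cinf_measurable)

text \<open>A single smooth approximant at finite distance suffices: it is bounded on the faces, and
  the trace differs from it by a square integrable function.\<close>

lemma is_trace_L2b: 
  assumes "is_trace V u g"
  shows "L2b g"
  unfolding L2b_def
proof
  fix z assume z: "z \<in> V"
  obtain un where un: "\<And>n. Cinf (un n)" "(\<lambda>n. fintnn V z (\<lambda>y. (un n y - g z y)\<^sup>2)) \<longlonglongrightarrow> 0"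
    and gm: "(\<lambda>x. g z (rproj V z x)) \<in> borel_measurable (lebesgue_on T)"
    using assms z unfolding is_trace_def by blast
  have "eventually (\<lambda>n. fintnn V z (\<lambda>y. (un n y - g z y)\<^sup>2) < 1) sequentially"
    using un(2) by (rule order_tendstoD) simp
  then obtain n where n: "fintnn V z (\<lambda>y. (un n y - g z y)\<^sup>2) < 1" by (auto simp: eventually_sequentially)
  have uL: "L2 T (\<lambda>x. un n (rproj V z x))" by (rule Cinf_rproj_L2[OF un(1) z])
  have "L2 T (\<lambda>x. un n (rproj V z x) - g z (rproj V z x))"
    unfolding L2_def sqnn_def
  proof
    show "(\<lambda>x. un n (rproj V z x) - g z (rproj V z x)) \<in> borel_measurable (lebesgue_on T)"
      using gm L2_measurable[OF uL] by simp
    have c: "0 < real CARD('n) / height V z" using height_pos[OF z] by simp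
    show "(\<integral>\<^sup>+x. ennreal ((un n (rproj V z x) - g z (rproj V z x))\<^sup>2) \<partial>lebesgue_on T) < \<infinity>"
    proof (rule ccontr)
      assume "\<not> ?thesis"
      then have "(\<integral>\<^sup>+x. ennreal ((un n (rproj V z x) - g z (rproj V z x))\<^sup>2) \<partial>lebesgue_on T) = top"
        by (metis infinity_ennreal_def top.not_eq_extremum)
      then show False using n height_pos[OF z] by (simp add: fintnn_def ennreal_mult_top)
    qed
  qed
  from L2_diff[OF uL this] show "L2 T (\<lambda>x. g z (rproj V z x))" by simp
qed

lemma trace_face_limit:
  assumes z: "z \<in> V" and un: "\<And>n. Cinf (un n)" and \<psi>: "Cinf \<psi>"
    and g: "L2 T (\<lambda>x. g (rproj V z x))"
    and lim: "(\<lambda>n. fintnn V z (\<lambda>y. (un n y - g y)\<^sup>2)) \<longlonglongrightarrow> 0"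
  shows "(\<lambda>n. fint V z (\<lambda>y. un n y * \<psi> y)) \<longlonglongrightarrow> fint V z (\<lambda>y. g y * \<psi> y)"
proof -
  interpret ip: psd_form "ipT T" "{f. L2 T f}" by (rule psd_form_ipT)
  define c where "c = real CARD('n) / height V z"
  have c: "c > 0" using height_pos[OF z] by (simp add: c_def)
  define e where "e n x = un n (rproj V z x) - g (rproj V z x)" for n x
  define p where "p x = \<psi> (rproj V z x)" for x
  have L: "L2 T (\<lambda>x. un n (rproj V z x))" "L2 T p" for n
    using Cinf_rproj_L2[OF un z] Cinf_rproj_L2[OF \<psi> z] by (auto simp: p_def[abs_def])
  have e: "L2 T (e n)" for n unfolding e_def[abs_def] by (rule L2_diff[OF L(1) g])
  have nn: "fintnn V z (\<lambda>y. (un n y - g y)\<^sup>2) = ennreal (c * ipT T (e n) (e n))" for n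
    using e[of n] c unfolding fintnn_def c_def[symmetric] ipT_def L2_iff e_def
    by (subst nn_integral_eq_integral) (auto simp: ennreal_mult' power2_eq_square)
  have nonneg: "0 \<le> ipT T (e n) (e n)" for n by (rule ip.B_nonneg) (simp add: e)
  have "(\<lambda>n. c * ipT T (e n) (e n)) \<longlonglongrightarrow> 0"
    using lim c nonneg unfolding nn by (subst (asm) tendsto_ennreal_iff[of _ _ 0, simplified]) (auto intro!: always_eventually)
  then have "(\<lambda>n. (1 / c) * (c * ipT T (e n) (e n))) \<longlonglongrightarrow> (1 / c) * 0" by (intro tendsto_mult tendsto_const)
  then have "(\<lambda>n. ipT T (e n) (e n)) \<longlonglongrightarrow> 0" using c by simp
  then have "(\<lambda>n. sqrt (ipT T (e n) (e n)) * sqrt (ipT T p p)) \<longlonglongrightarrow> sqrt 0 * sqrt (ipT T p p)"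
    by (intro tendsto_intros)
  then have 0: "(\<lambda>n. ipT T (e n) p) \<longlonglongrightarrow> 0"
    by (intro Lim_null_comparison[OF always_eventually, of "\<lambda>n. ipT T (e n) p" "\<lambda>n. sqrt (ipT T (e n) (e n)) * sqrt (ipT T p p)"])
       (simp_all add: ip.Cauchy_Schwarz e L)
  have "fint V z (\<lambda>y. un n y * \<psi> y) = c * ipT T (e n) p + fint V z (\<lambda>y. g y * \<psi> y)" for n
  proof -
    have "ipT T (e n) p = (\<integral>x. un n (rproj V z x) * p x - g (rproj V z x) * p x \<partial>lebesgue_on T)"
      by (simp add: ipT_def e_def left_diff_distrib)
    also have "\<dots> = (\<integral>x. un n (rproj V z x) * p x \<partial>lebesgue_on T) - (\<integral>x. g (rproj V z x) * p x \<partial>lebesgue_on T)"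
      by (intro Bochner_Integration.integral_diff L2_mult_integrable L g)
    finally show ?thesis by (simp add: fint_def c_def[symmetric] p_def right_diff_distrib)
  qed
  moreover have "(\<lambda>n. c * ipT T (e n) p + fint V z (\<lambda>y. g y * \<psi> y)) \<longlonglongrightarrow> c * 0 + fint V z (\<lambda>y. g y * \<psi> y)"
    by (intro tendsto_intros 0)
  ultimately show ?thesis by simp
qed

text \<open>An exchange of limits. The approximation error is small uniformly in the cut-off index
  by \<open>strip_bound_vcut\<close>, so the smooth case carries over although gradients of the
  approximants need not converge.\<close>

lemma trace_vcut_limit:
  assumes tr: "is_trace V u g" and \<psi>: "Cinf \<psi>"
  shows "(\<lambda>j. - (\<integral>x. u x * \<psi> x * pdiff i (vcut j) x \<partial>lebesgue_on T))
    \<longlonglongrightarrow> (\<Sum>z\<in>V. onormal V z $ i * fint V z (\<lambda>y. g z y * \<psi> y))"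
proof -
  obtain s un where s: "1/2 < s" "Hs s T u" and un: "\<And>n. Cinf (un n)"
    and lim: "(\<lambda>n. sqnn T (\<lambda>x. un n x - u x) + slob s T (\<lambda>x. un n x - u x)) \<longlonglongrightarrow> 0"
    and flim: "\<And>z. z \<in> V \<Longrightarrow> (\<lambda>n. fintnn V z (\<lambda>y. (un n y - g z y)\<^sup>2)) \<longlonglongrightarrow> 0"
    using tr unfolding is_trace_def by blast
  have u: "L2 T u" using s(2) by (simp add: Hs_def)
  obtain K J where K: "K \<ge> 0" "\<And>w a j. w \<in> borel_measurable (lebesgue_on T) \<Longrightarrow> 0 < a \<Longrightarrow> J \<le> j \<Longrightarrow>
    sqnn T w \<le> ennreal (a\<^sup>2) \<Longrightarrow> slob s T w \<le> ennreal (a\<^sup>2) \<Longrightarrow>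
    \<bar>\<integral>x. w x * \<psi> x * pdiff i (vcut j) x \<partial>lebesgue_on T\<bar> \<le> K * a"
    using strip_bound_vcut[OF s(1) \<psi>, of i] by blast
  define A where "A v j = - (\<integral>x. v x * \<psi> x * pdiff i (vcut j) x \<partial>lebesgue_on T)" for v j
  define Bn where "Bn n = (\<Sum>z\<in>V. onormal V z $ i * fint V z (\<lambda>y. un n y * \<psi> y))" for n
  define B where "B = (\<Sum>z\<in>V. onormal V z $ i * fint V z (\<lambda>y. g z y * \<psi> y))"
  have BnB: "Bn \<longlonglongrightarrow> B"
    unfolding Bn_def[abs_def] B_def using is_trace_L2b[OF tr]
    by (intro tendsto_sum tendsto_mult tendsto_const trace_face_limit un \<psi> flim) (auto simp: L2b_def)
  show ?thesis
    unfolding A_def[symmetric] B_def[symmetric]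
  proof (rule LIMSEQ_I)
    fix r :: real assume r: "0 < r"
    define a where "a = r / (3 * (K + 1))"
    have a: "a > 0" using r K(1) by (simp add: a_def)
    have Ka: "K * a < r / 3"
    proof -
      have "K * a < (K + 1) * a" using a by simp
      also have "\<dots> = r / 3" using K(1) by (simp add: a_def field_simps)
      finally show ?thesis .
    qed
    have e1: "eventually (\<lambda>n. sqnn T (\<lambda>x. un n x - u x) + slob s T (\<lambda>x. un n x - u x) < ennreal (a\<^sup>2)) sequentially"
      using lim a by (intro order_tendstoD) auto
    have e2: "eventually (\<lambda>n. dist (Bn n) B < r / 3) sequentially"
      using BnB r by (intro tendstoD) auto
    obtain n where n: "sqnn T (\<lambda>x. un n x - u x) + slob s T (\<lambda>x. un n x - u x) < ennreal (a\<^sup>2)" "dist (Bn n) B < r / 3"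
      using eventually_conj[OF e1 e2] by (auto simp: eventually_sequentially)
    have "A (un n) \<longlonglongrightarrow> Bn n" unfolding A_def Bn_def by (rule smooth_vcut_limit[OF un \<psi>])
    then have "eventually (\<lambda>j. dist (A (un n) j) (Bn n) < r / 3) sequentially"
      using r by (intro tendstoD) auto
    then obtain N where N: "\<And>j. N \<le> j \<Longrightarrow> dist (A (un n) j) (Bn n) < r / 3" by (auto simp: eventually_sequentially)
    show "\<exists>N. \<forall>j\<ge>N. norm (A u j - B) < r"
    proof (intro exI allI impI)
      fix j assume j: "max N J \<le> j"
      have Lu: "L2 T (un n)" by (intro continuous_L2 Cinf_continuous_on un)
      have "\<bar>\<integral>x. (un n x - u x) * \<psi> x * pdiff i (vcut j) x \<partial>lebesgue_on T\<bar> \<le> K * a"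
      proof (rule K(2)[OF _ a])
        show "(\<lambda>x. un n x - u x) \<in> borel_measurable (lebesgue_on T)"
          by (rule L2_measurable[OF L2_diff[OF Lu u]])
        have "sqnn T (\<lambda>x. un n x - u x) \<le> sqnn T (\<lambda>x. un n x - u x) + slob s T (\<lambda>x. un n x - u x)" by simp
        then show "sqnn T (\<lambda>x. un n x - u x) \<le> ennreal (a\<^sup>2)" using n(1) by (rule order_trans[OF _ less_imp_le])
        have "slob s T (\<lambda>x. un n x - u x) \<le> sqnn T (\<lambda>x. un n x - u x) + slob s T (\<lambda>x. un n x - u x)" by simp
        then show "slob s T (\<lambda>x. un n x - u x) \<le> ennreal (a\<^sup>2)" using n(1) by (rule order_trans[OF _ less_imp_le])
      qed (use j in simp)
      moreover have "(\<integral>x. (un n x - u x) * \<psi> x * pdiff i (vcut j) x \<partial>lebesgue_on T) = A u j - A (un n) j"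
        using integrable_mult_smooth[OF Lu \<psi> Cinf_pdiff[OF Cinf_vcut]] integrable_mult_smooth[OF u \<psi> Cinf_pdiff[OF Cinf_vcut]]
        by (simp add: A_def left_diff_distrib)
      ultimately have "\<bar>A u j - A (un n) j\<bar> < r / 3" using Ka by simp
      moreover have "\<bar>A (un n) j - Bn n\<bar> < r / 3" using N[of j] j by (simp add: dist_real_def)
      moreover have "\<bar>Bn n - B\<bar> < r / 3" using n(2) by (simp add: dist_real_def)
      ultimately show "norm (A u j - B) < r" unfolding real_norm_def by linarith
    qed
  qed
qed

lemma pdiff_vcut_mult: "Cinf q \<Longrightarrow> pdiff i (\<lambda>x. vcut j x * q x) x = vcut j x * pdiff i q x + pdiff i (vcut j) x * q x"
  by (simp add: pdiff_mult Cinf_differentiable Cinf_vcut)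

text \<open>By the product rule the gradient of the cut-off splits off; it concentrates at the
  boundary and leaves the trace term in the limit.\<close>

lemma trace_parts_limit:
  assumes tr: "is_trace V u g" and q: "Cinf q"
  shows "(\<lambda>j. \<integral>x. u x * pdiff i (\<lambda>x. vcut j x * q x) x \<partial>lebesgue_on T)
    \<longlonglongrightarrow> (\<integral>x. u x * pdiff i q x \<partial>lebesgue_on T) - (\<Sum>z\<in>V. onormal V z $ i * fint V z (\<lambda>y. g z y * q y))"
proof -
  have u: "L2 T u" using tr by (auto simp: is_trace_def Hs_def)
  have I: "integrable (lebesgue_on T) (\<lambda>x. u x * pdiff i q x)"
    by (intro L2_mult_integrable u continuous_L2 Cinf_continuous_on Cinf_pdiff q)
  have "(\<integral>x. u x * pdiff i (\<lambda>x. vcut j x * q x) x \<partial>lebesgue_on T)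
    = (\<integral>x. (u x * pdiff i q x) * vcut j x \<partial>lebesgue_on T) + (\<integral>x. u x * q x * pdiff i (vcut j) x \<partial>lebesgue_on T)" for j
  proof -
    have "(\<integral>x. u x * pdiff i (\<lambda>x. vcut j x * q x) x \<partial>lebesgue_on T)
      = (\<integral>x. u x * pdiff i q x * vcut j x + u x * q x * pdiff i (vcut j) x \<partial>lebesgue_on T)"
      by (intro Bochner_Integration.integral_cong refl) (simp only: pdiff_vcut_mult[OF q], simp add: algebra_simps)
    then show ?thesis
      using integrable_mult_smooth[OF u Cinf_pdiff[OF q] Cinf_vcut] integrable_mult_smooth[OF u q Cinf_pdiff[OF Cinf_vcut]]
      by simp
  qed
  moreover have "(\<lambda>j. (\<integral>x. (u x * pdiff i q x) * vcut j x \<partial>lebesgue_on T) - - (\<integral>x. u x * q x * pdiff i (vcut j) x \<partial>lebesgue_on T))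
    \<longlonglongrightarrow> (\<integral>x. u x * pdiff i q x \<partial>lebesgue_on T) - (\<Sum>z\<in>V. onormal V z $ i * fint V z (\<lambda>y. g z y * q y))"
    by (intro tendsto_diff integral_vcut_limit I trace_vcut_limit tr q)
  ultimately show ?thesis by simp
qed

lemma H1_integration_by_parts:
  assumes H1: "H1_grad T u G" and tr: "is_trace V u g" and q: "Cinf q"
  shows "(\<integral>x. u x * pdiff i q x \<partial>lebesgue_on T) + (\<integral>x. G x $ i * q x \<partial>lebesgue_on T)
    = (\<Sum>z\<in>V. onormal V z $ i * fint V z (\<lambda>y. g z y * q y))"
proof -
  have I: "integrable (lebesgue_on T) (\<lambda>x. G x $ i * q x)"
    using H1 by (intro L2_mult_integrable[OF _ continuous_L2[OF Cinf_continuous_on[OF q]]]) (simp add: H1_grad_def)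
  have "(\<integral>x. u x * pdiff i (\<lambda>x. vcut j x * q x) x \<partial>lebesgue_on T) = - (\<integral>x. (G x $ i * q x) * vcut j x \<partial>lebesgue_on T)" for j
    using H1 test_fun_vcut[OF q, of j] unfolding H1_grad_def weak_grad_def by (simp add: mult_ac)
  moreover have "(\<lambda>j. - (\<integral>x. (G x $ i * q x) * vcut j x \<partial>lebesgue_on T)) \<longlonglongrightarrow> - (\<integral>x. G x $ i * q x \<partial>lebesgue_on T)"
    by (intro tendsto_minus integral_vcut_limit I)
  ultimately have "(\<integral>x. u x * pdiff i q x \<partial>lebesgue_on T) - (\<Sum>z\<in>V. onormal V z $ i * fint V z (\<lambda>y. g z y * q y))
    = - (\<integral>x. G x $ i * q x \<partial>lebesgue_on T)"
    using trace_parts_limit[OF tr q, of i] LIMSEQ_unique by auto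
  then show ?thesis by simp
qed

lemma fint_sum:
  assumes "\<And>i. i \<in> I \<Longrightarrow> integrable (lebesgue_on T) (\<lambda>x. f i (rproj V z x))"
  shows "fint V z (\<lambda>y. \<Sum>i\<in>I. f i y) = (\<Sum>i\<in>I. fint V z (f i))"
  using assms by (simp add: fint_def Bochner_Integration.integral_sum sum_distrib_left)

text \<open>The components of \<open>\<sigma>\<close> have traces but no individual weak
  derivatives. Hence the limits are taken componentwise, and only their sum is matched with the weak
  divergence.\<close>

lemma Hdiv_integration_by_parts:
  assumes H: "Hdiv_div T \<sigma> D" and tr: "is_vtrace V \<sigma> gs" and q: "Cinf q"
  shows "(\<integral>x. \<sigma> x \<bullet> cgrad q x \<partial>lebesgue_on T) + (\<integral>x. D x * q x \<partial>lebesgue_on T)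
    = (\<Sum>z\<in>V. fint V z (\<lambda>y. (gs z y \<bullet> onormal V z) * q y))"
proof -
  have tri: "is_trace V (\<lambda>x. \<sigma> x $ i) (\<lambda>z y. gs z y $ i)" for i using tr by (simp add: is_vtrace_def)
  have \<sigma>: "L2 T (\<lambda>x. \<sigma> x $ i)" for i using H by (simp add: Hdiv_div_def)
  have I: "integrable (lebesgue_on T) (\<lambda>x. D x * q x)"
    using H by (intro L2_mult_integrable[OF _ continuous_L2[OF Cinf_continuous_on[OF q]]]) (simp add: Hdiv_div_def)
  have ip: "(\<integral>x. \<sigma> x \<bullet> cgrad f x \<partial>lebesgue_on T) = (\<Sum>i\<in>UNIV. \<integral>x. \<sigma> x $ i * pdiff i f x \<partial>lebesgue_on T)" if f: "Cinf f" for f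
    unfolding inner_vec_def cgrad_def
    using L2_mult_integrable[OF \<sigma> continuous_L2[OF Cinf_continuous_on[OF Cinf_pdiff[OF f]]]]
    by (simp add: Bochner_Integration.integral_sum)
  define b where "b i = (\<Sum>z\<in>V. onormal V z $ i * fint V z (\<lambda>y. gs z y $ i * q y))" for i
  have "(\<integral>x. \<sigma> x \<bullet> cgrad (\<lambda>x. vcut j x * q x) x \<partial>lebesgue_on T) = - (\<integral>x. (D x * q x) * vcut j x \<partial>lebesgue_on T)" for j
    using H test_fun_vcut[OF q, of j] unfolding Hdiv_div_def weak_div_def by (simp add: mult_ac)
  then have "(\<lambda>j. \<Sum>i\<in>UNIV. \<integral>x. \<sigma> x $ i * pdiff i (\<lambda>x. vcut j x * q x) x \<partial>lebesgue_on T)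
     = (\<lambda>j. - (\<integral>x. (D x * q x) * vcut j x \<partial>lebesgue_on T))"
    using ip[OF Cinf_mult[OF Cinf_vcut q]] by (auto simp: fun_eq_iff)
  moreover have "(\<lambda>j. - (\<integral>x. (D x * q x) * vcut j x \<partial>lebesgue_on T)) \<longlonglongrightarrow> - (\<integral>x. D x * q x \<partial>lebesgue_on T)"
    by (intro tendsto_minus integral_vcut_limit I)
  moreover have "(\<lambda>j. \<Sum>i\<in>UNIV. \<integral>x. \<sigma> x $ i * pdiff i (\<lambda>x. vcut j x * q x) x \<partial>lebesgue_on T)
     \<longlonglongrightarrow> (\<Sum>i\<in>UNIV. (\<integral>x. \<sigma> x $ i * pdiff i q x \<partial>lebesgue_on T) - b i)"
    unfolding b_def by (intro tendsto_sum trace_parts_limit[OF tri q])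
  ultimately have "(\<Sum>i\<in>UNIV. (\<integral>x. \<sigma> x $ i * pdiff i q x \<partial>lebesgue_on T) - b i) = - (\<integral>x. D x * q x \<partial>lebesgue_on T)"
    using LIMSEQ_unique by auto
  then have "(\<integral>x. \<sigma> x \<bullet> cgrad q x \<partial>lebesgue_on T) + (\<integral>x. D x * q x \<partial>lebesgue_on T) = (\<Sum>i\<in>UNIV. b i)"
    using ip[OF q] by (simp add: sum_subtractf)
  also have "\<dots> = (\<Sum>z\<in>V. \<Sum>i\<in>UNIV. onormal V z $ i * fint V z (\<lambda>y. gs z y $ i * q y))"
    unfolding b_def by (rule sum.swap)
  also have "\<dots> = (\<Sum>z\<in>V. fint V z (\<lambda>y. (gs z y \<bullet> onormal V z) * q y))"
  proof (rule sum.cong[OF refl])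
    fix z assume z: "z \<in> V"
    have g: "integrable (lebesgue_on T) (\<lambda>x. gs z (rproj V z x) $ i * q (rproj V z x))" for i
      using is_trace_L2b[OF tri[of i]] z by (intro L2_mult_integrable[OF _ Cinf_rproj_L2[OF q z]]) (simp add: L2b_def)
    have "fint V z (\<lambda>y. (gs z y \<bullet> onormal V z) * q y)
      = fint V z (\<lambda>y. \<Sum>i\<in>UNIV. onormal V z $ i * (gs z y $ i * q y))"
      by (simp add: inner_vec_def sum_distrib_left mult_ac)
    also have "\<dots> = (\<Sum>i\<in>UNIV. fint V z (\<lambda>y. onormal V z $ i * (gs z y $ i * q y)))"
      by (rule fint_sum) (intro integrable_mult_right g)
    also have "\<dots> = (\<Sum>i\<in>UNIV. onormal V z $ i * fint V z (\<lambda>y. gs z y $ i * q y))"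
      by (simp add: fint_def mult_ac)
    finally show "(\<Sum>i\<in>UNIV. onormal V z $ i * fint V z (\<lambda>y. gs z y $ i * q y))
      = fint V z (\<lambda>y. (gs z y \<bullet> onormal V z) * q y)" ..
  qed
  finally show ?thesis .
qed

end

section \<open>The reference simplex\<close>

abbreviation Vref :: "(real^'n::finite) set" where
  "Vref \<equiv> insert 0 Basis"

lemma zero_notin_Basis: "0 \<notin> (Basis :: 'a::euclidean_space set)"
  using nonzero_Basis by blast

interpretation ref: nsimplex "Vref :: (real^'n::finite) set"
proof
  have "independent (Basis :: (real^'n) set)" by (rule independent_Basis)
  moreover have "(\<lambda>x. - 0 + x) ` (Vref - {0}) = (Basis :: (real^'n) set)"
    using zero_notin_Basis by auto
  ultimately show "\<not> affine_dependent (Vref :: (real^'n) set)"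
    using affine_dependent_iff_dependent2[of 0 "Vref :: (real^'n) set"] by simp
  show "card (Vref :: (real^'n) set) = CARD('n) + 1"
    using zero_notin_Basis by (simp add: card_insert_if)
qed

lemma Basis_axis: "(Basis :: (real^'n::finite) set) = range (\<lambda>i. axis i 1)"
  by (auto simp: Basis_vec_def)

lemma lam_ref_zero: "lam Vref 0 (x :: real^'n::finite) = 1 - (\<Sum>i\<in>UNIV. x $ i)"
proof -
  have "linear (\<lambda>x :: real^'n. - (\<Sum>i\<in>UNIV. x $ i))"
    by (rule linearI) (simp_all add: sum.distrib sum_distrib_left)
  then have "lam Vref 0 x = 1 + - (\<Sum>i\<in>UNIV. x $ i)"
  proof (rule ref.lam_unique)
    fix w :: "real^'n" assume "w \<in> Vref" "w \<noteq> 0"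
    then obtain i where "w = axis i 1" by (auto simp: Basis_axis)
    then show "1 + - (\<Sum>i\<in>UNIV. w $ i) = 0" by (simp add: axis_def)
  qed simp_all
  then show ?thesis by simp
qed

lemma lam_ref_axis: "lam Vref (axis i 1) (x :: real^'n::finite) = x $ i"
proof -
  have "linear (\<lambda>x :: real^'n. x $ i)" by (rule linearI) simp_all
  then have "lam Vref (axis i 1) x = 0 + x $ i"
  proof (rule ref.lam_unique)
    show "axis i 1 \<in> Vref" by (simp add: Basis_axis)
    show "0 + axis i 1 $ i = (1::real)" by (simp add: axis_def)
    fix w :: "real^'n" assume w: "w \<in> Vref" "w \<noteq> axis i 1"
    then consider "w = 0" | j where "w = axis j 1" "j \<noteq> i" by (auto simp: Basis_axis)
    then show "0 + w $ i = 0" by cases (simp_all add: axis_def)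
  qed
  then show ?thesis by simp
qed

context nsimplex
begin

lemma reference_map:
  assumes z: "z \<in> V"
  shows "\<exists>B::real^'n \<Rightarrow> real^'n. linear B \<and> bij B \<and> (\<lambda>x. z + B x) ` Vref = V"
proof -
  have "card (Basis :: (real^'n) set) = card (V - {z})" using z cardV by simp
  then obtain g where g: "bij_betw g (Basis :: (real^'n) set) (V - {z})"
    using finite_same_card_bij[of "Basis :: (real^'n) set" "V - {z}"] by auto
  define B where "B x = (\<Sum>b\<in>Basis. (x \<bullet> b) *\<^sub>R (g b - z))" for x :: "real^'n"
  have lin: "linear B"
    by (rule linearI) (simp_all add: B_def inner_add_left scaleR_add_left sum.distrib scaleR_sum_right)
  have Bb: "B b = g b - z" if b: "b \<in> Basis" for b
  proof -
    have "B b = (\<Sum>c\<in>Basis. if c = b then g b - z else 0)"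
      unfolding B_def by (rule sum.cong) (use b in \<open>auto simp: inner_Basis\<close>)
    then show ?thesis using b by simp
  qed
  have img: "(\<lambda>x. z + B x) ` Vref = V"
  proof -
    have "(\<lambda>x. z + B x) ` Vref = insert z (g ` Basis)"
      using Bb linear_0[OF lin] by (auto simp: image_iff)
    then show ?thesis using g z by (auto simp: bij_betw_def)
  qed
  have "surj B"
  proof (rule surjI)
    fix y
    define c where "c b = lam V (g b) (z + y)" for b
    have "(\<Sum>w\<in>V. lam V w (z + y) *\<^sub>R (w - z)) = y"
      using sum_lam_vertex[of "z + y"] sum_lam[of "z + y"]
      by (simp add: scaleR_diff_right sum_subtractf scaleR_left.sum[symmetric])
    then have "(\<Sum>w\<in>V - {z}. lam V w (z + y) *\<^sub>R (w - z)) = y"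
      using sum.remove[OF finite_V z, of "\<lambda>w. lam V w (z + y) *\<^sub>R (w - z)"] by simp
    then have s: "(\<Sum>b\<in>Basis. c b *\<^sub>R (g b - z)) = y"
      unfolding c_def using sum.reindex_bij_betw[OF g, of "\<lambda>w. lam V w (z + y) *\<^sub>R (w - z)"] by simp
    show "B (\<Sum>b\<in>Basis. c b *\<^sub>R b) = y"
      unfolding linear_sum[OF lin] linear_scale[OF lin] using s Bb by (simp cong: sum.cong)
  qed
  then have "bij B" using lin linear_surjective_imp_injective by (auto simp: bij_def)
  then show ?thesis using lin img by blast
qed

end

text \<open>The affine map from the reference simplex sends the vertex 0 to \<open>z\<close>, so the
  face opposite to any chosen \<open>z\<close> is always compared with the reference face opposite
  to 0.\<close>

locale simplex_map = nsimplex V for V :: "(real^'n::finite) set" +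
  fixes z :: "real^'n" and B :: "real^'n \<Rightarrow> real^'n"
  assumes zV: "z \<in> V" and linB: "linear B" and bijB: "bij B"
    and img: "(\<lambda>x. z + B x) ` Vref = V"
    and dim: "CARD('n) = 2 \<or> CARD('n) = 3"
begin

definition F where "F x = z + B x"
definition A where "A = inv B"
definition Finv where "Finv x = A (x - z)"

lemma linA: "linear A"
  unfolding A_def using linB bijB by (intro inj_linear_imp_inv_linear bij_is_inj)

lemma AB: "A (B x) = x" "B (A x) = x"
  unfolding A_def using bijB by (simp_all add: bij_is_inj bij_is_surj surj_f_inv_f)

lemma F_Finv: "F (Finv x) = x" and Finv_F: "Finv (F x) = x"
  by (simp_all add: F_def Finv_def AB)

lemma F_zero: "F 0 = z"
  by (simp add: F_def linear_0[OF linB])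

lemma F_vertex: "w \<in> Vref \<Longrightarrow> F w \<in> V"
  using img by (auto simp: F_def[abs_def])

lemma V_eq: "V = F ` Vref"
  using img by (simp add: F_def[abs_def])

lemma F_inj: "F x = F y \<longleftrightarrow> x = y"
  using Finv_F by metis

text \<open>As functions of \<open>x\<close>, both sides are affine and agree on the vertices of the
  reference simplex.\<close>

lemma lam_F:
  assumes w: "w \<in> Vref"
  shows "lam V (F w) (F x) = lam Vref w x"
proof -
  define n where "n = onormal V (F w)"
  define H where "H = height V (F w)"
  have lin: "linear (\<lambda>x. - (n \<bullet> B x / H))"
    by (rule linearI) (simp_all add: linear_add[OF linB] linear_scale[OF linB] inner_add_right add_divide_distrib)
  have eq: "lam V (F w) (F x) = (1 - n \<bullet> (z - F w) / H) + - (n \<bullet> B x / H)" for x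
    by (simp add: lam_def n_def H_def F_def inner_diff_right inner_add_right diff_divide_distrib add_divide_distrib)
  have v: "lam V (F w) (F w') = (if w' = w then 1 else 0)" if "w' \<in> Vref" for w'
    using lam_vertex[OF F_vertex[OF w] F_vertex[OF that]] by (simp add: F_inj)
  show ?thesis
    unfolding eq
  proof (rule ref.lam_unique[OF lin w, symmetric])
    show "1 - n \<bullet> (z - F w) / H + - (n \<bullet> B w / H) = 1" using v[OF w] unfolding eq by simp
    show "1 - n \<bullet> (z - F w) / H + - (n \<bullet> B w' / H) = 0" if "w' \<in> Vref" "w' \<noteq> w" for w'
      using v[OF that(1)] that(2) unfolding eq by simp
  qed
qed

lemma F_mem_T: "F x \<in> T \<longleftrightarrow> x \<in> ref.T"
proof -
  have "F x \<in> T \<longleftrightarrow> (\<forall>w\<in>Vref. 0 \<le> lam V (F w) (F x))"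
    unfolding T_eq by (subst V_eq) auto
  then show ?thesis using lam_F by (simp add: ref.T_eq)
qed

text \<open>This affine invariance is the reason why the face form \<open>Aform\<close> picks up the
  same factor as the cell form.\<close>

lemma rproj_F: "rproj V z (F x) = F (rproj Vref 0 x)"
  using lam_F[of 0 x] by (simp add: rproj_eq ref.rproj_eq F_zero) (simp add: F_def linear_scale[OF linB])

lemma F_has_derivative: "(F has_derivative B) (at x)"
  using has_derivative_add[OF has_derivative_const linear_imp_has_derivative[OF linB]]
  by (simp add: F_def[abs_def])

lemma F_affine_Pm: "(\<lambda>x. F x $ i) \<in> Pm 1"
proof -
  have "linear (\<lambda>x. B x $ i)"
    by (rule linearI) (simp_all add: linear_add[OF linB] linear_scale[OF linB])
  from Pm_affine[OF this, of "z $ i"] show ?thesis by (simp add: F_def)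
qed

lemma Finv_affine_Pm: "(\<lambda>x. Finv x $ i) \<in> Pm 1"
proof -
  have "linear (\<lambda>x. A x $ i)"
    by (rule linearI) (simp_all add: linear_add[OF linA] linear_scale[OF linA])
  from Pm_affine[OF this, of "- (A z $ i)"] show ?thesis by (simp add: Finv_def linear_diff[OF linA])
qed

lemma Pm_F: "p \<in> Pm m \<Longrightarrow> (\<lambda>x. p (F x)) \<in> Pm m"
  by (rule Pm_compose[OF F_affine_Pm])

lemma Pm_Finv: "p \<in> Pm m \<Longrightarrow> (\<lambda>x. p (Finv x)) \<in> Pm m"
  by (rule Pm_compose[OF Finv_affine_Pm])

text \<open>The factor depends on the simplex but not on the integrand, so it cancels in every
  homogeneous inequality between integrals over the simplex.\<close>

lemma integral_F:
  "\<exists>c>0. \<forall>g::real^'n \<Rightarrow> real. g \<in> borel_measurable borel \<longrightarrow> (\<integral>x. g (F x) \<partial>lebesgue_on ref.T) = c * (\<integral>x. g x \<partial>lebesgue_on T)"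
proof -
  from integral_affine_change[OF dim linB bijB, of z]
  obtain c where c: "c > 0" and cg: "\<forall>g::real^'n \<Rightarrow> real. g \<in> borel_measurable borel \<longrightarrow>
    (\<integral>x. g (z + B x) \<partial>lborel) = c * (\<integral>x. g x \<partial>lborel)"
    by (elim exE conjE)
  have Bm [measurable]: "B \<in> borel_measurable borel" by (rule linear_borel_measurable[OF linB])
  have "(\<integral>x. g (F x) \<partial>lebesgue_on ref.T) = c * (\<integral>x. g x \<partial>lebesgue_on T)"
    if [measurable]: "g \<in> borel_measurable borel" for g :: "real^'n \<Rightarrow> real"
  proof -
    have Fm [measurable]: "F \<in> borel_measurable borel" unfolding F_def[abs_def] by measurable
    have "(\<integral>x. g (F x) \<partial>lebesgue_on ref.T) = (\<integral>x. indicator ref.T x * g (F x) \<partial>lborel)"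
      by (intro integral_lebesgue_on_borel) auto
    also have "\<dots> = (\<integral>x. indicator T (z + B x) * g (z + B x) \<partial>lborel)"
      by (intro Bochner_Integration.integral_cong refl) (use F_mem_T in \<open>auto simp: indicator_def F_def\<close>)
    also have "\<dots> = c * (\<integral>x. indicator T x * g x \<partial>lborel)"
      by (rule cg[rule_format, of "\<lambda>x. indicator T x * g x"]) measurable
    also have "(\<integral>x. indicator T x * g x \<partial>lborel) = (\<integral>x. g x \<partial>lebesgue_on T)"
      by (intro integral_lebesgue_on_borel[symmetric]) auto
    finally show ?thesis .
  qed
  then show ?thesis using c by (intro exI[of _ c]) simp
qed

lemma norm_B_le: "norm (B x) \<le> CARD('n) * diameter T * norm x"
proof -
  have nb: "norm (B b) \<le> diameter T" if "b \<in> Basis" for b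
  proof -
    have "F b \<in> T" "z \<in> T" using F_vertex[of b] that zV V_subset_T by auto
    from norm_diff_le_diameter[OF this] show ?thesis by (simp add: F_def)
  qed
  have "B x = B (\<Sum>b\<in>Basis. (x \<bullet> b) *\<^sub>R b)" by (simp add: euclidean_representation)
  also have "\<dots> = (\<Sum>b\<in>Basis. (x \<bullet> b) *\<^sub>R B b)" by (simp add: linear_sum[OF linB] linear_scale[OF linB])
  also have "norm \<dots> \<le> (\<Sum>b\<in>(Basis :: (real^'n) set). norm x * diameter T)"
    using nb Basis_le_norm[of _ x] by (intro sum_norm_le) (auto intro!: mult_mono)
  finally show ?thesis by (simp add: mult_ac)
qed

end

lemma (in nsimplex) simplex_map_exists:
  assumes "z \<in> V" "CARD('n) = 2 \<or> CARD('n) = 3"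
  shows "\<exists>B. simplex_map V z B"
  using reference_map[OF assms(1)] assms nsimplex_axioms
  by (auto simp: simplex_map_def simplex_map_axioms_def)

section \<open>Polynomial inequalities with uniform constants\<close>

lemma Pm_measurable: "p \<in> Pm m \<Longrightarrow> p \<in> borel_measurable borel"
  by (intro borel_measurable_continuous_onI Pm_continuous_on)

context nsimplex
begin

text \<open>The open set \<open>U\<close> accommodates functions composed with \<open>rproj\<close>,
  which are continuous only away from the hyperplane through \<open>z\<close> parallel to the face.
  A zero almost everywhere extends by continuity, since the simplex is the closure of its
  interior.\<close>

lemma integral_sq_zero:
  assumes f: "L2 T f" and U: "continuous_on U f" "open U" and int: "ipT T f f = 0"
    and x: "x \<in> T" "x \<in> U"
  shows "f x = 0"
proof -
  have "AE x in lebesgue_on T. (f x)\<^sup>2 = 0"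
    using int f unfolding ipT_def power2_eq_square[symmetric] L2_iff
    by (subst (asm) integral_nonneg_eq_0_iff_AE) auto
  then have ae: "AE x in lebesgue. x \<in> T \<longrightarrow> f x = 0" by (simp add: AE_restrict_space_iff)
  define S where "S = {y \<in> interior T \<inter> U. f y \<noteq> 0}"
  have "open S"
  proof -
    have "continuous_on (interior T \<inter> U) f" using U(1) by (rule continuous_on_subset) auto
    then have "open ((interior T \<inter> U) \<inter> f -` (- {0}))"
      using U(2) by (intro continuous_open_preimage) auto
    moreover have "(interior T \<inter> U) \<inter> f -` (- {0}) = S" by (auto simp: S_def)
    ultimately show ?thesis by simp
  qed
  moreover have "negligible S"
    unfolding negligible_iff_null_sets
  proof (rule AE_iff_null_sets[THEN iffD2])
    show "S \<in> sets lebesgue" using \<open>open S\<close> by (simp add: borel_open)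
    show "AE x in lebesgue. x \<notin> S" using ae by eventually_elim (use interior_subset[of T] in \<open>auto simp: S_def\<close>)
  qed
  ultimately have "S = {}" using open_not_negligible by blast
  then have zero: "\<And>y. y \<in> interior T \<inter> U \<Longrightarrow> f y = 0" by (auto simp: S_def)
  show ?thesis
  proof (rule ccontr)
    assume "f x \<noteq> 0"
    have "open (U \<inter> f -` (- {0}))" using U by (intro continuous_open_preimage) auto
    moreover have "x \<in> U \<inter> f -` (- {0})" using x \<open>f x \<noteq> 0\<close> by simp
    moreover have "x \<in> closure (interior T)" using x closure_interior_T by simp
    ultimately have "(U \<inter> f -` (- {0})) \<inter> interior T \<noteq> {}"
      using open_Int_closure_eq_empty by blast
    then show False using zero by auto
  qed
qed

lemma Pm_zero_T:
  assumes "p \<in> Pm m" "ipT T p p = 0"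
  shows "p = 0"
  using assms interior_nonempty interior_subset[of T]
  by (intro Pm_identity[OF assms(1), of "interior T"] integral_sq_zero[of p UNIV] Pm_L2 Pm_continuous_on) auto

lemma Pm_rproj_L2: "p \<in> Pm m \<Longrightarrow> z \<in> V \<Longrightarrow> L2 T (\<lambda>x. p (rproj V z x))"
  by (intro Cinf_rproj_L2 Pm_Cinf)

text \<open>The inner product on the face opposite to \<open>z\<close> without the factor
  \<open>CARD('n) / height V z\<close>; in this normalisation it scales under affine maps exactly
  like the cell inner product.\<close>

definition Aform :: "real^'n \<Rightarrow> (real^'n \<Rightarrow> real) \<Rightarrow> (real^'n \<Rightarrow> real) \<Rightarrow> real" where
  "Aform z p q = ipT T (\<lambda>x. p (rproj V z x)) (\<lambda>x. q (rproj V z x))"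

lemma Aform_zero:
  assumes p: "continuous_on UNIV p" and z: "z \<in> V" and 0: "Aform z p p = 0" and x: "x \<in> face V z"
  shows "p x = 0"
proof -
  have x': "x \<in> T" "lam V z x = 0" using x face_eq[OF z] by auto
  have "p (rproj V z x) = 0"
  proof (rule integral_sq_zero[where f = "\<lambda>x. p (rproj V z x)" and U = "{x. lam V z x \<noteq> 1}"])
    show "L2 T (\<lambda>x. p (rproj V z x))"
      using p z by (intro continuous_rproj_L2 borel_measurable_continuous_onI continuous_on_subset[OF p]) auto
    show "continuous_on {x. lam V z x \<noteq> 1} (\<lambda>x. p (rproj V z x))"
      using continuous_on_compose2[OF p rproj_continuous[OF z]] by simp
    show "open {x. lam V z x \<noteq> 1}" by (intro open_Collect_neq continuous_lam continuous_on_const)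
    show "ipT T (\<lambda>x. p (rproj V z x)) (\<lambda>x. p (rproj V z x)) = 0" using 0 by (simp add: Aform_def)
  qed (use x' in auto)
  then show ?thesis using rproj_of_face[OF x'(2)] by simp
qed

lemma psd_form_pullback:
  fixes \<Phi> :: "'v::real_vector \<Rightarrow> (real^'n \<Rightarrow> real)"
  assumes W: "subspace W" and L: "\<And>p. p \<in> W \<Longrightarrow> L2 T (\<Phi> p)"
    and add: "\<And>p q. p \<in> W \<Longrightarrow> q \<in> W \<Longrightarrow> \<Phi> (p + q) = \<Phi> p + \<Phi> q"
    and scale: "\<And>c p. p \<in> W \<Longrightarrow> \<Phi> (c *\<^sub>R p) = c *\<^sub>R \<Phi> p"
  shows "psd_form (\<lambda>p q. ipT T (\<Phi> p) (\<Phi> q)) W"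
proof -
  interpret ip: psd_form "ipT T" "{f. L2 T f}" by (rule psd_form_ipT)
  show ?thesis
    by unfold_locales (use W L add scale in \<open>auto simp: ip.B_add ip.B_scale ip.B_nonneg intro: ip.B_sym\<close>)
qed

lemma psd_form_Pm: "psd_form (ipT T) (Pm m)"
  by (rule psd_form.psd_form_subspace[OF psd_form_ipT subspace_Pm]) (auto intro: Pm_L2)

lemma psd_form_Aform: "z \<in> V \<Longrightarrow> psd_form (Aform z) (Pm m)"
  unfolding Aform_def[abs_def]
  by (rule psd_form_pullback) (auto simp: subspace_Pm fun_eq_iff intro: Pm_rproj_L2)

end

text \<open>The radial derivative about \<open>z\<close>. It is affinely invariant and occurs in the
  divergence \<open>d p + euler z p\<close> of the field \<open>p (x - z)\<close>.\<close>

definition euler :: "real^'n::finite \<Rightarrow> (real^'n \<Rightarrow> real) \<Rightarrow> real^'n \<Rightarrow> real" where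
  "euler z p x = cgrad p x \<bullet> (x - z)"

lemma euler_Pm: "p \<in> Pm m \<Longrightarrow> euler z p \<in> Pm m"
proof -
  assume p: "p \<in> Pm m"
  have "(\<lambda>x. \<Sum>i\<in>UNIV. pdiff i p x * (x $ i - z $ i)) \<in> Pm (m - 1 + 1)"
    by (intro Pm_sum Pm_mult Pm_pdiff p Pm_diff Pm_nth Pm_const) auto
  then show ?thesis by (simp add: euler_def[abs_def] cgrad_def inner_vec_def)
qed

lemma cgrad_add: "p \<in> Pm m \<Longrightarrow> q \<in> Pm m \<Longrightarrow> cgrad (p + q) = cgrad p + cgrad q"
  by (simp add: fun_eq_iff cgrad_def vec_eq_iff plus_fun_def pdiff_add Pm_differentiable)

lemma cgrad_scale: "p \<in> Pm m \<Longrightarrow> cgrad (c *\<^sub>R p) = c *\<^sub>R cgrad p"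
  by (simp add: fun_eq_iff cgrad_def vec_eq_iff scaleR_fun_def pdiff_cmult Pm_differentiable)

lemma cgrad_diff: "p \<in> Pm m \<Longrightarrow> q \<in> Pm m \<Longrightarrow> cgrad (\<lambda>x. p x - q x) x = cgrad p x - cgrad q x"
  by (simp add: cgrad_def vec_eq_iff pdiff_diff Pm_differentiable)

lemma (in simplex_map) transport:
  obtains c where "c > 0"
    "\<And>p q. p \<in> borel_measurable borel \<Longrightarrow> q \<in> borel_measurable borel \<Longrightarrow>
      ipT ref.T (\<lambda>x. p (F x)) (\<lambda>x. q (F x)) = c * ipT T p q"
proof -
  obtain c where c: "c > 0" and cg: "\<forall>g::real^'n \<Rightarrow> real. g \<in> borel_measurable borel \<longrightarrow>
      (\<integral>x. g (F x) \<partial>lebesgue_on ref.T) = c * (\<integral>x. g x \<partial>lebesgue_on T)"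
    using integral_F by (elim exE conjE)
  show ?thesis
  proof (rule that[OF c])
    fix p q :: "real^'n \<Rightarrow> real" assume [measurable]: "p \<in> borel_measurable borel" "q \<in> borel_measurable borel"
    show "ipT ref.T (\<lambda>x. p (F x)) (\<lambda>x. q (F x)) = c * ipT T p q"
      unfolding ipT_def by (rule cg[rule_format, of "\<lambda>x. p x * q x"]) measurable
  qed
qed

lemma (in simplex_map) Aform_transport:
  assumes "p \<in> Pm m" and c: "\<And>p q. p \<in> borel_measurable borel \<Longrightarrow> q \<in> borel_measurable borel \<Longrightarrow>
      ipT ref.T (\<lambda>x. p (F x)) (\<lambda>x. q (F x)) = c * ipT T p q"
  shows "ref.Aform 0 (\<lambda>x. p (F x)) (\<lambda>x. p (F x)) = c * Aform z p p"
proof -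
  note [measurable] = Pm_measurable[OF assms(1)]
  have "(\<lambda>x. p (rproj V z x)) \<in> borel_measurable borel" by measurable
  from c[OF this this] show ?thesis by (simp add: ref.Aform_def Aform_def rproj_F)
qed

text \<open>The orthogonal complement of lower degree polynomials is controlled on a single face: if
  \<open>e\<close> vanishes there, then \<open>e = lam * q\<close> with \<open>q\<close> of lower degree, and \<open>\<integral> lam q\<^sup>2 = \<integral> e q = 0\<close>.\<close>
lemma face_controls_complement:
  assumes dim: "CARD('n::finite) = 2 \<or> CARD('n) = 3"
  shows "\<exists>C\<ge>0. \<forall>(V::(real^'n) set) z e. nsimplex V \<longrightarrow> z \<in> V \<longrightarrow> e \<in> Pm m \<longrightarrow>
    (\<forall>w\<in>Pm (m - 1). ipT (convex hull V) e w = 0) \<longrightarrow>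
    ipT (convex hull V) e e \<le> C * nsimplex.Aform V z e e"
proof -
  define W where "W = {e \<in> Pm m. \<forall>w\<in>Pm (m - 1). ipT (ref.T :: (real^'n) set) e w = 0}"
  interpret ip: psd_form "ipT (ref.T :: (real^'n) set)" "Pm m" by (rule ref.psd_form_Pm)
  have low: "w \<in> Pm m" if "w \<in> Pm (m - 1)" for w :: "real^'n \<Rightarrow> real" using Pm_mono[OF _ that] by simp
  have subW: "subspace W"
    unfolding subspace_def W_def
    using low by (auto simp: ip.B_add ip.B_scale ip.B_zero ip.W_add ip.W_scale ip.W_zero)
  have WP: "W \<subseteq> Pm m" by (auto simp: W_def)
  obtain S where S: "finite S" "span S = W"
    using fin_dim_subset[OF fin_dim_Pm subW WP] by (auto simp: fin_dim_def)
  have null: "ipT ref.T p p = 0" if pW: "p \<in> W" and 0: "ref.Aform 0 p p = 0" for p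
  proof -
    have p: "p \<in> Pm m" using pW WP by auto
    define s :: "real^'n \<Rightarrow> real" where "s x = (\<Sum>i\<in>UNIV. x $ i)" for x
    have s: "s \<in> Pm 1" unfolding s_def[abs_def] by (intro Pm_sum Pm_nth) auto
    have ls: "lam Vref 0 x = 1 - s x" for x by (simp add: lam_ref_zero s_def)
    \<comment> \<open>Any coordinate direction will do: increasing one coordinate moves a point of
      the reference simplex, inside the simplex, to the face opposite to 0.\<close>
    obtain i :: 'n where True by auto
    obtain q where q: "q \<in> Pm (m - 1)"
      "\<And>x. p x = p (x + (1 - s x) *\<^sub>R axis i 1) + (1 - s x) * q x"
      using Pm_hyperplane_division[OF p s, of "axis i 1"] by blast
    have pq: "p x = (1 - s x) * q x" if x: "x \<in> ref.T" for x
    proof -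
      define y where "y = x + (1 - s x) *\<^sub>R axis i 1"
      have x0: "\<And>w. w \<in> Vref \<Longrightarrow> 0 \<le> lam Vref w x" using x ref.lam_nonneg by blast
      have ax: "axis j 1 \<in> (Vref :: (real^'n) set)" for j by (simp add: Basis_axis)
      have xi: "0 \<le> x $ j" for j using x0[OF ax[of j]] by (simp add: lam_ref_axis)
      have s1: "0 \<le> 1 - s x" using x0[of 0] by (simp add: ls)
      have sy: "s y = 1"
        by (simp add: s_def y_def axis_def sum.distrib if_distrib[of "\<lambda>a. _ * a"] cong: if_cong)
      have "0 \<le> lam Vref w y" if "w \<in> Vref" for w
      proof (cases "w = 0")
        case False
        then obtain j where "w = axis j 1" using \<open>w \<in> Vref\<close> by (auto simp: Basis_axis)
        then have "lam Vref w y = y $ j" by (simp only: lam_ref_axis)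
        then show ?thesis using xi[of j] s1 by (simp add: y_def axis_def)
      qed (use sy in \<open>simp add: ls\<close>)
      then have "y \<in> face Vref 0"
        unfolding ref.face_eq[OF insertI1] ref.T_eq using sy by (simp add: ls)
      then have "p y = 0" using ref.Aform_zero[OF Pm_continuous_on[OF p] _ 0] by simp
      then show ?thesis using q(2)[of x] by (simp add: y_def)
    qed
    have l0: "0 \<le> 1 - s x" if "x \<in> ref.T" for x
      using ref.lam_nonneg[OF that, of 0] by (simp add: ls)
    have "ipT ref.T p q = 0" using pW q(1) by (auto simp: W_def)
    moreover have "ipT ref.T p q = (\<integral>x. (1 - s x) * (q x)\<^sup>2 \<partial>lebesgue_on ref.T)"
      unfolding ipT_def by (rule Bochner_Integration.integral_cong)
        (auto simp: space_restrict_space pq power2_eq_square)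
    ultimately have int0: "(\<integral>x. (1 - s x) * (q x)\<^sup>2 \<partial>lebesgue_on ref.T) = 0" by simp
    have int: "integrable (lebesgue_on ref.T) (\<lambda>x. (1 - s x) * (q x)\<^sup>2)"
      unfolding power2_eq_square
      by (intro ref.L2_integrable ref.continuous_L2 continuous_intros Pm_continuous_on[OF q(1)] Pm_continuous_on[OF s])
    have "AE x in lebesgue_on ref.T. 0 \<le> (1 - s x) * (q x)\<^sup>2"
      by (rule AE_I2, rule mult_nonneg_nonneg) (use l0 in \<open>auto simp: space_restrict_space\<close>)
    then have "AE x in lebesgue_on ref.T. (1 - s x) * (q x)\<^sup>2 = 0"
      using integral_nonneg_eq_0_iff_AE[OF int] int0 by blast
    then have "AE x in lebesgue_on ref.T. p x * p x = 0"
      using AE_space by eventually_elim (auto simp: space_restrict_space pq)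
    then show ?thesis unfolding ipT_def by (rule integral_eq_zero_AE)
  qed
  have "\<exists>C\<ge>0. \<forall>p\<in>span S. ipT ref.T p p \<le> C * ref.Aform 0 p p"
    by (rule finite_dim_bound_id[OF ref.psd_form_Aform[OF insertI1] ref.psd_form_Pm S(1)])
       (use S(2) WP null in auto)
  then obtain C where C: "C \<ge> 0" "\<And>p. p \<in> W \<Longrightarrow> ipT ref.T p p \<le> C * ref.Aform 0 p p"
    using S(2) by auto
  have "ipT (convex hull V) e e \<le> C * nsimplex.Aform V z e e"
    if V: "nsimplex V" and z: "z \<in> V" and e: "e \<in> Pm m"
    and orth: "\<forall>w\<in>Pm (m - 1). ipT (convex hull V) e w = 0" for V :: "(real^'n) set" and z e
  proof -
    interpret nsimplex V by fact
    obtain B where "simplex_map V z B" using simplex_map_exists[OF z dim] by blast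
    then interpret simplex_map V z B .
    obtain c where c: "c > 0" "\<And>p q. p \<in> borel_measurable borel \<Longrightarrow> q \<in> borel_measurable borel \<Longrightarrow>
      ipT ref.T (\<lambda>x. p (F x)) (\<lambda>x. q (F x)) = c * ipT T p q" using transport by blast
    have em: "e \<in> borel_measurable borel" by (rule Pm_measurable[OF e])
    have "(\<lambda>x. e (F x)) \<in> W"
      unfolding W_def
    proof (intro CollectI conjI ballI Pm_F e)
      fix w :: "real^'n \<Rightarrow> real" assume w: "w \<in> Pm (m - 1)"
      have "ipT ref.T (\<lambda>x. e (F x)) (\<lambda>x. w (Finv (F x))) = c * ipT T e (\<lambda>x. w (Finv x))"
        by (rule c(2)[OF em Pm_measurable[OF Pm_Finv[OF w]]])
      then show "ipT ref.T (\<lambda>x. e (F x)) w = 0" using orth Pm_Finv[OF w] by (simp add: Finv_F)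
    qed
    moreover have "ref.Aform 0 (\<lambda>x. e (F x)) (\<lambda>x. e (F x)) = c * Aform z e e"
      by (rule Aform_transport[OF e c(2)])
    ultimately have "c * ipT T e e \<le> C * (c * Aform z e e)"
      using C(2) c(2)[OF em em] by metis
    then have "c * ipT T e e \<le> c * (C * Aform z e e)" by (simp add: mult_ac)
    then show ?thesis using c(1) by simp
  qed
  then show ?thesis using C(1) by blast
qed

text \<open>The discrete trace inequality in scale-free form; the customary inverse power of the
  diameter returns with \<open>fcoef\<close>.\<close>

lemma face_bounded_by_volume:
  assumes dim: "CARD('n::finite) = 2 \<or> CARD('n) = 3"
  shows "\<exists>C\<ge>0. \<forall>(V::(real^'n) set) z p. nsimplex V \<longrightarrow> z \<in> V \<longrightarrow> p \<in> Pm m \<longrightarrow>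
    nsimplex.Aform V z p p \<le> C * ipT (convex hull V) p p"
proof -
  obtain S :: "(real^'n \<Rightarrow> real) set" where S: "finite S" "span S = Pm m" using fin_dim_Pm by (auto simp: fin_dim_def)
  have "ref.Aform 0 p p = 0" if "p \<in> Pm m" "ipT ref.T p p = 0" for p :: "real^'n \<Rightarrow> real"
    using ref.Pm_zero_T[OF that] by (simp add: ref.Aform_def ipT_def)
  then have "\<exists>C\<ge>0. \<forall>p\<in>span S. ref.Aform 0 p p \<le> C * ipT ref.T p p"
    by (intro finite_dim_bound_id[OF ref.psd_form_Pm ref.psd_form_Aform[OF insertI1] S(1)]) (use S(2) in auto)
  then obtain C where C: "C \<ge> 0" "\<And>p :: real^'n \<Rightarrow> real. p \<in> Pm m \<Longrightarrow> ref.Aform 0 p p \<le> C * ipT ref.T p p"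
    using S(2) by auto
  have "nsimplex.Aform V z p p \<le> C * ipT (convex hull V) p p"
    if V: "nsimplex V" and z: "z \<in> V" and p: "p \<in> Pm m" for V :: "(real^'n) set" and z p
  proof -
    interpret nsimplex V by fact
    obtain B where "simplex_map V z B" using simplex_map_exists[OF z dim] by blast
    then interpret simplex_map V z B .
    obtain c where c: "c > 0" "\<And>p q. p \<in> borel_measurable borel \<Longrightarrow> q \<in> borel_measurable borel \<Longrightarrow>
      ipT ref.T (\<lambda>x. p (F x)) (\<lambda>x. q (F x)) = c * ipT T p q" using transport by blast
    have pm: "p \<in> borel_measurable borel" by (rule Pm_measurable[OF p])
    have "ref.Aform 0 (\<lambda>x. p (F x)) (\<lambda>x. p (F x)) = c * Aform z p p"
      by (rule Aform_transport[OF p c(2)])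
    then have "c * Aform z p p \<le> C * (c * ipT T p p)"
      using C(2)[OF Pm_F[OF p]] c(2)[OF pm pm] by simp
    then have "c * Aform z p p \<le> c * (C * ipT T p p)" by (simp add: mult_ac)
    then show ?thesis using c(1) by simp
  qed
  then show ?thesis using C(1) by blast
qed

text \<open>An inverse inequality without a power of the diameter, because the factor
  \<open>x - z\<close> compensates the derivative.\<close>

lemma euler_bounded:
  assumes dim: "CARD('n::finite) = 2 \<or> CARD('n) = 3"
  shows "\<exists>C\<ge>0. \<forall>(V::(real^'n) set) z p. nsimplex V \<longrightarrow> z \<in> V \<longrightarrow> p \<in> Pm m \<longrightarrow>
    ipT (convex hull V) (euler z p) (euler z p) \<le> C * ipT (convex hull V) p p"
proof -
  obtain S :: "(real^'n \<Rightarrow> real) set" where S: "finite S" "span S = Pm m" using fin_dim_Pm by (auto simp: fin_dim_def)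
  have N: "psd_form (\<lambda>p q. ipT (ref.T :: (real^'n) set) (euler 0 p) (euler 0 q)) (Pm m)"
  proof (rule ref.psd_form_pullback)
    show "L2 ref.T (euler 0 p)" if "p \<in> Pm m" for p :: "real^'n \<Rightarrow> real"
      by (rule ref.Pm_L2[OF euler_Pm[OF that]])
  qed (auto simp: subspace_Pm fun_eq_iff euler_def cgrad_add cgrad_scale inner_add_left)
  have "ipT ref.T (euler 0 p) (euler 0 p) = 0" if "p \<in> Pm m" "ipT ref.T p p = 0" for p :: "real^'n \<Rightarrow> real"
  proof -
    have "p = (\<lambda>x. 0)" using ref.Pm_zero_T[OF that] by (simp add: zero_fun_def)
    then show ?thesis by (simp add: euler_def[abs_def] cgrad_def inner_vec_def ipT_def)
  qed
  then have "\<exists>C\<ge>0. \<forall>p\<in>span S. ipT ref.T (euler 0 p) (euler 0 p) \<le> C * ipT ref.T p p"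
    by (intro finite_dim_bound_id[OF ref.psd_form_Pm N S(1)]) (use S(2) in auto)
  then obtain C where C: "C \<ge> 0" "\<And>p :: real^'n \<Rightarrow> real. p \<in> Pm m \<Longrightarrow> ipT ref.T (euler 0 p) (euler 0 p) \<le> C * ipT ref.T p p"
    using S(2) by auto
  have "ipT (convex hull V) (euler z p) (euler z p) \<le> C * ipT (convex hull V) p p"
    if V: "nsimplex V" and z: "z \<in> V" and p: "p \<in> Pm m" for V :: "(real^'n) set" and z p
  proof -
    interpret nsimplex V by fact
    obtain B where "simplex_map V z B" using simplex_map_exists[OF z dim] by blast
    then interpret simplex_map V z B .
    obtain c where c: "c > 0" "\<And>p q. p \<in> borel_measurable borel \<Longrightarrow> q \<in> borel_measurable borel \<Longrightarrow>
      ipT ref.T (\<lambda>x. p (F x)) (\<lambda>x. q (F x)) = c * ipT T p q" using transport by blast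
    have pm: "p \<in> borel_measurable borel" by (rule Pm_measurable[OF p])
    have em: "euler z p \<in> borel_measurable borel" by (rule Pm_measurable[OF euler_Pm[OF p]])
    have eu: "euler 0 (\<lambda>x. p (F x)) x = euler z p (F x)" for x
    proof -
      have "((\<lambda>x. p (F x)) has_derivative (\<lambda>h. cgrad p (F x) \<bullet> B h)) (at x)"
        by (rule has_derivative_compose[OF F_has_derivative has_derivative_cgrad[OF Pm_differentiable[OF p]]])
      from cgrad_inner_eq[OF this, of x] show ?thesis by (simp add: euler_def F_def)
    qed
    from C(2)[OF Pm_F[OF p]] have "c * ipT T (euler z p) (euler z p) \<le> C * (c * ipT T p p)"
      unfolding c(2)[OF pm pm] eu[abs_def] c(2)[OF em em] .
    then have "c * ipT T (euler z p) (euler z p) \<le> c * (C * ipT T p p)" by (simp add: mult_ac)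
    then show ?thesis using c(1) by simp
  qed
  then show ?thesis using C(1) by blast
qed

section \<open>Integration by parts against polynomials\<close>

lemma Pmv_subspace: "subspace (Pmv m :: (real^'n::finite \<Rightarrow> real^'n) set)"
  unfolding subspace_def
  by (auto simp: Pmv_def plus_fun_def zero_fun_def scaleR_fun_def intro: Pm_add Pm_scale Pm_zero)

lemma Pmv_nth: "\<xi> \<in> Pmv m \<Longrightarrow> (\<lambda>x. \<xi> x $ i) \<in> Pm m"
  by (simp add: Pmv_def)

lemma Pmv_inner: "\<xi> \<in> Pmv m \<Longrightarrow> (\<lambda>x. \<xi> x \<bullet> n) \<in> Pm m"
proof -
  assume \<xi>: "\<xi> \<in> Pmv m"
  have "(\<lambda>x. \<Sum>i\<in>UNIV. n $ i * \<xi> x $ i) \<in> Pm m" by (intro Pm_sum Pm_scale Pmv_nth \<xi>)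
  then show ?thesis by (simp add: inner_vec_def mult.commute)
qed

lemma pdiv_add: "\<xi> \<in> Pmv m \<Longrightarrow> \<eta> \<in> Pmv m \<Longrightarrow> pdiv (\<xi> + \<eta>) = pdiv \<xi> + pdiv \<eta>"
proof
  fix x assume "\<xi> \<in> Pmv m" "\<eta> \<in> Pmv m"
  then have "(\<lambda>x. \<xi> x $ i) differentiable (at x)" "(\<lambda>x. \<eta> x $ i) differentiable (at x)" for i
    by (auto intro: Pm_differentiable Pmv_nth)
  then show "pdiv (\<xi> + \<eta>) x = (pdiv \<xi> + pdiv \<eta>) x"
    by (simp add: pdiv_def pdiff_add sum.distrib)
qed

lemma pdiv_scale: "\<xi> \<in> Pmv m \<Longrightarrow> pdiv (c *\<^sub>R \<xi>) = c *\<^sub>R pdiv \<xi>"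
proof
  fix x assume "\<xi> \<in> Pmv m"
  then have "(\<lambda>x. \<xi> x $ i) differentiable (at x)" for i
    by (auto intro: Pm_differentiable Pmv_nth)
  then show "pdiv (c *\<^sub>R \<xi>) x = (c *\<^sub>R pdiv \<xi>) x"
    by (simp add: pdiv_def pdiff_cmult sum_distrib_left)
qed

context nsimplex
begin

lemma Pmv_L2v: "\<xi> \<in> Pmv m \<Longrightarrow> L2v T \<xi>"
  unfolding L2v_def Pmv_def using Pm_L2 by blast

lemma psd_form_Pmv: "psd_form (ipTv T) (Pmv m)"
  by (rule psd_form.psd_form_subspace[OF psd_form_ipTv Pmv_subspace]) (auto intro: Pmv_L2v)

definition fcoef :: "real^'n \<Rightarrow> real" where
  "fcoef z = real CARD('n) / height V z"

lemma fcoef_pos: "z \<in> V \<Longrightarrow> 0 < fcoef z"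
  using height_pos by (simp add: fcoef_def)

lemma fint_mult: "fint V z (\<lambda>y. f y * g y) = fcoef z * ipT T (\<lambda>x. f (rproj V z x)) (\<lambda>x. g (rproj V z x))"
  by (simp add: fint_def fcoef_def ipT_def)

lemma bip_eq: "bip V f g = (\<Sum>z\<in>V. fcoef z * ipT T (\<lambda>x. f z (rproj V z x)) (\<lambda>x. g z (rproj V z x)))"
  by (simp add: bip_def fint_mult)

lemma L2b_add: "L2b f \<Longrightarrow> L2b g \<Longrightarrow> L2b (\<lambda>z y. f z y + g z y)"
  and L2b_diff: "L2b f \<Longrightarrow> L2b g \<Longrightarrow> L2b (\<lambda>z y. f z y - g z y)"
  and L2b_scale: "L2b f \<Longrightarrow> L2b (\<lambda>z y. c * f z y)"
  and L2b_face_scale: "L2b f \<Longrightarrow> L2b (\<lambda>z y. d z * f z y)"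
  and L2b_zero: "L2b (\<lambda>z y. 0)"
  by (simp_all add: L2b_def L2_add L2_diff L2_scale L2_zero)

lemma L2b_sum: "(\<And>i. i \<in> I \<Longrightarrow> L2b (f i)) \<Longrightarrow> L2b (\<lambda>z y. \<Sum>i\<in>I. f i z y)"
  by (simp add: L2b_def L2_sum)

lemma L2b_Pm: "(\<And>z. z \<in> V \<Longrightarrow> p z \<in> Pm m) \<Longrightarrow> L2b p"
  unfolding L2b_def using Pm_rproj_L2 by blast

lemma psd_form_bip: "psd_form (bip V) {f. L2b f}"
proof
  interpret ip: psd_form "ipT T" "{f. L2 T f}" by (rule psd_form_ipT)
  show "subspace {f. L2b f}"
    by (auto simp: subspace_def plus_fun_def zero_fun_def scaleR_fun_def L2b_add L2b_zero L2b_scale)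
  fix u v w :: "real^'n \<Rightarrow> real^'n \<Rightarrow> real" and c
  show "bip V (u + v) w = bip V u w + bip V v w"
    if "u \<in> {f. L2b f}" "v \<in> {f. L2b f}" "w \<in> {f. L2b f}"
    unfolding bip_eq sum.distrib[symmetric]
  proof (rule sum.cong[OF refl])
    fix z assume z: "z \<in> V"
    let ?r = "\<lambda>f x. f z (rproj V z x)"
    have "?r (u + v) = ?r u + ?r v" by (simp add: fun_eq_iff)
    then show "fcoef z * ipT T (?r (u + v)) (?r w) = fcoef z * ipT T (?r u) (?r w) + fcoef z * ipT T (?r v) (?r w)"
      using that z ip.B_add[of "?r u" "?r v" "?r w"] by (simp add: L2b_def distrib_left)
  qed
  show "bip V (c *\<^sub>R u) w = c * bip V u w"
    by (simp add: bip_eq sum_distrib_left ipT_def mult_ac)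
  show "bip V u w = bip V w u" by (simp add: bip_eq ipT_def mult.commute)
  show "0 \<le> bip V u u" unfolding bip_eq by (intro sum_nonneg mult_nonneg_nonneg less_imp_le[OF fcoef_pos]) (auto simp: ipT_def)
qed

lemma AE_neq_vertex: "AE x in lebesgue_on T. x \<noteq> z"
proof -
  have "AE x in lebesgue. x \<notin> {z}"
    by (intro AE_not_in) (simp add: negligible_iff_null_sets[symmetric])
  then have "AE x in lebesgue. x \<in> T \<longrightarrow> x \<noteq> z" by eventually_elim simp
  then show ?thesis by (simp add: AE_restrict_space_iff)
qed

text \<open>Completeness of Lebesgue measure carries measurability over to a function that is equal
  almost everywhere.\<close>

lemma AE_eq_measurable:
  fixes f g :: "real^'n \<Rightarrow> real"
  assumes ae: "AE x in lebesgue_on T. f x = g x" and f: "f \<in> borel_measurable (lebesgue_on T)"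
  shows "g \<in> borel_measurable (lebesgue_on T)"
proof -
  have "AE x in lebesgue. x \<in> T \<longrightarrow> f x = g x" using ae by (simp add: AE_restrict_space_iff)
  then have "AE x in lebesgue. (if x \<in> T then f x else 0) = (if x \<in> T then g x else 0)"
    by eventually_elim simp
  moreover have "(\<lambda>x. if x \<in> T then f x else 0) \<in> borel_measurable lebesgue"
    using f by (simp only: borel_measurable_if[OF T_sets_lebesgue])
  ultimately have "(\<lambda>x. if x \<in> T then g x else 0) \<in> borel_measurable lebesgue"
    by (rule borel_measurable_AE[rotated])
  then show ?thesis by (simp only: borel_measurable_if[OF T_sets_lebesgue])
qed

text \<open>Functions on a face only matter on that face, although \<open>rproj\<close> maps the vertex to itself.\<close>
lemma fint_cong:
  assumes z: "z \<in> V" and eq: "\<And>y. y \<in> face V z \<Longrightarrow> f y = g y"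
  shows "fint V z f = fint V z g"
proof -
  have "AE x in lebesgue_on T. f (rproj V z x) - g (rproj V z x) = 0"
    using AE_neq_vertex[of z] AE_space
    by eventually_elim (auto simp: space_restrict_space eq rproj_face z)
  then have ae: "AE x in lebesgue_on T. f (rproj V z x) = g (rproj V z x)" by eventually_elim simp
  have ae': "AE x in lebesgue_on T. g (rproj V z x) = f (rproj V z x)" using ae by eventually_elim simp
  have "(\<integral>x. f (rproj V z x) \<partial>lebesgue_on T) = (\<integral>x. g (rproj V z x) \<partial>lebesgue_on T)"
  proof (cases "(\<lambda>x. f (rproj V z x)) \<in> borel_measurable (lebesgue_on T)")
    case True
    then show ?thesis
      using AE_eq_measurable[OF ae True] ae by (intro Bochner_Integration.integral_cong_AE)
  next
    \<comment> \<open>If one integrand is not measurable, neither is the other, and both integrals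
      take the default value 0.\<close>
    case False
    then have "(\<lambda>x. g (rproj V z x)) \<notin> borel_measurable (lebesgue_on T)"
      using AE_eq_measurable[OF ae'] by blast
    then show ?thesis using False by (metis borel_measurable_integrable not_integrable_integral_eq)
  qed
  then show ?thesis by (simp add: fint_def)
qed

lemma bip_cong:
  assumes "\<And>z y. z \<in> V \<Longrightarrow> y \<in> face V z \<Longrightarrow> f z y = f' z y"
    and "\<And>z y. z \<in> V \<Longrightarrow> y \<in> face V z \<Longrightarrow> g z y = g' z y"
  shows "bip V f g = bip V f' g'"
  unfolding bip_def using assms by (intro sum.cong refl fint_cong) auto

text \<open>All that the estimates use of a function with gradient and trace. The class contains
  Sobolev functions and polynomials and is closed under differences, hence contains
  \<open>v - E v\<close> with its trace.\<close>

definition ibp :: "(real^'n \<Rightarrow> real) \<Rightarrow> (real^'n \<Rightarrow> real^'n) \<Rightarrow> (real^'n \<Rightarrow> real^'n \<Rightarrow> real) \<Rightarrow> bool" where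
  "ibp u G g \<longleftrightarrow> L2 T u \<and> L2v T G \<and> L2b g \<and> (\<forall>i m q. q \<in> Pm m \<longrightarrow>
    ipT T u (pdiff i q) + ipT T (\<lambda>x. G x $ i) q = (\<Sum>z\<in>V. onormal V z $ i * fint V z (\<lambda>y. g z y * q y)))"

lemma ibp_H1: "H1_grad T u G \<Longrightarrow> is_trace V u g \<Longrightarrow> ibp u G g"
  unfolding ibp_def using H1_integration_by_parts[OF _ _ Pm_Cinf] is_trace_L2b
  by (auto simp: H1_grad_def L2v_def ipT_def)

lemma ibp_poly:
  assumes p: "p \<in> Pm m"
  shows "ibp p (cgrad p) (\<lambda>z. p)"
  unfolding ibp_def
proof (intro conjI allI impI)
  show "L2 T p" by (rule Pm_L2[OF p])
  show "L2v T (cgrad p)" by (rule Pmv_L2v[OF Pm_frechet[OF p]])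
  show "L2b (\<lambda>z. p)" by (rule L2b_Pm[OF p])
  fix i k and q :: "real^'n \<Rightarrow> real" assume q: "q \<in> Pm k"
  have "(\<integral>x. pdiff i (\<lambda>x. p x * q x) x \<partial>lebesgue_on T) = (\<integral>x. p x * pdiff i q x + pdiff i p x * q x \<partial>lebesgue_on T)"
    by (simp add: pdiff_mult Pm_differentiable[OF p] Pm_differentiable[OF q])
  also have "\<dots> = ipT T p (pdiff i q) + ipT T (pdiff i p) q"
    unfolding ipT_def by (intro Bochner_Integration.integral_add L2_mult_integrable Pm_L2[OF p] Pm_L2[OF q]
      Pm_L2[OF Pm_pdiff[OF p]] Pm_L2[OF Pm_pdiff[OF q]])
  finally show "ipT T p (pdiff i q) + ipT T (\<lambda>x. cgrad p x $ i) q = (\<Sum>z\<in>V. onormal V z $ i * fint V z (\<lambda>y. p y * q y))"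
    using divergence_theorem[OF Pm_Cinf[OF Pm_mult[OF p q]]] by (simp add: cgrad_def)
qed

lemma ibp_diff:
  assumes 1: "ibp u G g" and 2: "ibp u' G' g'"
  shows "ibp (\<lambda>x. u x - u' x) (\<lambda>x. G x - G' x) (\<lambda>z y. g z y - g' z y)"
  unfolding ibp_def
proof (intro conjI allI impI)
  interpret ip: psd_form "ipT T" "{f. L2 T f}" by (rule psd_form_ipT)
  show "L2 T (\<lambda>x. u x - u' x)" "L2v T (\<lambda>x. G x - G' x)" "L2b (\<lambda>z y. g z y - g' z y)"
    using 1 2 by (auto simp: ibp_def L2_diff L2v_diff L2b_diff)
  fix i k and q :: "real^'n \<Rightarrow> real" assume q: "q \<in> Pm k"
  have L: "L2 T q" "L2 T (pdiff i q)" by (rule Pm_L2[OF q], rule Pm_L2[OF Pm_pdiff[OF q]])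
  have a: "ipT T (\<lambda>x. u x - u' x) (pdiff i q) = ipT T u (pdiff i q) - ipT T u' (pdiff i q)"
    using 1 2 L ip.B_diff[of u u' "pdiff i q"] by (simp add: ibp_def fun_diff_def)
  have b: "ipT T (\<lambda>x. (G x - G' x) $ i) q = ipT T (\<lambda>x. G x $ i) q - ipT T (\<lambda>x. G' x $ i) q"
    using 1 2 L ip.B_diff[of "\<lambda>x. G x $ i" "\<lambda>x. G' x $ i" q] by (simp add: ibp_def fun_diff_def L2v_def)
  have c: "fint V z (\<lambda>y. (g z y - g' z y) * q y) = fint V z (\<lambda>y. g z y * q y) - fint V z (\<lambda>y. g' z y * q y)"
    if z: "z \<in> V" for z
    using 1 2 z Pm_rproj_L2[OF q z] ip.B_diff[of "\<lambda>x. g z (rproj V z x)" "\<lambda>x. g' z (rproj V z x)" "\<lambda>x. q (rproj V z x)"]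
    by (simp add: ibp_def fun_diff_def L2b_def fint_mult right_diff_distrib)
  have "(\<Sum>z\<in>V. onormal V z $ i * fint V z (\<lambda>y. (g z y - g' z y) * q y))
    = (\<Sum>z\<in>V. onormal V z $ i * fint V z (\<lambda>y. g z y * q y)) - (\<Sum>z\<in>V. onormal V z $ i * fint V z (\<lambda>y. g' z y * q y))"
    unfolding sum_subtractf[symmetric] by (rule sum.cong) (simp_all add: c right_diff_distrib)
  moreover have "ipT T u (pdiff i q) + ipT T (\<lambda>x. G x $ i) q = (\<Sum>z\<in>V. onormal V z $ i * fint V z (\<lambda>y. g z y * q y))"
    "ipT T u' (pdiff i q) + ipT T (\<lambda>x. G' x $ i) q = (\<Sum>z\<in>V. onormal V z $ i * fint V z (\<lambda>y. g' z y * q y))"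
    using 1 2 q unfolding ibp_def by blast+
  ultimately show "ipT T (\<lambda>x. u x - u' x) (pdiff i q) + ipT T (\<lambda>x. (G x - G' x) $ i) q
    = (\<Sum>z\<in>V. onormal V z $ i * fint V z (\<lambda>y. (g z y - g' z y) * q y))"
    unfolding a b by simp
qed

lemma ibp_vec:
  assumes i: "ibp u G g" and \<xi>: "\<xi> \<in> Pmv m"
  shows "ipT T u (pdiv \<xi>) + ipTv T G \<xi> = bip V g (\<lambda>z y. \<xi> y \<bullet> onormal V z)"
proof -
  have L: "L2 T u" "L2v T G" "L2b g" using i by (auto simp: ibp_def)
  have \<xi>i: "(\<lambda>x. \<xi> x $ i) \<in> Pm m" for i by (rule Pmv_nth[OF \<xi>])
  have 1: "ipT T u (pdiv \<xi>) = (\<Sum>i\<in>UNIV. ipT T u (pdiff i (\<lambda>x. \<xi> x $ i)))"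
    unfolding ipT_def pdiv_def sum_distrib_left
    by (intro Bochner_Integration.integral_sum L2_mult_integrable L Pm_L2[OF Pm_pdiff[OF \<xi>i]])
  have "ipT T u (pdiv \<xi>) + ipTv T G \<xi>
    = (\<Sum>i\<in>UNIV. ipT T u (pdiff i (\<lambda>x. \<xi> x $ i)) + ipT T (\<lambda>x. G x $ i) (\<lambda>x. \<xi> x $ i))"
    unfolding 1 ipTv_sum[OF L(2) Pmv_L2v[OF \<xi>]] by (simp add: sum.distrib)
  also have "\<dots> = (\<Sum>i\<in>UNIV. \<Sum>z\<in>V. onormal V z $ i * fint V z (\<lambda>y. g z y * \<xi> y $ i))"
    using i \<xi>i by (intro sum.cong refl) (auto simp: ibp_def)
  also have "\<dots> = (\<Sum>z\<in>V. \<Sum>i\<in>UNIV. onormal V z $ i * fint V z (\<lambda>y. g z y * \<xi> y $ i))"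
    by (rule sum.swap)
  also have "\<dots> = bip V g (\<lambda>z y. \<xi> y \<bullet> onormal V z)"
    unfolding bip_def
  proof (rule sum.cong[OF refl])
    fix z assume z: "z \<in> V"
    have int: "integrable (lebesgue_on T) (\<lambda>x. onormal V z $ i * (g z (rproj V z x) * \<xi> (rproj V z x) $ i))" for i
      using L(3) z by (intro integrable_mult_right L2_mult_integrable Pm_rproj_L2[OF \<xi>i]) (auto simp: L2b_def)
    have "fint V z (\<lambda>y. g z y * (\<xi> y \<bullet> onormal V z)) = fint V z (\<lambda>y. \<Sum>i\<in>UNIV. onormal V z $ i * (g z y * \<xi> y $ i))"
      by (simp add: inner_vec_def sum_distrib_left mult_ac)
    also have "\<dots> = (\<Sum>i\<in>UNIV. fint V z (\<lambda>y. onormal V z $ i * (g z y * \<xi> y $ i)))"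
      by (rule fint_sum) (rule int)
    also have "\<dots> = (\<Sum>i\<in>UNIV. onormal V z $ i * fint V z (\<lambda>y. g z y * \<xi> y $ i))"
      by (simp add: fint_def mult_ac)
    finally show "(\<Sum>i\<in>UNIV. onormal V z $ i * fint V z (\<lambda>y. g z y * \<xi> y $ i)) = fint V z (\<lambda>y. g z y * (\<xi> y \<bullet> onormal V z))" ..
  qed
  finally show ?thesis .
qed

text \<open>The condition is imposed on the whole hyperplane of each face, which keeps it algebraic
  and easy to transport by affine maps.\<close>

definition tangent :: "(real^'n \<Rightarrow> real^'n) \<Rightarrow> bool" where
  "tangent \<xi> \<longleftrightarrow> (\<forall>w\<in>V. \<forall>x. lam V w x = 0 \<longrightarrow> \<xi> x \<bullet> onormal V w = 0)"

lemma lam_add: "lam V w (x + v) = lam V w x - (v \<bullet> onormal V w) / height V w"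
  by (simp add: lam_def inner_diff_right inner_add_right inner_commute diff_divide_distrib add_divide_distrib)

text \<open>Affine maps do not preserve normals, but they preserve barycentric coordinates; this
  form survives the change of simplex.\<close>

lemma tangent_iff: "tangent \<xi> \<longleftrightarrow> (\<forall>w\<in>V. \<forall>x. lam V w x = 0 \<longrightarrow> lam V w (x + \<xi> x) = 0)"
proof -
  have "height V w \<noteq> 0" if "w \<in> V" for w using height_pos[OF that] by simp
  then show ?thesis unfolding tangent_def lam_add by auto
qed

lemma ibp_tangent:
  assumes i: "ibp u G g" and \<xi>: "\<xi> \<in> Pmv m" and t: "tangent \<xi>"
  shows "ipT T u (pdiv \<xi>) = - ipTv T G \<xi>"
proof -
  have "bip V g (\<lambda>z y. \<xi> y \<bullet> onormal V z) = bip V g (\<lambda>z y. 0)"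
    by (rule bip_cong) (use t face_eq in \<open>auto simp: tangent_def\<close>)
  also have "\<dots> = 0" by (simp add: bip_eq ipT_def)
  finally show ?thesis using ibp_vec[OF i \<xi>] by simp
qed

end

section \<open>Bounded right inverse of the divergence\<close>

text \<open>The factor \<open>x $ j\<close> keeps the right side a multiple of the same monomial,
  also for a zero exponent.\<close>

lemma pdiff_monomial: "x $ j * pdiff j (monomial \<alpha>) x = real (\<alpha> j) * monomial \<alpha> (x :: real^'n::finite)"
proof -
  define f where "f i x = x $ i ^ \<alpha> i" for i and x :: "real^'n"
  have nd: "(\<lambda>x :: real^'n. x $ i) differentiable (at x)" for i
    by (rule Pm_differentiable[OF Pm_nth[of 1]]) simp
  have pf: "pdiff j (f i) x = (real (\<alpha> i) * x $ i ^ (\<alpha> i - 1)) * (if j = i then 1 else 0)" for i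
    unfolding f_def by (subst pdiff_compose[where F = "\<lambda>s. s ^ \<alpha> i" and f = "\<lambda>x. x $ i", OF _ nd])
      (auto intro!: derivative_eq_intros)
  have "pdiff j (monomial \<alpha>) x = (\<Sum>i\<in>UNIV. pdiff j (f i) x * (\<Prod>l\<in>UNIV - {i}. f l x))"
  proof -
    have "f i differentiable (at x)" for i unfolding f_def using nd by (intro differentiable_power)
    then show ?thesis using pdiff_prod[of UNIV f x j] by (simp add: f_def)
  qed
  also have "\<dots> = (\<Sum>i\<in>UNIV. if i = j then (real (\<alpha> j) * x $ j ^ (\<alpha> j - 1)) * (\<Prod>l\<in>UNIV - {j}. f l x) else 0)"
    by (rule sum.cong) (auto simp: pf)
  also have "\<dots> = (real (\<alpha> j) * x $ j ^ (\<alpha> j - 1)) * (\<Prod>l\<in>UNIV - {j}. f l x)" by simp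
  finally have "x $ j * pdiff j (monomial \<alpha>) x = real (\<alpha> j) * (x $ j * x $ j ^ (\<alpha> j - 1)) * (\<Prod>l\<in>UNIV - {j}. f l x)"
    by simp
  also have "real (\<alpha> j) * (x $ j * x $ j ^ (\<alpha> j - 1)) = real (\<alpha> j) * f j x"
    by (cases "\<alpha> j") (auto simp: f_def)
  also have "real (\<alpha> j) * f j x * (\<Prod>l\<in>UNIV - {j}. f l x) = real (\<alpha> j) * (\<Prod>l\<in>UNIV. f l x)"
    by (simp add: prod.remove[of UNIV j])
  finally show ?thesis by (simp add: f_def)
qed

text \<open>With \<open>Z j = div (x\<^sub>j l x\<^sup>\<alpha> e\<^sub>j)\<close> and \<open>l = 1 - \<Sum> x\<^sub>j\<close> one finds
  \<open>Z j = (\<alpha>\<^sub>j + 1) l x\<^sup>\<alpha> - x\<^sub>j x\<^sup>\<alpha>\<close> and \<open>\<Sum> Z j = (|\<alpha>| + d + 1) l x\<^sup>\<alpha> - x\<^sup>\<alpha>\<close>;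
  hence \<open>x\<^sub>i x\<^sup>\<alpha>\<close> is a multiple of \<open>x\<^sup>\<alpha>\<close> up to divergences of fields tangent to the boundary.\<close>
lemma ref_divergence_decomposition:
  fixes p :: "real^'n::finite \<Rightarrow> real"
  assumes "p \<in> Pm (int m)"
  shows "\<exists>c q. (\<forall>i. q i \<in> Pm (int m - 1)) \<and>
    p = (\<lambda>x. c + (\<Sum>i\<in>UNIV. pdiff i (\<lambda>x. x $ i * lam Vref 0 x * q i x) x))"
  using assms
proof (induction rule: Pm_induct_monomial)
  case (one m)
  show ?case by (intro exI[of _ 1] exI[of _ "\<lambda>i x. 0"]) (simp add: Pm_zero)
next
  case (add m c p r)
  obtain a q b q' where p: "\<And>i. q i \<in> Pm (int m - 1)" "p = (\<lambda>x. a + (\<Sum>i\<in>UNIV. pdiff i (\<lambda>x. x $ i * lam Vref 0 x * q i x) x))"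
    and r: "\<And>i. q' i \<in> Pm (int m - 1)" "r = (\<lambda>x. b + (\<Sum>i\<in>UNIV. pdiff i (\<lambda>x. x $ i * lam Vref 0 x * q' i x) x))"
    using add(3,4) by blast
  have d: "(\<lambda>x. x $ i * lam Vref 0 x * s x) differentiable (at x)" if "s \<in> Pm n" for i n s and x :: "real^'n"
    by (rule Pm_differentiable[OF Pm_mult[OF Pm_mult[OF Pm_nth[OF order_refl] ref.lam_Pm] that]])
  have "pdiff i (\<lambda>x. x $ i * lam Vref 0 x * (c * q i x + q' i x)) x
    = c * pdiff i (\<lambda>x. x $ i * lam Vref 0 x * q i x) x + pdiff i (\<lambda>x. x $ i * lam Vref 0 x * q' i x) x" for i x
  proof -
    have "(\<lambda>x. x $ i * lam Vref 0 x * (c * q i x + q' i x))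
      = (\<lambda>x. c * (x $ i * lam Vref 0 x * q i x) + x $ i * lam Vref 0 x * q' i x)"
      by (simp add: fun_eq_iff algebra_simps)
    then show ?thesis
      using d[OF p(1)] d[OF r(1)] by (simp add: pdiff_add pdiff_cmult)
  qed
  then show ?case
    using Pm_add[OF Pm_scale[OF p(1), of c] r(1)]
    by (intro exI[of _ "c * a + b"] exI[of _ "\<lambda>i x. c * q i x + q' i x"])
       (simp add: p(2) r(2) fun_eq_iff sum.distrib sum_distrib_left algebra_simps)
next
  case (mult m i \<alpha>)
  obtain c q where q: "\<And>j. q j \<in> Pm (int m - 1)"
    and c: "monomial \<alpha> = (\<lambda>x. c + (\<Sum>j\<in>UNIV. pdiff j (\<lambda>x. x $ j * lam Vref 0 x * q j x) x))"
    using mult(2) by blast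
  define l where "l = lam Vref (0 :: real^'n)"
  have l: "l x = 1 - (\<Sum>j\<in>UNIV. x $ j)" for x by (simp add: l_def lam_ref_zero)
  have lP: "l \<in> Pm 1" unfolding l_def by (rule ref.lam_Pm)
  have aP: "monomial \<alpha> \<in> Pm (int m)" by (rule monomial_in_Pm[OF mult(1)])
  have nP: "(\<lambda>x :: real^'n. x $ j) \<in> Pm 1" for j by (rule Pm_nth) simp
  have nd: "(\<lambda>x :: real^'n. x $ j) differentiable (at x)" for j x by (rule Pm_differentiable[OF nP])
  have pl: "pdiff j l x = - 1" for j x
  proof -
    have "l = (\<lambda>x. 1 - (\<Sum>j\<in>UNIV. x $ j))" using l by auto
    then show ?thesis
      using nd by (simp add: pdiff_diff differentiable_sum pdiff_sum)
  qed
  define Z where "Z j = pdiff j (\<lambda>x. x $ j * l x * monomial \<alpha> x)" for j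
  have Z: "Z j x = (real (\<alpha> j) + 1) * (l x * monomial \<alpha> x) - x $ j * monomial \<alpha> x" for j x
  proof -
    have "Z j x = x $ j * l x * pdiff j (monomial \<alpha>) x + pdiff j (\<lambda>x. x $ j * l x) x * monomial \<alpha> x"
      unfolding Z_def by (rule pdiff_mult[OF Pm_differentiable[OF Pm_mult[OF nP lP]] Pm_differentiable[OF aP]])
    also have "pdiff j (\<lambda>x. x $ j * l x) x = - x $ j + l x"
      using pdiff_mult[OF nd Pm_differentiable[OF lP], where i = j] by (simp add: pl)
    also have "x $ j * l x * pdiff j (monomial \<alpha>) x = l x * (real (\<alpha> j) * monomial \<alpha> x)"
      by (simp add: pdiff_monomial[symmetric] mult_ac)
    finally show ?thesis by (simp add: algebra_simps)
  qed
  define N where "N = real (sum \<alpha> UNIV) + real CARD('n) + 1"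
  have N: "N > 0"
    using of_nat_0_le_iff[of "sum \<alpha> UNIV", where 'a = real] of_nat_0_le_iff[of "CARD('n)", where 'a = real]
    unfolding N_def by linarith
  have sumZ: "(\<Sum>j\<in>UNIV. Z j x) = N * (l x * monomial \<alpha> x) - monomial \<alpha> x" for x
  proof -
    have "(\<Sum>j\<in>UNIV. Z j x) = (\<Sum>j\<in>UNIV. real (\<alpha> j) + 1) * (l x * monomial \<alpha> x) - (\<Sum>j\<in>UNIV. x $ j) * monomial \<alpha> x"
      unfolding Z by (simp add: sum_subtractf sum_distrib_right)
    also have "(\<Sum>j\<in>UNIV. real (\<alpha> j) + 1) = N - 1" by (simp add: N_def sum.distrib)
    also have "(\<Sum>j\<in>UNIV. x $ j) = 1 - l x" by (simp add: l)
    finally show ?thesis by (simp add: algebra_simps)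
  qed
  \<comment> \<open>With this \<open>k\<close> the terms in \<open>l x * monomial \<alpha> x\<close>
    cancel, and \<open>x $ i * monomial \<alpha> x\<close> equals
    \<open>k * monomial \<alpha> x\<close> plus \<open>k\<close> times the sum of all
    \<open>Z j\<close>, minus \<open>Z i\<close>. The coefficients in \<open>q'\<close> are read off
    after inserting the decomposition of the monomial.\<close>
  define k where "k = (real (\<alpha> i) + 1) / N"
  define q' where "q' j x = k * q j x + (k - (if j = i then 1 else 0)) * monomial \<alpha> x" for j x
  have "q' j \<in> Pm (int m)" for j
    unfolding q'_def[abs_def] using Pm_mono[OF _ q[of j], of "int m"] by (intro Pm_add Pm_scale aP) simp
  moreover have "x $ i * monomial \<alpha> x = k * c + (\<Sum>j\<in>UNIV. pdiff j (\<lambda>x. x $ j * lam Vref 0 x * q' j x) x)" for x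
  proof -
    have pd: "pdiff j (\<lambda>x. x $ j * l x * q' j x) x
      = k * pdiff j (\<lambda>x. x $ j * l x * q j x) x + (k - (if j = i then 1 else 0)) * Z j x" for j
    proof -
      have "(\<lambda>x. x $ j * l x * q' j x)
        = (\<lambda>x. k * (x $ j * l x * q j x) + (k - (if j = i then 1 else 0)) * (x $ j * l x * monomial \<alpha> x))"
        by (simp add: fun_eq_iff q'_def algebra_simps)
      moreover have "(\<lambda>x. x $ j * l x * q j x) differentiable (at x)"
        "(\<lambda>x. x $ j * l x * monomial \<alpha> x) differentiable (at x)"
        by (rule Pm_differentiable[OF Pm_mult[OF Pm_mult[OF nP lP] q]],
            rule Pm_differentiable[OF Pm_mult[OF Pm_mult[OF nP lP] aP]])
      ultimately show ?thesis by (simp add: pdiff_add pdiff_cmult Z_def)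
    qed
    have sZ: "(\<Sum>j\<in>UNIV. (k - (if j = i then 1 else 0)) * Z j x) = k * (\<Sum>j\<in>UNIV. Z j x) - Z i x"
    proof -
      have "(\<Sum>j\<in>UNIV. (k - (if j = i then 1 else 0)) * Z j x) = (\<Sum>j\<in>UNIV. k * Z j x - (if j = i then Z i x else 0))"
        by (rule sum.cong) (auto simp: left_diff_distrib)
      then show ?thesis by (simp add: sum_subtractf sum_distrib_left)
    qed
    have "k * c + (\<Sum>j\<in>UNIV. pdiff j (\<lambda>x. x $ j * l x * q' j x) x)
      = k * (c + (\<Sum>j\<in>UNIV. pdiff j (\<lambda>x. x $ j * l x * q j x) x)) + k * (\<Sum>j\<in>UNIV. Z j x) - Z i x"
      unfolding pd sum.distrib sZ by (simp add: sum_distrib_left distrib_left)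
    also have "c + (\<Sum>j\<in>UNIV. pdiff j (\<lambda>x. x $ j * l x * q j x) x) = monomial \<alpha> x"
      using fun_cong[OF c, of x] by (simp add: l_def)
    also have "k * monomial \<alpha> x + k * (\<Sum>j\<in>UNIV. Z j x) - Z i x = k * N * (l x * monomial \<alpha> x) - Z i x"
      unfolding sumZ by (simp add: algebra_simps)
    also have "k * N = real (\<alpha> i) + 1" using N by (simp add: k_def)
    finally show ?thesis by (simp add: Z l_def[symmetric])
  qed
  ultimately show ?case by (intro exI[of _ "k * c"] exI[of _ q']) auto
qed

text \<open>The j-th component contains the factors \<open>x $ j\<close> and
  \<open>lam Vref 0 x\<close>, so the field is tangent to all faces. The divergence of a tangent
  field has mean zero, hence the constant left by the decomposition is the mean of \<open>p\<close>,
  which vanishes.\<close>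

lemma ref_bubble_field:
  fixes p :: "real^'n::finite \<Rightarrow> real"
  assumes p: "p \<in> Pm m" and mean: "ipT ref.T p (\<lambda>x. 1) = 0"
  shows "\<exists>\<xi>\<in>Pmv (m + 1). pdiv \<xi> = p \<and> ref.tangent \<xi>"
proof (cases "m < 0")
  case True
  then have "p = 0" using p by (simp add: Pm_neg)
  then show ?thesis
    by (intro bexI[of _ "\<lambda>x. 0"]) (auto simp: pdiv_def zero_fun_def ref.tangent_def Pmv_def Pm_zero)
next
  case False
  then have "p \<in> Pm (int (nat m))" using p by simp
  from ref_divergence_decomposition[OF this] obtain c q where q: "\<And>i. q i \<in> Pm (m - 1)"
    and c: "p = (\<lambda>x. c + (\<Sum>i\<in>UNIV. pdiff i (\<lambda>x. x $ i * lam Vref 0 x * q i x) x))"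
    using False by auto
  define \<xi> where "\<xi> x = (\<chi> i. x $ i * lam Vref 0 x * q i x)" for x :: "real^'n"
  have \<xi>P: "\<xi> \<in> Pmv (m + 1)"
  proof -
    have "(\<lambda>x. x $ i * lam Vref 0 x * q i x) \<in> Pm (1 + 1 + (m - 1))" for i
      by (intro Pm_mult Pm_nth ref.lam_Pm q) simp
    then show ?thesis by (simp add: Pmv_def \<xi>_def add.commute)
  qed
  have pd: "p x = c + pdiv \<xi> x" for x by (simp add: c pdiv_def \<xi>_def)
  have t: "ref.tangent \<xi>"
    unfolding ref.tangent_iff
  proof (intro ballI allI impI)
    fix w x :: "real^'n" assume w: "w \<in> Vref" and l: "lam Vref w x = 0"
    show "lam Vref w (x + \<xi> x) = 0"
    proof (cases "w = 0")
      case True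
      then have "lam Vref 0 x = 0" using l by simp
      then have "\<xi> x = 0" by (simp add: \<xi>_def vec_eq_iff)
      then show ?thesis using l by simp
    next
      case False
      then obtain j where j: "w = axis j 1" using w by (auto simp: Basis_axis)
      then show ?thesis using l unfolding j lam_ref_axis by (simp add: \<xi>_def)
    qed
  qed
  have "ipT ref.T (\<lambda>x. 1) (pdiv \<xi>) = - ipTv ref.T (cgrad (\<lambda>x. 1)) \<xi>"
    by (rule ref.ibp_tangent[OF ref.ibp_poly[OF Pm_const[of 0 1]] \<xi>P t]) simp
  also have "\<dots> = 0" by (simp add: cgrad_def ipTv_def inner_vec_def)
  finally have 0: "(\<integral>x. pdiv \<xi> x \<partial>lebesgue_on ref.T) = 0" by (simp add: ipT_def)
  have "(\<integral>x. c + pdiv \<xi> x \<partial>lebesgue_on ref.T) = (\<integral>x. c \<partial>lebesgue_on (ref.T :: (real^'n) set)) + (\<integral>x. pdiv \<xi> x \<partial>lebesgue_on ref.T)"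
    by (intro Bochner_Integration.integral_add ref.L2_integrable ref.Pm_L2[OF pdiv_Pm[OF \<xi>P]] ref.continuous_L2 continuous_on_const)
  also have "\<dots> = c * measure lebesgue (ref.T :: (real^'n) set)"
    using 0 by (simp add: measure_restrict_space)
  finally have "c * measure lebesgue (ref.T :: (real^'n) set) = 0"
    using mean by (simp add: ipT_def pd)
  then have "c = 0" using ref.measure_T_pos[where 'n = 'n] by simp
  then show ?thesis using \<xi>P t pd by (intro bexI[of _ \<xi>]) auto
qed

text \<open>The field is not unique, so its norm is bounded by choosing a partner in the linear
  relation between \<open>p\<close> and the tangent fields with divergence \<open>p\<close>.\<close>

lemma ref_bounded_bubble_field:
  "\<exists>C\<ge>0. \<forall>p :: real^'n::finite \<Rightarrow> real. p \<in> Pm m \<longrightarrow> ipT ref.T p (\<lambda>x. 1) = 0 \<longrightarrow>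
    (\<exists>\<xi>\<in>Pmv (m + 1). pdiv \<xi> = p \<and> ref.tangent \<xi> \<and> ipTv ref.T \<xi> \<xi> \<le> C * ipT ref.T p p)"
proof -
  interpret ip: psd_form "ipT (ref.T :: (real^'n) set)" "{f. L2 ref.T f}" by (rule psd_form_ipT)
  have one: "L2 (ref.T :: (real^'n) set) (\<lambda>x. 1)" by (rule ref.continuous_L2) (rule continuous_on_const)
  define W where "W = {p :: real^'n \<Rightarrow> real. p \<in> Pm m \<and> ipT ref.T p (\<lambda>x. 1) = 0}"
  have subW: "subspace W"
    unfolding W_def subspace_def
    using one ip.B_zero(1)[of "\<lambda>x. 1"]
    by (auto simp: ip.B_add ip.B_scale ref.Pm_L2 subspace_add[OF subspace_Pm] subspace_scale[OF subspace_Pm] subspace_0[OF subspace_Pm])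
  obtain S where S: "finite S" "span S = W"
    using fin_dim_subset[OF fin_dim_Pm[of m] subW] by (auto simp: fin_dim_def W_def)
  define K where "K = {(p, \<xi>). p \<in> Pm m \<and> \<xi> \<in> Pmv (m + 1) \<and> pdiv \<xi> = p \<and> ref.tangent (\<xi> :: real^'n \<Rightarrow> real^'n)}"
  have subK: "subspace K"
    unfolding subspace_def K_def
  proof (intro conjI ballI allI)
    show "0 \<in> {(p, \<xi>). p \<in> Pm m \<and> \<xi> \<in> Pmv (m + 1) \<and> pdiv \<xi> = p \<and> ref.tangent (\<xi> :: real^'n \<Rightarrow> real^'n)}"
      by (auto simp: zero_prod_def subspace_0[OF subspace_Pm] subspace_0[OF Pmv_subspace] pdiv_def fun_eq_iff ref.tangent_def)
  next
    fix a b assume "a \<in> {(p, \<xi>). p \<in> Pm m \<and> \<xi> \<in> Pmv (m + 1) \<and> pdiv \<xi> = p \<and> ref.tangent (\<xi> :: real^'n \<Rightarrow> real^'n)}"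
      "b \<in> {(p, \<xi>). p \<in> Pm m \<and> \<xi> \<in> Pmv (m + 1) \<and> pdiv \<xi> = p \<and> ref.tangent (\<xi> :: real^'n \<Rightarrow> real^'n)}"
    then show "a + b \<in> {(p, \<xi>). p \<in> Pm m \<and> \<xi> \<in> Pmv (m + 1) \<and> pdiv \<xi> = p \<and> ref.tangent (\<xi> :: real^'n \<Rightarrow> real^'n)}"
      by (auto simp: subspace_add[OF subspace_Pm] subspace_add[OF Pmv_subspace] pdiv_add ref.tangent_def inner_add_left)
  next
    fix c a assume "a \<in> {(p, \<xi>). p \<in> Pm m \<and> \<xi> \<in> Pmv (m + 1) \<and> pdiv \<xi> = p \<and> ref.tangent (\<xi> :: real^'n \<Rightarrow> real^'n)}"
    then show "c *\<^sub>R a \<in> {(p, \<xi>). p \<in> Pm m \<and> \<xi> \<in> Pmv (m + 1) \<and> pdiv \<xi> = p \<and> ref.tangent (\<xi> :: real^'n \<Rightarrow> real^'n)}"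
      by (auto simp: subspace_scale[OF subspace_Pm] subspace_scale[OF Pmv_subspace] pdiv_scale ref.tangent_def)
  qed
  have ex: "\<exists>\<xi>. (p, \<xi>) \<in> K \<and> (ipT ref.T p p = 0 \<longrightarrow> ipTv ref.T \<xi> \<xi> = 0)" if "p \<in> span S" for p
  proof (cases "ipT ref.T p p = 0")
    case True
    have pm: "p \<in> Pm m" using that S(2) by (simp add: W_def)
    have "p = 0" by (rule ref.Pm_zero_T[OF pm True])
    then have "(p, 0) \<in> K" using subspace_0[OF subK] by (simp add: zero_prod_def)
    then show ?thesis by (intro exI[of _ 0]) (simp add: ipTv_def)
  next
    case False
    then show ?thesis using ref_bubble_field[of p m] that S(2) by (auto simp: W_def K_def)
  qed
  have "\<exists>C\<ge>0. \<forall>p\<in>span S. \<exists>\<xi>. (p, \<xi>) \<in> K \<and> ipTv ref.T \<xi> \<xi> \<le> C * ipT ref.T p p"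
    by (rule finite_dim_bound[OF ref.psd_form_Pm ref.psd_form_Pmv S(1) _ subK _ ex])
       (use S(2) in \<open>auto simp: W_def K_def\<close>)
  then obtain C where C: "C \<ge> 0" "\<And>p. p \<in> W \<Longrightarrow> \<exists>\<xi>. (p, \<xi>) \<in> K \<and> ipTv ref.T \<xi> \<xi> \<le> C * ipT ref.T p p"
    using S(2) by auto
  show ?thesis
  proof (intro exI[of _ C] conjI C(1) allI impI)
    fix p :: "real^'n \<Rightarrow> real" assume "p \<in> Pm m" "ipT ref.T p (\<lambda>x. 1) = 0"
    then have "p \<in> W" by (simp add: W_def)
    from C(2)[OF this] show "\<exists>\<xi>\<in>Pmv (m + 1). pdiv \<xi> = p \<and> ref.tangent \<xi> \<and> ipTv ref.T \<xi> \<xi> \<le> C * ipT ref.T p p"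
      by (auto simp: K_def)
  qed
qed

text \<open>The Piola map without its determinant factor. The transformed Jacobian is conjugate to
  the original one by \<open>B\<close>, so its trace, the divergence, is preserved
  pointwise.\<close>

lemma (in simplex_map) piola_transform:
  assumes \<xi>: "\<xi> \<in> Pmv m"
  shows "(\<lambda>x. B (\<xi> (Finv x))) \<in> Pmv m" "pdiv (\<lambda>x. B (\<xi> (Finv x))) x = pdiv \<xi> (Finv x)"
proof -
  have comp: "L v $ i = (\<Sum>j\<in>UNIV. L (axis j 1) $ i * v $ j)" if L: "linear L" for L :: "real^'n \<Rightarrow> real^'n" and v i
  proof -
    have "L v = L (\<Sum>j\<in>UNIV. v $ j *\<^sub>R axis j 1)" by (simp add: vec_basis_sum)
    then show ?thesis by (simp add: linear_sum[OF L] linear_scale[OF L] mult.commute)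
  qed
  have \<xi>j: "(\<lambda>x. \<xi> (Finv x) $ j) \<in> Pm m" for j by (rule Pm_Finv[OF Pmv_nth[OF \<xi>]])
  have "(\<lambda>x. \<Sum>j\<in>UNIV. B (axis j 1) $ i * \<xi> (Finv x) $ j) \<in> Pm m" for i
    by (intro Pm_sum Pm_scale \<xi>j)
  then show "(\<lambda>x. B (\<xi> (Finv x))) \<in> Pmv m"
    unfolding Pmv_def by (simp only: comp[OF linB, of "\<xi> (Finv _)"] mem_Collect_eq) blast
  have Fd: "(Finv has_derivative A) (at x)" for x
  proof -
    have Ad: "(A has_derivative A) (at x)" by (rule linear_imp_has_derivative[OF linA])
    have "((\<lambda>x. A x - A z) has_derivative (\<lambda>h. A h - 0)) (at x)"
      by (rule has_derivative_diff[OF Ad has_derivative_const])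
    moreover have "Finv = (\<lambda>x. A x - A z)" by (rule ext) (simp only: Finv_def linear_diff[OF linA])
    ultimately show ?thesis by simp
  qed
  have pj: "pdiff i (\<lambda>x. \<xi> (Finv x) $ j) x = (\<Sum>k\<in>UNIV. A (axis i 1) $ k * pdiff k (\<lambda>x. \<xi> x $ j) (Finv x))" for i j
  proof -
    have "((\<lambda>x. \<xi> (Finv x) $ j) has_derivative (\<lambda>h. cgrad (\<lambda>x. \<xi> x $ j) (Finv x) \<bullet> A h)) (at x)"
      by (rule has_derivative_compose[OF Fd has_derivative_cgrad[OF Pm_differentiable[OF Pmv_nth[OF \<xi>]]]])
    then show ?thesis by (simp add: pdiff_eq inner_vec_def cgrad_def mult.commute)
  qed
  have BA: "(\<Sum>i\<in>UNIV. B (axis j 1) $ i * A (axis i 1) $ k) = (if k = j then 1 else 0)" for j k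
    using comp[OF linA, of "B (axis j 1)" k] by (simp add: AB axis_def mult.commute)
  have "pdiv (\<lambda>x. B (\<xi> (Finv x))) x = (\<Sum>i\<in>UNIV. pdiff i (\<lambda>x. \<Sum>j\<in>UNIV. B (axis j 1) $ i * \<xi> (Finv x) $ j) x)"
    unfolding pdiv_def by (simp only: comp[OF linB, of "\<xi> (Finv _)"])
  also have "\<dots> = (\<Sum>i\<in>UNIV. \<Sum>j\<in>UNIV. B (axis j 1) $ i * (\<Sum>k\<in>UNIV. A (axis i 1) $ k * pdiff k (\<lambda>x. \<xi> x $ j) (Finv x)))"
    by (intro sum.cong refl, subst pdiff_sum[OF Pm_differentiable[OF Pm_scale[OF \<xi>j]]])
      (simp only: pdiff_cmult[OF Pm_differentiable[OF \<xi>j]] pj)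
  also have "\<dots> = (\<Sum>i\<in>UNIV. \<Sum>j\<in>UNIV. \<Sum>k\<in>UNIV. (B (axis j 1) $ i * A (axis i 1) $ k) * pdiff k (\<lambda>x. \<xi> x $ j) (Finv x))"
    by (simp add: sum_distrib_left mult.assoc)
  also have "\<dots> = (\<Sum>j\<in>UNIV. \<Sum>i\<in>UNIV. \<Sum>k\<in>UNIV. (B (axis j 1) $ i * A (axis i 1) $ k) * pdiff k (\<lambda>x. \<xi> x $ j) (Finv x))"
    by (rule sum.swap)
  also have "\<dots> = (\<Sum>j\<in>UNIV. \<Sum>k\<in>UNIV. \<Sum>i\<in>UNIV. (B (axis j 1) $ i * A (axis i 1) $ k) * pdiff k (\<lambda>x. \<xi> x $ j) (Finv x))"
    by (intro sum.cong refl sum.swap)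
  also have "\<dots> = (\<Sum>j\<in>UNIV. \<Sum>k\<in>UNIV. (if k = j then 1 else 0) * pdiff k (\<lambda>x. \<xi> x $ j) (Finv x))"
    by (simp only: sum_distrib_right[symmetric] BA)
  also have "\<dots> = (\<Sum>j\<in>UNIV. \<Sum>k\<in>UNIV. if k = j then pdiff j (\<lambda>x. \<xi> x $ j) (Finv x) else 0)"
    by (intro sum.cong refl) auto
  also have "\<dots> = pdiv \<xi> (Finv x)" by (simp add: pdiv_def)
  finally show "pdiv (\<lambda>x. B (\<xi> (Finv x))) x = pdiv \<xi> (Finv x)" .
qed

text \<open>The squared diameter comes from applying \<open>B\<close> to the reference field; it is
  the scaling of a Poincare inequality.\<close>

lemma bounded_bubble_field:
  assumes dim: "CARD('n::finite) = 2 \<or> CARD('n) = 3"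
  shows "\<exists>C\<ge>0. \<forall>(V::(real^'n) set) p. nsimplex V \<longrightarrow> p \<in> Pm m \<longrightarrow> ipT (convex hull V) p (\<lambda>x. 1) = 0 \<longrightarrow>
    (\<exists>\<xi>\<in>Pmv (m + 1). pdiv \<xi> = p \<and> nsimplex.tangent V \<xi> \<and>
      ipTv (convex hull V) \<xi> \<xi> \<le> C * (diameter (convex hull V))\<^sup>2 * ipT (convex hull V) p p)"
proof -
  obtain C where C: "C \<ge> 0" "\<forall>p :: real^'n \<Rightarrow> real. p \<in> Pm m \<longrightarrow> ipT ref.T p (\<lambda>x. 1) = 0 \<longrightarrow>
    (\<exists>\<xi>\<in>Pmv (m + 1). pdiv \<xi> = p \<and> ref.tangent \<xi> \<and> ipTv ref.T \<xi> \<xi> \<le> C * ipT ref.T p p)"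
    using ref_bounded_bubble_field[where 'n = 'n and m = m] by (elim exE conjE)
  define d where "d = real CARD('n)"
  have "\<exists>\<xi>\<in>Pmv (m + 1). pdiv \<xi> = p \<and> nsimplex.tangent V \<xi> \<and>
      ipTv (convex hull V) \<xi> \<xi> \<le> (d\<^sup>2 * C) * (diameter (convex hull V))\<^sup>2 * ipT (convex hull V) p p"
    if V: "nsimplex V" and p: "p \<in> Pm m" and mean: "ipT (convex hull V) p (\<lambda>x. 1) = 0" for V :: "(real^'n) set" and p
  proof -
    interpret nsimplex V by fact
    obtain z where z: "z \<in> V" using V_nontrivial by blast
    obtain B where "simplex_map V z B" using simplex_map_exists[OF z dim] by blast
    then interpret simplex_map V z B .
    obtain c where c: "c > 0" and cg: "\<forall>g::real^'n \<Rightarrow> real. g \<in> borel_measurable borel \<longrightarrow>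
      (\<integral>x. g (F x) \<partial>lebesgue_on ref.T) = c * (\<integral>x. g x \<partial>lebesgue_on T)"
      using integral_F by (elim exE conjE)
    define h where "h = diameter T"
    have pm: "p \<in> borel_measurable borel" by (rule Pm_measurable[OF p])
    have "ipT ref.T (\<lambda>x. p (F x)) (\<lambda>x. 1) = 0"
      using cg[rule_format, OF pm] mean by (simp add: ipT_def)
    from C(2)[rule_format, OF Pm_F[OF p] this] obtain \<xi> where \<xi>: "\<xi> \<in> Pmv (m + 1)" "pdiv \<xi> = (\<lambda>x. p (F x))" "ref.tangent \<xi>"
      "ipTv ref.T \<xi> \<xi> \<le> C * ipT ref.T (\<lambda>x. p (F x)) (\<lambda>x. p (F x))" by blast
    define \<eta> where "\<eta> x = B (\<xi> (Finv x))" for x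
    have \<eta>P: "\<eta> \<in> Pmv (m + 1)" unfolding \<eta>_def[abs_def] by (rule piola_transform(1)[OF \<xi>(1)])
    have div: "pdiv \<eta> = p"
      using piola_transform(2)[OF \<xi>(1)] by (auto simp: \<eta>_def[abs_def] \<xi>(2) F_Finv)
    have tan: "tangent \<eta>"
      unfolding tangent_iff
    proof (intro ballI allI impI)
      fix w x assume "w \<in> V" and l: "lam V w x = 0"
      then obtain v where v: "v \<in> Vref" "w = F v" using V_eq by blast
      define y where "y = Finv x"
      have x: "x = F y" by (simp add: y_def F_Finv)
      have "x + \<eta> x = F (y + \<xi> y)"
        by (simp add: \<eta>_def y_def[symmetric]) (simp add: x F_def linear_add[OF linB])
      moreover have "lam Vref v (y + \<xi> y) = 0"
        using \<xi>(3) v(1) l unfolding ref.tangent_iff v(2) x lam_F[OF v(1)] by blast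
      ultimately show "lam V w (x + \<eta> x) = 0" by (simp only: v(2) lam_F[OF v(1)])
    qed
    have pp: "ipT ref.T (\<lambda>x. p (F x)) (\<lambda>x. p (F x)) = c * ipT T p p"
      unfolding ipT_def using cg[rule_format, of "\<lambda>x. p x * p x"] pm by simp
    have im: "(\<lambda>x. \<eta> x \<bullet> \<eta> x) \<in> borel_measurable borel"
      unfolding inner_vec_def
      by (intro borel_measurable_sum borel_measurable_times Pm_measurable[OF Pmv_nth[OF \<eta>P]] | simp)+
    have "c * ipTv T \<eta> \<eta> = (\<integral>x. \<eta> (F x) \<bullet> \<eta> (F x) \<partial>lebesgue_on ref.T)"
      unfolding ipTv_def using cg[rule_format, OF im] by simp
    also have "\<dots> \<le> (\<integral>x. (d * h)\<^sup>2 * (\<xi> x \<bullet> \<xi> x) \<partial>lebesgue_on ref.T)"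
    proof (rule integral_mono)
      have "(\<lambda>x. \<eta> (F x)) \<in> Pmv (m + 1)"
        using Pm_F[OF Pmv_nth[OF \<eta>P]] by (simp add: Pmv_def)
      then show "integrable (lebesgue_on ref.T) (\<lambda>x. \<eta> (F x) \<bullet> \<eta> (F x))"
        by (intro L2v_inner_integrable ref.Pmv_L2v)
      show "integrable (lebesgue_on ref.T) (\<lambda>x. (d * h)\<^sup>2 * (\<xi> x \<bullet> \<xi> x))"
        by (intro integrable_mult_right L2v_inner_integrable ref.Pmv_L2v[OF \<xi>(1)])
      fix x
      have "norm (\<eta> (F x)) \<le> d * h * norm (\<xi> x)"
        using norm_B_le[of "\<xi> x"] by (simp add: \<eta>_def Finv_F d_def h_def)
      from power_mono[OF this, of 2] show "\<eta> (F x) \<bullet> \<eta> (F x) \<le> (d * h)\<^sup>2 * (\<xi> x \<bullet> \<xi> x)"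
        by (simp add: power_mult_distrib power2_norm_eq_inner)
    qed
    also have "\<dots> = (d * h)\<^sup>2 * ipTv ref.T \<xi> \<xi>" by (simp add: ipTv_def)
    also have "\<dots> \<le> (d * h)\<^sup>2 * (C * (c * ipT T p p))"
      using \<xi>(4) unfolding pp by (intro mult_left_mono) auto
    finally have "c * ipTv T \<eta> \<eta> \<le> c * ((d\<^sup>2 * C) * h\<^sup>2 * ipT T p p)" by (simp add: power_mult_distrib mult_ac)
    then have "ipTv T \<eta> \<eta> \<le> (d\<^sup>2 * C) * h\<^sup>2 * ipT T p p" using c by simp
    then show ?thesis using \<eta>P div tan by (auto simp: h_def)
  qed
  moreover have "0 \<le> d\<^sup>2 * C" using C(1) by simp
  ultimately show ?thesis by blast
qed

section \<open>Projections\<close>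

text \<open>Vector-valued and facewise polynomials are finite sums of linear images of scalar
  polynomials, so no bases for them have to be exhibited.\<close>

lemma fin_dim_linear_images:
  assumes "subspace Q" "finite I" "\<And>i. i \<in> I \<Longrightarrow> linear (L i)" "fin_dim P"
    and dec: "\<And>q. q \<in> Q \<Longrightarrow> \<exists>p. (\<forall>i\<in>I. p i \<in> P) \<and> q = (\<Sum>i\<in>I. L i (p i))"
  shows "fin_dim Q"
proof -
  obtain S where S: "finite S" "span S = P" using assms(4) by (auto simp: fin_dim_def)
  define M where "M = (\<Union>i\<in>I. L i ` S)"
  have "finite M" unfolding M_def using assms(2) S(1) by auto
  then have M: "fin_dim (span M)" by (auto simp: fin_dim_def)
  have "L i p \<in> span M" if "i \<in> I" "p \<in> P" for i p
  proof -
    have "L i p \<in> span (L i ` S)"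
      using that S(2) linear_span_image[OF assms(3)[OF that(1)], of S] by auto
    moreover have "span (L i ` S) \<subseteq> span M" unfolding M_def using that(1) by (intro span_mono) auto
    ultimately show ?thesis by blast
  qed
  then have "(\<Sum>i\<in>I. L i (p i)) \<in> span M" if "\<forall>i\<in>I. p i \<in> P" for p
    using that by (intro span_sum) blast
  then have "Q \<subseteq> span M" using dec by blast
  then show ?thesis by (rule fin_dim_subset[OF M assms(1)])
qed

lemma fin_dim_Pmv: "fin_dim (Pmv m :: (real^'n::finite \<Rightarrow> real^'n) set)"
proof (rule fin_dim_linear_images[OF Pmv_subspace finite, where L = "\<lambda>i p x. axis i (p x)" and P = "Pm m" and I = "UNIV :: 'n set"])
  show "linear (\<lambda>p (x :: real^'n). axis i (p x) :: real^'n)" for i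
    by (rule linearI) (auto simp: fun_eq_iff axis_def vec_eq_iff)
  show "fin_dim (Pm m :: (real^'n \<Rightarrow> real) set)" by (rule fin_dim_Pm)
  fix \<xi> :: "real^'n \<Rightarrow> real^'n" assume \<xi>: "\<xi> \<in> Pmv m"
  have "\<xi> = (\<Sum>i\<in>UNIV. (\<lambda>x. axis i (\<xi> x $ i)))"
    by (simp add: fun_eq_iff vec_eq_iff sum_fun_apply sum_component axis_def if_distrib cong: if_cong)
  then show "\<exists>p. (\<forall>i\<in>UNIV. p i \<in> Pm m) \<and> \<xi> = (\<Sum>i\<in>UNIV. (\<lambda>x. axis i (p i x)))"
    using Pmv_nth[OF \<xi>] by (intro exI[of _ "\<lambda>i x. \<xi> x $ i"]) simp
qed

context nsimplex
begin

lemma PiT_in: "L2 T u \<Longrightarrow> PiT V m u \<in> Pm m"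
  and PiT_eq: "L2 T u \<Longrightarrow> q \<in> Pm m \<Longrightarrow> ipT T (PiT V m u) q = ipT T u q"
  and PiT_unique: "L2 T u \<Longrightarrow> p \<in> Pm m \<Longrightarrow> (\<And>q. q \<in> Pm m \<Longrightarrow> ipT T p q = ipT T u q) \<Longrightarrow> PiT V m u = p"
proof -
  interpret ip: psd_form "ipT T" "{f. L2 T f}" by (rule psd_form_ipT)
  have sub: "Pm m \<subseteq> {f. L2 T f}" by (auto intro: Pm_L2)
  have u': "u \<in> {f. L2 T f}" if "L2 T u" using that by simp
  show "L2 T u \<Longrightarrow> PiT V m u \<in> Pm m"
    unfolding PiT_def by (rule ip.orth_proj_in[OF fin_dim_Pm sub u' Pm_zero_T])
  show "L2 T u \<Longrightarrow> q \<in> Pm m \<Longrightarrow> ipT T (PiT V m u) q = ipT T u q"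
    unfolding PiT_def by (rule ip.orth_proj_eq[OF fin_dim_Pm sub u' Pm_zero_T])
  show "L2 T u \<Longrightarrow> p \<in> Pm m \<Longrightarrow> (\<And>q. q \<in> Pm m \<Longrightarrow> ipT T p q = ipT T u q) \<Longrightarrow> PiT V m u = p"
    unfolding PiT_def by (rule ip.orth_proj_unique[OF fin_dim_Pm sub u' Pm_zero_T])
qed

lemma Pmv_zero_T:
  assumes "\<xi> \<in> Pmv m" "ipTv T \<xi> \<xi> = 0"
  shows "\<xi> = 0"
proof -
  have "(\<Sum>i\<in>UNIV. ipT T (\<lambda>x. \<xi> x $ i) (\<lambda>x. \<xi> x $ i)) = 0"
    using assms ipTv_sum[OF Pmv_L2v[OF assms(1)] Pmv_L2v[OF assms(1)]] by simp
  then have "ipT T (\<lambda>x. \<xi> x $ i) (\<lambda>x. \<xi> x $ i) = 0" for i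
    by (subst (asm) sum_nonneg_eq_0_iff) (auto simp: ipT_def)
  from Pm_zero_T[OF Pmv_nth[OF assms(1)] this] have "(\<lambda>x. \<xi> x $ i) = 0" for i .
  then show ?thesis by (simp add: fun_eq_iff vec_eq_iff)
qed

lemma PiTv_in: "L2v T u \<Longrightarrow> PiTv V m u \<in> Pmv m"
  and PiTv_eq: "L2v T u \<Longrightarrow> q \<in> Pmv m \<Longrightarrow> ipTv T (PiTv V m u) q = ipTv T u q"
proof -
  interpret ip: psd_form "ipTv T" "{f. L2v T f}" by (rule psd_form_ipTv)
  have sub: "Pmv m \<subseteq> {f. L2v T f}" by (auto intro: Pmv_L2v)
  have u': "u \<in> {f. L2v T f}" if "L2v T u" using that by simp
  show "L2v T u \<Longrightarrow> PiTv V m u \<in> Pmv m"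
    unfolding PiTv_def by (rule ip.orth_proj_in[OF fin_dim_Pmv sub u' Pmv_zero_T])
  show "L2v T u \<Longrightarrow> q \<in> Pmv m \<Longrightarrow> ipTv T (PiTv V m u) q = ipTv T u q"
    unfolding PiTv_def by (rule ip.orth_proj_eq[OF fin_dim_Pmv sub u' Pmv_zero_T])
qed

lemma L2b_cong:
  assumes f: "L2b f" and eq: "\<And>z y. z \<in> V \<Longrightarrow> y \<in> face V z \<Longrightarrow> f z y = g z y"
  shows "L2b g"
  unfolding L2b_def
proof
  fix z assume z: "z \<in> V"
  have ae: "AE x in lebesgue_on T. f z (rproj V z x) = g z (rproj V z x)"
    using AE_neq_vertex[of z] AE_space
    by eventually_elim (auto simp: space_restrict_space eq rproj_face z)
  have fz: "L2 T (\<lambda>x. f z (rproj V z x))" using f z by (simp add: L2b_def)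
  have gm: "(\<lambda>x. g z (rproj V z x)) \<in> borel_measurable (lebesgue_on T)"
    by (rule AE_eq_measurable[OF ae L2_measurable[OF fz]])
  have "integrable (lebesgue_on T) (\<lambda>x. (g z (rproj V z x))\<^sup>2)"
  proof (rule integrable_cong_AE_imp)
    show "integrable (lebesgue_on T) (\<lambda>x. (f z (rproj V z x))\<^sup>2)" using fz by (simp add: L2_iff)
    show "AE x in lebesgue_on T. (f z (rproj V z x))\<^sup>2 = (g z (rproj V z x))\<^sup>2" using ae by eventually_elim simp
    show "(\<lambda>x. (g z (rproj V z x))\<^sup>2) \<in> borel_measurable (lebesgue_on T)" by (rule borel_measurable_power[OF gm])
  qed
  then show "L2 T (\<lambda>x. g z (rproj V z x))" using gm by (simp add: L2_iff)
qed

lemma Pface_poly: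
  assumes "\<mu> \<in> Pface V m"
  shows "\<exists>p. (\<forall>z\<in>V. p z \<in> Pm m) \<and> (\<forall>z\<in>V. \<forall>y\<in>face V z. \<mu> z y = p z y)"
proof -
  have "\<forall>z\<in>V. \<exists>p. p \<in> Pm m \<and> (\<forall>y\<in>face V z. \<mu> z y = p y)" using assms by (auto simp: Pface_def)
  then show ?thesis by (drule_tac bchoice) auto
qed

lemma canon_canon: "canon V (canon V f) = canon V f"
  by (simp add: canon_def fun_eq_iff)

lemma canon_Pface: "(\<And>z. z \<in> V \<Longrightarrow> p z \<in> Pm m) \<Longrightarrow> canon V p \<in> Pface V m"
  unfolding Pface_def by (auto simp: canon_canon) (auto simp: canon_def)

lemma canon_face: "z \<in> V \<Longrightarrow> y \<in> face V z \<Longrightarrow> canon V f z y = f z y"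
  by (simp add: canon_def)

lemma Pface_L2b: "\<mu> \<in> Pface V m \<Longrightarrow> L2b \<mu>"
  using Pface_poly[of \<mu> m] L2b_cong[OF L2b_Pm] by metis

lemma subspace_Pface: "subspace (Pface V m)"
  unfolding subspace_def
proof (intro conjI ballI allI)
  show "0 \<in> Pface V m"
    by (auto simp: Pface_def canon_def fun_eq_iff intro!: bexI[of _ "\<lambda>x. 0"] Pm_zero)
  fix f g assume f: "f \<in> Pface V m" and g: "g \<in> Pface V m"
  obtain p q where p: "\<forall>z\<in>V. p z \<in> Pm m" "\<forall>z\<in>V. \<forall>y\<in>face V z. f z y = p z y"
    and q: "\<forall>z\<in>V. q z \<in> Pm m" "\<forall>z\<in>V. \<forall>y\<in>face V z. g z y = q z y"
    using Pface_poly[OF f] Pface_poly[OF g] by blast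
  have cf: "canon V f = f" "canon V g = g" using f g by (auto simp: Pface_def)
  have "f + g = canon V (\<lambda>z y. p z y + q z y)"
    using p(2) q(2) by (subst cf(1)[symmetric], subst cf(2)[symmetric]) (auto simp: canon_def fun_eq_iff)
  then show "f + g \<in> Pface V m" using p(1) q(1) by (simp add: canon_Pface Pm_add)
next
  fix c f assume f: "f \<in> Pface V m"
  obtain p where p: "\<forall>z\<in>V. p z \<in> Pm m" "\<forall>z\<in>V. \<forall>y\<in>face V z. f z y = p z y"
    using Pface_poly[OF f] by blast
  have cf: "canon V f = f" using f by (auto simp: Pface_def)
  have "c *\<^sub>R f = canon V (\<lambda>z y. c * p z y)"
    using p(2) by (subst cf(1)[symmetric]) (auto simp: canon_def fun_eq_iff)
  then show "c *\<^sub>R f \<in> Pface V m" using p(1) by (simp add: canon_Pface Pm_scale)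
qed

lemma fin_dim_Pface: "fin_dim (Pface V m)"
proof (rule fin_dim_linear_images[OF subspace_Pface finite_V, where L = "\<lambda>w p. canon V (\<lambda>z y. if z = w then p y else 0)" and P = "Pm m"])
  show "linear (\<lambda>p. canon V (\<lambda>z y. if z = w then p y else (0::real)))" for w
    by (rule linearI) (auto simp: canon_def fun_eq_iff)
  show "fin_dim (Pm m :: (real^'n \<Rightarrow> real) set)" by (rule fin_dim_Pm)
  fix \<mu> assume \<mu>: "\<mu> \<in> Pface V m"
  obtain p where p: "\<forall>z\<in>V. p z \<in> Pm m" "\<forall>z\<in>V. \<forall>y\<in>face V z. \<mu> z y = p z y"
    using Pface_poly[OF \<mu>] by blast
  have c: "canon V \<mu> = \<mu>" using \<mu> by (auto simp: Pface_def)
  have "\<mu> z y = (\<Sum>w\<in>V. canon V (\<lambda>z y. if z = w then p w y else 0)) z y" for z y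
  proof (cases "z \<in> V \<and> y \<in> face V z")
    case True
    then show ?thesis using p(2) by (simp add: sum_fun_apply canon_def)
  next
    case False
    then have "\<mu> z y = 0" using c by (metis canon_def)
    moreover have "(\<Sum>w\<in>V. canon V (\<lambda>z y. if z = w then p w y else 0)) z y = 0"
      using False unfolding sum_fun_apply by (intro sum.neutral) (auto simp: canon_def)
    ultimately show ?thesis by simp
  qed
  then show "\<exists>p. (\<forall>i\<in>V. p i \<in> Pm m) \<and> \<mu> = (\<Sum>w\<in>V. canon V (\<lambda>z y. if z = w then p w y else 0))"
    using p(1) by (intro exI[of _ p]) (simp add: fun_eq_iff)
qed

text \<open>\<open>bip\<close> sees only the values on the faces. The form is definite because
  \<open>canon\<close> fixes all other values to be zero.\<close>

lemma Pface_zero: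
  assumes \<mu>: "\<mu> \<in> Pface V m" and 0: "bip V \<mu> \<mu> = 0"
  shows "\<mu> = 0"
proof -
  obtain p where p: "\<forall>z\<in>V. p z \<in> Pm m" "\<forall>z\<in>V. \<forall>y\<in>face V z. \<mu> z y = p z y"
    using Pface_poly[OF \<mu>] by blast
  have "bip V p p = 0" using 0 bip_cong[of \<mu> p \<mu> p] p(2) by simp
  then have "(\<Sum>z\<in>V. fcoef z * Aform z (p z) (p z)) = 0" by (simp add: bip_eq Aform_def)
  then have "\<forall>z\<in>V. fcoef z * Aform z (p z) (p z) = 0"
    by (subst (asm) sum_nonneg_eq_0_iff)
      (auto simp: Aform_def ipT_def intro!: mult_nonneg_nonneg less_imp_le[OF fcoef_pos])
  then have A: "Aform z (p z) (p z) = 0" if "z \<in> V" for z using that fcoef_pos[OF that] by fastforce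
  have "\<mu> z y = 0" for z y
  proof (cases "z \<in> V \<and> y \<in> face V z")
    case True
    then show ?thesis using Aform_zero[OF Pm_continuous_on _ A] p by metis
  next
    case False
    have "canon V \<mu> = \<mu>" using \<mu> by (auto simp: Pface_def)
    then show ?thesis using False by (metis canon_def)
  qed
  then show ?thesis by (simp add: fun_eq_iff)
qed

lemma PidT_in: "L2b g \<Longrightarrow> PidT V m g \<in> Pface V m"
  and PidT_eq: "L2b g \<Longrightarrow> \<mu> \<in> Pface V m \<Longrightarrow> bip V (PidT V m g) \<mu> = bip V g \<mu>"
proof -
  interpret ip: psd_form "bip V" "{f. L2b f}" by (rule psd_form_bip)
  have sub: "Pface V m \<subseteq> {f. L2b f}" by (auto intro: Pface_L2b)
  have u': "g \<in> {f. L2b f}" if "L2b g" using that by simp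
  show "L2b g \<Longrightarrow> PidT V m g \<in> Pface V m"
    unfolding PidT_def by (rule ip.orth_proj_in[OF fin_dim_Pface sub u' Pface_zero])
  show "L2b g \<Longrightarrow> \<mu> \<in> Pface V m \<Longrightarrow> bip V (PidT V m g) \<mu> = bip V g \<mu>"
    unfolding PidT_def by (rule ip.orth_proj_eq[OF fin_dim_Pface sub u' Pface_zero])
qed

lemma bip_add: "L2b f \<Longrightarrow> L2b g \<Longrightarrow> L2b \<mu> \<Longrightarrow> bip V (\<lambda>z y. f z y + g z y) \<mu> = bip V f \<mu> + bip V g \<mu>"
  and bip_diff: "L2b f \<Longrightarrow> L2b g \<Longrightarrow> L2b \<mu> \<Longrightarrow> bip V (\<lambda>z y. f z y - g z y) \<mu> = bip V f \<mu> - bip V g \<mu>"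
proof -
  interpret ip: psd_form "bip V" "{f. L2b f}" by (rule psd_form_bip)
  show "L2b f \<Longrightarrow> L2b g \<Longrightarrow> L2b \<mu> \<Longrightarrow> bip V (\<lambda>z y. f z y + g z y) \<mu> = bip V f \<mu> + bip V g \<mu>"
    using ip.B_add[of f g \<mu>] by (simp add: plus_fun_def)
  show "L2b f \<Longrightarrow> L2b g \<Longrightarrow> L2b \<mu> \<Longrightarrow> bip V (\<lambda>z y. f z y - g z y) \<mu> = bip V f \<mu> - bip V g \<mu>"
    using ip.B_diff[of f g \<mu>] by (simp add: fun_diff_def)
qed

lemma bip_sym: "bip V f g = bip V g f"
  by (simp add: bip_def mult.commute)

lemma ipT_add: "L2 T f \<Longrightarrow> L2 T g \<Longrightarrow> L2 T q \<Longrightarrow> ipT T (\<lambda>x. f x + g x) q = ipT T f q + ipT T g q"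
  and ipT_diff: "L2 T f \<Longrightarrow> L2 T g \<Longrightarrow> L2 T q \<Longrightarrow> ipT T (\<lambda>x. f x - g x) q = ipT T f q - ipT T g q"
proof -
  interpret ip: psd_form "ipT T" "{f. L2 T f}" by (rule psd_form_ipT)
  show "L2 T f \<Longrightarrow> L2 T g \<Longrightarrow> L2 T q \<Longrightarrow> ipT T (\<lambda>x. f x + g x) q = ipT T f q + ipT T g q"
    using ip.B_add[of f g q] by (simp add: plus_fun_def)
  show "L2 T f \<Longrightarrow> L2 T g \<Longrightarrow> L2 T q \<Longrightarrow> ipT T (\<lambda>x. f x - g x) q = ipT T f q - ipT T g q"
    using ip.B_diff[of f g q] by (simp add: fun_diff_def)
qed

lemma ipT_sym: "ipT T f g = ipT T g f"
  by (simp add: ipT_def mult.commute)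

lemma ipTv_sym: "ipTv T f g = ipTv T g f"
  by (simp add: ipTv_def inner_commute)

lemma ipTv_diff: "L2v T f \<Longrightarrow> L2v T g \<Longrightarrow> L2v T q \<Longrightarrow> ipTv T (\<lambda>x. f x - g x) q = ipTv T f q - ipTv T g q"
proof -
  interpret ip: psd_form "ipTv T" "{f. L2v T f}" by (rule psd_form_ipTv)
  show "L2v T f \<Longrightarrow> L2v T g \<Longrightarrow> L2v T q \<Longrightarrow> ipTv T (\<lambda>x. f x - g x) q = ipTv T f q - ipTv T g q"
    using ip.B_diff[of f g q] by (simp add: fun_diff_def)
qed

lemma ipT_CS: "L2 T f \<Longrightarrow> L2 T g \<Longrightarrow> \<bar>ipT T f g\<bar> \<le> normT T f * normT T g"
  unfolding normT_def by (rule psd_form.Cauchy_Schwarz[OF psd_form_ipT]) auto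

lemma ipTv_CS: "L2v T f \<Longrightarrow> L2v T g \<Longrightarrow> \<bar>ipTv T f g\<bar> \<le> normTv T f * normTv T g"
  unfolding normTv_def by (rule psd_form.Cauchy_Schwarz[OF psd_form_ipTv]) auto

lemma bip_CS: "L2b f \<Longrightarrow> L2b g \<Longrightarrow> \<bar>bip V f g\<bar> \<le> bnorm V f * bnorm V g"
  unfolding bnorm_def by (rule psd_form.Cauchy_Schwarz[OF psd_form_bip]) auto

lemma norm_nonneg: "0 \<le> normT T f" "0 \<le> normTv T f'" "L2b g \<Longrightarrow> 0 \<le> bnorm V g"
  and norm_sq: "(normT T f)\<^sup>2 = ipT T f f" "(normTv T f')\<^sup>2 = ipTv T f' f'" "L2b g \<Longrightarrow> (bnorm V g)\<^sup>2 = bip V g g"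
proof -
  have 1: "0 \<le> ipT T f f" "0 \<le> ipTv T f' f'" by (auto simp: ipT_def ipTv_def)
  have 2: "0 \<le> bip V g g" if "L2b g" using psd_form.B_nonneg[OF psd_form_bip, of g] that by simp
  show "0 \<le> normT T f" "0 \<le> normTv T f'" "L2b g \<Longrightarrow> 0 \<le> bnorm V g"
    "(normT T f)\<^sup>2 = ipT T f f" "(normTv T f')\<^sup>2 = ipTv T f' f'" "L2b g \<Longrightarrow> (bnorm V g)\<^sup>2 = bip V g g"
    using 1 2 by (auto simp: normT_def normTv_def bnorm_def)
qed

lemma normT_triangle: "L2 T f \<Longrightarrow> L2 T g \<Longrightarrow> normT T (\<lambda>x. f x + g x) \<le> normT T f + normT T g"
  using psd_form.norm_triangle[OF psd_form_ipT, of f T g] by (simp add: normT_def plus_fun_def)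

lemma sq_le_mult_imp_le: "0 \<le> x \<Longrightarrow> 0 \<le> c \<Longrightarrow> x\<^sup>2 \<le> c * x \<Longrightarrow> x \<le> (c::real)"
  by (cases "x = 0") (auto simp: power2_eq_square)

lemma L2_const: "L2 T (\<lambda>x. c)"
  by (rule continuous_L2) (rule continuous_on_const)

lemma ipT_const_1: "ipT T (\<lambda>x. c) (\<lambda>x. 1) = c * measure lebesgue T"
  by (simp add: ipT_def measure_restrict_space)

lemma L2b_const_face: "p \<in> Pm m \<Longrightarrow> L2b (\<lambda>z. p)"
  by (rule L2b_Pm)

lemma L2b_normal: "\<xi> \<in> Pmv m \<Longrightarrow> L2b (\<lambda>z y. \<xi> y \<bullet> onormal V z)"
  by (rule L2b_Pm[of "\<lambda>z y. \<xi> y \<bullet> onormal V z"]) (rule Pmv_inner)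

lemma normal_canon_Pface: "\<xi> \<in> Pmv m \<Longrightarrow> canon V (\<lambda>z y. \<xi> y \<bullet> onormal V z) \<in> Pface V m"
  by (rule canon_Pface) (rule Pmv_inner)

lemma bip_canon: "bip V f (canon V g) = bip V f g" "bip V (canon V f) g = bip V f g"
  by (rule bip_cong; simp add: canon_face)+

end

section \<open>Discrete estimates on a shape-regular simplex\<close>

text \<open>The affinely invariant inequalities enter with named constants. Every constant
  \<open>K\<close> built from them then depends on these numbers and on the dimension, never on
  \<open>V\<close>.\<close>

locale regular_simplex = nsimplex V for V :: "(real^'n::finite) set" +
  fixes k :: nat and \<kappa> c1 c2 c5 c7 :: real
  assumes nonneg: "0 \<le> \<kappa>" "0 \<le> c1" "0 \<le> c2" "0 \<le> c5" "0 \<le> c7"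
    and regular: "\<And>z. z \<in> V \<Longrightarrow> diameter T \<le> \<kappa> * height V z"
    and complement_le: "\<And>e z. e \<in> Pm (int k) \<Longrightarrow> z \<in> V \<Longrightarrow> (\<And>w. w \<in> Pm (int k - 1) \<Longrightarrow> ipT T e w = 0) \<Longrightarrow>
      ipT T e e \<le> c1 * Aform z e e"
    and trace_le: "\<And>p z. p \<in> Pm (int k + 1) \<Longrightarrow> z \<in> V \<Longrightarrow> Aform z p p \<le> c2 * ipT T p p"
    and euler_le: "\<And>p z. p \<in> Pm (int k) \<Longrightarrow> z \<in> V \<Longrightarrow> ipT T (euler z p) (euler z p) \<le> c5 * ipT T p p"
    and bubble: "\<And>p. p \<in> Pm (int k + 1) \<Longrightarrow> ipT T p (\<lambda>x. 1) = 0 \<Longrightarrow>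
      \<exists>\<xi>\<in>Pmv (int k + 1 + 1). pdiv \<xi> = p \<and> tangent \<xi> \<and> ipTv T \<xi> \<xi> \<le> c7 * (diameter T)\<^sup>2 * ipT T p p"
begin

definition h where "h = diameter T"
text \<open>The number of faces times the trace constant of one face; \<open>\<kappa>\<close> trades
  its inverse height for the inverse diameter.\<close>

definition K2 where "K2 = (real CARD('n) + 1) * (real CARD('n) * \<kappa> * c2)"

lemma h_pos: "0 < h"
  by (simp add: h_def diameter_pos)

lemma K2_nonneg: "0 \<le> K2"
  using nonneg by (simp add: K2_def)

lemma fint_sq: "fint V z (\<lambda>y. p y * p y) = fcoef z * Aform z p p"
  by (simp add: fint_mult Aform_def)

lemma Aform_nonneg: "0 \<le> Aform z p p"
  by (simp add: Aform_def ipT_def)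

lemma fint_sq_nonneg: "z \<in> V \<Longrightarrow> 0 \<le> fint V z (\<lambda>y. f y * f y)"
  using fcoef_pos[of z] by (simp add: fint_mult ipT_def)

lemma Aform_le_fint: "z \<in> V \<Longrightarrow> Aform z p p \<le> h * fint V z (\<lambda>y. p y * p y)"
proof -
  assume z: "z \<in> V"
  have H: "0 < height V z" "height V z \<le> h" using height_pos[OF z] height_le_diameter[OF z] by (auto simp: h_def)
  have "height V z \<le> h * real CARD('n)"
    using H h_pos mult_left_mono[of 1 "real CARD('n)" h] zero_less_card_finite[where 'a='n] by linarith
  then have "1 \<le> h * fcoef z" using H by (simp add: fcoef_def field_simps)
  from mult_right_mono[OF this Aform_nonneg[of z p]] show ?thesis by (simp add: fint_sq mult_ac)
qed

lemma complement_face_le: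
  assumes "e \<in> Pm (int k)" "z \<in> V" "\<And>w. w \<in> Pm (int k - 1) \<Longrightarrow> ipT T e w = 0"
  shows "ipT T e e \<le> c1 * h * fint V z (\<lambda>y. e y * e y)"
proof -
  have "ipT T e e \<le> c1 * Aform z e e" by (rule complement_le[OF assms])
  also have "\<dots> \<le> c1 * (h * fint V z (\<lambda>y. e y * e y))"
    by (intro mult_left_mono Aform_le_fint assms nonneg)
  finally show ?thesis by (simp add: mult.assoc)
qed

lemma fint_sq_le:
  assumes p: "p \<in> Pm (int k + 1)" and z: "z \<in> V"
  shows "fint V z (\<lambda>y. p y * p y) \<le> real CARD('n) * \<kappa> * c2 / h * ipT T p p"
proof -
  have H: "0 < height V z" by (rule height_pos[OF z])
  have "h \<le> \<kappa> * height V z" using regular[OF z] by (simp add: h_def)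
  then have "1 / height V z \<le> \<kappa> / h" using H h_pos by (simp add: field_simps)
  then have "fcoef z \<le> real CARD('n) * \<kappa> / h"
    using mult_left_mono[of "1 / height V z" "\<kappa> / h" "real CARD('n)"] by (simp add: fcoef_def)
  then have "fcoef z * Aform z p p \<le> real CARD('n) * \<kappa> / h * (c2 * ipT T p p)"
    using trace_le[OF p z] fcoef_pos[OF z] nonneg h_pos by (intro mult_mono) (auto simp: Aform_nonneg)
  then show ?thesis by (simp add: fint_sq)
qed

lemma bip_face_le:
  assumes "\<And>z. z \<in> V \<Longrightarrow> fint V z (\<lambda>y. f z y * f z y) \<le> real CARD('n) * \<kappa> * c2 / h * r"
  shows "bip V f f \<le> K2 / h * r"
proof -
  have "bip V f f \<le> (\<Sum>z\<in>V. real CARD('n) * \<kappa> * c2 / h * r)"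
    unfolding bip_def by (rule sum_mono) (rule assms)
  also have "\<dots> = K2 / h * r" using cardV by (simp add: K2_def algebra_simps)
  finally show ?thesis .
qed

lemma sqrt_K2: "sqrt (K2 / h * r\<^sup>2) = sqrt K2 / sqrt h * \<bar>r\<bar>"
  by (simp add: real_sqrt_mult real_sqrt_divide)

lemma bnorm_poly_le:
  assumes p: "p \<in> Pm (int k + 1)"
  shows "bnorm V (\<lambda>z. p) \<le> sqrt K2 / sqrt h * normT T p"
proof -
  have "bip V (\<lambda>z. p) (\<lambda>z. p) \<le> K2 / h * (normT T p)\<^sup>2"
    unfolding norm_sq by (rule bip_face_le) (rule fint_sq_le[OF p])
  then show ?thesis unfolding bnorm_def using real_sqrt_le_mono sqrt_K2[of "normT T p"] norm_nonneg(1)[of p] by fastforce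
qed

lemma bnorm_normal_le:
  assumes \<xi>: "\<xi> \<in> Pmv (int k + 1)"
  shows "bnorm V (\<lambda>z y. \<xi> y \<bullet> onormal V z) \<le> sqrt K2 / sqrt h * normTv T \<xi>"
proof -
  have "bip V (\<lambda>z y. \<xi> y \<bullet> onormal V z) (\<lambda>z y. \<xi> y \<bullet> onormal V z) \<le> K2 / h * (normTv T \<xi>)\<^sup>2"
    unfolding norm_sq
  proof (rule bip_face_le)
    fix z assume z: "z \<in> V"
    define p where "p x = \<xi> x \<bullet> onormal V z" for x
    have p: "p \<in> Pm (int k + 1)" unfolding p_def[abs_def] by (rule Pmv_inner[OF \<xi>])
    have "ipT T p p \<le> ipTv T \<xi> \<xi>"
      unfolding ipT_def ipTv_def
    proof (rule integral_mono)
      show "integrable (lebesgue_on T) (\<lambda>x. p x * p x)" by (intro L2_mult_integrable Pm_L2[OF p])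
      show "integrable (lebesgue_on T) (\<lambda>x. \<xi> x \<bullet> \<xi> x)" by (intro L2v_inner_integrable Pmv_L2v[OF \<xi>])
      fix x
      have "\<bar>p x\<bar> \<le> norm (\<xi> x)" using Cauchy_Schwarz_ineq2[of "\<xi> x" "onormal V z"] norm_onormal[OF z] by (simp add: p_def)
      from power_mono[OF this, of 2] show "p x * p x \<le> \<xi> x \<bullet> \<xi> x"
        by (simp add: power2_eq_square[symmetric] power2_norm_eq_inner)
    qed
    then have "real CARD('n) * \<kappa> * c2 / h * ipT T p p \<le> real CARD('n) * \<kappa> * c2 / h * ipTv T \<xi> \<xi>"
      using nonneg h_pos by (intro mult_left_mono) auto
    then show "fint V z (\<lambda>y. (\<xi> y \<bullet> onormal V z) * (\<xi> y \<bullet> onormal V z)) \<le> real CARD('n) * \<kappa> * c2 / h * ipTv T \<xi> \<xi>"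
      using fint_sq_le[OF p z] by (simp add: p_def)
  qed
  then show ?thesis unfolding bnorm_def using real_sqrt_le_mono sqrt_K2[of "normTv T \<xi>"] norm_nonneg(2)[of \<xi>] by fastforce
qed

text \<open>A mean-zero polynomial is the divergence of a bubble field, so integration by parts suffices.\<close>
lemma moment_Poincare:
  assumes i: "ibp u G g" and mean: "ipT T u (\<lambda>x. 1) = 0" and p: "p \<in> Pm (int k + 1)"
  shows "\<bar>ipT T u p\<bar> \<le> sqrt c7 * h * normTv T G * normT T p"
proof -
  define m where "m = measure lebesgue T"
  have m: "m > 0" using measure_T_pos by (simp add: m_def)
  define a where "a = ipT T p (\<lambda>x. 1) / m"
  have am: "ipT T p (\<lambda>x. 1) = a * m" using m by (simp add: a_def)
  \<comment> \<open>Since \<open>u\<close> has mean zero, subtracting the mean of \<open>p\<close>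
    does not change the moment, and it does not increase the norm of \<open>p\<close>.\<close>
  define p0 where "p0 = (\<lambda>x. p x - a)"
  have p0: "p0 \<in> Pm (int k + 1)" unfolding p0_def by (intro Pm_diff p Pm_const) simp
  have u: "L2 T u" "L2v T G" using i by (auto simp: ibp_def)
  have pa: "ipT T (\<lambda>x. a) f = a * ipT T f (\<lambda>x. 1)" for f by (simp add: ipT_def)
  have p01: "ipT T p0 (\<lambda>x. 1) = 0"
    unfolding p0_def using ipT_diff[OF Pm_L2[OF p] L2_const[of a] L2_const[of 1]] by (simp add: am ipT_const_1 m_def)
  have "ipT T p0 p0 = ipT T p p0 - a * ipT T p0 (\<lambda>x. 1)"
    using ipT_diff[OF Pm_L2[OF p] L2_const[of a] Pm_L2[OF p0]] pa[of p0] by (simp add: p0_def[symmetric])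
  also have "ipT T p p0 = ipT T p p - a * (a * m)"
    using ipT_diff[OF Pm_L2[OF p] L2_const[of a] Pm_L2[OF p]] pa[of p] ipT_sym[of p p0]
    by (simp add: p0_def[symmetric] am)
  finally have "ipT T p0 p0 = ipT T p p - m * (a * a)" using p01 by simp
  then have pp: "ipT T p0 p0 \<le> ipT T p p" using m by simp
  have up: "ipT T u p0 = ipT T u p"
    using ipT_diff[OF Pm_L2[OF p] L2_const[of a] u(1)] pa[of u] mean ipT_sym[of u p] ipT_sym[of u p0] ipT_sym[of u "\<lambda>x. 1"] by (simp add: p0_def[symmetric])
  obtain \<xi> where \<xi>: "\<xi> \<in> Pmv (int k + 1 + 1)" "pdiv \<xi> = p0" "tangent \<xi>" "ipTv T \<xi> \<xi> \<le> c7 * (diameter T)\<^sup>2 * ipT T p0 p0"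
    using bubble[OF p0 p01] by blast
  have "ipTv T \<xi> \<xi> \<le> c7 * h\<^sup>2 * ipT T p p"
    using \<xi>(4) mult_left_mono[OF pp, of "c7 * h\<^sup>2"] nonneg by (simp add: h_def)
  then have n\<xi>: "normTv T \<xi> \<le> sqrt c7 * h * normT T p"
    using real_sqrt_le_mono[of "ipTv T \<xi> \<xi>" "c7 * h\<^sup>2 * ipT T p p"] h_pos
    by (simp add: normTv_def normT_def real_sqrt_mult)
  have "\<bar>ipT T u p\<bar> = \<bar>ipTv T G \<xi>\<bar>" using ibp_tangent[OF i \<xi>(1,3)] up \<xi>(2) by simp
  also have "\<dots> \<le> normTv T G * normTv T \<xi>" by (rule ipTv_CS[OF u(2) Pmv_L2v[OF \<xi>(1)]])
  also have "\<dots> \<le> normTv T G * (sqrt c7 * h * normT T p)"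
    by (intro mult_left_mono n\<xi> norm_nonneg)
  finally show ?thesis by (simp add: mult_ac)
qed

lemma Poincare_poly:
  assumes p: "p \<in> Pm (int k + 1)" and mean: "ipT T p (\<lambda>x. 1) = 0"
  shows "normT T p \<le> sqrt c7 * h * normTv T (cgrad p)"
proof -
  have "(normT T p)\<^sup>2 \<le> (sqrt c7 * h * normTv T (cgrad p)) * normT T p"
    using moment_Poincare[OF ibp_poly[OF p] mean p] unfolding norm_sq by simp
  then show ?thesis
    by (rule sq_le_mult_imp_le[rotated 2])
      (intro mult_nonneg_nonneg norm_nonneg real_sqrt_ge_zero nonneg less_imp_le[OF h_pos])+
qed

text \<open>The projection is tested with itself, so that only a polynomial moment of
  \<open>u\<close> occurs.\<close>

lemma PiT_Poincare:
  assumes i: "ibp u G g" and mean: "ipT T u (\<lambda>x. 1) = 0" and m: "m \<le> int k + 1"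
  shows "normT T (PiT V m u) \<le> sqrt c7 * h * normTv T G"
proof -
  have u: "L2 T u" using i by (auto simp: ibp_def)
  define w where "w = PiT V m u"
  have w: "w \<in> Pm m" unfolding w_def by (rule PiT_in[OF u])
  have "(normT T w)\<^sup>2 = ipT T u w" unfolding norm_sq using PiT_eq[OF u w] by (simp add: w_def)
  also have "\<dots> \<le> (sqrt c7 * h * normTv T G) * normT T w"
    using moment_Poincare[OF i mean Pm_mono[OF m w]] by simp
  finally have "normT T w \<le> sqrt c7 * h * normTv T G"
    by (rule sq_le_mult_imp_le[rotated 2])
      (intro mult_nonneg_nonneg norm_nonneg real_sqrt_ge_zero nonneg less_imp_le[OF h_pos])+
  then show ?thesis by (simp add: w_def)
qed

text \<open>Adding \<open>lam * q\<close> leaves the values on the face unchanged, and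
  \<open>q\<close> is chosen from a lower degree problem with weight \<open>lam\<close>, which is
  positive in the interior. The extension meets the hypothesis of \<open>complement_face_le\<close>,
  so its cell norm is controlled by the face norm of \<open>p\<close>.\<close>

lemma orthogonal_extension:
  assumes p: "p \<in> Pm (int k)" and z: "z \<in> V"
  shows "\<exists>p'\<in>Pm (int k). (\<forall>y. lam V z y = 0 \<longrightarrow> p' y = p y) \<and> (\<forall>w\<in>Pm (int k - 1). ipT T p' w = 0)"
proof -
  define l where "l = lam V z"
  have l: "l \<in> Pm 1" unfolding l_def by (rule lam_Pm)
  have l01: "0 \<le> l x" "l x \<le> 1" if "x \<in> T" for x
    using lam_nonneg[OF that z] lam_le_1[OF that z] by (auto simp: l_def)
  define Q where "Q a b = ipT T (\<lambda>x. l x * a x) b" for a b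
  have LL: "L2 T (\<lambda>x. l x * a x)" "L2 T a" if "a \<in> Pm (int k - 1)" for a
    using Pm_L2[OF Pm_mult[OF l that]] Pm_L2[OF that] by auto
  have Qq: "psd_form Q (Pm (int k - 1))"
  proof
    show "subspace (Pm (int k - 1) :: (real^'n \<Rightarrow> real) set)" by (rule subspace_Pm)
    fix u v w :: "real^'n \<Rightarrow> real" and c
    show "Q (u + v) w = Q u w + Q v w" if "u \<in> Pm (int k - 1)" "v \<in> Pm (int k - 1)" "w \<in> Pm (int k - 1)"
      using ipT_add[OF LL(1)[OF that(1)] LL(1)[OF that(2)] LL(2)[OF that(3)]] by (simp add: Q_def distrib_left)
    show "Q (c *\<^sub>R u) w = c * Q u w" by (simp add: Q_def ipT_def mult_ac)
    show "Q u w = Q w u" by (simp add: Q_def ipT_def mult_ac)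
    show "0 \<le> Q u u"
      unfolding Q_def ipT_def
      by (rule Bochner_Integration.integral_nonneg) (use l01 in \<open>auto simp: space_restrict_space mult.assoc\<close>)
  qed
  have definite: "a = 0" if a: "a \<in> Pm (int k - 1)" and 0: "Q a a = 0" for a
  proof -
    \<comment> \<open>As \<open>l\<close> takes values between 0 and 1,
      \<open>l\<^sup>2 \<le> l\<close>; a null vector of the weighted form therefore satisfies
      \<open>l * a = 0\<close>.\<close>
    have "ipT T (\<lambda>x. l x * a x) (\<lambda>x. l x * a x) \<le> Q a a"
      unfolding Q_def ipT_def
    proof (rule integral_mono)
      show "integrable (lebesgue_on T) (\<lambda>x. l x * a x * (l x * a x))" by (intro L2_mult_integrable LL a)
      show "integrable (lebesgue_on T) (\<lambda>x. l x * a x * a x)" by (intro L2_mult_integrable LL a)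
      fix x assume "x \<in> space (lebesgue_on T)"
      then have x: "x \<in> T" by (simp add: space_restrict_space)
      have "l x * (l x * (a x)\<^sup>2) \<le> 1 * (l x * (a x)\<^sup>2)" using l01[OF x] by (intro mult_right_mono) auto
      then show "l x * a x * (l x * a x) \<le> l x * a x * a x" by (simp add: power2_eq_square mult_ac)
    qed
    then have "ipT T (\<lambda>x. l x * a x) (\<lambda>x. l x * a x) = 0"
      using 0 by (auto simp: ipT_def intro!: antisym)
    from Pm_zero_T[OF Pm_mult[OF l a] this] have "l x * a x = 0" for x by (simp add: fun_eq_iff)
    then have "a x = 0" if "x \<in> interior T" for x
    proof -
      have "0 < l x" using that z by (auto simp: interior_T l_def)
      then show ?thesis using \<open>l x * a x = 0\<close> by simp
    qed
    then show ?thesis using interior_nonempty by (intro Pm_identity[OF a, of "interior T"]) auto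
  qed
  obtain S where S: "finite S" "span S = (Pm (int k - 1) :: (real^'n \<Rightarrow> real) set)" using fin_dim_Pm by (auto simp: fin_dim_def)
  interpret Q: psd_form Q "Pm (int k - 1)" by (rule Qq)
  have "\<exists>q\<in>span S. \<forall>b\<in>span S. Q q b = - ipT T p b"
  proof (rule Q.riesz_span[OF S(1)])
    show "span S \<subseteq> Pm (int k - 1)" using S(2) by simp
    show "- ipT T p (u + v) = - ipT T p u + - ipT T p v" if "u \<in> span S" "v \<in> span S" for u v
      using that ipT_add[OF LL(2) LL(2) Pm_L2[OF p], of u v] unfolding S(2)
      by (simp add: ipT_sym[of p] plus_fun_def)
    show "- ipT T p (c *\<^sub>R u) = c * - ipT T p u" for c u by (simp add: ipT_def mult_ac)
    show "- ipT T p u = 0" if "u \<in> span S" "Q u u = 0" for u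
      using definite[of u] that S(2) by (simp add: ipT_def)
  qed
  then obtain q where q: "q \<in> Pm (int k - 1)" "\<And>b. b \<in> Pm (int k - 1) \<Longrightarrow> Q q b = - ipT T p b"
    using S(2) by auto
  define p' where "p' x = p x + l x * q x" for x
  have "p' \<in> Pm (int k)"
    unfolding p'_def[abs_def] using Pm_mult[OF l q(1)] by (intro Pm_add p) simp
  moreover have "p' y = p y" if "lam V z y = 0" for y using that by (simp add: p'_def l_def)
  moreover have "ipT T p' w = 0" if w: "w \<in> Pm (int k - 1)" for w
    using ipT_add[OF Pm_L2[OF p] LL(1)[OF q(1)] LL(2)[OF w]] q(2)[OF w] by (simp add: p'_def[abs_def] Q_def)
  ultimately show ?thesis by blast
qed

text \<open>In \<open>face_moment\<close> the sum of the dimension and \<open>sqrt c5\<close> bounds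
  the divergence of the radial field, \<open>sqrt c7\<close> its moment against \<open>u\<close>,
  and the summand 1 the field itself; \<open>sqrt c1\<close> passes from cell to face, and
  \<open>\<kappa>\<close> bounds the diameter over the height.\<close>

definition K5 where "K5 = \<kappa> * ((sqrt c7 * (real CARD('n) + sqrt c5) + 1) * sqrt c1)"

lemma K5_nonneg: "0 \<le> K5"
  using nonneg by (simp add: K5_def)

text \<open>The field \<open>p (x - z)\<close> has normal component \<open>height * p\<close> on the face opposite to \<open>z\<close> and \<open>0\<close>
  on the other faces.\<close>
lemma face_moment:
  assumes i: "ibp u G g" and mean: "ipT T u (\<lambda>x. 1) = 0" and p: "p \<in> Pm (int k)" and z: "z \<in> V"
  shows "\<bar>fint V z (\<lambda>y. g z y * p y)\<bar> \<le> K5 * sqrt h * normTv T G * sqrt (fint V z (\<lambda>y. p y * p y))"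
proof -
  \<comment> \<open>Only the values of \<open>p\<close> on the face matter, so \<open>p\<close> is
    exchanged for an extension whose cell norm these values control.\<close>
  obtain q where q: "q \<in> Pm (int k)" "\<And>y. lam V z y = 0 \<Longrightarrow> q y = p y"
    "\<And>w. w \<in> Pm (int k - 1) \<Longrightarrow> ipT T q w = 0"
    using orthogonal_extension[OF p z] by blast
  have u: "L2 T u" "L2v T G" using i by (auto simp: ibp_def)
  define H where "H = height V z"
  have H: "H > 0" by (simp add: H_def height_pos[OF z])
  define d where "d = real CARD('n)"
  define \<phi> where "\<phi> = fint V z (\<lambda>y. p y * p y)"
  have qf: "q y = p y" if "y \<in> face V z" for y using q(2) that face_eq[OF z] by auto
  have "fint V z (\<lambda>y. q y * q y) = \<phi>" unfolding \<phi>_def by (rule fint_cong[OF z]) (simp add: qf)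
  then have "ipT T q q \<le> c1 * h * \<phi>" using complement_face_le[OF q(1) z q(3)] by simp
  then have nq: "normT T q \<le> sqrt c1 * sqrt h * sqrt \<phi>"
    using real_sqrt_le_mono[of "ipT T q q" "c1 * h * \<phi>"] by (simp add: normT_def real_sqrt_mult)
  define \<xi> where "\<xi> x = q x *\<^sub>R (x - z)" for x
  have comp: "(\<lambda>x. \<xi> x $ j) = (\<lambda>x. q x * (x $ j - z $ j))" for j by (simp add: \<xi>_def)
  have nP: "(\<lambda>x::real^'n. x $ j - z $ j) \<in> Pm 1" for j by (intro Pm_diff Pm_nth Pm_const) auto
  have \<xi>P: "\<xi> \<in> Pmv (int k + 1)"
    unfolding Pmv_def mem_Collect_eq comp using Pm_mult[OF q(1) nP] by blast
  have div: "pdiv \<xi> = (\<lambda>x. d * q x + euler z q x)"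
  proof
    fix x
    have "pdiff j (\<lambda>x. x $ j - z $ j) x = 1" for j
      by (subst pdiff_diff) (auto intro!: Pm_differentiable[OF Pm_nth[of 1]] Pm_differentiable[OF Pm_const[of 0]])
    then have "pdiff j (\<lambda>x. \<xi> x $ j) x = q x + pdiff j q x * (x $ j - z $ j)" for j
      unfolding comp by (subst pdiff_mult[OF Pm_differentiable[OF q(1)] Pm_differentiable[OF nP]]) simp
    then show "pdiv \<xi> x = d * q x + euler z q x"
      by (simp add: pdiv_def sum.distrib euler_def cgrad_def inner_vec_def d_def)
  qed
  have bd: "bip V g (\<lambda>w y. \<xi> y \<bullet> onormal V w) = H * fint V z (\<lambda>y. g z y * p y)"
  proof -
    have "bip V g (\<lambda>w y. \<xi> y \<bullet> onormal V w) = (\<Sum>w\<in>V. if w = z then H * fint V z (\<lambda>y. g z y * p y) else 0)"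
      unfolding bip_def
    proof (rule sum.cong[OF refl])
      fix w assume w: "w \<in> V"
      have Hw: "height V w > 0" by (rule height_pos[OF w])
      have *: "(y - z) \<bullet> onormal V w = (if w = z then H else 0)" if "y \<in> face V w" for y
      proof -
        have "lam V w y = lam V w z - ((y - z) \<bullet> onormal V w) / height V w"
          using lam_add[of w z "y - z"] by simp
        moreover have "lam V w y = 0" using that face_eq[OF w] by auto
        ultimately show ?thesis using lam_vertex[OF w z] Hw by (auto simp: H_def split: if_splits)
      qed
      show "fint V w (\<lambda>y. g w y * (\<xi> y \<bullet> onormal V w)) = (if w = z then H * fint V z (\<lambda>y. g z y * p y) else 0)"
      proof (cases "w = z")
        case True
        have "fint V z (\<lambda>y. g z y * (\<xi> y \<bullet> onormal V z)) = fint V z (\<lambda>y. H * (g z y * p y))"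
          by (rule fint_cong[OF z]) (use * True qf in \<open>auto simp: \<xi>_def\<close>)
        then show ?thesis using True by (simp add: fint_def)
      next
        case False
        have "fint V w (\<lambda>y. g w y * (\<xi> y \<bullet> onormal V w)) = fint V w (\<lambda>y. 0)"
          by (rule fint_cong[OF w]) (use * False in \<open>auto simp: \<xi>_def\<close>)
        then show ?thesis using False by (simp add: fint_def)
      qed
    qed
    then show ?thesis using z by simp
  qed
  have n1: "normT T (pdiv \<xi>) \<le> (d + sqrt c5) * normT T q"
  proof -
    have L1: "L2 T (\<lambda>x. d * q x)" by (rule L2_scale[OF Pm_L2[OF q(1)]])
    have "normT T (pdiv \<xi>) \<le> normT T (\<lambda>x. d * q x) + normT T (euler z q)"
      unfolding div by (rule normT_triangle[OF L1 Pm_L2[OF euler_Pm[OF q(1)]]])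
    also have "normT T (\<lambda>x. d * q x) = d * normT T q"
    proof -
      have "ipT T (\<lambda>x. d * q x) (\<lambda>x. d * q x) = d\<^sup>2 * ipT T q q"
        by (simp add: ipT_def power2_eq_square mult_ac)
      then show ?thesis by (simp add: normT_def real_sqrt_mult d_def)
    qed
    also have "normT T (euler z q) \<le> sqrt c5 * normT T q"
      using real_sqrt_le_mono[OF euler_le[OF q(1) z]] by (simp add: normT_def real_sqrt_mult)
    finally show ?thesis by (simp add: distrib_right)
  qed
  have n2: "normTv T \<xi> \<le> h * normT T q"
  proof -
    have "ipTv T \<xi> \<xi> \<le> (\<integral>x. h\<^sup>2 * (q x * q x) \<partial>lebesgue_on T)"
      unfolding ipTv_def
    proof (rule integral_mono)
      show "integrable (lebesgue_on T) (\<lambda>x. \<xi> x \<bullet> \<xi> x)" by (intro L2v_inner_integrable Pmv_L2v[OF \<xi>P])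
      show "integrable (lebesgue_on T) (\<lambda>x. h\<^sup>2 * (q x * q x))"
        by (intro integrable_mult_right L2_mult_integrable Pm_L2[OF q(1)])
      fix x assume "x \<in> space (lebesgue_on T)"
      then have "norm (x - z) \<le> h"
        using norm_diff_le_diameter[of x z] z V_subset_T by (auto simp: h_def space_restrict_space)
      then have "(norm (x - z))\<^sup>2 * (q x)\<^sup>2 \<le> h\<^sup>2 * (q x)\<^sup>2" by (intro mult_right_mono power_mono) auto
      moreover have "\<xi> x \<bullet> \<xi> x = (norm (x - z))\<^sup>2 * (q x)\<^sup>2"
        by (simp add: \<xi>_def power2_norm_eq_inner power2_eq_square[of "q x"])
      ultimately show "\<xi> x \<bullet> \<xi> x \<le> h\<^sup>2 * (q x * q x)" by (simp add: power2_eq_square[of "q x"])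
    qed
    also have "\<dots> = h\<^sup>2 * ipT T q q" by (simp add: ipT_def)
    finally have "sqrt (ipTv T \<xi> \<xi>) \<le> sqrt (h\<^sup>2 * ipT T q q)" by (rule real_sqrt_le_mono)
    then show ?thesis using h_pos by (simp add: normT_def normTv_def real_sqrt_mult)
  qed
  have nG: "0 \<le> normTv T G" by (rule norm_nonneg)
  have "H * \<bar>fint V z (\<lambda>y. g z y * p y)\<bar> = \<bar>ipT T u (pdiv \<xi>) + ipTv T G \<xi>\<bar>"
    using ibp_vec[OF i \<xi>P] bd H by (simp add: abs_mult)
  also have "\<dots> \<le> \<bar>ipT T u (pdiv \<xi>)\<bar> + \<bar>ipTv T G \<xi>\<bar>" by (rule abs_triangle_ineq)
  also have "\<dots> \<le> sqrt c7 * h * normTv T G * normT T (pdiv \<xi>) + normTv T G * normTv T \<xi>"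
    using moment_Poincare[OF i mean Pm_mono[OF _ pdiv_Pm[OF \<xi>P]]] ipTv_CS[OF u(2) Pmv_L2v[OF \<xi>P]]
    by (intro add_mono) auto
  also have "\<dots> \<le> sqrt c7 * h * normTv T G * ((d + sqrt c5) * normT T q) + normTv T G * (h * normT T q)"
    using nG nonneg h_pos by (intro add_mono mult_left_mono n1 n2) auto
  also have "\<dots> = h * (sqrt c7 * (d + sqrt c5) + 1) * normTv T G * normT T q"
    by (simp add: algebra_simps)
  also have "\<dots> \<le> h * (sqrt c7 * (d + sqrt c5) + 1) * normTv T G * (sqrt c1 * sqrt h * sqrt \<phi>)"
    using nG nonneg h_pos by (intro mult_left_mono nq) (auto simp: d_def)
  also have "\<dots> \<le> (\<kappa> * H) * (sqrt c7 * (d + sqrt c5) + 1) * normTv T G * (sqrt c1 * sqrt h * sqrt \<phi>)"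
  proof (intro mult_right_mono)
    show "h \<le> \<kappa> * H" using regular[OF z] by (simp add: h_def H_def)
    show "0 \<le> sqrt c1 * sqrt h * sqrt \<phi>" using nonneg h_pos fint_sq_nonneg[OF z] by (simp add: \<phi>_def)
  qed (use nG nonneg in \<open>auto simp: d_def\<close>)
  also have "\<dots> = H * (K5 * sqrt h * normTv T G * sqrt \<phi>)" by (simp add: K5_def d_def mult_ac)
  finally show ?thesis using H by (simp add: \<phi>_def)
qed

lemma trace_moment:
  assumes i: "ibp u G g" and mean: "ipT T u (\<lambda>x. 1) = 0" and \<mu>: "\<mu> \<in> Pface V (int k)"
  shows "\<bar>bip V g \<mu>\<bar> \<le> (real CARD('n) + 1) * K5 * sqrt h * normTv T G * bnorm V \<mu>"
proof -
  obtain p where p: "\<forall>z\<in>V. p z \<in> Pm (int k)" "\<forall>z\<in>V. \<forall>y\<in>face V z. \<mu> z y = p z y"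
    using Pface_poly[OF \<mu>] by blast
  have "bip V g \<mu> = bip V g p" "bip V \<mu> \<mu> = bip V p p"
    using p(2) by (auto intro!: bip_cong)
  have "\<bar>bip V g p\<bar> \<le> (\<Sum>z\<in>V. \<bar>fint V z (\<lambda>y. g z y * p z y)\<bar>)"
    unfolding bip_def by (rule sum_abs)
  also have "\<dots> \<le> (\<Sum>z\<in>V. K5 * sqrt h * normTv T G * bnorm V p)"
  proof (rule sum_mono)
    fix z assume z: "z \<in> V"
    have "fint V z (\<lambda>y. p z y * p z y) \<le> bip V p p"
      unfolding bip_def by (rule member_le_sum[OF z]) (auto intro: fint_sq_nonneg)
    then have "sqrt (fint V z (\<lambda>y. p z y * p z y)) \<le> bnorm V p" by (simp add: bnorm_def)
    then have "K5 * sqrt h * normTv T G * sqrt (fint V z (\<lambda>y. p z y * p z y)) \<le> K5 * sqrt h * normTv T G * bnorm V p"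
      using K5_nonneg h_pos norm_nonneg by (intro mult_left_mono) auto
    then show "\<bar>fint V z (\<lambda>y. g z y * p z y)\<bar> \<le> K5 * sqrt h * normTv T G * bnorm V p"
      using face_moment[OF i mean _ z, of "p z"] p(1) z by fastforce
  qed
  also have "\<dots> = (real CARD('n) + 1) * K5 * sqrt h * normTv T G * bnorm V p" using cardV by simp
  finally show ?thesis
    using \<open>bip V g \<mu> = bip V g p\<close> \<open>bip V \<mu> \<mu> = bip V p p\<close> by (simp add: bnorm_def)
qed

text \<open>The first summand belongs to the projection of \<open>u\<close> on the faces, the second
  to its trace.\<close>

definition K6 where "K6 = sqrt K2 * sqrt c7 + (real CARD('n) + 1) * K5"

text \<open>The residual \<open>b\<close> is tested with itself. The polynomial part is bounded by
  the discrete trace inequality and \<open>PiT_Poincare\<close>, the trace part by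
  \<open>trace_moment\<close>.\<close>

lemma interpolation_residual_le:
  assumes i: "ibp u G g" and mean: "ipT T u (\<lambda>x. 1) = 0" and m: "m \<le> int k + 1"
    and b: "b \<in> Pface V (int k)" and bb: "bip V b b = bip V (\<lambda>z y. PiT V m u y - g z y) b"
  shows "bnorm V b \<le> K6 * sqrt h * normTv T G"
proof -
  have L: "L2 T u" "L2b g" "L2b b" using i b by (auto simp: ibp_def Pface_L2b)
  define w where "w = PiT V m u"
  have w: "w \<in> Pm (int k + 1)" unfolding w_def by (rule Pm_mono[OF m PiT_in[OF L(1)]])
  have Lw: "L2b (\<lambda>z. w)" by (rule L2b_const_face[OF w])
  have nb: "0 \<le> bnorm V b" by (rule norm_nonneg(3)[OF L(3)])
  have "bnorm V (\<lambda>z. w) \<le> sqrt K2 / sqrt h * normT T w" by (rule bnorm_poly_le[OF w])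
  also have "\<dots> \<le> sqrt K2 / sqrt h * (sqrt c7 * h * normTv T G)"
    using PiT_Poincare[OF i mean m] K2_nonneg h_pos unfolding w_def by (intro mult_left_mono) auto
  also have "\<dots> = sqrt K2 * sqrt c7 * sqrt h * normTv T G"
    using h_pos real_div_sqrt[of h] by (simp add: field_simps)
  finally have nw: "bnorm V (\<lambda>z. w) \<le> sqrt K2 * sqrt c7 * sqrt h * normTv T G" .
  have "(bnorm V b)\<^sup>2 = bip V (\<lambda>z. w) b - bip V g b"
    unfolding norm_sq(3)[OF L(3)] bb w_def[symmetric] using bip_diff[OF Lw L(2,3)] .
  also have "\<dots> \<le> bnorm V (\<lambda>z. w) * bnorm V b + (real CARD('n) + 1) * K5 * sqrt h * normTv T G * bnorm V b"
    using bip_CS[OF Lw L(3)] trace_moment[OF i mean b] by linarith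
  also have "\<dots> \<le> (sqrt K2 * sqrt c7 * sqrt h * normTv T G) * bnorm V b + (real CARD('n) + 1) * K5 * sqrt h * normTv T G * bnorm V b"
    using nb by (intro add_right_mono mult_right_mono nw)
  also have "\<dots> = (K6 * sqrt h * normTv T G) * bnorm V b" by (simp add: K6_def algebra_simps)
  finally show ?thesis
  proof (rule sq_le_mult_imp_le[rotated 2, OF _ nb])
    have "0 \<le> K6" unfolding K6_def
      by (intro add_nonneg_nonneg mult_nonneg_nonneg real_sqrt_ge_zero nonneg K2_nonneg K5_nonneg) auto
    then show "0 \<le> K6 * sqrt h * normTv T G"
      by (intro mult_nonneg_nonneg norm_nonneg real_sqrt_ge_zero less_imp_le[OF h_pos])
  qed
qed

definition K7 where "K7 = sqrt c7 * sqrt K2 + 1 + K2 * sqrt c7"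

text \<open>Covers degree \<open>k + 1\<close> as well, beyond the range of
  \<open>complement_le\<close>. The Laplacian of \<open>e\<close> has degree \<open>k - 1\<close>,
  so the energy of \<open>e\<close> equals a boundary term with its normal derivative; this has
  degree \<open>k\<close>, and \<open>e\<close> may be replaced by \<open>a\<close>. The gradient
  controls \<open>e\<close> up to its mean \<open>c\<close>, and \<open>c\<close> is recovered by
  testing \<open>a\<close> with a constant.\<close>

lemma cell_le_face_projection:
  assumes e: "e \<in> Pm (int k + 1)" and orth: "\<And>w. w \<in> Pm (int k - 1) \<Longrightarrow> ipT T e w = 0"
    and a: "a \<in> Pface V (int k)" and ae: "\<And>\<mu>. \<mu> \<in> Pface V (int k) \<Longrightarrow> bip V a \<mu> = bip V (\<lambda>z. e) \<mu>"
  shows "normT T e \<le> K7 * sqrt h * bnorm V a"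
proof -
  have La: "L2b a" by (rule Pface_L2b[OF a])
  have Le: "L2b (\<lambda>z. e)" by (rule L2b_const_face[OF e])
  have na: "0 \<le> bnorm V a" by (rule norm_nonneg(3)[OF La])
  have sh: "sqrt h > 0" using h_pos by simp
  have g: "cgrad e \<in> Pmv (int k)" using Pm_frechet[OF e] by simp
  have g1: "cgrad e \<in> Pmv (int k + 1)" using g Pm_mono[of "int k" "int k + 1"] by (auto simp: Pmv_def)
  have "ipT T e (pdiv (cgrad e)) = 0" by (rule orth) (rule pdiv_Pm[OF g])
  then have "(normTv T (cgrad e))\<^sup>2 = bip V (\<lambda>z. e) (\<lambda>z y. cgrad e y \<bullet> onormal V z)"
    using ibp_vec[OF ibp_poly[OF e] g] by (simp add: norm_sq)
  also have "\<dots> = bip V a (\<lambda>z y. cgrad e y \<bullet> onormal V z)"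
    using ae[OF normal_canon_Pface[OF g]] by (simp add: bip_canon)
  also have "\<dots> \<le> bnorm V a * bnorm V (\<lambda>z y. cgrad e y \<bullet> onormal V z)"
    using bip_CS[OF La L2b_normal[OF g]] by simp
  also have "\<dots> \<le> bnorm V a * (sqrt K2 / sqrt h * normTv T (cgrad e))"
    by (intro mult_left_mono bnorm_normal_le g1 na)
  finally have "(normTv T (cgrad e))\<^sup>2 \<le> (sqrt K2 / sqrt h * bnorm V a) * normTv T (cgrad e)" by (simp add: mult_ac)
  then have ng: "normTv T (cgrad e) \<le> sqrt K2 / sqrt h * bnorm V a"
    by (rule sq_le_mult_imp_le[rotated 2])
      (intro norm_nonneg mult_nonneg_nonneg divide_nonneg_nonneg real_sqrt_ge_zero na K2_nonneg less_imp_le[OF h_pos])+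
  define m where "m = measure lebesgue T"
  have m: "m > 0" using measure_T_pos by (simp add: m_def)
  define c where "c = ipT T e (\<lambda>x. 1) / m"
  define e0 where "e0 x = e x - c" for x
  have e0: "e0 \<in> Pm (int k + 1)" unfolding e0_def[abs_def] by (intro Pm_diff e Pm_const) simp
  have mean: "ipT T e0 (\<lambda>x. 1) = 0"
    unfolding e0_def using ipT_diff[OF Pm_L2[OF e] L2_const[of c] L2_const[of 1]] m
    by (simp add: ipT_const_1 m_def[symmetric] c_def)
  have cge: "cgrad e0 = cgrad e"
    unfolding e0_def[abs_def] using cgrad_diff[OF e Pm_const[of "int k + 1" c]] by (simp add: fun_eq_iff cgrad_def vec_eq_iff)
  have "normT T e0 \<le> sqrt c7 * h * normTv T (cgrad e)" using Poincare_poly[OF e0 mean] by (simp add: cge)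
  also have "\<dots> \<le> sqrt c7 * h * (sqrt K2 / sqrt h * bnorm V a)"
    using nonneg h_pos by (intro mult_left_mono ng) auto
  also have "\<dots> = sqrt c7 * sqrt K2 * sqrt h * bnorm V a"
    using h_pos real_div_sqrt[of h] by (simp add: field_simps)
  finally have ne0: "normT T e0 \<le> sqrt c7 * sqrt K2 * sqrt h * bnorm V a" .
  have Lc: "L2b (\<lambda>z y. c)" using L2b_const_face[OF Pm_const[of 0 c]] by simp
  have Le0: "L2b (\<lambda>z. e0)" by (rule L2b_const_face[OF e0])
  have "bnorm V (\<lambda>z. e0) \<le> sqrt K2 / sqrt h * normT T e0" by (rule bnorm_poly_le[OF e0])
  also have "\<dots> \<le> sqrt K2 / sqrt h * (sqrt c7 * sqrt K2 * sqrt h * bnorm V a)"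
    using K2_nonneg h_pos by (intro mult_left_mono ne0) auto
  also have "\<dots> = K2 * sqrt c7 * bnorm V a" using sh K2_nonneg by (simp add: field_simps)
  finally have be0: "bnorm V (\<lambda>z. e0) \<le> K2 * sqrt c7 * bnorm V a" .
  have nc: "0 \<le> bnorm V (\<lambda>z y. c)" by (rule norm_nonneg(3)[OF Lc])
  have "canon V (\<lambda>z y. c) \<in> Pface V (int k)" by (rule canon_Pface) (simp add: Pm_const)
  from ae[OF this] have ac: "bip V a (\<lambda>z y. c) = bip V (\<lambda>z. e) (\<lambda>z y. c)" by (simp add: bip_canon)
  have "(bnorm V (\<lambda>z y. c))\<^sup>2 = bip V (\<lambda>z y. e y - e0 y) (\<lambda>z y. c)"
    unfolding norm_sq(3)[OF Lc] by (simp add: e0_def)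
  also have "\<dots> = bip V a (\<lambda>z y. c) - bip V (\<lambda>z. e0) (\<lambda>z y. c)"
    unfolding ac by (rule bip_diff[OF Le Le0 Lc])
  also have "\<dots> \<le> bnorm V a * bnorm V (\<lambda>z y. c) + bnorm V (\<lambda>z. e0) * bnorm V (\<lambda>z y. c)"
    using bip_CS[OF La Lc] bip_CS[OF Le0 Lc] by linarith
  also have "\<dots> \<le> bnorm V a * bnorm V (\<lambda>z y. c) + (K2 * sqrt c7 * bnorm V a) * bnorm V (\<lambda>z y. c)"
    by (intro add_left_mono mult_right_mono be0 nc)
  finally have "(bnorm V (\<lambda>z y. c))\<^sup>2 \<le> ((1 + K2 * sqrt c7) * bnorm V a) * bnorm V (\<lambda>z y. c)"
    by (simp add: algebra_simps)
  then have bc: "bnorm V (\<lambda>z y. c) \<le> (1 + K2 * sqrt c7) * bnorm V a"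
    by (rule sq_le_mult_imp_le[rotated 2])
      (intro nc na mult_nonneg_nonneg add_nonneg_nonneg zero_le_one real_sqrt_ge_zero K2_nonneg nonneg)+
  have cT: "normT T (\<lambda>x. c) \<le> sqrt h * bnorm V (\<lambda>z y. c)"
  proof -
    obtain z where z: "z \<in> V" using V_nontrivial by blast
    have "ipT T (\<lambda>x. c) (\<lambda>x. c) = Aform z (\<lambda>x. c) (\<lambda>x. c)" by (simp add: Aform_def ipT_def)
    also have "\<dots> \<le> h * fint V z (\<lambda>y. c * c)" using Aform_le_fint[OF z, of "\<lambda>x. c"] by simp
    also have "\<dots> \<le> h * bip V (\<lambda>z y. c) (\<lambda>z y. c)"
    proof (rule mult_left_mono)
      show "fint V z (\<lambda>y. c * c) \<le> bip V (\<lambda>z y. c) (\<lambda>z y. c)"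
        unfolding bip_def by (rule member_le_sum[OF z]) (auto intro: fint_sq_nonneg)
    qed (use h_pos in simp)
    finally show ?thesis
      using real_sqrt_le_mono[of "ipT T (\<lambda>x. c) (\<lambda>x. c)"] by (simp add: normT_def bnorm_def real_sqrt_mult[symmetric])
  qed
  have "normT T e \<le> normT T e0 + normT T (\<lambda>x. c)"
    using normT_triangle[OF Pm_L2[OF e0] L2_const[of c]] by (simp add: e0_def)
  also have "\<dots> \<le> sqrt c7 * sqrt K2 * sqrt h * bnorm V a + sqrt h * ((1 + K2 * sqrt c7) * bnorm V a)"
    using order_trans[OF cT mult_left_mono[OF bc]] sh by (intro add_mono ne0) auto
  finally show ?thesis by (simp add: K7_def algebra_simps)
qed

text \<open>The number of faces comes from Cauchy-Schwarz over the faces, and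
  \<open>\<kappa>\<close> from edge lengths relative to heights.\<close>

definition K8 where "K8 = \<kappa> * sqrt ((real CARD('n) + 1) * c1)"

text \<open>Each component along a fixed face normal is a scalar polynomial orthogonal to lower
  degree, hence controlled on that face. The components along all face normals determine the
  vector.\<close>

lemma flux_le_normal_trace:
  assumes e: "\<epsilon> \<in> Pmv (int k)" and orth: "\<And>\<xi>. \<xi> \<in> Pmv (int k - 1) \<Longrightarrow> ipTv T \<epsilon> \<xi> = 0"
  shows "normTv T \<epsilon> \<le> K8 * sqrt h * bnorm V (\<lambda>z y. \<epsilon> y \<bullet> onormal V z)"
proof -
  define p where "p z x = \<epsilon> x \<bullet> onormal V z" for z x
  have p: "p z \<in> Pm (int k)" for z unfolding p_def[abs_def] by (rule Pmv_inner[OF e])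
  have porth: "ipT T (p z) w = 0" if w: "w \<in> Pm (int k - 1)" for z w
  proof -
    have "(\<lambda>x. w x *\<^sub>R onormal V z) \<in> Pmv (int k - 1)"
      unfolding Pmv_def
    proof (rule CollectI, rule allI)
      fix i
      have "(\<lambda>x. (w x *\<^sub>R onormal V z) $ i) = (\<lambda>x. onormal V z $ i * w x)" by (simp add: mult.commute)
      then show "(\<lambda>x. (w x *\<^sub>R onormal V z) $ i) \<in> Pm (int k - 1)" using Pm_scale[OF w] by simp
    qed
    from orth[OF this] show ?thesis by (simp add: ipTv_def ipT_def p_def mult.commute)
  qed
  have N: "real (card V) = real CARD('n) + 1" using cardV by simp
  have pt: "\<epsilon> x \<bullet> \<epsilon> x \<le> \<kappa>\<^sup>2 * (real CARD('n) + 1) * (\<Sum>z\<in>V. p z x * p z x)" for x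
  proof -
    obtain z0 where z0: "z0 \<in> V" using V_nontrivial by blast
    \<comment> \<open>The base point of \<open>sum_normals_vertex\<close> is free; at a vertex
      \<open>z0\<close> the vectors are edges, of length at most \<open>\<kappa>\<close> times the
      height.\<close>
    have "\<epsilon> x = (\<Sum>z\<in>V. (p z x / height V z) *\<^sub>R (z0 - z))"
      using sum_normals_vertex[of "\<epsilon> x" z0] by (simp add: p_def)
    then have "norm (\<epsilon> x) \<le> (\<Sum>z\<in>V. norm ((p z x / height V z) *\<^sub>R (z0 - z)))" using norm_sum by metis
    also have "\<dots> \<le> (\<Sum>z\<in>V. \<kappa> * \<bar>p z x\<bar>)"
    proof (rule sum_mono)
      fix z assume z: "z \<in> V"
      have H: "0 < height V z" by (rule height_pos[OF z])
      have "norm (z0 - z) \<le> \<kappa> * height V z"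
        using norm_diff_le_diameter[of z0 z] z z0 V_subset_T regular[OF z] by fastforce
      then have "\<bar>p z x\<bar> / height V z * norm (z0 - z) \<le> \<bar>p z x\<bar> / height V z * (\<kappa> * height V z)"
        using H by (intro mult_left_mono) auto
      then show "norm ((p z x / height V z) *\<^sub>R (z0 - z)) \<le> \<kappa> * \<bar>p z x\<bar>" using H by (simp add: mult_ac)
    qed
    also have "\<dots> = \<kappa> * (\<Sum>z\<in>V. \<bar>p z x\<bar>)" by (simp add: sum_distrib_left)
    finally have "(norm (\<epsilon> x))\<^sup>2 \<le> (\<kappa> * (\<Sum>z\<in>V. \<bar>p z x\<bar>))\<^sup>2" by (intro power_mono) auto
    also have "\<dots> = \<kappa>\<^sup>2 * (\<Sum>z\<in>V. \<bar>p z x\<bar>)\<^sup>2" by (simp add: power_mult_distrib)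
    finally have le: "\<epsilon> x \<bullet> \<epsilon> x \<le> \<kappa>\<^sup>2 * (\<Sum>z\<in>V. \<bar>p z x\<bar>)\<^sup>2" unfolding power2_norm_eq_inner .
    have "(\<Sum>z\<in>V. \<bar>p z x\<bar>)\<^sup>2 \<le> (real CARD('n) + 1) * (\<Sum>z\<in>V. p z x * p z x)"
      using Cauchy_Schwarz_ineq_sum[of "\<lambda>_. 1" "\<lambda>z. \<bar>p z x\<bar>" V] N by (simp add: power2_eq_square)
    from order_trans[OF le mult_left_mono[OF this zero_le_power2]] show ?thesis by (simp only: mult.assoc)
  qed
  have "ipTv T \<epsilon> \<epsilon> \<le> (\<integral>x. \<kappa>\<^sup>2 * (real CARD('n) + 1) * (\<Sum>z\<in>V. p z x * p z x) \<partial>lebesgue_on T)"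
    unfolding ipTv_def
    by (intro integral_mono pt L2v_inner_integrable Pmv_L2v[OF e] integrable_mult_right Bochner_Integration.integrable_sum
        L2_mult_integrable Pm_L2[OF p])
  also have "\<dots> = \<kappa>\<^sup>2 * (real CARD('n) + 1) * (\<Sum>z\<in>V. ipT T (p z) (p z))"
    unfolding ipT_def by (subst Bochner_Integration.integral_sum[symmetric]) (auto intro!: L2_mult_integrable Pm_L2[OF p])
  also have "\<dots> \<le> \<kappa>\<^sup>2 * (real CARD('n) + 1) * (\<Sum>z\<in>V. c1 * h * fint V z (\<lambda>y. p z y * p z y))"
    by (intro mult_left_mono sum_mono complement_face_le p porth) auto
  also have "\<dots> = (\<kappa>\<^sup>2 * ((real CARD('n) + 1) * c1)) * h * bip V p p"
    by (simp add: bip_def sum_distrib_left mult_ac)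
  finally have "ipTv T \<epsilon> \<epsilon> \<le> (\<kappa>\<^sup>2 * ((real CARD('n) + 1) * c1)) * h * bip V p p" .
  from real_sqrt_le_mono[OF this] show ?thesis
    using nonneg by (simp add: normTv_def bnorm_def K8_def real_sqrt_mult p_def[abs_def])
qed

end

section \<open>The discrete operators\<close>

context nsimplex
begin

lemma bip_sum: "finite I \<Longrightarrow> (\<And>i. i \<in> I \<Longrightarrow> L2b (f i)) \<Longrightarrow> L2b \<mu> \<Longrightarrow>
    bip V (\<lambda>z y. \<Sum>i\<in>I. f i z y) \<mu> = (\<Sum>i\<in>I. bip V (f i) \<mu>)"
proof (induction I rule: finite_induct)
  case empty
  then show ?case by (simp add: bip_def fint_def)
next
  case (insert i I)
  then have "bip V (\<lambda>z y. f i z y + (\<Sum>i\<in>I. f i z y)) \<mu> = bip V (f i) \<mu> + bip V (\<lambda>z y. \<Sum>i\<in>I. f i z y) \<mu>"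
    by (intro bip_add L2b_sum) auto
  with insert show ?case by simp
qed

lemma bip_face_scale: "bip V (\<lambda>z y. d z * f z y) \<mu> = bip V f (\<lambda>z y. d z * \<mu> z y)"
  by (simp add: bip_def mult_ac)

lemma Pface_face_scale:
  assumes "\<mu> \<in> Pface V m"
  shows "(\<lambda>z y. d z * \<mu> z y) \<in> Pface V m"
proof -
  obtain p where p: "\<forall>z\<in>V. p z \<in> Pm m" "\<forall>z\<in>V. \<forall>y\<in>face V z. \<mu> z y = p z y"
    using Pface_poly[OF assms] by blast
  have c: "canon V \<mu> = \<mu>" using assms by (auto simp: Pface_def)
  have "(\<lambda>z y. d z * \<mu> z y) = canon V (\<lambda>z y. d z * p z y)"
    using p(2) by (subst c[symmetric]) (auto simp: canon_def fun_eq_iff)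
  then show ?thesis using p(1) by (simp add: canon_Pface Pm_scale)
qed

lemma L2b_btr: "p \<in> Pm m \<Longrightarrow> L2b (btr V p)"
  unfolding btr_def by (rule Pface_L2b[OF canon_Pface])

lemma L2b_deltaT: "p \<in> Pm m \<Longrightarrow> L2b f \<Longrightarrow> L2b (deltaT V p f)"
  unfolding deltaT_def by (intro L2b_diff L2b_btr)

lemma bip_btr: "bip V (btr V p) \<mu> = bip V (\<lambda>z. p) \<mu>"
  unfolding btr_def bip_canon ..

lemma bip_deltaT:
  "p \<in> Pm m \<Longrightarrow> L2b f \<Longrightarrow> L2b \<mu> \<Longrightarrow> bip V (deltaT V p f) \<mu> = bip V (\<lambda>z. p) \<mu> - bip V f \<mu>"
  unfolding deltaT_def by (subst bip_diff) (auto simp: bip_btr intro: L2b_btr)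

lemma vtrace_normal_L2b:
  assumes "is_vtrace V \<sigma> gs"
  shows "L2b (\<lambda>z y. gs z y $ i)" "L2b (\<lambda>z y. gs z y \<bullet> onormal V z)"
proof -
  have 1: "L2b (\<lambda>z y. gs z y $ i)" for i using assms is_trace_L2b by (auto simp: is_vtrace_def)
  then show "L2b (\<lambda>z y. gs z y $ i)" .
  have "L2b (\<lambda>z y. \<Sum>i\<in>UNIV. onormal V z $ i * gs z y $ i)" by (intro L2b_sum L2b_face_scale 1)
  then show "L2b (\<lambda>z y. gs z y \<bullet> onormal V z)" by (simp add: inner_vec_def mult.commute)
qed

text \<open>The normal is constant on each face, so the componentwise projection commutes with
  taking normal components.\<close>

lemma PidTv_normal:
  assumes tr: "is_vtrace V \<sigma> gs"
  shows "(\<lambda>z y. PidTv V m gs z y \<bullet> onormal V z) \<in> Pface V m"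
    and "\<mu> \<in> Pface V m \<Longrightarrow> bip V (\<lambda>z y. PidTv V m gs z y \<bullet> onormal V z) \<mu> = bip V (\<lambda>z y. gs z y \<bullet> onormal V z) \<mu>"
proof -
  define P where "P i = PidT V m (\<lambda>z y. gs z y $ i)" for i
  have g: "L2b (\<lambda>z y. gs z y $ i)" for i by (rule vtrace_normal_L2b(1)[OF tr])
  have P: "P i \<in> Pface V m" for i unfolding P_def by (rule PidT_in[OF g])
  have eq: "(\<lambda>z y. PidTv V m gs z y \<bullet> onormal V z) = (\<lambda>z y. \<Sum>i\<in>UNIV. onormal V z $ i * P i z y)"
    by (simp add: PidTv_def P_def inner_vec_def mult.commute)
  have "(\<Sum>i\<in>UNIV. (\<lambda>z y. onormal V z $ i * P i z y)) \<in> Pface V m"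
    by (intro subspace_sum[OF subspace_Pface] Pface_face_scale P)
  moreover have "(\<Sum>i\<in>UNIV. (\<lambda>z y. onormal V z $ i * P i z y)) = (\<lambda>z y. \<Sum>i\<in>UNIV. onormal V z $ i * P i z y)"
    by (simp add: fun_eq_iff sum_fun_apply)
  ultimately show "(\<lambda>z y. PidTv V m gs z y \<bullet> onormal V z) \<in> Pface V m"
    unfolding eq by simp
  assume \<mu>: "\<mu> \<in> Pface V m"
  have L: "L2b \<mu>" by (rule Pface_L2b[OF \<mu>])
  have LP: "L2b (\<lambda>z y. onormal V z $ i * P i z y)" for i by (rule L2b_face_scale[OF Pface_L2b[OF P]])
  have Lg: "L2b (\<lambda>z y. onormal V z $ i * gs z y $ i)" for i by (rule L2b_face_scale[OF g])
  have "bip V (\<lambda>z y. PidTv V m gs z y \<bullet> onormal V z) \<mu> = (\<Sum>i\<in>UNIV. bip V (P i) (\<lambda>z y. onormal V z $ i * \<mu> z y))"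
    unfolding eq bip_sum[OF finite LP L] by (intro sum.cong refl bip_face_scale)
  also have "\<dots> = (\<Sum>i\<in>UNIV. bip V (\<lambda>z y. gs z y $ i) (\<lambda>z y. onormal V z $ i * \<mu> z y))"
    by (intro sum.cong refl) (simp add: P_def PidT_eq[OF g Pface_face_scale[OF \<mu>]])
  also have "\<dots> = bip V (\<lambda>z y. \<Sum>i\<in>UNIV. onormal V z $ i * gs z y $ i) \<mu>"
    unfolding bip_sum[OF finite Lg L] by (intro sum.cong refl bip_face_scale[symmetric])
  finally show "bip V (\<lambda>z y. PidTv V m gs z y \<bullet> onormal V z) \<mu> = bip V (\<lambda>z y. gs z y \<bullet> onormal V z) \<mu>"
    by (simp add: inner_vec_def mult.commute)
qed

lemma PiT_shift:
  assumes E: "L2 T E" and R: "R = (\<lambda>x. E x + c)" and m: "0 \<le> m"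
  shows "PiT V m R = (\<lambda>x. PiT V m E x + c)"
proof (rule PiT_unique)
  show "L2 T R" unfolding R by (intro L2_add E L2_const)
  show "(\<lambda>x. PiT V m E x + c) \<in> Pm m" by (intro Pm_add PiT_in E Pm_const m)
  show "ipT T (\<lambda>x. PiT V m E x + c) q = ipT T R q" if q: "q \<in> Pm m" for q
    unfolding R ipT_add[OF E L2_const Pm_L2[OF q]] ipT_add[OF Pm_L2[OF PiT_in[OF E]] L2_const Pm_L2[OF q]]
    by (simp add: PiT_eq[OF E q])
qed

lemma PiT_self: "p \<in> Pm m \<Longrightarrow> PiT V m p = p"
  by (rule PiT_unique[OF Pm_L2 _ refl])

lemma PiT_diff: "L2 T f \<Longrightarrow> L2 T g \<Longrightarrow> PiT V m (\<lambda>x. f x - g x) = (\<lambda>x. PiT V m f x - PiT V m g x)"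
proof (rule PiT_unique)
  assume f: "L2 T f" and g: "L2 T g"
  show "L2 T (\<lambda>x. f x - g x)" by (rule L2_diff[OF f g])
  show "(\<lambda>x. PiT V m f x - PiT V m g x) \<in> Pm m" by (intro Pm_diff PiT_in f g)
  show "ipT T (\<lambda>x. PiT V m f x - PiT V m g x) q = ipT T (\<lambda>x. f x - g x) q" if q: "q \<in> Pm m" for q
    unfolding ipT_diff[OF f g Pm_L2[OF q]] ipT_diff[OF Pm_L2[OF PiT_in[OF f]] Pm_L2[OF PiT_in[OF g]] Pm_L2[OF q]]
    by (simp add: PiT_eq[OF _ q] f g)
qed

end

section \<open>Solvability of gradient problems: elliptic projection and reconstruction\<close>

context regular_simplex
begin

lemma grad_L2v: "p \<in> Pm m \<Longrightarrow> L2v T (cgrad p)"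
  using Pm_frechet Pmv_L2v by blast

lemma grad_zero_const:
  assumes d: "d \<in> Pm (int k + 1)" and 0: "ipTv T (cgrad d) (cgrad d) = 0"
  shows "\<exists>c. d = (\<lambda>x. c)"
proof -
  define m where "m = measure lebesgue T"
  have m: "m > 0" using measure_T_pos by (simp add: m_def)
  define c where "c = ipT T d (\<lambda>x. 1) / m"
  define e where "e = (\<lambda>x. d x - c)"
  have e: "e \<in> Pm (int k + 1)" unfolding e_def by (intro Pm_diff d Pm_const) simp
  have "ipT T e (\<lambda>x. 1) = 0"
    unfolding e_def using ipT_diff[OF Pm_L2[OF d] L2_const[of c] L2_const[of 1]] m
    by (simp add: ipT_const_1 m_def[symmetric] c_def)
  moreover have "cgrad e = cgrad d"
    unfolding e_def using cgrad_diff[OF d Pm_const[of "int k + 1" c]] by (simp add: fun_eq_iff cgrad_def vec_eq_iff)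
  ultimately have "normT T e \<le> 0" using Poincare_poly[OF e] 0 by (simp add: normTv_def)
  then have "ipT T e e = 0" using norm_nonneg(1)[of e] norm_sq(1)[of e] by simp
  then have "e = 0" by (rule Pm_zero_T[OF e])
  then have "d = (\<lambda>x. c)" by (simp add: e_def fun_eq_iff)
  then show ?thesis ..
qed

text \<open>Adding the product of the means makes the gradient form definite on polynomials. Testing
  with the constant 1, where \<open>l\<close> vanishes, shows that the solution has the prescribed
  mean, after which the added term cancels.\<close>

lemma gradient_problem:
  fixes l :: "(real^'n \<Rightarrow> real) \<Rightarrow> real"
  assumes add: "\<And>p q. p \<in> Pm (int k + 1) \<Longrightarrow> q \<in> Pm (int k + 1) \<Longrightarrow> l (p + q) = l p + l q"
    and scale: "\<And>c p. p \<in> Pm (int k + 1) \<Longrightarrow> l (c *\<^sub>R p) = c * l p"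
    and one: "l (\<lambda>x. 1) = 0"
  shows "\<exists>!r. r \<in> Pm (int k + 1) \<and> (\<forall>w\<in>Pm (int k + 1). ipTv T (cgrad r) (cgrad w) = l w) \<and> ipT T r (\<lambda>x. 1) = c"
proof -
  let ?P = "Pm (int k + 1) :: (real^'n \<Rightarrow> real) set"
  let ?one = "\<lambda>x::real^'n. 1::real"
  have 1: "?one \<in> ?P" by (rule Pm_const) simp
  define B where "B p q = ipTv T (cgrad p) (cgrad q) + ipT T p ?one * ipT T q ?one" for p q
  interpret iv: psd_form "ipTv T" "{f. L2v T f}" by (rule psd_form_ipTv)
  interpret ip: psd_form "ipT T" "{f. L2 T f}" by (rule psd_form_ipT)
  have L: "cgrad p \<in> {f. L2v T f}" "p \<in> {f. L2 T f}" "?one \<in> {f. L2 T f}" if "p \<in> ?P" for p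
    using grad_L2v[OF that] Pm_L2[OF that] Pm_L2[OF 1] by auto
  have psd: "psd_form B ?P"
  proof
    show "subspace ?P" by (rule subspace_Pm)
    show "B (u + v) w = B u w + B v w" if "u \<in> ?P" "v \<in> ?P" "w \<in> ?P" for u v w
      unfolding B_def cgrad_add[OF that(1,2)] iv.B_add[OF L(1)[OF that(1)] L(1)[OF that(2)] L(1)[OF that(3)]]
        ip.B_add[OF L(2)[OF that(1)] L(2)[OF that(2)] L(3)[OF that(1)]] by (simp add: algebra_simps)
    show "B (c *\<^sub>R u) w = c * B u w" if "u \<in> ?P" "w \<in> ?P" for c u w
      unfolding B_def cgrad_scale[OF that(1)] iv.B_scale[OF L(1)[OF that(1)] L(1)[OF that(2)]]
        ip.B_scale[OF L(2)[OF that(1)] L(3)[OF that(1)]] by (simp add: algebra_simps)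
    show "B u w = B w u" for u w by (simp add: B_def ipTv_sym mult.commute)
    show "0 \<le> B u u" for u
    proof -
      have "0 \<le> ipTv T (cgrad u) (cgrad u)" by (simp add: ipTv_def)
      then show ?thesis by (simp add: B_def)
    qed
  qed
  obtain S where S: "finite S" "span S = ?P" using fin_dim_Pm by (auto simp: fin_dim_def)
  have definite: "u = 0" if u: "u \<in> ?P" and 0: "ipTv T (cgrad u) (cgrad u) = 0" "ipT T u ?one = 0" for u
  proof -
    have "normT T u \<le> 0" using Poincare_poly[OF u 0(2)] 0(1) by (simp add: normTv_def)
    then have "ipT T u u = 0" using norm_nonneg(1)[of u] norm_sq(1)[of u] by simp
    then show ?thesis by (rule Pm_zero_T[OF u])
  qed
  have "\<exists>p\<in>span S. \<forall>q\<in>span S. B p q = l q + c * ipT T q ?one"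
  proof (rule psd_form.riesz_span[OF psd S(1)])
    show "span S \<subseteq> ?P" using S(2) by simp
    show "l (u + v) + c * ipT T (u + v) ?one = l u + c * ipT T u ?one + (l v + c * ipT T v ?one)"
      if "u \<in> span S" "v \<in> span S" for u v
      using that unfolding S(2) by (simp add: add ip.B_add[OF L(2,2,3)] algebra_simps)
    show "l (a *\<^sub>R u) + c * ipT T (a *\<^sub>R u) ?one = a * (l u + c * ipT T u ?one)" if "u \<in> span S" for a u
      using that unfolding S(2) by (simp add: scale ip.B_scale[OF L(2,3)] algebra_simps)
    show "l u + c * ipT T u ?one = 0" if "u \<in> span S" "B u u = 0" for u
    proof -
      have u: "u \<in> ?P" using that S(2) by simp
      have "0 \<le> ipTv T (cgrad u) (cgrad u)" by (simp add: ipTv_def)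
      then have "ipTv T (cgrad u) (cgrad u) = 0" "ipT T u ?one = 0"
        using that(2) zero_le_square[of "ipT T u ?one"] unfolding B_def by (smt (verit) mult_eq_0_iff)+
      then have "u = 0 *\<^sub>R ?one" using definite[OF u] by simp
      then show ?thesis using scale[OF 1, of 0] by (simp add: ipT_def zero_fun_def)
    qed
  qed
  then obtain p where p: "p \<in> ?P" "\<And>q. q \<in> ?P \<Longrightarrow> B p q = l q + c * ipT T q ?one" using S(2) by auto
  have g1: "cgrad ?one = (\<lambda>x. 0)" by (simp add: fun_eq_iff cgrad_def vec_eq_iff)
  have "ipT T p ?one * measure lebesgue T = c * measure lebesgue T"
    using p(2)[OF 1] one by (simp add: B_def g1 ipT_const_1 ipTv_def)
  then have mean: "ipT T p ?one = c" using measure_T_pos by simp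
  show ?thesis
  proof (rule ex1I[of _ p])
    show "p \<in> ?P \<and> (\<forall>w\<in>?P. ipTv T (cgrad p) (cgrad w) = l w) \<and> ipT T p ?one = c"
      using p mean by (auto simp: B_def)
    fix r assume r: "r \<in> ?P \<and> (\<forall>w\<in>?P. ipTv T (cgrad r) (cgrad w) = l w) \<and> ipT T r ?one = c"
    then have rP: "r \<in> ?P" by simp
    have d: "r - p \<in> ?P" using subspace_diff[OF subspace_Pm rP p(1)] .
    have gd: "cgrad (r - p) = cgrad r - cgrad p"
      using cgrad_diff[OF rP p(1)] by (simp add: fun_eq_iff fun_diff_def)
    have "ipTv T (cgrad r - cgrad p) (cgrad (r - p)) = ipTv T (cgrad r) (cgrad (r - p)) - ipTv T (cgrad p) (cgrad (r - p))"
      by (rule iv.B_diff[OF L(1)[OF rP] L(1)[OF p(1)] L(1)[OF d]])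
    moreover have "ipTv T (cgrad r) (cgrad (r - p)) = l (r - p)" using r d by blast
    moreover have "ipTv T (cgrad p) (cgrad (r - p)) = l (r - p)" using p(2)[OF d] mean by (simp add: B_def)
    ultimately have "ipTv T (cgrad (r - p)) (cgrad (r - p)) = 0" using gd by simp
    moreover have "ipT T (r - p) ?one = 0"
      using r mean ip.B_diff[OF L(2)[OF rP] L(2)[OF p(1)] L(3)[OF rP]] by simp
    ultimately have "r - p = 0" by (rule definite[OF d])
    then show "r = p" by simp
  qed
qed

lemma ellproj:
  assumes "L2 T v" "L2v T G"
  shows "ellproj V k v G \<in> Pm (int k + 1)"
    and "q \<in> Pm (int k + 1) \<Longrightarrow> ipTv T (cgrad (ellproj V k v G)) (cgrad q) = ipTv T G (cgrad q)"
    and "ipT T (ellproj V k v G) (\<lambda>x. 1) = ipT T v (\<lambda>x. 1)"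
proof -
  interpret iv: psd_form "ipTv T" "{f. L2v T f}" by (rule psd_form_ipTv)
  have "\<exists>!r. r \<in> Pm (int k + 1) \<and> (\<forall>w\<in>Pm (int k + 1). ipTv T (cgrad r) (cgrad w) = ipTv T G (cgrad w)) \<and>
      ipT T r (\<lambda>x. 1) = ipT T v (\<lambda>x. 1)"
  proof (rule gradient_problem)
    fix p q :: "real^'n \<Rightarrow> real" and c :: real
    assume p: "p \<in> Pm (int k + 1)"
    show "ipTv T G (cgrad (c *\<^sub>R p)) = c * ipTv T G (cgrad p)"
      unfolding cgrad_scale[OF p] using grad_L2v[OF p] assms by (simp add: iv.B_scale_right)
    assume q: "q \<in> Pm (int k + 1)"
    show "ipTv T G (cgrad (p + q)) = ipTv T G (cgrad p) + ipTv T G (cgrad q)"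
      unfolding cgrad_add[OF p q] using grad_L2v[OF p] grad_L2v[OF q] assms by (simp add: iv.B_add_right)
  qed (simp add: ipTv_def cgrad_def inner_vec_def)
  from theI'[OF this] show "ellproj V k v G \<in> Pm (int k + 1)"
    "q \<in> Pm (int k + 1) \<Longrightarrow> ipTv T (cgrad (ellproj V k v G)) (cgrad q) = ipTv T G (cgrad q)"
    "ipT T (ellproj V k v G) (\<lambda>x. 1) = ipT T v (\<lambda>x. 1)"
    unfolding ellproj_def by auto
qed

lemma grad_normal:
  assumes w: "w \<in> Pm (int k + 1)"
  shows "cgrad w \<in> Pmv (int k)" "L2b (\<lambda>z y. cgrad w y \<bullet> onormal V z)" "pdiv (cgrad w) \<in> Pm (int k - 1)"
    "canon V (\<lambda>z y. cgrad w y \<bullet> onormal V z) \<in> Pface V (int k)"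
proof -
  show w': "cgrad w \<in> Pmv (int k)" using Pm_frechet[OF w] by simp
  show "L2b (\<lambda>z y. cgrad w y \<bullet> onormal V z)" by (rule L2b_normal[OF w'])
  show "pdiv (cgrad w) \<in> Pm (int k - 1)" by (rule pdiv_Pm[OF w'])
  show "canon V (\<lambda>z y. cgrad w y \<bullet> onormal V z) \<in> Pface V (int k)" by (rule normal_canon_Pface[OF w'])
qed

text \<open>After integration by parts the cell polynomial enters only through moments of degree
  \<open>k - 1\<close>. In this form the reconstruction of the interpolate can be compared with the
  elliptic projection of \<open>v\<close>.\<close>

lemma RT:
  assumes p: "p \<in> Pm (int k + 1)" and f: "L2b f"
  shows "RT V k p f \<in> Pm (int k + 1)"
    and "w \<in> Pm (int k + 1) \<Longrightarrow> ipTv T (cgrad (RT V k p f)) (cgrad w) =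
      bip V f (\<lambda>z y. cgrad w y \<bullet> onormal V z) - ipT T p (pdiv (cgrad w))"
    and "ipT T (RT V k p f) (\<lambda>x. 1) = ipT T p (\<lambda>x. 1)"
proof -
  interpret iv: psd_form "ipTv T" "{f. L2v T f}" by (rule psd_form_ipTv)
  interpret ib: psd_form "bip V" "{f. L2b f}" by (rule psd_form_bip)
  define N where "N w = (\<lambda>z y. cgrad w y \<bullet> onormal V z)" for w :: "real^'n \<Rightarrow> real"
  have N: "L2b (N w)" if "w \<in> Pm (int k + 1)" for w unfolding N_def by (rule grad_normal(2)[OF that])
  let ?\<delta> = "deltaT V p f"
  have \<delta>: "L2b ?\<delta>" by (rule L2b_deltaT[OF p f])
  let ?l = "\<lambda>w. ipTv T (cgrad p) (cgrad w) - bip V ?\<delta> (N w)"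
  have "\<exists>!r. r \<in> Pm (int k + 1) \<and> (\<forall>w\<in>Pm (int k + 1). ipTv T (cgrad r) (cgrad w) = ?l w) \<and>
      ipT T r (\<lambda>x. 1) = ipT T p (\<lambda>x. 1)"
  proof (rule gradient_problem)
    fix u w :: "real^'n \<Rightarrow> real" and c :: real
    assume u: "u \<in> Pm (int k + 1)"
    have "N (c *\<^sub>R u) = c *\<^sub>R N u" unfolding N_def cgrad_scale[OF u] by (simp add: fun_eq_iff)
    then show "?l (c *\<^sub>R u) = c * ?l u"
      unfolding cgrad_scale[OF u] using grad_L2v[OF u] grad_L2v[OF p] \<delta> N[OF u]
      by (simp add: iv.B_scale_right ib.B_scale_right right_diff_distrib)
    assume w: "w \<in> Pm (int k + 1)"
    have "N (u + w) = N u + N w" unfolding N_def cgrad_add[OF u w] by (simp add: fun_eq_iff inner_add_left)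
    then show "?l (u + w) = ?l u + ?l w"
      unfolding cgrad_add[OF u w] using grad_L2v[OF u] grad_L2v[OF w] grad_L2v[OF p] \<delta> N[OF u] N[OF w]
      by (simp add: iv.B_add_right ib.B_add_right)
  qed (simp add: ipTv_def cgrad_def inner_vec_def N_def bip_def fint_def)
  moreover have "ipT T (\<lambda>x. r x - p x) (\<lambda>x. 1) = 0 \<longleftrightarrow> ipT T r (\<lambda>x. 1) = ipT T p (\<lambda>x. 1)"
    if "r \<in> Pm (int k + 1)" for r
    using ipT_diff[OF Pm_L2[OF that] Pm_L2[OF p] L2_const[of 1]] by simp
  ultimately have "\<exists>!r. r \<in> Pm (int k + 1) \<and> (\<forall>w\<in>Pm (int k + 1). ipTv T (cgrad r) (cgrad w) = ?l w) \<and>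
      ipT T (\<lambda>x. r x - p x) (\<lambda>x. 1) = 0" by (simp cong: conj_cong)
  from theI'[OF this] have R: "RT V k p f \<in> Pm (int k + 1)"
    "\<And>w. w \<in> Pm (int k + 1) \<Longrightarrow> ipTv T (cgrad (RT V k p f)) (cgrad w) = ?l w"
    "ipT T (\<lambda>x. RT V k p f x - p x) (\<lambda>x. 1) = 0"
    unfolding RT_def N_def by auto
  show "RT V k p f \<in> Pm (int k + 1)" by (rule R(1))
  show "ipT T (RT V k p f) (\<lambda>x. 1) = ipT T p (\<lambda>x. 1)"
    using R(3) ipT_diff[OF Pm_L2[OF R(1)] Pm_L2[OF p] L2_const[of 1]] by simp
  assume w: "w \<in> Pm (int k + 1)"
  show "ipTv T (cgrad (RT V k p f)) (cgrad w) = bip V f (\<lambda>z y. cgrad w y \<bullet> onormal V z) - ipT T p (pdiv (cgrad w))"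
    using R(2)[OF w] bip_deltaT[OF p f N[OF w]] ibp_vec[OF ibp_poly[OF p] grad_normal(1)[OF w]]
    by (simp add: N_def)
qed

section \<open>Action of the stabilization\<close>

text \<open>Equal gradient moments leave only an additive constant, which cancels in the difference
  to the projection.\<close>

lemma fluctuation_eq:
  assumes R: "R \<in> Pm (int k + 1)" and E: "E \<in> Pm (int k + 1)"
    and eq: "\<And>w. w \<in> Pm (int k + 1) \<Longrightarrow> ipTv T (cgrad R) (cgrad w) = ipTv T (cgrad E) (cgrad w)"
  shows "R x - PiT V (int k) R x = E x - PiT V (int k) E x"
proof -
  have d: "(\<lambda>x. R x - E x) \<in> Pm (int k + 1)" by (intro Pm_diff R E)
  have "cgrad (\<lambda>x. R x - E x) = (\<lambda>x. cgrad R x - cgrad E x)" using cgrad_diff[OF R E] by (simp add: fun_eq_iff)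
  then have "ipTv T (cgrad (\<lambda>x. R x - E x)) (cgrad (\<lambda>x. R x - E x)) = 0"
    using ipTv_diff[OF grad_L2v[OF R] grad_L2v[OF E] grad_L2v[OF d]] eq[OF d] by simp
  from grad_zero_const[OF d this] obtain c where "(\<lambda>x. R x - E x) = (\<lambda>x. c)" by blast
  then have "R x = E x + c" for x by (metis add.commute diff_add_cancel)
  then have "R = (\<lambda>x. E x + c)" by blast
  from PiT_shift[OF Pm_L2[OF E] this, of "int k"] show ?thesis using \<open>\<And>x. R x = E x + c\<close> by simp
qed

lemma SdT_in:
  assumes p: "p \<in> Pm (int k + 1)" and f: "L2b f"
  shows "SdT V k k' p f \<in> Pface V (int k)"
proof -
  have R: "(\<lambda>x. RT V k p f x - PiT V (int k) (RT V k p f) x) \<in> Pm (int k + 1)"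
    using RT(1)[OF p f] Pm_mono[OF _ PiT_in[OF Pm_L2[OF RT(1)[OF p f]], of "int k"], of "int k + 1"] by (intro Pm_diff) auto
  show ?thesis
    unfolding SdT_def by (auto intro!: PidT_in L2b_add L2b_deltaT[OF p f] L2b_btr[OF R])
qed

text \<open>One formula for both choices of \<open>k'\<close>: for \<open>k' = k + 1\<close> the
  fluctuation of \<open>E\<close> vanishes by itself. The reconstruction may be represented by any
  \<open>E\<close> with the same gradient moments.\<close>

lemma bip_SdT:
  assumes kk': "k' = k \<or> k' = k + 1" and p: "p \<in> Pm (int k')" and f: "L2b f"
    and E: "E \<in> Pm (int k + 1)" and \<mu>: "\<mu> \<in> Pface V (int k)"
    and eq: "\<And>w. w \<in> Pm (int k + 1) \<Longrightarrow> ipTv T (cgrad E) (cgrad w) =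
      bip V f (\<lambda>z y. cgrad w y \<bullet> onormal V z) - ipT T p (pdiv (cgrad w))"
  shows "bip V (SdT V k k' p f) \<mu> = bip V (\<lambda>z y. p y + (E y - PiT V (int k') E y)) \<mu> - bip V f \<mu>"
proof -
  have p1: "p \<in> Pm (int k + 1)" using Pm_mono[OF _ p] kk' by auto
  have L\<mu>: "L2b \<mu>" by (rule Pface_L2b[OF \<mu>])
  have \<delta>: "L2b (deltaT V p f)" by (rule L2b_deltaT[OF p1 f])
  have Lp: "L2b (\<lambda>z. p)" by (rule L2b_const_face[OF p])
  show ?thesis
  proof (cases "k' = k")
    case True
    define e where "e = (\<lambda>x. E x - PiT V (int k) E x)"
    have e: "e \<in> Pm (int k + 1)"
      unfolding e_def using Pm_mono[OF _ PiT_in[OF Pm_L2[OF E], of "int k"], of "int k + 1"] by (intro Pm_diff E) auto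
    have "RT V k p f x - PiT V (int k) (RT V k p f) x = E x - PiT V (int k) E x" for x
      by (rule fluctuation_eq[OF RT(1)[OF p1 f] E]) (simp add: RT(2)[OF p1 f] eq)
    then have S: "SdT V k k' p f = PidT V (int k) (\<lambda>z y. deltaT V p f z y + btr V e z y)"
      using True by (simp add: SdT_def e_def)
    have "bip V (SdT V k k' p f) \<mu> = bip V (deltaT V p f) \<mu> + bip V (\<lambda>z. e) \<mu>"
      unfolding S PidT_eq[OF L2b_add[OF \<delta> L2b_btr[OF e]] \<mu>] bip_add[OF \<delta> L2b_btr[OF e] L\<mu>] bip_btr ..
    also have "\<dots> = bip V (\<lambda>z y. p y + e y) \<mu> - bip V f \<mu>"
      using bip_deltaT[OF p1 f L\<mu>] bip_add[OF Lp L2b_const_face[OF e] L\<mu>] by simp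
    finally show ?thesis using True by (simp add: e_def)
  next
    case False
    then have k': "int k' = int k + 1" using kk' by simp
    have "PiT V (int k') E = E" unfolding k' by (rule PiT_self[OF E])
    then show ?thesis
      using False bip_deltaT[OF p1 f L\<mu>] by (simp add: SdT_def PidT_eq[OF \<delta> \<mu>])
  qed
qed

text \<open>\<open>e\<close> satisfies the gradient equation for the reconstruction of
  \<open>(0, a)\<close>: it is orthogonal to the Laplacians, and \<open>a\<close> agrees with it
  against normal derivatives. Having degree \<open>k'\<close>, it has no fluctuation, so only
  \<open>- a\<close> remains.\<close>

lemma SdT_zero_test:
  assumes kk': "k' = k \<or> k' = k + 1" and e: "e \<in> Pm (int k')"
    and orth: "\<And>w. w \<in> Pm (int k - 1) \<Longrightarrow> ipT T e w = 0"
    and a: "a \<in> Pface V (int k)" and ae: "\<And>\<mu>. \<mu> \<in> Pface V (int k) \<Longrightarrow> bip V a \<mu> = bip V (\<lambda>z. e) \<mu>"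
    and \<mu>: "\<mu> \<in> Pface V (int k)"
  shows "bip V (SdT V k k' (\<lambda>x. 0) a) \<mu> = - bip V a \<mu>"
proof -
  have e1: "e \<in> Pm (int k + 1)" using Pm_mono[OF _ e] kk' by auto
  have La: "L2b a" by (rule Pface_L2b[OF a])
  have eq: "ipTv T (cgrad e) (cgrad w) = bip V a (\<lambda>z y. cgrad w y \<bullet> onormal V z) - ipT T (\<lambda>x. 0) (pdiv (cgrad w))"
    if w: "w \<in> Pm (int k + 1)" for w
    using ibp_vec[OF ibp_poly[OF e1] grad_normal(1)[OF w]] orth[OF grad_normal(3)[OF w]]
      ae[OF grad_normal(4)[OF w]] by (simp add: bip_canon ipT_def)
  have "bip V (SdT V k k' (\<lambda>x. 0) a) \<mu> = bip V (\<lambda>z y. 0 + (e y - PiT V (int k') e y)) \<mu> - bip V a \<mu>"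
    by (rule bip_SdT[OF kk' Pm_zero La e1 \<mu> eq])
  then show ?thesis by (simp add: PiT_self[OF e] bip_def fint_def)
qed

text \<open>The 1 stands for the face function itself, the other summand for the fluctuation of its
  reconstruction.\<close>

definition KS where "KS = 1 + K2 * sqrt c7"

text \<open>Needed for the flux error, whose normal trace is not of the form treated in
  \<open>SdT_zero_test\<close>.\<close>

lemma SdT_bounded:
  assumes kk': "k' = k \<or> k' = k + 1" and \<mu>: "\<mu> \<in> Pface V (int k)"
  shows "bnorm V (SdT V k k' (\<lambda>x. 0) \<mu>) \<le> KS * bnorm V \<mu>"
proof -
  let ?S = "SdT V k k' (\<lambda>x. 0) \<mu>"
  have L: "L2b \<mu>" by (rule Pface_L2b[OF \<mu>])
  have z: "(\<lambda>x::real^'n. 0) \<in> Pm (int k + 1)" by (rule Pm_zero)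
  define r where "r = RT V k (\<lambda>x. 0) \<mu>"
  have r: "r \<in> Pm (int k + 1)" "ipT T r (\<lambda>x. 1) = 0"
    using RT(1,3)[OF z L] by (auto simp: r_def ipT_def)
  define s where "s = (\<lambda>x. r x - PiT V (int k') r x)"
  have k1: "int k' \<le> int k + 1" using kk' by auto
  have Pr: "PiT V (int k') r \<in> Pm (int k')" by (rule PiT_in[OF Pm_L2[OF r(1)]])
  have s: "s \<in> Pm (int k + 1)" unfolding s_def using Pm_mono[OF k1 Pr] by (intro Pm_diff r)
  have S: "?S \<in> Pface V (int k)" by (rule SdT_in[OF z L])
  note LS = Pface_L2b[OF S]
  note nn = norm_nonneg(3)[OF L] norm_nonneg(3)[OF LS] K2_nonneg less_imp_le[OF h_pos] nonneg
  have "(normTv T (cgrad r))\<^sup>2 = bip V \<mu> (\<lambda>z y. cgrad r y \<bullet> onormal V z)"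
    unfolding norm_sq using RT(2)[OF z L r(1)] by (simp add: r_def ipT_def)
  also have "\<dots> \<le> bnorm V \<mu> * bnorm V (\<lambda>z y. cgrad r y \<bullet> onormal V z)"
    using bip_CS[OF L grad_normal(2)[OF r(1)]] by simp
  also have "\<dots> \<le> bnorm V \<mu> * (sqrt K2 / sqrt h * normTv T (cgrad r))"
    using grad_normal(1)[OF r(1)] Pm_mono[of "int k" "int k + 1"]
    by (intro mult_left_mono bnorm_normal_le nn) (auto simp: Pmv_def)
  finally have "(normTv T (cgrad r))\<^sup>2 \<le> (sqrt K2 / sqrt h * bnorm V \<mu>) * normTv T (cgrad r)"
    by (simp add: mult_ac)
  then have nr: "normTv T (cgrad r) \<le> sqrt K2 / sqrt h * bnorm V \<mu>"
    by (rule sq_le_mult_imp_le[rotated 2])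
      (intro norm_nonneg mult_nonneg_nonneg divide_nonneg_nonneg real_sqrt_ge_zero nn)+
  have "(normT T s)\<^sup>2 = ipT T r s - ipT T (PiT V (int k') r) s"
    unfolding norm_sq using ipT_diff[OF Pm_L2[OF r(1)] Pm_L2[OF Pr] Pm_L2[OF s]] by (simp add: s_def)
  also have "ipT T (PiT V (int k') r) s = 0"
    using ipT_diff[OF Pm_L2[OF r(1)] Pm_L2[OF Pr] Pm_L2[OF Pr]] PiT_eq[OF Pm_L2[OF r(1)] Pr]
    by (simp add: s_def ipT_sym[of "PiT V (int k') r" "\<lambda>x. r x - PiT V (int k') r x"])
  also have "ipT T r s - 0 \<le> normT T r * normT T s" using ipT_CS[OF Pm_L2[OF r(1)] Pm_L2[OF s]] by simp
  finally have "normT T s \<le> normT T r" by (rule sq_le_mult_imp_le[rotated 2]) (rule norm_nonneg)+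
  also have "\<dots> \<le> sqrt c7 * h * normTv T (cgrad r)" by (rule Poincare_poly[OF r])
  also have "\<dots> \<le> sqrt c7 * h * (sqrt K2 / sqrt h * bnorm V \<mu>)"
    by (intro mult_left_mono nr mult_nonneg_nonneg real_sqrt_ge_zero nn)
  finally have ns: "normT T s \<le> sqrt c7 * h * (sqrt K2 / sqrt h * bnorm V \<mu>)" .
  have "bnorm V (\<lambda>z. s) \<le> sqrt K2 / sqrt h * normT T s" by (rule bnorm_poly_le[OF s])
  also have "\<dots> \<le> sqrt K2 / sqrt h * (sqrt c7 * h * (sqrt K2 / sqrt h * bnorm V \<mu>))"
    by (intro mult_left_mono ns divide_nonneg_nonneg real_sqrt_ge_zero nn)
  also have "\<dots> = K2 * sqrt c7 * bnorm V \<mu>" using h_pos K2_nonneg by (simp add: field_simps)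
  finally have bs: "bnorm V (\<lambda>z. s) \<le> K2 * sqrt c7 * bnorm V \<mu>" .
  have eq: "ipTv T (cgrad r) (cgrad w) = bip V \<mu> (\<lambda>z y. cgrad w y \<bullet> onormal V z) - ipT T (\<lambda>x. 0) (pdiv (cgrad w))"
    if w: "w \<in> Pm (int k + 1)" for w using RT(2)[OF z L w] by (simp add: r_def)
  have "(bnorm V ?S)\<^sup>2 = bip V (\<lambda>z. s) ?S - bip V \<mu> ?S"
    unfolding norm_sq(3)[OF LS] using bip_SdT[OF kk' Pm_zero L r(1) S eq] by (simp add: s_def)
  also have "\<dots> \<le> bnorm V (\<lambda>z. s) * bnorm V ?S + bnorm V \<mu> * bnorm V ?S"
    using bip_CS[OF L2b_const_face[OF s] LS] bip_CS[OF L LS] by linarith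
  also have "\<dots> \<le> K2 * sqrt c7 * bnorm V \<mu> * bnorm V ?S + bnorm V \<mu> * bnorm V ?S"
    by (intro add_right_mono mult_right_mono bs nn)
  finally have "(bnorm V ?S)\<^sup>2 \<le> (KS * bnorm V \<mu>) * bnorm V ?S" by (simp add: KS_def algebra_simps)
  then show ?thesis
    unfolding KS_def
    by (rule sq_le_mult_imp_le[rotated 2])
      (intro mult_nonneg_nonneg add_nonneg_nonneg real_sqrt_ge_zero zero_le_one nn)+
qed

section \<open>The two estimates on one simplex\<close>

text \<open>Being a sum of nonnegative terms, it dominates every coefficient of both final
  bounds.\<close>

definition K_total where
  "K_total = K7\<^sup>2 + K7 * K6 + K8 + K8 * KS * K7 + 2 * (K8 * KS * K6)"

lemma constants_nonneg: "0 \<le> K6" "0 \<le> K7" "0 \<le> K8" "0 \<le> KS"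
  unfolding K6_def K7_def K8_def KS_def
  by (intro add_nonneg_nonneg mult_nonneg_nonneg real_sqrt_ge_zero nonneg K2_nonneg K5_nonneg
      of_nat_0_le_iff zero_le_one)+

theorem H_interpolation_estimates:
  assumes kk': "k' = k \<or> k' = k + 1" and ell: "h \<le> ell"
    and \<sigma>: "Hdiv_div T \<sigma> D" and gs: "is_vtrace V \<sigma> gs" and v: "H1_grad T v G" and gv: "is_trace V v gv"
    and H: "Hinterp ell V k k' \<sigma> gs v gv ps pv"
  defines "divt \<equiv> normT T (\<lambda>x. D x - PiT V (int k - 1) D x)"
    and "gradt \<equiv> normTv T (\<lambda>x. G x - cgrad (ellproj V k v G) x)"
    and "N \<equiv> bnorm V (\<lambda>z y. (PiTv V (int k) \<sigma> y - gs z y) \<bullet> onormal V z)"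
  shows "normT T (\<lambda>x. pv x - PiT V (int k') v x) \<le> K_total * (h\<^sup>2 / ell * divt + h * gradt)"
    and "normTv T (\<lambda>x. ps x - PiTv V (int k) \<sigma> x) \<le> K_total * (sqrt h * N + h * divt + ell * gradt)"
proof -
  define \<tau> where "\<tau> = ell / h"
  have \<tau>: "\<tau> > 0" using ell h_pos by (simp add: \<tau>_def)
  have k1: "int k' \<le> int k + 1" and kk: "int k - 1 \<le> int k'" using kk' by auto
  have Lv: "L2 T v" "L2v T G" using v by (auto simp: H1_grad_def L2v_def)
  have L\<sigma>: "L2v T \<sigma>" "L2 T D" using \<sigma> by (auto simp: Hdiv_div_def L2v_def)
  have H1: "ps \<in> Pmv (int k)" and H2: "pv \<in> Pm (int k')"
    and H3: "\<And>w. w \<in> Pm (int k - 1) \<Longrightarrow> ipT T (\<lambda>x. pv x - v x) w = 0"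
    and H4: "\<And>\<xi>. \<xi> \<in> Pmv (int k - 1) \<Longrightarrow> ipTv T (\<lambda>x. ps x - \<sigma> x) \<xi> = 0"
    and H5: "\<And>\<mu>. \<mu> \<in> Pface V (int k) \<Longrightarrow> bip V (\<lambda>z y. (gs z y - ps y) \<bullet> onormal V z) \<mu> =
      \<tau> * bip V (SdT V k k' pv (PidT V (int k) gv)) (SdT V k k' (\<lambda>x. 0) \<mu>)"
    and H6: "\<And>q. q \<in> Pm (int k') \<Longrightarrow> ipTv T (\<lambda>x. ps x - \<sigma> x) (cgrad q) =
      bip V (\<lambda>z y. (PidTv V (int k) gs z y - gs z y) \<bullet> onormal V z) (btr V q)"
    using H by (auto simp: Hinterp_def Let_def \<tau>_def h_def)
  define E where "E = ellproj V k v G"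
  note E = ellproj[OF Lv, folded E_def]
  define u where "u = (\<lambda>x. v x - E x)"
  define GE where "GE = (\<lambda>x. G x - cgrad E x)"
  define gu where "gu = (\<lambda>z y. gv z y - E y)"
  have iv: "ibp v G gv" by (rule ibp_H1[OF v gv])
  have iu: "ibp u GE gu" unfolding u_def GE_def gu_def by (rule ibp_diff[OF iv ibp_poly[OF E(1)]])
  have Lg: "L2b gv" "L2b gu" and Lu: "L2 T u" using iv iu by (auto simp: ibp_def)
  have mean: "ipT T u (\<lambda>x. 1) = 0"
    using ipT_diff[OF Lv(1) Pm_L2[OF E(1)] L2_const[of 1]] E(3) by (simp add: u_def)
  have gradt: "normTv T GE = gradt" by (simp add: GE_def gradt_def E_def)
  define e where "e = (\<lambda>x. pv x - PiT V (int k') v x)"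
  have Pv: "PiT V (int k') v \<in> Pm (int k')" by (rule PiT_in[OF Lv(1)])
  have e: "e \<in> Pm (int k')" unfolding e_def by (intro Pm_diff H2 Pv)
  have e1: "e \<in> Pm (int k + 1)" by (rule Pm_mono[OF k1 e])
  have Le: "L2b (\<lambda>z. e)" by (rule L2b_const_face[OF e])
  have pvv: "ipT T pv w = ipT T v w" if "w \<in> Pm (int k - 1)" for w
    using H3[OF that] ipT_diff[OF Pm_L2[OF H2] Lv(1) Pm_L2[OF that]] by simp
  have orth: "ipT T e w = 0" if w: "w \<in> Pm (int k - 1)" for w
    unfolding e_def ipT_diff[OF Pm_L2[OF H2] Pm_L2[OF Pv] Pm_L2[OF w]]
    using pvv[OF w] PiT_eq[OF Lv(1) Pm_mono[OF kk w]] by simp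
  define a where "a = PidT V (int k) (\<lambda>z. e)"
  have a: "a \<in> Pface V (int k)" unfolding a_def by (rule PidT_in[OF Le])
  have ae: "bip V a \<mu> = bip V (\<lambda>z. e) \<mu>" if "\<mu> \<in> Pface V (int k)" for \<mu>
    unfolding a_def by (rule PidT_eq[OF Le that])
  define w where "w = PiT V (int k') u"
  have w: "w \<in> Pm (int k')" unfolding w_def by (rule PiT_in[OF Lu])
  have Lw: "L2b (\<lambda>z. w)" by (rule L2b_const_face[OF w])
  have Lb': "L2b (\<lambda>z y. w y - gu z y)" by (rule L2b_diff[OF Lw Lg(2)])
  define b where "b = PidT V (int k) (\<lambda>z y. w y - gu z y)"
  have b: "b \<in> Pface V (int k)" unfolding b_def by (rule PidT_in[OF Lb'])
  have be: "bip V b \<mu> = bip V (\<lambda>z y. w y - gu z y) \<mu>" if "\<mu> \<in> Pface V (int k)" for \<mu>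
    unfolding b_def by (rule PidT_eq[OF Lb' that])
  note La = Pface_L2b[OF a] and Lb = Pface_L2b[OF b]
  have nb: "bnorm V b \<le> K6 * sqrt h * gradt"
    using interpolation_residual_le[OF iu mean k1 b] be[OF b] by (simp add: w_def gradt)
  have ne: "normT T e \<le> K7 * sqrt h * bnorm V a"
    by (rule cell_le_face_projection[OF e1 orth a ae])
  define S where "S = SdT V k k' pv (PidT V (int k) gv)"
  note Pg = PidT_in[OF Lg(1), of "int k"]
  note LPg = Pface_L2b[OF Pg]
  have pv1: "pv \<in> Pm (int k + 1)" by (rule Pm_mono[OF k1 H2])
  have S: "S \<in> Pface V (int k)" unfolding S_def by (rule SdT_in[OF pv1 LPg])
  \<comment> \<open>The low moments of \<open>pv\<close> and \<open>v\<close> agree, so the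
    reconstruction of the interpolate has the gradient of \<open>E\<close>. By linearity of the
    projection, \<open>pv\<close> plus the fluctuation of \<open>E\<close> minus the trace of
    \<open>v\<close> is \<open>e\<close> plus the projected \<open>u\<close> minus the trace of
    \<open>u\<close>.\<close>
  have Seq: "bip V S \<mu> = bip V a \<mu> + bip V b \<mu>" if \<mu>: "\<mu> \<in> Pface V (int k)" for \<mu>
  proof -
    note L\<mu> = Pface_L2b[OF \<mu>]
    have "bip V S \<mu> = bip V (\<lambda>z y. pv y + (E y - PiT V (int k') E y)) \<mu> - bip V (PidT V (int k) gv) \<mu>"
      unfolding S_def
    proof (rule bip_SdT[OF kk' H2 LPg E(1) \<mu>])
      fix w :: "real^'n \<Rightarrow> real" assume w: "w \<in> Pm (int k + 1)"
      show "ipTv T (cgrad E) (cgrad w) = bip V (PidT V (int k) gv) (\<lambda>z y. cgrad w y \<bullet> onormal V z) - ipT T pv (pdiv (cgrad w))"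
        using E(2)[OF w] PidT_eq[OF Lg(1) grad_normal(4)[OF w]] pvv[OF grad_normal(3)[OF w]]
          ibp_vec[OF iv grad_normal(1)[OF w]] by (simp add: bip_canon)
    qed
    also have "\<dots> = bip V (\<lambda>z y. pv y + (E y - PiT V (int k') E y)) \<mu> - bip V gv \<mu>"
      by (simp add: PidT_eq[OF Lg(1) \<mu>])
    also have "\<dots> = bip V (\<lambda>z y. (pv y + (E y - PiT V (int k') E y)) - gv z y) \<mu>"
    proof -
      have "PiT V (int k') E \<in> Pm (int k + 1)" by (rule Pm_mono[OF k1 PiT_in[OF Pm_L2[OF E(1)]]])
      then have "(\<lambda>y. pv y + (E y - PiT V (int k') E y)) \<in> Pm (int k + 1)" by (intro Pm_add Pm_diff pv1 E(1))
      from bip_diff[OF L2b_const_face[OF this] Lg(1) L\<mu>] show ?thesis by simp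
    qed
    also have "(\<lambda>z y. (pv y + (E y - PiT V (int k') E y)) - gv z y) = (\<lambda>z y. e y + (w y - gu z y))"
      using PiT_diff[OF Lv(1) Pm_L2[OF E(1)], of "int k'"] by (simp add: fun_eq_iff e_def w_def gu_def u_def)
    finally show ?thesis
      unfolding bip_add[OF Le Lb' L\<mu>] ae[OF \<mu>] be[OF \<mu>] .
  qed
  let ?gn = "\<lambda>z y. gs z y \<bullet> onormal V z"
  have Lgn: "L2b ?gn" by (rule vtrace_normal_L2b(2)[OF gs])
  have Lpn: "L2b (\<lambda>z y. ps y \<bullet> onormal V z)" by (rule L2b_normal[OF H1])
  define na where "na = bnorm V a"
  have na0: "0 \<le> na" unfolding na_def by (rule norm_nonneg(3)[OF La])
  have divt0: "0 \<le> divt" unfolding divt_def by (rule norm_nonneg)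
  have gradt0: "0 \<le> gradt" unfolding gradt_def by (rule norm_nonneg)
  note knn = constants_nonneg
  \<comment> \<open>The projected normal trace turns \<open>a\<close> back into \<open>e\<close>, so
    the last interpolation condition applies with \<open>q = e\<close>. The terms with
    \<open>ps\<close> then cancel, and integration by parts of \<open>\<sigma>\<close> leaves its
    divergence.\<close>
  have key: "\<tau> * (bip V a a + bip V b a) = - ipT T D e"
  proof -
    let ?\<rho> = "\<lambda>z y. PidTv V (int k) gs z y \<bullet> onormal V z"
    note \<rho> = PidTv_normal[OF gs, where m = "int k"]
    have "bip V S (SdT V k k' (\<lambda>x. 0) a) = - bip V a S"
      using SdT_zero_test[OF kk' e orth a ae S] bip_sym by metis
    also have "\<dots> = - (bip V a a + bip V b a)" using Seq[OF a] bip_sym[of a S] by simp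
    finally have "bip V (\<lambda>z y. (gs z y - ps y) \<bullet> onormal V z) a = - (\<tau> * (bip V a a + bip V b a))"
      using H5[OF a] unfolding S_def[symmetric] by (simp only: mult_minus_right)
    also have "bip V (\<lambda>z y. (gs z y - ps y) \<bullet> onormal V z) a = bip V ?gn a - bip V (\<lambda>z y. ps y \<bullet> onormal V z) a"
      using bip_diff[OF Lgn Lpn La] by (simp add: inner_diff_left)
    also have "bip V ?gn a = bip V ?\<rho> (\<lambda>z. e)"
      using \<rho>(2)[OF a] ae[OF \<rho>(1)] by (simp add: bip_sym)
    also have "bip V ?\<rho> (\<lambda>z. e) = ipTv T (\<lambda>x. ps x - \<sigma> x) (cgrad e) + bip V ?gn (\<lambda>z. e)"
      using H6[OF e] bip_diff[OF Pface_L2b[OF \<rho>(1)] Lgn Le]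
      by (simp add: inner_diff_left btr_def bip_canon)
    also have "bip V ?gn (\<lambda>z. e) = ipTv T \<sigma> (cgrad e) + ipT T D e"
      using Hdiv_integration_by_parts[OF \<sigma> gs Pm_Cinf[OF e]] by (simp add: bip_def ipTv_def ipT_def)
    also have "bip V (\<lambda>z y. ps y \<bullet> onormal V z) a = bip V (\<lambda>z. e) (\<lambda>z y. ps y \<bullet> onormal V z)"
      using ae[OF normal_canon_Pface[OF H1]] bip_sym[of a] by (simp add: bip_canon)
    also have "\<dots> = ipTv T ps (cgrad e)"
      using ibp_vec[OF ibp_poly[OF e] H1] orth[OF pdiv_Pm[OF H1]] ipTv_sym[of ps] by simp
    finally show ?thesis
      using ipTv_diff[OF Pmv_L2v[OF H1] L\<sigma>(1) grad_L2v[OF e]] by simp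
  qed
  have De: "\<bar>ipT T D e\<bar> \<le> divt * (K7 * sqrt h * na)"
  proof -
    \<comment> \<open>For \<open>k = 0\<close> the target space \<open>Pm (-1)\<close> contains only
      zero, in accordance with the stated convention.\<close>
    note PD = PiT_in[OF L\<sigma>(2), of "int k - 1"]
    have "ipT T D e = ipT T (\<lambda>x. D x - PiT V (int k - 1) D x) e"
      using ipT_diff[OF L\<sigma>(2) Pm_L2[OF PD] Pm_L2[OF e]] orth[OF PD] by (simp add: ipT_sym)
    then have "\<bar>ipT T D e\<bar> \<le> divt * normT T e"
      using ipT_CS[OF L2_diff[OF L\<sigma>(2) Pm_L2[OF PD]] Pm_L2[OF e]] by (simp add: divt_def)
    also have "\<dots> \<le> divt * (K7 * sqrt h * na)" unfolding na_def by (rule mult_left_mono[OF ne divt0])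
    finally show ?thesis .
  qed
  \<comment> \<open>Every term on the right of the tested equation carries one factor
    \<open>na\<close>, which is cancelled; no absorption with a small parameter is required.\<close>
  have na: "na \<le> K7 * sqrt h * divt / \<tau> + K6 * sqrt h * gradt"
  proof -
    have "\<bar>bip V b a\<bar> \<le> (K6 * sqrt h * gradt) * na"
      using bip_CS[OF Lb La] mult_right_mono[OF nb na0] by (simp add: na_def)
    then have "\<tau> * \<bar>bip V b a\<bar> \<le> \<tau> * ((K6 * sqrt h * gradt) * na)" using \<tau> by (intro mult_left_mono) auto
    moreover have "\<tau> * bip V a a = - ipT T D e - \<tau> * bip V b a" using key by (simp add: algebra_simps)
    moreover have "- (\<tau> * bip V b a) \<le> \<tau> * \<bar>bip V b a\<bar>" using \<tau> by (simp add: abs_if)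
    ultimately have "\<tau> * bip V a a \<le> divt * (K7 * sqrt h * na) + \<tau> * ((K6 * sqrt h * gradt) * na)"
      using De by linarith
    then have "\<tau> * na\<^sup>2 \<le> \<tau> * ((K7 * sqrt h * divt / \<tau> + K6 * sqrt h * gradt) * na)"
      using \<tau> by (simp add: na_def norm_sq(3)[OF La] algebra_simps)
    then have "na\<^sup>2 \<le> (K7 * sqrt h * divt / \<tau> + K6 * sqrt h * gradt) * na" using \<tau> by simp
    then show ?thesis
      by (rule sq_le_mult_imp_le[rotated 2])
        (intro na0 add_nonneg_nonneg mult_nonneg_nonneg divide_nonneg_nonneg real_sqrt_ge_zero
          less_imp_le[OF h_pos] less_imp_le[OF \<tau>] knn divt0 gradt0)+
  qed
  have ell0: "ell > 0" using ell h_pos by simp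
  have hh: "sqrt h * sqrt h = h" using h_pos by simp
  have "normT T e \<le> K7 * sqrt h * (K7 * sqrt h * divt / \<tau> + K6 * sqrt h * gradt)"
    using ne mult_left_mono[OF na, of "K7 * sqrt h"] knn h_pos by (simp add: na_def)
  also have "\<dots> = K7\<^sup>2 * ((sqrt h * sqrt h) * divt / \<tau>) + K7 * K6 * ((sqrt h * sqrt h) * gradt)"
    by (simp add: algebra_simps power2_eq_square del: real_sqrt_mult_self)
  \<comment> \<open>The two factors \<open>sqrt h\<close> and the quotient
    \<open>1 / \<tau> = h / ell\<close> combine to the weight of the divergence term.\<close>
  also have "\<dots> = K7\<^sup>2 * (h\<^sup>2 / ell * divt) + K7 * K6 * (h * gradt)"
    unfolding hh by (simp add: \<tau>_def power2_eq_square)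
  also have "\<dots> \<le> K_total * (h\<^sup>2 / ell * divt) + K_total * (h * gradt)"
    unfolding K_total_def using knn h_pos ell0 divt0 gradt0 by (intro add_mono mult_right_mono) auto
  finally show "normT T (\<lambda>x. pv x - PiT V (int k') v x) \<le> K_total * (h\<^sup>2 / ell * divt + h * gradt)"
    by (simp add: e_def distrib_left)
  define \<epsilon> where "\<epsilon> = (\<lambda>x. ps x - PiTv V (int k) \<sigma> x)"
  note P\<sigma> = PiTv_in[OF L\<sigma>(1), of "int k"]
  have \<epsilon>: "\<epsilon> \<in> Pmv (int k)"
    using subspace_diff[OF Pmv_subspace H1 P\<sigma>] by (simp add: \<epsilon>_def fun_diff_def)
  have \<epsilon>orth: "ipTv T \<epsilon> \<xi> = 0" if \<xi>: "\<xi> \<in> Pmv (int k - 1)" for \<xi>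
  proof -
    have \<xi>': "\<xi> \<in> Pmv (int k)" using \<xi> Pm_mono[of "int k - 1" "int k"] by (auto simp: Pmv_def)
    show ?thesis
      unfolding \<epsilon>_def ipTv_diff[OF Pmv_L2v[OF H1] Pmv_L2v[OF P\<sigma>] Pmv_L2v[OF \<xi>]] PiTv_eq[OF L\<sigma>(1) \<xi>']
      using H4[OF \<xi>] ipTv_diff[OF Pmv_L2v[OF H1] L\<sigma>(1) Pmv_L2v[OF \<xi>]] by simp
  qed
  define \<mu> where "\<mu> = canon V (\<lambda>z y. \<epsilon> y \<bullet> onormal V z)"
  have \<mu>: "\<mu> \<in> Pface V (int k)" unfolding \<mu>_def by (rule normal_canon_Pface[OF \<epsilon>])
  note L\<mu> = Pface_L2b[OF \<mu>]
  have n\<mu>: "bnorm V (\<lambda>z y. \<epsilon> y \<bullet> onormal V z) = bnorm V \<mu>" by (simp add: bnorm_def \<mu>_def bip_canon)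
  define X where "X = SdT V k k' (\<lambda>x. 0) \<mu>"
  have X: "X \<in> Pface V (int k)" unfolding X_def by (rule SdT_in[OF Pm_zero L\<mu>])
  note LX = Pface_L2b[OF X]
  define nm where "nm = bnorm V \<mu>"
  have nm0: "0 \<le> nm" unfolding nm_def by (rule norm_nonneg(3)[OF L\<mu>])
  have nX: "bnorm V X \<le> KS * nm" unfolding X_def nm_def by (rule SdT_bounded[OF kk' \<mu>])
  define A where "A = na + K6 * sqrt h * gradt"
  have A0: "0 \<le> A" unfolding A_def using na0 knn h_pos gradt0 by (intro add_nonneg_nonneg mult_nonneg_nonneg) auto
  have LN: "L2b (\<lambda>z y. (PiTv V (int k) \<sigma> y - gs z y) \<bullet> onormal V z)"
    unfolding inner_diff_left by (rule L2b_diff[OF L2b_normal[OF P\<sigma>] Lgn])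
  have N0: "0 \<le> N" unfolding N_def by (rule norm_nonneg(3)[OF LN])
  have "nm\<^sup>2 = bip V (\<lambda>z y. \<epsilon> y \<bullet> onormal V z) \<mu>"
    unfolding nm_def norm_sq(3)[OF L\<mu>] by (simp add: \<mu>_def bip_canon)
  \<comment> \<open>The trace \<open>gs\<close> is inserted: the first difference is governed by the
    flux equation, the second is the boundary term \<open>N\<close> of the estimate.\<close>
  also have "\<dots> = - bip V (\<lambda>z y. (gs z y - ps y) \<bullet> onormal V z) \<mu> - bip V (\<lambda>z y. (PiTv V (int k) \<sigma> y - gs z y) \<bullet> onormal V z) \<mu>"
    unfolding \<epsilon>_def inner_diff_left bip_diff[OF Lgn Lpn L\<mu>] bip_diff[OF L2b_normal[OF P\<sigma>] Lgn L\<mu>]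
      bip_diff[OF Lpn L2b_normal[OF P\<sigma>] L\<mu>] by simp
  also have "bip V (\<lambda>z y. (gs z y - ps y) \<bullet> onormal V z) \<mu> = \<tau> * bip V S X"
    unfolding S_def X_def by (rule H5[OF \<mu>])
  also have "- (\<tau> * bip V S X) - bip V (\<lambda>z y. (PiTv V (int k) \<sigma> y - gs z y) \<bullet> onormal V z) \<mu> \<le> \<tau> * (A * (KS * nm)) + N * nm"
  proof -
    have "\<bar>bip V S X\<bar> \<le> na * bnorm V X + bnorm V b * bnorm V X"
      using bip_CS[OF La LX] bip_CS[OF Lb LX] by (simp add: Seq[OF X] na_def)
    also have "\<dots> \<le> na * bnorm V X + (K6 * sqrt h * gradt) * bnorm V X"
      by (intro add_left_mono mult_right_mono nb norm_nonneg(3)[OF LX])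
    also have "\<dots> = A * bnorm V X" by (simp add: A_def algebra_simps)
    also have "\<dots> \<le> A * (KS * nm)" by (rule mult_left_mono[OF nX A0])
    finally have "\<tau> * \<bar>bip V S X\<bar> \<le> \<tau> * (A * (KS * nm))" using \<tau> by (intro mult_left_mono) auto
    moreover have "- (\<tau> * bip V S X) \<le> \<tau> * \<bar>bip V S X\<bar>" using \<tau> by (simp add: abs_if)
    ultimately show ?thesis using bip_CS[OF LN L\<mu>] by (simp add: N_def nm_def)
  qed
  also have "\<dots> = (\<tau> * (A * KS) + N) * nm" by (simp add: algebra_simps)
  finally have nm: "nm \<le> \<tau> * (A * KS) + N"
    by (rule sq_le_mult_imp_le[rotated 2])
      (intro nm0 add_nonneg_nonneg mult_nonneg_nonneg A0 knn less_imp_le[OF \<tau>] N0)+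
  have "A \<le> K7 * sqrt h * divt / \<tau> + 2 * (K6 * sqrt h * gradt)" using na unfolding A_def by linarith
  then have "\<tau> * KS * A \<le> \<tau> * KS * (K7 * sqrt h * divt / \<tau> + 2 * (K6 * sqrt h * gradt))"
    using \<tau> knn by (intro mult_left_mono) auto
  also have "\<dots> = KS * K7 * (sqrt h * divt) + 2 * (KS * K6 * (sqrt h * \<tau> * gradt))"
    using \<tau> by (simp add: algebra_simps)
  finally have nm': "nm \<le> KS * K7 * (sqrt h * divt) + 2 * (KS * K6 * (sqrt h * \<tau> * gradt)) + N"
    using nm by (simp add: mult_ac)
  have "normTv T \<epsilon> \<le> K8 * sqrt h * nm"
    using flux_le_normal_trace[OF \<epsilon> \<epsilon>orth] by (simp add: n\<mu> nm_def)
  also have "\<dots> \<le> K8 * sqrt h * (KS * K7 * (sqrt h * divt) + 2 * (KS * K6 * (sqrt h * \<tau> * gradt)) + N)"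
    using knn h_pos by (intro mult_left_mono nm') auto
  also have "\<dots> = K8 * (sqrt h * N) + K8 * KS * K7 * ((sqrt h * sqrt h) * divt) + 2 * (K8 * KS * K6) * ((sqrt h * sqrt h) * \<tau> * gradt)"
    by (simp add: algebra_simps del: real_sqrt_mult_self)
  also have "\<dots> = K8 * (sqrt h * N) + K8 * KS * K7 * (h * divt) + 2 * (K8 * KS * K6) * (ell * gradt)"
    unfolding hh using h_pos by (simp add: \<tau>_def)
  also have "\<dots> \<le> K_total * (sqrt h * N) + K_total * (h * divt) + K_total * (ell * gradt)"
    unfolding K_total_def using knn h_pos ell0 divt0 gradt0 N0 by (intro add_mono mult_right_mono) auto
  finally show "normTv T (\<lambda>x. ps x - PiTv V (int k) \<sigma> x) \<le> K_total * (sqrt h * N + h * divt + ell * gradt)"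
    by (simp add: \<epsilon>_def distrib_left)
qed

end

section \<open>Uniform constants over the shape-regular family\<close>

theorem theorem3p2:
  fixes \<gamma> :: real and k k' :: nat
  assumes dim: "CARD('n::finite) = 2 \<or> CARD('n) = 3"
    and kk': "k' = k \<or> k' = k + 1"
  shows "\<exists>C. \<forall>(V :: (real^'n) set) (ell::real) (\<sigma> :: real^'n \<Rightarrow> real^'n) D gs
              (v :: real^'n \<Rightarrow> real) G gv ps pv.
     \<not> affine_dependent V \<longrightarrow> card V = CARD('n) + 1 \<longrightarrow>
     diameter (convex hull V) \<le> \<gamma> * inradius (convex hull V) \<longrightarrow>
     diameter (convex hull V) \<le> ell \<longrightarrow>
     Hdiv_div (convex hull V) \<sigma> D \<longrightarrow> is_vtrace V \<sigma> gs \<longrightarrow>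
     H1_grad (convex hull V) v G \<longrightarrow> is_trace V v gv \<longrightarrow>
     Hinterp ell V k k' \<sigma> gs v gv ps pv \<longrightarrow>
     (let T = convex hull V; h = diameter T; E = ellproj V k v G;
          divt = normT T (\<lambda>x. D x - PiT V (int k - 1) D x);
          gradt = normTv T (\<lambda>x. G x - cgrad E x) in
      normT T (\<lambda>x. pv x - PiT V (int k') v x)
        \<le> C * (h\<^sup>2 / ell * divt + h * gradt)
      \<and> normTv T (\<lambda>x. ps x - PiTv V (int k) \<sigma> x)
        \<le> C * (sqrt h * bnorm V (\<lambda>z y. (PiTv V (int k) \<sigma> y - gs z y) \<bullet> onormal V z)
               + h * divt + ell * gradt))"
proof -
  \<comment> \<open>All four constants are fixed before a simplex is chosen, from \<open>k\<close>
    and the dimension alone.\<close>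
  obtain c1 where c1: "0 \<le> c1" "\<And>(V::(real^'n) set) z e. nsimplex V \<Longrightarrow> z \<in> V \<Longrightarrow> e \<in> Pm (int k) \<Longrightarrow>
      (\<And>w. w \<in> Pm (int k - 1) \<Longrightarrow> ipT (convex hull V) e w = 0) \<Longrightarrow>
      ipT (convex hull V) e e \<le> c1 * nsimplex.Aform V z e e"
    using face_controls_complement[OF dim, of "int k"] by metis
  obtain c2 where c2: "0 \<le> c2" "\<And>(V::(real^'n) set) z p. nsimplex V \<Longrightarrow> z \<in> V \<Longrightarrow> p \<in> Pm (int k + 1) \<Longrightarrow>
      nsimplex.Aform V z p p \<le> c2 * ipT (convex hull V) p p"
    using face_bounded_by_volume[OF dim, of "int k + 1"] by metis
  obtain c5 where c5: "0 \<le> c5" "\<And>(V::(real^'n) set) z p. nsimplex V \<Longrightarrow> z \<in> V \<Longrightarrow> p \<in> Pm (int k) \<Longrightarrow>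
      ipT (convex hull V) (euler z p) (euler z p) \<le> c5 * ipT (convex hull V) p p"
    using euler_bounded[OF dim, of "int k"] by metis
  obtain c7 where c7: "0 \<le> c7" "\<And>(V::(real^'n) set) p. nsimplex V \<Longrightarrow> p \<in> Pm (int k + 1) \<Longrightarrow> ipT (convex hull V) p (\<lambda>x. 1) = 0 \<Longrightarrow>
      \<exists>\<xi>\<in>Pmv (int k + 1 + 1). pdiv \<xi> = p \<and> nsimplex.tangent V \<xi> \<and>
        ipTv (convex hull V) \<xi> \<xi> \<le> c7 * (diameter (convex hull V))\<^sup>2 * ipT (convex hull V) p p"
    using bounded_bubble_field[OF dim, of "int k + 1"] by metis
  show ?thesis
  \<comment> \<open>The maximum with 0 supplies the nonnegative regularity constant that the locale
    asks for.\<close>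
  proof (intro exI[of _ "regular_simplex.K_total TYPE('n) (max \<gamma> 0) c1 c2 c5 c7"] allI impI)
    fix V :: "(real^'n) set" and ell \<sigma> D gs v G gv ps pv
    assume V: "\<not> affine_dependent V" "card V = CARD('n) + 1"
      and reg: "diameter (convex hull V) \<le> \<gamma> * inradius (convex hull V)"
      and A: "diameter (convex hull V) \<le> ell" "Hdiv_div (convex hull V) \<sigma> D" "is_vtrace V \<sigma> gs"
        "H1_grad (convex hull V) v G" "is_trace V v gv" "Hinterp ell V k k' \<sigma> gs v gv ps pv"
    interpret nsimplex V by (rule nsimplex.intro[OF V])
    have regular: "diameter T \<le> max \<gamma> 0 * height V z" if "z \<in> V" for z
    proof -
      have "\<gamma> * inradius T \<le> max \<gamma> 0 * inradius T" by (rule mult_right_mono[OF _ inradius_nonneg]) simp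
      also have "\<dots> \<le> max \<gamma> 0 * height V z" by (rule mult_left_mono[OF inradius_le_height[OF that]]) simp
      finally show ?thesis using reg by linarith
    qed
    interpret regular_simplex V k "max \<gamma> 0" c1 c2 c5 c7
      by unfold_locales (use c1 c2 c5 c7 regular nsimplex_axioms in auto)
    show "let T = convex hull V; h = diameter T; E = ellproj V k v G;
          divt = normT T (\<lambda>x. D x - PiT V (int k - 1) D x);
          gradt = normTv T (\<lambda>x. G x - cgrad E x) in
      normT T (\<lambda>x. pv x - PiT V (int k') v x)
        \<le> K_total * (h\<^sup>2 / ell * divt + h * gradt)
      \<and> normTv T (\<lambda>x. ps x - PiTv V (int k) \<sigma> x)
        \<le> K_total * (sqrt h * bnorm V (\<lambda>z y. (PiTv V (int k) \<sigma> y - gs z y) \<bullet> onormal V z)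
               + h * divt + ell * gradt)"
      using H_interpolation_estimates[OF kk' A(1)[folded h_def] A(2-6)] by (simp only: Let_def h_def simp_thms)
  qed
qed

end
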